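(* Assume that $k$ is a field of characteristic zero, let $A$ be the monogenic extension of $K$ associated with $\alpha$ and $f$, and assume that there exists $\breve\lambda\in\mathcal Z(K)$ (the center of $K$) such that $\alpha^n(\breve\lambda)=\breve\lambda$ and $\breve\lambda-\alpha^i(\breve\lambda)$ is invertible in $K$ for $1\le i<n$. Assume also that $\alpha$ is diagonalizable, with distinct eigenvalues $\omega_1=1,\omega_2,\dots,\omega_s$. Let $\mathrm{HC}^{K,\omega_h}_*(A)$ denote the cyclic homology of the mixed complex $(C^{S,\omega_h}_*(A),d^{\omega_h}_*,D^{\omega_h}_* )$. Then the cyclic homology of $A$ relative to $K$ decomposes as $$\mathrm{HC}^K_*(A)=\bigoplus_{h=1}^s\mathrm{HC}^{K,\omega_h}_*(A).$$ Moreover, for all $m\ge0$, $$\mathrm{HC}^{K,\omega_h}_{2m}(A)=\begin{cases}\dfrac{K^1}{[K,K]^1}&\text{if } h=1,\\[8pt]\dfrac{K^{\omega_h}}{[K,K]^{\omega_h}+K^{\omega_h}\lambda_n}&\text{if }\omega_h^n\ne1,\\[8pt]\dfrac{K^{\omega_h}}{[K,K]^{\omega_h}+K^{\omega_h}\lambda_n^{m+1}}&\text{otherwise},\end{cases}$$ $$\mathrm{HC}^{K,\omega_h}_{2m+1}(A)=\begin{cases}0&\text{if } h=1\text{ or }\omega_h^n\ne1,\\[8pt]\dfrac{\{\lambda\in K^{\omega_h}:\lambda\lambda_n^{m+1}\in[K,K]^{\omega_h}\}}{[K,K]^{\omega_h}_{\alpha^{(m+1)n}}}\,x^{n-1}&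\text{otherwise}.\end{cases}$$
   Context: Setting: $k$ is a commutative ring with $1$ (here a field of characteristic zero), $K$ is an associative unital $k$-algebra (not necessarily commutative), $\alpha$ is a $k$-algebra endomorphism of $K$, and $K[x,\alpha]$ is the Ore extension: the algebra generated by $K$ and $x$ subject to $x\lambda=\alpha(\lambda)x$ for $\lambda\in K$. Let $f=\sum_{i=0}^n\lambda_ix^{n-i}$ with $\lambda_0=1$, $n\ge 2$, $\lambda_i\in K$, $\alpha(\lambda_i)=\lambda_i$ and $\lambda_i\lambda=\alpha^i(\lambda)\lambda_i$ for all $\lambda\in K$ and $1\le i\le n$. The monogenic extension of $K$ associated with $\alpha$ and $f$ is $A=K[x,\alpha]/\langle f\rangle$. $[K,K]_{\alpha^j}$ is the $k$-submodule of $K$ generated by all $\lambda'\alpha^j(\lambda)-\lambda\lambda'$ ($\lambda,\lambda'\in K$). $K^{\omega_h}$ is the eigenspace of $\alpha$ of eigenvalue $\omega_h$, $[K,K]^{\omega_h}_{\alpha^r}=K^{\omega_h}\cap[K,K]_{\alpha^r}$ and $[K,K]^{\omega_h}=[K,K]^{\omega_h}_{\alpha^0}$. A mixed complex $(X,b,B)$ is a graded module $(X_r)_{r\ge0}$ with maps $b\colon X_r\to X_{r-1}$, $B\colon X_r\to X_{r+1}$ with $bb=0$, $BB=0$, $Bb+bB=0$. Its cyclic homology is the homology of the total complex with $r$-th module $X_r\oplus X_{r-2}\oplus X_{r-4}\oplus\cdots$ and differential $b+B$ (where the component of $B$ on the summand $X_r$ of top degree is dropped). $\mathrm{HC}^K_*(A)$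 is the cyclic homology of the mixed complex $(A\otimes_K\overline A^{\otimes_K^*}\otimes,b,B)$, where $\overline A=A/K$; for a $K$-bimodule $N$, $N\otimes$ denotes the quotient of $N$ by the $k$-submodule generated by all $m\lambda-\lambda m$ ($m\in N,\lambda\in K$); $b$ is the canonical Hochschild boundary; and $B([a_0\otimes\cdots\otimes a_r])=\sum_{i=0}^r(-1)^{ir}[1\otimes a_i\otimes\cdots\otimes a_r\otimes a_0\otimes\cdots\otimes a_{i-1}]$. $(C^{S,\omega_h}_*(A),d^{\omega_h}_*,D^{\omega_h}_* )$ is the mixed complex with $C^{S,\omega_h}_{2m}(A)=K^{\omega_h}/[K,K]^{\omega_h}_{\alpha^{mn}}$, $C^{S,\omega_h}_{2m+1}(A)=(K^{\omega_h}/[K,K]^{\omega_h}_{\alpha^{(m+1)n}})x^{n-1}$ ($m\ge0$), $d^{\omega_h}_{2m}([\lambda])=(\sum_{l=0}^{n-1}\omega_h^l)[\lambda]x^{n-1}$ ($m\ge1$), $d^{\omega_h}_{2m+1}([\lambda]x^{n-1})=(\omega_h-1)[\lambda\lambda_n]$, $D^{\omega_h}_{2m}=0$, $D^{\omega_h}_{2m+1}([\lambda]x^{n-1})=(1-\omega_h)(\sum_{u=0}^m\omega_h^{nu})[\lambda]$ ($m\ge0$); $x^{n-1}$ is a label recording that classes are represented by elements of $Kx^{n-1}\subseteq A$. *)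

theory Defs
  imports
    "HOL-Computational_Algebra.Polynomial"
    "HOL-Library.Poly_Mapping"
    "HOL-Library.Function_Algebras"
    "HOL-Algebra.QuotRing"
begin

section \<open>Algebras, endomorphisms and eigenspaces\<close>

locale k_algebra = vector_space scale
  for scale :: "'k::field \<Rightarrow> 'a::ring_1 \<Rightarrow> 'a" +
  assumes scale_mult_left: "scale c (x * y) = scale c x * y"
    and scale_mult_right: "scale c (x * y) = x * scale c y"

definition algebra_endo :: "('k::field \<Rightarrow> 'a::ring_1 \<Rightarrow> 'a) \<Rightarrow> ('a \<Rightarrow> 'a) \<Rightarrow> bool" where
  "algebra_endo scale \<alpha> \<longleftrightarrow>
     Vector_Spaces.linear scale scale \<alpha> \<and> \<alpha> 1 = 1 \<and> (\<forall>x y. \<alpha> (x * y) = \<alpha> x * \<alpha> y)"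

definition center :: "'a::ring_1 set" where
  "center = {z. \<forall>x. z * x = x * z}"

definition invertible_elem :: "'a::ring_1 \<Rightarrow> bool" where
  "invertible_elem u \<longleftrightarrow> (\<exists>v. u * v = 1 \<and> v * u = 1)"

definition eigenspace :: "('k::field \<Rightarrow> 'a::ring_1 \<Rightarrow> 'a) \<Rightarrow> ('a \<Rightarrow> 'a) \<Rightarrow> 'k \<Rightarrow> 'a set" where
  "eigenspace scale \<alpha> c = {x. \<alpha> x = scale c x}"

definition eigenvalues :: "('k::field \<Rightarrow> 'a::ring_1 \<Rightarrow> 'a) \<Rightarrow> ('a \<Rightarrow> 'a) \<Rightarrow> 'k set" where
  "eigenvalues scale \<alpha> = {c. \<exists>x. x \<noteq> 0 \<and> \<alpha> x = scale c x}"

definition diagonalizable :: "('k::field \<Rightarrow> 'a::ring_1 \<Rightarrow> 'a) \<Rightarrow> ('a \<Rightarrow> 'a) \<Rightarrow> bool" where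
  "diagonalizable scale \<alpha> \<longleftrightarrow>
     (\<exists>B. \<not> module.dependent scale B \<and> module.span scale B = UNIV \<and>
          (\<forall>x\<in>B. \<exists>c. \<alpha> x = scale c x))"

definition twisted_comm ::
    "('k::field \<Rightarrow> 'a::ring_1 \<Rightarrow> 'a) \<Rightarrow> ('a \<Rightarrow> 'a) \<Rightarrow> nat \<Rightarrow> 'a set" where
  "twisted_comm scale \<alpha> j =
     module.span scale {x' * (\<alpha> ^^ j) x - x * x' | x x'. True}"

definition twisted_comm_eig ::
    "('k::field \<Rightarrow> 'a::ring_1 \<Rightarrow> 'a) \<Rightarrow> ('a \<Rightarrow> 'a) \<Rightarrow> 'k \<Rightarrow> nat \<Rightarrow> 'a set" where
  "twisted_comm_eig scale \<alpha> c j = eigenspace scale \<alpha> c \<inter> twisted_comm scale \<alpha> j"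


section \<open>Ore extensions and monogenic extensions\<close>

text \<open>The product of \<open>K[x, \<alpha>]\<close>, whose elements are the polynomials \<open>\<Sum> a\<^sub>i x\<^sup>i\<close> with
  coefficients on the left; it is determined by \<open>x \<lambda> = \<alpha>(\<lambda>) x\<close>. Only the additive structure
  of the type of polynomials is used.\<close>

definition ore_mult :: "('a::ring_1 \<Rightarrow> 'a) \<Rightarrow> 'a poly \<Rightarrow> 'a poly \<Rightarrow> 'a poly" where
  "ore_mult \<alpha> p q =
     (\<Sum>i\<le>degree p. \<Sum>j\<le>degree q. monom (coeff p i * (\<alpha> ^^ i) (coeff q j)) (i + j))"

definition ore_ring :: "('a::ring_1 \<Rightarrow> 'a) \<Rightarrow> 'a poly ring" where
  "ore_ring \<alpha> = \<lparr>carrier = UNIV, mult = ore_mult \<alpha>, one = [:1:], zero = 0, add = (+)\<rparr>"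

definition monogenic_poly :: "nat \<Rightarrow> (nat \<Rightarrow> 'a::ring_1) \<Rightarrow> 'a poly" where
  "monogenic_poly n lam = (\<Sum>i\<le>n. monom (lam i) (n - i))"

definition monogenic_ideal ::
    "('a::ring_1 \<Rightarrow> 'a) \<Rightarrow> nat \<Rightarrow> (nat \<Rightarrow> 'a) \<Rightarrow> 'a poly set" where
  "monogenic_ideal \<alpha> n lam = genideal (ore_ring \<alpha>) {monogenic_poly n lam}"

definition monogenic_ext ::
    "('a::ring_1 \<Rightarrow> 'a) \<Rightarrow> nat \<Rightarrow> (nat \<Rightarrow> 'a) \<Rightarrow> 'a poly set ring" where
  "monogenic_ext \<alpha> n lam = ore_ring \<alpha> Quot monogenic_ideal \<alpha> n lam"

definition monogenic_incl ::
    "('a::ring_1 \<Rightarrow> 'a) \<Rightarrow> nat \<Rightarrow> (nat \<Rightarrow> 'a) \<Rightarrow> 'a \<Rightarrow> 'a poly set" where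
  "monogenic_incl \<alpha> n lam l = monogenic_ideal \<alpha> n lam +>\<^bsub>ore_ring \<alpha>\<^esub> [:l:]"

text \<open>The definition of \<^const>\<open>genideal\<close> is only meaningful over a ring.\<close>

lemma coeff_ore_mult:
  assumes "algebra_endo scale \<alpha>"
  shows "coeff (ore_mult \<alpha> p q) k = (\<Sum>i\<le>k. coeff p i * (\<alpha> ^^ i) (coeff q (k - i)))"
proof -
  interpret l: Vector_Spaces.linear scale scale \<alpha> using assms by (simp add: algebra_endo_def)
  have a0: "(\<alpha> ^^ i) 0 = 0" for i by (induction i) (auto simp: l.zero)
  let ?h = "\<lambda>i j. coeff p i * (\<alpha> ^^ i) (coeff q j)"
  have "coeff (ore_mult \<alpha> p q) k
      = (\<Sum>i\<le>degree p. \<Sum>j\<le>degree q. if i + j = k then ?h i j else 0)"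
    by (simp add: ore_mult_def coeff_sum)
  also have "\<dots> = (\<Sum>i\<le>degree p. if i \<le> k then ?h i (k - i) else 0)"
  proof (rule sum.cong[OF refl])
    fix i
    have "(\<Sum>j\<le>degree q. if i + j = k then ?h i j else 0)
        = (\<Sum>j\<le>degree q. if j = k - i then (if i \<le> k then ?h i (k - i) else 0) else 0)"
      by (rule sum.cong) auto
    also have "\<dots> = (if i \<le> k then ?h i (k - i) else 0)"
      by (auto simp: coeff_eq_0 a0)
    finally show "(\<Sum>j\<le>degree q. if i + j = k then ?h i j else 0)
        = (if i \<le> k then ?h i (k - i) else 0)" .
  qed
  also have "\<dots> = (\<Sum>i\<le>max (degree p) k. if i \<le> k then ?h i (k - i) else 0)"
    by (rule sum.mono_neutral_left) (auto simp: coeff_eq_0)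
  also have "\<dots> = (\<Sum>i\<le>k. ?h i (k - i))"
    by (rule sum.mono_neutral_cong_right) auto
  finally show ?thesis .
qed

lemma ring_ore_ring:
  fixes \<alpha> :: "'a::ring_1 \<Rightarrow> 'a"
  assumes "algebra_endo scale \<alpha>"
  shows "ring (ore_ring \<alpha>)"
proof -
  interpret l: Vector_Spaces.linear scale scale \<alpha> using assms by (simp add: algebra_endo_def)
  have a0: "(\<alpha> ^^ i) 0 = 0" and a1: "(\<alpha> ^^ i) 1 = 1" for i
    using assms by (induction i) (auto simp: l.zero algebra_endo_def)
  have aa: "(\<alpha> ^^ i) (x + y) = (\<alpha> ^^ i) x + (\<alpha> ^^ i) y"
    and am: "(\<alpha> ^^ i) (x * y) = (\<alpha> ^^ i) x * (\<alpha> ^^ i) y" for i x y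
    using assms by (induction i) (auto simp: l.add algebra_endo_def)
  have as: "(\<alpha> ^^ i) (sum g S) = (\<Sum>j\<in>S. (\<alpha> ^^ i) (g j))" for i S and g :: "nat \<Rightarrow> 'a"
    by (induction S rule: infinite_finite_induct) (auto simp: a0 aa)
  note c = coeff_ore_mult[OF assms]
  have assoc: "ore_mult \<alpha> (ore_mult \<alpha> p q) r = ore_mult \<alpha> p (ore_mult \<alpha> q r)" for p q r
  proof (rule poly_eqI)
    fix k
    let ?t = "\<lambda>i j. coeff p i * (\<alpha> ^^ i) (coeff q j) * (\<alpha> ^^ (i + j)) (coeff r (k - (i + j)))"
    have "coeff (ore_mult \<alpha> (ore_mult \<alpha> p q) r) k = (\<Sum>m\<le>k. \<Sum>i\<le>m. ?t i (m - i))"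
      by (auto simp: c sum_distrib_right intro!: sum.cong)
    also have "\<dots> = (\<Sum>(i, j)\<in>{(i, j). i + j \<le> k}. ?t i j)"
      by (rule sum.triangle_reindex_eq[symmetric])
    also have "{(i, j). i + j \<le> k} = Sigma {..k} (\<lambda>i. {..k - i})" by auto
    also have "(\<Sum>(i, j)\<in>Sigma {..k} (\<lambda>i. {..k - i}). ?t i j) = (\<Sum>i\<le>k. \<Sum>j\<le>k - i. ?t i j)"
      by (rule sum.Sigma[symmetric]) auto
    also have "\<dots> = coeff (ore_mult \<alpha> p (ore_mult \<alpha> q r)) k"
      by (auto simp: c as am sum_distrib_left funpow_add mult.assoc intro!: sum.cong)
    finally show "coeff (ore_mult \<alpha> (ore_mult \<alpha> p q) r) k = coeff (ore_mult \<alpha> p (ore_mult \<alpha> q r)) k" .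
  qed
  have one_l: "ore_mult \<alpha> [:1:] p = p" for p
  proof (rule poly_eqI)
    fix k
    have "coeff (ore_mult \<alpha> [:1:] p) k = (\<Sum>i\<le>k. if i = 0 then coeff p k else 0)"
      unfolding c by (rule sum.cong) (auto simp: coeff_pCons split: nat.splits)
    then show "coeff (ore_mult \<alpha> [:1:] p) k = coeff p k" by simp
  qed
  have one_r: "ore_mult \<alpha> p [:1:] = p" for p
  proof (rule poly_eqI)
    fix k
    have "coeff (ore_mult \<alpha> p [:1:]) k = (\<Sum>i\<le>k. if i = k then coeff p k else 0)"
      unfolding c by (rule sum.cong) (auto simp: coeff_pCons a0 a1 split: nat.splits)
    then show "coeff (ore_mult \<alpha> p [:1:]) k = coeff p k" by simp
  qed
  show ?thesis
  proof (rule ringI)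
    show "abelian_group (ore_ring \<alpha>)"
    proof (rule abelian_groupI)
      fix p assume "p \<in> carrier (ore_ring \<alpha>)"
      show "\<exists>q\<in>carrier (ore_ring \<alpha>). q \<oplus>\<^bsub>ore_ring \<alpha>\<^esub> p = \<zero>\<^bsub>ore_ring \<alpha>\<^esub>"
        by (rule bexI[of _ "- p"]) (auto simp: ore_ring_def)
    qed (auto simp: ore_ring_def algebra_simps)
    show "monoid (ore_ring \<alpha>)"
      by (rule monoidI) (auto simp: ore_ring_def assoc one_l one_r)
  qed (auto simp: ore_ring_def poly_eq_iff c aa algebra_simps sum.distrib)
qed


section \<open>Quotient spaces\<close>

text \<open>The \<open>k\<close>-vector space \<open>qnum Q / qden Q\<close>, for subspaces \<open>qden Q \<subseteq> qnum Q\<close> of an ambient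
  space whose scalar multiplication is \<open>qscale Q\<close>.\<close>

record ('k, 'v) quot_space =
  qscale :: "'k \<Rightarrow> 'v \<Rightarrow> 'v"
  qnum :: "'v set"
  qden :: "'v set"

definition qclass :: "('k, 'v::ab_group_add) quot_space \<Rightarrow> 'v \<Rightarrow> 'v set" where
  "qclass Q x = {y \<in> qnum Q. y - x \<in> qden Q}"

definition qcarrier :: "('k, 'v::ab_group_add) quot_space \<Rightarrow> 'v set set" where
  "qcarrier Q = qclass Q ` qnum Q"

definition q_iso :: "('k, 'v::ab_group_add) quot_space \<Rightarrow> ('k, 'w::ab_group_add) quot_space \<Rightarrow> bool"
    (infix \<open>\<cong>\<^sub>q\<close> 50) where
  "Q \<cong>\<^sub>q Q' \<longleftrightarrow>
     (\<exists>\<phi>. bij_betw \<phi> (qcarrier Q) (qcarrier Q') \<and>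
        (\<forall>c. \<forall>x\<in>qnum Q. \<forall>y\<in>qnum Q. \<forall>u\<in>qnum Q'. \<forall>v\<in>qnum Q'.
           \<phi> (qclass Q x) = qclass Q' u \<longrightarrow> \<phi> (qclass Q y) = qclass Q' v \<longrightarrow>
           \<phi> (qclass Q (qscale Q c x + y)) = qclass Q' (qscale Q' c u + v)))"

definition q_zero :: "('k \<Rightarrow> 'v \<Rightarrow> 'v) \<Rightarrow> ('k, 'v::ab_group_add) quot_space" where
  "q_zero s = \<lparr>qscale = s, qnum = {0}, qden = {0}\<rparr>"

text \<open>Direct sum over a finite index set.\<close>

definition q_sum :: "'i set \<Rightarrow> ('i \<Rightarrow> ('k, 'v::ab_group_add) quot_space) \<Rightarrow> ('k, 'i \<Rightarrow> 'v) quot_space" where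
  "q_sum I Q =
     \<lparr>qscale = (\<lambda>c z i. qscale (Q i) c (z i)),
      qnum = {z. (\<forall>i\<in>I. z i \<in> qnum (Q i)) \<and> (\<forall>i. i \<notin> I \<longrightarrow> z i = 0)},
      qden = {z. (\<forall>i\<in>I. z i \<in> qden (Q i)) \<and> (\<forall>i. i \<notin> I \<longrightarrow> z i = 0)}\<rparr>"


section \<open>Mixed complexes and cyclic homology\<close>

text \<open>The modules \<open>X\<^sub>r\<close> are quotient spaces; \<open>mc_b X r\<close> and \<open>mc_B X r\<close> act on the ambient space
  of \<open>X\<^sub>r\<close>, and are to be read as the maps that they induce on the quotient.\<close>

record ('k, 'v) mixed_complex =
  mc_space :: "nat \<Rightarrow> ('k, 'v) quot_space"
  mc_b :: "nat \<Rightarrow> 'v \<Rightarrow> 'v"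
  mc_B :: "nat \<Rightarrow> 'v \<Rightarrow> 'v"

text \<open>In an element \<open>z\<close> of the total complex of degree \<open>r\<close>, the component \<open>z j\<close> lies in
  \<open>X\<^bsub>r - 2j\<^esub>\<close>. The value of \<open>B\<close> on \<open>z 0\<close> does not occur in the differential, and neither
  does \<open>b\<close> on \<open>X\<^sub>0\<close>.\<close>

definition tot_space ::
    "('k, 'v::ab_group_add) mixed_complex \<Rightarrow> nat \<Rightarrow> ('k, nat \<Rightarrow> 'v) quot_space" where
  "tot_space X r = q_sum {j. 2 * j \<le> r} (\<lambda>j. mc_space X (r - 2 * j))"

definition tot_diff ::
    "('k, 'v::ab_group_add) mixed_complex \<Rightarrow> nat \<Rightarrow> (nat \<Rightarrow> 'v) \<Rightarrow> (nat \<Rightarrow> 'v)" where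
  "tot_diff X r z = (\<lambda>j.
     if 2 * j + 1 \<le> r
     then mc_b X (r - 2 * j) (z j) +
          (if 2 * j + 2 \<le> r then mc_B X (r - 2 * j - 2) (z (Suc j)) else 0)
     else 0)"

text \<open>Cycles modulo boundaries of the complex of the quotients \<open>tot_space X r\<close>, written in the
  ambient spaces: \<open>z\<close> represents a cycle if its differential represents zero, and the
  representatives of zero are part of the denominator.\<close>

definition cyclic_homology ::
    "('k, 'v::ab_group_add) mixed_complex \<Rightarrow> nat \<Rightarrow> ('k, nat \<Rightarrow> 'v) quot_space" where
  "cyclic_homology X r =
     \<lparr>qscale = qscale (tot_space X r),
      qnum = {z \<in> qnum (tot_space X r).
                r = 0 \<or> tot_diff X r z \<in> qden (tot_space X (r - 1))},
      qden = {tot_diff X (Suc r) y + w | y w.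
                y \<in> qnum (tot_space X (Suc r)) \<and> w \<in> qden (tot_space X r)}\<rparr>"


section \<open>The mixed complex of an algebra relative to a subalgebra\<close>

text \<open>Formal \<open>k\<close>-linear combinations of elements of \<open>'x\<close>.\<close>

definition fscale :: "'k::field \<Rightarrow> ('x \<Rightarrow>\<^sub>0 'k) \<Rightarrow> ('x \<Rightarrow>\<^sub>0 'k)" where
  "fscale c v = Poly_Mapping.map ((*) c) v"

lemma lookup_fscale: "Poly_Mapping.lookup (fscale c v) x = c * Poly_Mapping.lookup v x"
  by (simp add: fscale_def Poly_Mapping.map.rep_eq when_def)

global_interpretation free_space: vector_space fscale
  by unfold_locales
    (auto intro!: poly_mapping_eqI simp: lookup_fscale lookup_add algebra_simps)

abbreviation gen :: "'x \<Rightarrow> ('x \<Rightarrow>\<^sub>0 'k::field)" where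
  "gen x \<equiv> Poly_Mapping.single x 1"

definition free_extend ::
    "('x \<Rightarrow> ('y \<Rightarrow>\<^sub>0 'k::field)) \<Rightarrow> ('x \<Rightarrow>\<^sub>0 'k) \<Rightarrow> ('y \<Rightarrow>\<^sub>0 'k)" where
  "free_extend h v = (\<Sum>x\<in>Poly_Mapping.keys v. fscale (Poly_Mapping.lookup v x) (h x))"

text \<open>In this section \<open>A\<close> is a ring and \<open>\<iota>\<close> its structure map from \<open>K\<close>; the scalar \<open>c\<close> of \<open>k\<close>
  acts on \<open>A\<close> as \<open>\<iota> (scale c 1)\<close>.\<close>

definition tuples :: "('b, 'm) ring_scheme \<Rightarrow> nat \<Rightarrow> 'b list set" where
  "tuples A r = {as. length as = Suc r \<and> set as \<subseteq> carrier A}"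

text \<open>The tuple \<open>[a\<^sub>0, \<dots>, a\<^sub>r]\<close> stands for the class of
  \<open>a\<^sub>0 \<otimes> \<dots> \<otimes> a\<^sub>r\<close> in \<open>(A \<otimes>\<^sub>K (A/K) \<otimes>\<^sub>K \<dots> \<otimes>\<^sub>K (A/K)) \<otimes>\<close>. The rules \<open>add\<close>, \<open>smult\<close> and \<open>balanced\<close>
  are the defining relations of the tensor product over \<open>K\<close>, \<open>reduced\<close> says that an entry other than
  \<open>a\<^sub>0\<close> only matters through its class in \<open>A/K\<close>, and \<open>cyclic\<close> kills \<open>m \<lambda> - \<lambda> m\<close>.\<close>

inductive_set cyclic_tensor_rel ::
    "('k::field \<Rightarrow> 'a::ring_1 \<Rightarrow> 'a) \<Rightarrow> ('b, 'm) ring_scheme \<Rightarrow> ('a \<Rightarrow> 'b) \<Rightarrow> nat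
      \<Rightarrow> ('b list \<Rightarrow>\<^sub>0 'k) set"
  for scale :: "'k \<Rightarrow> 'a \<Rightarrow> 'a" and A :: "('b, 'm) ring_scheme" and \<iota> :: "'a \<Rightarrow> 'b" and r :: nat
where
  add: "\<lbrakk>xs @ a # ys \<in> tuples A r; a' \<in> carrier A\<rbrakk> \<Longrightarrow>
    gen (xs @ (a \<oplus>\<^bsub>A\<^esub> a') # ys) - gen (xs @ a # ys) - gen (xs @ a' # ys)
      \<in> cyclic_tensor_rel scale A \<iota> r"
| smult: "xs @ a # ys \<in> tuples A r \<Longrightarrow>
    gen (xs @ (\<iota> (scale c 1) \<otimes>\<^bsub>A\<^esub> a) # ys) - fscale c (gen (xs @ a # ys))
      \<in> cyclic_tensor_rel scale A \<iota> r"
| balanced: "xs @ a # a' # ys \<in> tuples A r \<Longrightarrow>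
    gen (xs @ (a \<otimes>\<^bsub>A\<^esub> \<iota> l) # a' # ys) - gen (xs @ a # (\<iota> l \<otimes>\<^bsub>A\<^esub> a') # ys)
      \<in> cyclic_tensor_rel scale A \<iota> r"
| reduced: "a0 # xs @ a # ys \<in> tuples A r \<Longrightarrow>
    gen (a0 # xs @ (a \<oplus>\<^bsub>A\<^esub> \<iota> l) # ys) - gen (a0 # xs @ a # ys)
      \<in> cyclic_tensor_rel scale A \<iota> r"
| cyclic: "as \<in> tuples A r \<Longrightarrow>
    gen (as[r := (as ! r) \<otimes>\<^bsub>A\<^esub> \<iota> l]) - gen (as[0 := \<iota> l \<otimes>\<^bsub>A\<^esub> (as ! 0)])
      \<in> cyclic_tensor_rel scale A \<iota> r"

definition cyclic_tensor ::
    "('k::field \<Rightarrow> 'a::ring_1 \<Rightarrow> 'a) \<Rightarrow> ('b, 'm) ring_scheme \<Rightarrow> ('a \<Rightarrow> 'b) \<Rightarrow> nat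
      \<Rightarrow> ('k, 'b list \<Rightarrow>\<^sub>0 'k) quot_space" where
  "cyclic_tensor scale A \<iota> r =
     \<lparr>qscale = fscale,
      qnum = {v. Poly_Mapping.keys v \<subseteq> tuples A r},
      qden = module.span fscale (cyclic_tensor_rel scale A \<iota> r)\<rparr>"

definition hochschild_b ::
    "('b, 'm) ring_scheme \<Rightarrow> nat \<Rightarrow> 'b list \<Rightarrow> ('b list \<Rightarrow>\<^sub>0 'k::field)" where
  "hochschild_b A r as =
     (if r = 0 then 0 else
       (\<Sum>i<r. fscale ((- 1) ^ i)
          (gen (take i as @ (as ! i \<otimes>\<^bsub>A\<^esub> as ! Suc i) # drop (i + 2) as))) +
       fscale ((- 1) ^ r) (gen ((as ! r \<otimes>\<^bsub>A\<^esub> as ! 0) # take (r - 1) (tl as))))"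

definition connes_B ::
    "('b, 'm) ring_scheme \<Rightarrow> nat \<Rightarrow> 'b list \<Rightarrow> ('b list \<Rightarrow>\<^sub>0 'k::field)" where
  "connes_B A r as =
     (\<Sum>i\<le>r. fscale ((- 1) ^ (i * r)) (gen (\<one>\<^bsub>A\<^esub> # drop i as @ take i as)))"

definition relative_mixed_complex ::
    "('k::field \<Rightarrow> 'a::ring_1 \<Rightarrow> 'a) \<Rightarrow> ('b, 'm) ring_scheme \<Rightarrow> ('a \<Rightarrow> 'b)
      \<Rightarrow> ('k, 'b list \<Rightarrow>\<^sub>0 'k) mixed_complex" where
  "relative_mixed_complex scale A \<iota> =
     \<lparr>mc_space = cyclic_tensor scale A \<iota>,
      mc_b = (\<lambda>r. free_extend (hochschild_b A r)),
      mc_B = (\<lambda>r. free_extend (connes_B A r))\<rparr>"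


section \<open>The small mixed complexes\<close>

text \<open>The label \<open>x\<^bsup>n-1\<^esup>\<close> carried by the classes of odd degree is omitted. In odd degree
  \<open>r = 2m + 1\<close> one has \<open>(m + 1) n = (r + 1) div 2 * n\<close>, and in even degree \<open>r = 2m\<close> also
  \<open>m n = (r + 1) div 2 * n\<close>.\<close>

definition small_mixed_complex ::
    "('k::field \<Rightarrow> 'a::ring_1 \<Rightarrow> 'a) \<Rightarrow> ('a \<Rightarrow> 'a) \<Rightarrow> nat \<Rightarrow> (nat \<Rightarrow> 'a) \<Rightarrow> 'k
      \<Rightarrow> ('k, 'a) mixed_complex" where
  "small_mixed_complex scale \<alpha> n lam w =
     \<lparr>mc_space = (\<lambda>r.
        \<lparr>qscale = scale,
         qnum = eigenspace scale \<alpha> w,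
         qden = twisted_comm_eig scale \<alpha> w ((r + 1) div 2 * n)\<rparr>),
      mc_b = (\<lambda>r y.
        if r = 0 then 0
        else if even r then scale (\<Sum>l<n. w ^ l) y
        else scale (w - 1) (y * lam n)),
      mc_B = (\<lambda>r y.
        if even r then 0
        else scale ((1 - w) * (\<Sum>u\<le>r div 2. w ^ (n * u))) y)\<rparr>"

end

theory Submission
  imports Defs
begin

text \<open>The hypothesis on the central element \<open>z\<close> is used twice. On the one hand \<open>z \<lambda>\<^sub>i = \<lambda>\<^sub>i z = \<alpha>\<^sup>i(z) \<lambda>\<^sub>i\<close>, and \<open>z - \<alpha>\<^sup>i(z)\<close>
  is invertible, so that \<open>\<lambda>\<^sub>i = 0\<close> for \<open>1 \<le> i < n\<close> and \<open>f = x\<^sup>n + l\<close> with \<open>l = \<lambda>\<^sub>n\<close>. On the other hand every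
  element of \<open>K\<close> is a sum of \<open>\<alpha>\<^sup>j\<close>-commutators unless \<open>n\<close> divides \<open>j\<close> (\<open>TC_UNIV_if_separated\<close>).

  The tensors that make up the relative complex of \<open>A\<close> have a normal form: they are combinations of words
  \<open>x\<^bsup>i\<^sub>0\<^esup> \<otimes> \<dots> \<otimes> x\<^bsup>i\<^sub>r\<^esup>\<close> with \<open>i\<^sub>1, \<dots>, i\<^sub>r \<ge> 1\<close> and all exponents below \<open>n\<close>, with coefficients in \<open>K\<close> on the left. Because the
  tensors are cyclic over \<open>K\<close>, the coefficient of a word of weight \<open>j = i\<^sub>0 + \<dots> + i\<^sub>r\<close> counts modulo \<open>[K,K]\<close> twisted by \<open>\<alpha>\<^sup>j\<close>
  (\<open>relative_HC_normal\<close>). Therefore only the weights \<open>n N\<close> matter. The Hochschild boundary merges neighbours; it preserves the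
  weight, or lowers it by \<open>n\<close> if the relation \<open>x\<^sup>n = -l\<close> has to be applied. The part that preserves the weight is a
  version of the Hochschild boundary of \<open>k[x]/(x\<^sup>n)\<close> twisted by \<open>\<alpha>\<close>. A combinatorial argument on words
  (\<open>words_acyclic\<close>, \<open>HH_acyclic\<close>) shows that in weight \<open>n N\<close> its homology sits in the degrees \<open>2N - 1\<close> and \<open>2N\<close>, on words in
  which \<open>x\<close> and \<open>x\<^bsup>n-1\<^esup>\<close> alternate; the functionals \<open>pf\<close> and \<open>qf\<close> detect it, and they are linked by the norm operator
  \<open>E = 1 + \<alpha> + \<dots> + \<alpha>\<^bsup>n-1\<^esup>\<close> (\<open>pf_b0\<close>).

  The small mixed complexes are the parts, on the eigenspaces of \<open>\<alpha>\<close>, of a single mixed complex \<open>full_complex\<close> on \<open>K\<close>, and Lagrange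
  interpolation makes all constructions compatible with the eigenspaces (\<open>full_HC_split\<close>). A map \<open>th\<close> from this complex to the
  complex of normal forms can be given explicitly. It is made of alternating words, and in positive degrees it lives on the eigenvalues \<open>w \<noteq> 1\<close> with
  \<open>w\<^sup>n = 1\<close>, where \<open>1 - \<alpha>\<close> can be inverted; this is what makes it possible to have it commute with \<open>b\<close> and \<open>B\<close> at the same time.
  For the other eigenvalues the operator \<open>E\<close> is invertible and there is nothing to compare in
  positive degrees. Descending through the weights one sees that the cone of \<open>th\<close> is acyclic (\<open>cone_even\<close>, \<open>cone_odd\<close>), and a
  map of mixed complexes with acyclic cone induces isomorphisms in cyclic homology (\<open>cyclic_homology_iso\<close>).

  Finally the cyclic homology of a small complex is computed directly. If \<open>1 + w + \<dots> + w\<^bsup>n-1\<^esup> \<noteq> 0\<close>, then the boundary from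
  even to odd degrees is invertible (\<open>small_HC_regular\<close>). Otherwise this boundary is zero, and in the total complex
  the relations identify \<open>[\<lambda> l]\<close> in one column with a multiple of \<open>[\<lambda>]\<close> in the next one, so that all columns can be
  moved into one by means of divided powers of \<open>l\<close> (\<open>small_HC_singular_even\<close>, \<open>small_HC_singular_odd\<close>).\<close>

section \<open>Isomorphisms of quotient spaces\<close>

lemma qclass_eq_iff:
  assumes "0 \<in> qden Q" and "\<And>x y. x \<in> qden Q \<Longrightarrow> y \<in> qden Q \<Longrightarrow> x - y \<in> qden Q"
    and "x \<in> qnum Q" "y \<in> qnum Q"
  shows "qclass Q x = qclass Q y \<longleftrightarrow> x - y \<in> qden Q"
proof
  assume "qclass Q x = qclass Q y"
  moreover have "x \<in> qclass Q x" using assms by (simp add: qclass_def)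
  ultimately show "x - y \<in> qden Q" by (simp add: qclass_def)
next
  assume d: "x - y \<in> qden Q"
  have "z - x \<in> qden Q \<longleftrightarrow> z - y \<in> qden Q" for z
  proof
    assume "z - x \<in> qden Q"
    from assms(2)[OF this assms(2)[OF assms(1) d]] show "z - y \<in> qden Q" by simp
  next
    assume "z - y \<in> qden Q"
    from assms(2)[OF this d] show "z - x \<in> qden Q" by simp
  qed
  then show "qclass Q x = qclass Q y" by (auto simp: qclass_def)
qed

text \<open>A linear map of the ambient spaces induces a linear isomorphism of the quotients if it detects the denominators
  and is onto modulo the second one. The inverse is built from a choice of preimages, so it is a map of classes only; for
  this reason both directions are recorded here.\<close>

lemma q_iso_induced:
  fixes Q :: "('k, 'v::ab_group_add) quot_space" and Q' :: "('k, 'w::ab_group_add) quot_space"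
  assumes num: "\<And>c x y. x \<in> qnum Q \<Longrightarrow> y \<in> qnum Q \<Longrightarrow> qscale Q c x + y \<in> qnum Q"
    and num': "\<And>c x y. x \<in> qnum Q' \<Longrightarrow> y \<in> qnum Q' \<Longrightarrow> qscale Q' c x + y \<in> qnum Q'"
    and den0: "0 \<in> qden Q" and den: "\<And>x y. x \<in> qden Q \<Longrightarrow> y \<in> qden Q \<Longrightarrow> x - y \<in> qden Q"
    and den0': "0 \<in> qden Q'" and den': "\<And>x y. x \<in> qden Q' \<Longrightarrow> y \<in> qden Q' \<Longrightarrow> x - y \<in> qden Q'"
    and sden: "\<And>c x y. x - y \<in> qden Q \<Longrightarrow> qscale Q c x - qscale Q c y \<in> qden Q"
    and sden': "\<And>c x y. x - y \<in> qden Q' \<Longrightarrow> qscale Q' c x - qscale Q' c y \<in> qden Q'"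
    and f_num: "\<And>x. x \<in> qnum Q \<Longrightarrow> f x \<in> qnum Q'"
    and f_add: "\<And>x y. f (x - y) = f x - f y"
    and f_lin: "\<And>c x y. x \<in> qnum Q \<Longrightarrow> y \<in> qnum Q \<Longrightarrow> f (qscale Q c x + y) = qscale Q' c (f x) + f y"
    and numd: "\<And>x y. x \<in> qnum Q \<Longrightarrow> y \<in> qnum Q \<Longrightarrow> x - y \<in> qnum Q"
    and f_den: "\<And>x. x \<in> qnum Q \<Longrightarrow> x \<in> qden Q \<Longrightarrow> f x \<in> qden Q'"
    and f_inj: "\<And>x. x \<in> qnum Q \<Longrightarrow> f x \<in> qden Q' \<Longrightarrow> x \<in> qden Q"
    and f_surj: "\<And>u. u \<in> qnum Q' \<Longrightarrow> \<exists>x\<in>qnum Q. u - f x \<in> qden Q'"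
  shows "Q \<cong>\<^sub>q Q'" and "Q' \<cong>\<^sub>q Q"
proof -
  note eq = qclass_eq_iff[of Q, OF den0 den] and eq' = qclass_eq_iff[of Q', OF den0' den']
  define g where "g u = (SOME x. x \<in> qnum Q \<and> u - f x \<in> qden Q')" for u
  have g: "g u \<in> qnum Q" "u - f (g u) \<in> qden Q'" if "u \<in> qnum Q'" for u
    using someI_ex[of "\<lambda>x. x \<in> qnum Q \<and> u - f x \<in> qden Q'"] f_surj[OF that] by (auto simp: g_def)
  define \<phi> where "\<phi> C = qclass Q' (f (SOME x. x \<in> C))" for C
  define \<psi> where "\<psi> C = qclass Q (g (SOME u. u \<in> C))" for C
  have ff: "f x - f y \<in> qden Q' \<longleftrightarrow> x - y \<in> qden Q" if "x \<in> qnum Q" "y \<in> qnum Q" for x y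
    using f_den[OF numd[OF that]] f_inj[OF numd[OF that]] by (auto simp: f_add)
  have some: "(SOME y. y \<in> qclass Q x) \<in> qnum Q \<and> (SOME y. y \<in> qclass Q x) - x \<in> qden Q"
    if "x \<in> qnum Q" for x
  proof -
    have "x \<in> qclass Q x" using that den0 by (simp add: qclass_def)
    then have "(SOME y. y \<in> qclass Q x) \<in> qclass Q x" by (rule someI)
    then show ?thesis by (simp add: qclass_def)
  qed
  have some': "(SOME y. y \<in> qclass Q' x) \<in> qnum Q' \<and> (SOME y. y \<in> qclass Q' x) - x \<in> qden Q'"
    if "x \<in> qnum Q'" for x
  proof -
    have "x \<in> qclass Q' x" using that den0' by (simp add: qclass_def)
    then have "(SOME y. y \<in> qclass Q' x) \<in> qclass Q' x" by (rule someI)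
    then show ?thesis by (simp add: qclass_def)
  qed
  have phi: "\<phi> (qclass Q x) = qclass Q' (f x)" if "x \<in> qnum Q" for x
    unfolding \<phi>_def using some[OF that] that by (subst eq') (auto simp: f_num ff)
  have gu: "g u - g v \<in> qden Q" if "u \<in> qnum Q'" "v \<in> qnum Q'" "u - v \<in> qden Q'" for u v
  proof -
    have "(u - v) - (u - f (g u)) - (0 - (v - f (g v))) \<in> qden Q'"
      by (intro den' den0' g that)
    then have "f (g u) - f (g v) \<in> qden Q'" by simp
    then show ?thesis using ff g(1) that by blast
  qed
  have psi: "\<psi> (qclass Q' u) = qclass Q (g u)" if "u \<in> qnum Q'" for u
    unfolding \<psi>_def using some'[OF that] that by (subst eq) (auto simp: g gu)
  have inv1: "\<psi> (\<phi> (qclass Q x)) = qclass Q x" if "x \<in> qnum Q" for x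
  proof -
    have "f x - f (g (f x)) \<in> qden Q'" using g f_num that by blast
    then have "x - g (f x) \<in> qden Q" using ff g f_num that by blast
    then have "qclass Q x = qclass Q (g (f x))" using that f_num g by (simp add: eq)
    then show ?thesis using phi[OF that] psi[OF f_num[OF that]] by simp
  qed
  have inv2: "\<phi> (\<psi> (qclass Q' u)) = qclass Q' u" if "u \<in> qnum Q'" for u
  proof -
    have "qclass Q' u = qclass Q' (f (g u))" using that f_num g by (simp add: eq')
    then show ?thesis using psi[OF that] phi[OF g(1)[OF that]] by simp
  qed
  show "Q \<cong>\<^sub>q Q'"
    unfolding q_iso_def
  proof (intro exI[of _ \<phi>] conjI allI ballI impI)
    show "bij_betw \<phi> (qcarrier Q) (qcarrier Q')"
      by (rule bij_betw_byWitness[where f' = \<psi>])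
        (auto simp: qcarrier_def inv1 inv2, auto simp: phi psi f_num g)
    fix c x y u v
    assume a: "x \<in> qnum Q" "y \<in> qnum Q" "u \<in> qnum Q'" "v \<in> qnum Q'"
      "\<phi> (qclass Q x) = qclass Q' u" "\<phi> (qclass Q y) = qclass Q' v"
    then have "f x - u \<in> qden Q'" "f y - v \<in> qden Q'" by (simp_all add: phi eq' f_num)
    then have "qscale Q' c (f x) - qscale Q' c u \<in> qden Q'" "0 - (f y - v) \<in> qden Q'"
      using sden' den'[OF den0'] by blast+
    from den'[OF this] have "qscale Q' c (f x) + f y - (qscale Q' c u + v) \<in> qden Q'"
      by (simp add: algebra_simps)
    then show "\<phi> (qclass Q (qscale Q c x + y)) = qclass Q' (qscale Q' c u + v)"
      using a by (simp add: phi num num' eq' f_num f_lin[symmetric])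
  qed
  show "Q' \<cong>\<^sub>q Q"
    unfolding q_iso_def
  proof (intro exI[of _ \<psi>] conjI allI ballI impI)
    show "bij_betw \<psi> (qcarrier Q') (qcarrier Q)"
      by (rule bij_betw_byWitness[where f' = \<phi>])
        (auto simp: qcarrier_def inv1 inv2, auto simp: phi psi f_num g)
    fix c u v x y
    assume a: "u \<in> qnum Q'" "v \<in> qnum Q'" "x \<in> qnum Q" "y \<in> qnum Q"
      "\<psi> (qclass Q' u) = qclass Q x" "\<psi> (qclass Q' v) = qclass Q y"
    then have "\<phi> (qclass Q x) = qclass Q' u" "\<phi> (qclass Q y) = qclass Q' v"
      using inv2 by metis+
    then have "f x - u \<in> qden Q'" "f y - v \<in> qden Q'" using a by (simp_all add: phi eq' f_num)
    then have "qscale Q' c (f x) - qscale Q' c u \<in> qden Q'" "0 - (f y - v) \<in> qden Q'"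
      using sden' den'[OF den0'] by blast+
    from den'[OF this] have "qscale Q' c (f x) + f y - (qscale Q' c u + v) \<in> qden Q'"
      by (simp add: algebra_simps)
    then have "\<phi> (qclass Q (qscale Q c x + y)) = qclass Q' (qscale Q' c u + v)"
      using a by (simp add: phi num num' eq' f_num f_lin[symmetric])
    then show "\<psi> (qclass Q' (qscale Q' c u + v)) = qclass Q (qscale Q c x + y)"
      using inv1 num a by metis
  qed
qed

lemma q_iso_trans:
  fixes Q :: "('k, 'v::ab_group_add) quot_space" and Q' :: "('k, 'w::ab_group_add) quot_space"
    and Q'' :: "('k, 'x::ab_group_add) quot_space"
  assumes "Q \<cong>\<^sub>q Q'" "Q' \<cong>\<^sub>q Q''"
  shows "Q \<cong>\<^sub>q Q''"
proof -
  obtain \<phi> where bij: "bij_betw \<phi> (qcarrier Q) (qcarrier Q')"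
    and lin: "\<And>c x y u v. x \<in> qnum Q \<Longrightarrow> y \<in> qnum Q \<Longrightarrow> u \<in> qnum Q' \<Longrightarrow> v \<in> qnum Q' \<Longrightarrow>
       \<phi> (qclass Q x) = qclass Q' u \<Longrightarrow> \<phi> (qclass Q y) = qclass Q' v \<Longrightarrow>
       \<phi> (qclass Q (qscale Q c x + y)) = qclass Q' (qscale Q' c u + v)"
    using assms(1) unfolding q_iso_def by metis
  obtain \<psi> where bij': "bij_betw \<psi> (qcarrier Q') (qcarrier Q'')"
    and lin': "\<And>c x y u v. x \<in> qnum Q' \<Longrightarrow> y \<in> qnum Q' \<Longrightarrow> u \<in> qnum Q'' \<Longrightarrow> v \<in> qnum Q'' \<Longrightarrow>
       \<psi> (qclass Q' x) = qclass Q'' u \<Longrightarrow> \<psi> (qclass Q' y) = qclass Q'' v \<Longrightarrow>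
       \<psi> (qclass Q' (qscale Q' c x + y)) = qclass Q'' (qscale Q'' c u + v)"
    using assms(2) unfolding q_iso_def by metis
  have rep: "\<exists>u\<in>qnum Q'. \<phi> (qclass Q x) = qclass Q' u" if "x \<in> qnum Q" for x
  proof -
    have "qclass Q x \<in> qcarrier Q" using that by (simp add: qcarrier_def)
    then have "\<phi> (qclass Q x) \<in> qcarrier Q'" using bij by (rule bij_betw_apply[rotated])
    then show ?thesis by (auto simp: qcarrier_def)
  qed
  show ?thesis
    unfolding q_iso_def
  proof (intro exI[of _ "\<psi> \<circ> \<phi>"] conjI allI ballI impI)
    show "bij_betw (\<psi> \<circ> \<phi>) (qcarrier Q) (qcarrier Q'')" using bij bij' by (rule bij_betw_trans)
    fix c x y u v
    assume a: "x \<in> qnum Q" "y \<in> qnum Q" "u \<in> qnum Q''" "v \<in> qnum Q''"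
      "(\<psi> \<circ> \<phi>) (qclass Q x) = qclass Q'' u" "(\<psi> \<circ> \<phi>) (qclass Q y) = qclass Q'' v"
    obtain x' y' where "x' \<in> qnum Q'" "\<phi> (qclass Q x) = qclass Q' x'"
      "y' \<in> qnum Q'" "\<phi> (qclass Q y) = qclass Q' y'" using rep a by meson
    then show "(\<psi> \<circ> \<phi>) (qclass Q (qscale Q c x + y)) = qclass Q'' (qscale Q'' c u + v)"
      using a lin lin' by simp
  qed
qed

section \<open>Comparison of mixed complexes\<close>

text \<open>A mixed complex is handled through representatives: the maps \<open>b\<close> and \<open>B\<close> are linear on the ambient
  spaces and respect numerators and denominators, and the identities between them hold modulo the denominators.\<close>

locale presented_mixed =
  fixes X :: "('k::field, 'v::ab_group_add) mixed_complex" and sc :: "'k \<Rightarrow> 'v \<Rightarrow> 'v"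
  assumes vs: "vector_space sc"
    and qsc: "\<And>r. qscale (mc_space X r) = sc"
    and num_sub: "\<And>r. module.subspace sc (qnum (mc_space X r))"
    and den_sub: "\<And>r. module.subspace sc (qden (mc_space X r))"
    and b_lin: "\<And>r. Vector_Spaces.linear sc sc (mc_b X r)"
    and B_lin: "\<And>r. Vector_Spaces.linear sc sc (mc_B X r)"
    and b_num: "\<And>r x. x \<in> qnum (mc_space X (Suc r)) \<Longrightarrow> mc_b X (Suc r) x \<in> qnum (mc_space X r)"
    and B_num: "\<And>r x. x \<in> qnum (mc_space X r) \<Longrightarrow> mc_B X r x \<in> qnum (mc_space X (Suc r))"
    and b_den: "\<And>r x. x \<in> qnum (mc_space X (Suc r)) \<Longrightarrow> x \<in> qden (mc_space X (Suc r)) \<Longrightarrow>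
       mc_b X (Suc r) x \<in> qden (mc_space X r)"
    and B_den: "\<And>r x. x \<in> qnum (mc_space X r) \<Longrightarrow> x \<in> qden (mc_space X r) \<Longrightarrow>
       mc_B X r x \<in> qden (mc_space X (Suc r))"
    and b_0: "\<And>x. mc_b X 0 x = 0"
    and anti: "\<And>r x. x \<in> qnum (mc_space X r) \<Longrightarrow>
       mc_b X (Suc r) (mc_B X r x) + mc_B X (r - 1) (mc_b X r x) \<in> qden (mc_space X r)"
    and B_B: "\<And>r x. x \<in> qnum (mc_space X r) \<Longrightarrow>
       mc_B X (Suc r) (mc_B X r x) \<in> qden (mc_space X (Suc (Suc r)))"
begin

interpretation vs: vector_space sc by (rule vs)

abbreviation "N r \<equiv> qnum (mc_space X r)"
abbreviation "D r \<equiv> qden (mc_space X r)"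

lemma num0: "0 \<in> N r" and num_add: "x \<in> N r \<Longrightarrow> y \<in> N r \<Longrightarrow> x + y \<in> N r"
  and num_diff: "x \<in> N r \<Longrightarrow> y \<in> N r \<Longrightarrow> x - y \<in> N r"
  and num_scale: "x \<in> N r \<Longrightarrow> sc c x \<in> N r"
  and den0: "0 \<in> D r" and den_add: "x \<in> D r \<Longrightarrow> y \<in> D r \<Longrightarrow> x + y \<in> D r"
  and den_diff: "x \<in> D r \<Longrightarrow> y \<in> D r \<Longrightarrow> x - y \<in> D r"
  and den_scale: "x \<in> D r \<Longrightarrow> sc c x \<in> D r"
  using num_sub den_sub
  by (auto simp: vs.subspace_0 vs.subspace_add vs.subspace_diff vs.subspace_scale)

lemma b_add: "mc_b X r (x + y) = mc_b X r x + mc_b X r y"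
  and b_diff: "mc_b X r (x - y) = mc_b X r x - mc_b X r y"
  and b_scale: "mc_b X r (sc c x) = sc c (mc_b X r x)"
  and b_zero: "mc_b X r 0 = 0"
proof -
  interpret Vector_Spaces.linear sc sc "mc_b X r" by (rule b_lin)
  show "mc_b X r (x + y) = mc_b X r x + mc_b X r y" "mc_b X r (x - y) = mc_b X r x - mc_b X r y"
    "mc_b X r (sc c x) = sc c (mc_b X r x)" "mc_b X r 0 = 0"
    by (simp_all add: add diff scale zero)
qed

lemma B_add: "mc_B X r (x + y) = mc_B X r x + mc_B X r y"
  and B_diff: "mc_B X r (x - y) = mc_B X r x - mc_B X r y"
  and B_scale: "mc_B X r (sc c x) = sc c (mc_B X r x)"
  and B_zero: "mc_B X r 0 = 0"
proof -
  interpret Vector_Spaces.linear sc sc "mc_B X r" by (rule B_lin)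
  show "mc_B X r (x + y) = mc_B X r x + mc_B X r y" "mc_B X r (x - y) = mc_B X r x - mc_B X r y"
    "mc_B X r (sc c x) = sc c (mc_B X r x)" "mc_B X r 0 = 0"
    by (simp_all add: add diff scale zero)
qed

definition "sct c z = (\<lambda>i. sc c (z i))" for z :: "nat \<Rightarrow> 'v"

lemma tot_scale: "qscale (tot_space X r) c z = sct c z"
  by (simp add: tot_space_def q_sum_def qsc sct_def)

lemma tot_num: "z \<in> qnum (tot_space X r) \<longleftrightarrow>
    (\<forall>j. 2 * j \<le> r \<longrightarrow> z j \<in> N (r - 2 * j)) \<and> (\<forall>j. r < 2 * j \<longrightarrow> z j = 0)"
  by (auto simp: tot_space_def q_sum_def not_le)

lemma tot_den: "z \<in> qden (tot_space X r) \<longleftrightarrow>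
    (\<forall>j. 2 * j \<le> r \<longrightarrow> z j \<in> D (r - 2 * j)) \<and> (\<forall>j. r < 2 * j \<longrightarrow> z j = 0)"
  by (auto simp: tot_space_def q_sum_def not_le)

lemma tot_numD: "z \<in> qnum (tot_space X r) \<Longrightarrow> 2 * j \<le> r \<Longrightarrow> r - 2 * j = m \<Longrightarrow> z j \<in> N m"
  and tot_denD: "z \<in> qden (tot_space X r) \<Longrightarrow> 2 * j \<le> r \<Longrightarrow> r - 2 * j = m \<Longrightarrow> z j \<in> D m"
  by (auto simp: tot_num tot_den)

lemma tot_num0: "0 \<in> qnum (tot_space X r)"
  and tot_num_add: "z \<in> qnum (tot_space X r) \<Longrightarrow> y \<in> qnum (tot_space X r) \<Longrightarrow> z + y \<in> qnum (tot_space X r)"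
  and tot_num_diff: "z \<in> qnum (tot_space X r) \<Longrightarrow> y \<in> qnum (tot_space X r) \<Longrightarrow> z - y \<in> qnum (tot_space X r)"
  and tot_num_scale: "z \<in> qnum (tot_space X r) \<Longrightarrow> sct c z \<in> qnum (tot_space X r)"
  and tot_den0: "0 \<in> qden (tot_space X r)"
  and tot_den_add: "z \<in> qden (tot_space X r) \<Longrightarrow> y \<in> qden (tot_space X r) \<Longrightarrow> z + y \<in> qden (tot_space X r)"
  and tot_den_diff: "z \<in> qden (tot_space X r) \<Longrightarrow> y \<in> qden (tot_space X r) \<Longrightarrow> z - y \<in> qden (tot_space X r)"
  and tot_den_scale: "z \<in> qden (tot_space X r) \<Longrightarrow> sct c z \<in> qden (tot_space X r)"
  by (auto simp: tot_num tot_den num0 num_add num_diff num_scale den0 den_add den_diff den_scale sct_def)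

lemma tot_diff_add: "tot_diff X r (z + y) = tot_diff X r z + tot_diff X r y"
  and tot_diff_diff: "tot_diff X r (z - y) = tot_diff X r z - tot_diff X r y"
  and tot_diff_scale: "tot_diff X r (sct c z) = sct c (tot_diff X r z)"
  and tot_diff_zero: "tot_diff X r 0 = 0"
  by (auto simp: tot_diff_def fun_eq_iff b_add B_add b_diff B_diff b_scale B_scale b_zero B_zero
      vs.scale_right_distrib sct_def algebra_simps)

lemma HC_num: "z \<in> qnum (cyclic_homology X r) \<longleftrightarrow> z \<in> qnum (tot_space X r) \<and>
    (r = 0 \<or> tot_diff X r z \<in> qden (tot_space X (r - 1)))"
  by (simp add: cyclic_homology_def)

lemma HC_den: "z \<in> qden (cyclic_homology X r) \<longleftrightarrow>
    (\<exists>y w. z = tot_diff X (Suc r) y + w \<and> y \<in> qnum (tot_space X (Suc r)) \<and> w \<in> qden (tot_space X r))"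
  by (simp add: cyclic_homology_def)

lemma HC_scale: "qscale (cyclic_homology X r) c z = sct c z"
  by (simp add: cyclic_homology_def tot_scale)

lemma HC_num_lin:
  assumes "x \<in> qnum (cyclic_homology X r)" "y \<in> qnum (cyclic_homology X r)"
  shows "qscale (cyclic_homology X r) c x + y \<in> qnum (cyclic_homology X r)"
  using assms by (auto simp: HC_scale HC_num tot_diff_add tot_diff_scale tot_den_add tot_den_scale
      tot_num_add tot_num_scale)

lemma HC_num_diff:
  assumes "x \<in> qnum (cyclic_homology X r)" "y \<in> qnum (cyclic_homology X r)"
  shows "x - y \<in> qnum (cyclic_homology X r)"
  using assms by (auto simp: HC_num tot_diff_diff tot_den_diff tot_num_diff)

lemma HC_den0: "0 \<in> qden (cyclic_homology X r)"
  unfolding HC_den by (rule exI[of _ 0], rule exI[of _ 0]) (simp add: tot_diff_zero tot_num0 tot_den0)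

lemma HC_den_diff:
  assumes "x \<in> qden (cyclic_homology X r)" "y \<in> qden (cyclic_homology X r)"
  shows "x - y \<in> qden (cyclic_homology X r)"
proof -
  obtain a b c d where
    "x = tot_diff X (Suc r) a + b" "a \<in> qnum (tot_space X (Suc r))" "b \<in> qden (tot_space X r)"
    "y = tot_diff X (Suc r) c + d" "c \<in> qnum (tot_space X (Suc r))" "d \<in> qden (tot_space X r)"
    using assms unfolding HC_den by blast
  then show ?thesis unfolding HC_den
    by (intro exI[of _ "a - c"] exI[of _ "b - d"]) (simp add: tot_diff_diff tot_num_diff tot_den_diff)
qed

lemma HC_den_scale:
  assumes "x - y \<in> qden (cyclic_homology X r)"
  shows "qscale (cyclic_homology X r) c x - qscale (cyclic_homology X r) c y \<in> qden (cyclic_homology X r)"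
proof -
  obtain a b where
    e: "x - y = tot_diff X (Suc r) a + b" "a \<in> qnum (tot_space X (Suc r))" "b \<in> qden (tot_space X r)"
    using assms unfolding HC_den by blast
  have "sct c x - sct c y = sct c (x - y)" "sct c (u + v) = sct c u + sct c v" for u v
    by (auto simp: sct_def fun_eq_iff vs.scale_right_diff_distrib vs.scale_right_distrib)
  with e show ?thesis unfolding HC_den HC_scale
    by (intro exI[of _ "sct c a"] exI[of _ "sct c b"]) (simp add: tot_diff_scale tot_num_scale tot_den_scale)
qed

end

text \<open>The last two assumptions say that the mapping cone of \<open>\<theta>\<close>, with respect to \<open>b\<close> alone, is acyclic: a
  cycle \<open>(z, s)\<close> of the cone is the boundary of a pair \<open>(z', s')\<close>. This form of the hypothesis is what the induction over
  the columns of the total complexes consumes directly.\<close>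

locale mixed_quasi_iso = S: presented_mixed S sc + Z: presented_mixed Z sc'
  for S :: "('k::field, 'v::ab_group_add) mixed_complex" and sc
    and Z :: "('k, 'w::ab_group_add) mixed_complex" and sc' +
  fixes \<theta> :: "nat \<Rightarrow> 'v \<Rightarrow> 'w"
  assumes th_lin: "\<And>r. Vector_Spaces.linear sc sc' (\<theta> r)"
    and th_num: "\<And>r x. x \<in> S.N r \<Longrightarrow> \<theta> r x \<in> Z.N r"
    and th_den: "\<And>r x. x \<in> S.N r \<Longrightarrow> x \<in> S.D r \<Longrightarrow> \<theta> r x \<in> Z.D r"
    and th_b: "\<And>r x. x \<in> S.N (Suc r) \<Longrightarrow> mc_b Z (Suc r) (\<theta> (Suc r) x) - \<theta> r (mc_b S (Suc r) x) \<in> Z.D r"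
    and th_B: "\<And>r x. x \<in> S.N r \<Longrightarrow> mc_B Z r (\<theta> r x) - \<theta> (Suc r) (mc_B S r x) \<in> Z.D (Suc r)"
    and cone_0: "\<And>z. z \<in> Z.N 0 \<Longrightarrow>
      \<exists>s'\<in>S.N 0. \<exists>z'\<in>Z.N 1. z - \<theta> 0 s' - mc_b Z 1 z' \<in> Z.D 0"
    and cone_Suc: "\<And>r z s. z \<in> Z.N (Suc r) \<Longrightarrow> s \<in> S.N r \<Longrightarrow>
      mc_b Z (Suc r) z - \<theta> r s \<in> Z.D r \<Longrightarrow> (r > 0 \<Longrightarrow> mc_b S r s \<in> S.D (r - 1)) \<Longrightarrow>
      \<exists>s'\<in>S.N (Suc r). \<exists>z'\<in>Z.N (Suc (Suc r)).
         z - \<theta> (Suc r) s' - mc_b Z (Suc (Suc r)) z' \<in> Z.D (Suc r) \<and>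
         s - mc_b S (Suc r) s' \<in> S.D r"
begin

lemma th_add: "\<theta> r (x + y) = \<theta> r x + \<theta> r y"
  and th_diff: "\<theta> r (x - y) = \<theta> r x - \<theta> r y"
  and th_scale: "\<theta> r (sc c x) = sc' c (\<theta> r x)"
  and th_zero: "\<theta> r 0 = 0"
proof -
  interpret Vector_Spaces.linear sc sc' "\<theta> r" by (rule th_lin)
  show "\<theta> r (x + y) = \<theta> r x + \<theta> r y" "\<theta> r (x - y) = \<theta> r x - \<theta> r y"
    "\<theta> r (sc c x) = sc' c (\<theta> r x)" "\<theta> r 0 = 0"
    by (simp_all add: add diff scale zero)
qed

text \<open>The map that \<open>\<theta>\<close> induces between the total complexes in degree \<open>r\<close>.\<close>

definition F :: "nat \<Rightarrow> (nat \<Rightarrow> 'v) \<Rightarrow> nat \<Rightarrow> 'w" where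
  "F r z = (\<lambda>j. \<theta> (r - 2 * j) (z j))"

text \<open>Acyclicity of the cone of the map induced between the total complexes. The tail
  \<open>z 1, z 2, \<dots>\<close> of an element of degree \<open>r\<close> is an element of degree \<open>r - 2\<close>, and it is dealt with first;
  the relations \<open>bB + Bb = 0\<close> and \<open>BB = 0\<close> then turn the condition on \<open>z 0\<close> into the hypothesis
  on the cone of \<open>b\<close>.\<close>

lemma tot_cone:
  assumes "z \<in> qnum (tot_space Z r)"
    and "r > 0 \<Longrightarrow> s \<in> qnum (tot_space S (r - 1))"
    and "r > 0 \<Longrightarrow> tot_diff Z r z - F (r - 1) s \<in> qden (tot_space Z (r - 1))"
    and "r > 1 \<Longrightarrow> tot_diff S (r - 1) s \<in> qden (tot_space S (r - 2))"
  shows "\<exists>s'\<in>qnum (tot_space S r). \<exists>z'\<in>qnum (tot_space Z (Suc r)).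
      z - F r s' - tot_diff Z (Suc r) z' \<in> qden (tot_space Z r) \<and>
      (r > 0 \<longrightarrow> s - tot_diff S r s' \<in> qden (tot_space S (r - 1)))"
  using assms
proof (induction r arbitrary: z s rule: less_induct)
  case (less r)
  have [simp]: "2 * j \<le> Suc 0 \<longleftrightarrow> j = 0" for j by auto
  note z = less.prems(1)[unfolded Z.tot_num] and sn = less.prems(2)[unfolded S.tot_num]
    and zs = less.prems(3)[unfolded Z.tot_den] and sd = less.prems(4)[unfolded S.tot_den]
  consider "r = 0" | "r = 1" | t where "r = Suc (Suc t)"
    by (metis One_nat_def not0_implies_Suc)
  then show ?case
  proof cases
    case 1
    obtain s' z' where h: "s' \<in> S.N 0" "z' \<in> Z.N 1" "z 0 - \<theta> 0 s' - mc_b Z 1 z' \<in> Z.D 0"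
      using cone_0[of "z 0"] z 1 by auto
    show ?thesis
      using h z 1
      by (intro bexI[of _ "\<lambda>j. if j = 0 then s' else 0"] bexI[of _ "\<lambda>j. if j = 0 then z' else 0"])
        (auto simp: S.tot_num Z.tot_num Z.tot_den F_def tot_diff_def th_zero Z.num0)
  next
    case 2
    have "z 0 \<in> Z.N (Suc 0)" "s 0 \<in> S.N 0" "mc_b Z (Suc 0) (z 0) - \<theta> 0 (s 0) \<in> Z.D 0"
      using z sn zs 2 by (auto simp: tot_diff_def F_def)
    then obtain s' z' where h: "s' \<in> S.N (Suc 0)" "z' \<in> Z.N (Suc (Suc 0))"
      "z 0 - \<theta> (Suc 0) s' - mc_b Z (Suc (Suc 0)) z' \<in> Z.D (Suc 0)" "s 0 - mc_b S (Suc 0) s' \<in> S.D 0"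
      using cone_Suc[of "z 0" 0 "s 0"] by auto
    show ?thesis
      using h z sn 2
      by (intro bexI[of _ "\<lambda>j. if j = 0 then s' else 0"] bexI[of _ "\<lambda>j. if j = 0 then z' else 0"])
        (auto simp: S.tot_num Z.tot_num Z.tot_den S.tot_den F_def tot_diff_def th_zero Z.num0 S.num0
          Z.B_zero Z.b_zero S.B_zero S.b_zero Z.den0 S.den0)
  next
    case t: 3
    have ix: "2 * j \<le> t \<longleftrightarrow> 2 * Suc j \<le> r" "t - 2 * j = r - 2 * Suc j" for j using t by auto
    have shift: "r - 2 * Suc j = t - 2 * j" "r - 1 - 2 * Suc j = t - 1 - 2 * j" for j using t by auto
    have dZ: "tot_diff Z t (z \<circ> Suc) j = tot_diff Z r z (Suc j)" for j
      using t by (simp add: tot_diff_def shift)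
    have dS: "tot_diff S (t - 1) (s \<circ> Suc) j = tot_diff S (r - 1) s (Suc j)" if "t > 0" for j
    proof -
      obtain u where u: "t = Suc u" using \<open>t > 0\<close> gr0_conv_Suc by blast
      show ?thesis using t u by (simp add: tot_diff_def)
    qed
    have "\<exists>s'\<in>qnum (tot_space S t). \<exists>z'\<in>qnum (tot_space Z (Suc t)).
      (z \<circ> Suc) - F t s' - tot_diff Z (Suc t) z' \<in> qden (tot_space Z t) \<and>
      (t > 0 \<longrightarrow> (s \<circ> Suc) - tot_diff S t s' \<in> qden (tot_space S (t - 1)))"
    proof (rule less.IH)
      show "t < r" using t by simp
      show "z \<circ> Suc \<in> qnum (tot_space Z t)"
        unfolding Z.tot_num
      proof (intro conjI allI impI)
        fix j
        show "(z \<circ> Suc) j \<in> Z.N (t - 2 * j)" if "2 * j \<le> t"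
          using z[THEN conjunct1, rule_format, of "Suc j"] t that by simp
        show "(z \<circ> Suc) j = 0" if "t < 2 * j"
          using z[THEN conjunct2, rule_format, of "Suc j"] t that by simp
      qed
      show "s \<circ> Suc \<in> qnum (tot_space S (t - 1))" if "t > 0"
        unfolding S.tot_num
      proof (intro conjI allI impI)
        fix j
        show "(s \<circ> Suc) j \<in> S.N (t - 1 - 2 * j)" if "2 * j \<le> t - 1"
          using sn[THEN conjunct1, rule_format, of "Suc j"] t that \<open>t > 0\<close> by (simp add: shift)
        show "(s \<circ> Suc) j = 0" if "t - 1 < 2 * j"
          using sn[THEN conjunct2, rule_format, of "Suc j"] t that \<open>t > 0\<close> by simp
      qed
      show "tot_diff Z t (z \<circ> Suc) - F (t - 1) (s \<circ> Suc) \<in> qden (tot_space Z (t - 1))" if "t > 0"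
        unfolding Z.tot_den
      proof (intro conjI allI impI)
        fix j
        have e: "(tot_diff Z t (z \<circ> Suc) - F (t - 1) (s \<circ> Suc)) j = (tot_diff Z r z - F (r - 1) s) (Suc j)"
          using t by (simp add: dZ F_def)
        show "(tot_diff Z t (z \<circ> Suc) - F (t - 1) (s \<circ> Suc)) j \<in> Z.D (t - 1 - 2 * j)" if "2 * j \<le> t - 1"
        proof -
          have r: "0 < r" "2 * Suc j \<le> r - 1" using that t \<open>t > 0\<close> by auto
          show ?thesis
            unfolding e using zs[OF r(1), THEN conjunct1, rule_format, OF r(2)] by (simp only: shift)
        qed
        show "(tot_diff Z t (z \<circ> Suc) - F (t - 1) (s \<circ> Suc)) j = 0" if "t - 1 < 2 * j"
          unfolding e using zs[THEN conjunct2, rule_format, of "Suc j"] t that \<open>t > 0\<close> by simp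
      qed
      show "tot_diff S (t - 1) (s \<circ> Suc) \<in> qden (tot_space S (t - 2))" if "t > 1"
        unfolding S.tot_den
      proof (intro conjI allI impI)
        fix j
        have "t > 0" using that by simp
        note e = dS[OF this, of j]
        show "tot_diff S (t - 1) (s \<circ> Suc) j \<in> S.D (t - 2 - 2 * j)" if "2 * j \<le> t - 2"
          unfolding e using sd[THEN conjunct1, rule_format, of "Suc j"] t that \<open>t > 1\<close>
          by (simp add: numeral_2_eq_2)
        show "tot_diff S (t - 1) (s \<circ> Suc) j = 0" if "t - 2 < 2 * j"
          unfolding e using sd[THEN conjunct2, rule_format, of "Suc j"] t that \<open>t > 1\<close> by simp
      qed
    qed
    then obtain s1 z1 where s1: "s1 \<in> qnum (tot_space S t)" and z1: "z1 \<in> qnum (tot_space Z (Suc t))"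
      and h1: "(z \<circ> Suc) - F t s1 - tot_diff Z (Suc t) z1 \<in> qden (tot_space Z t)"
      and h2: "t > 0 \<Longrightarrow> (s \<circ> Suc) - tot_diff S t s1 \<in> qden (tot_space S (t - 1))" by blast
    have s10: "s1 0 \<in> S.N t" and z10: "z1 0 \<in> Z.N (Suc t)"
      using S.tot_numD[OF s1, of 0 t] Z.tot_numD[OF z1, of 0 "Suc t"] by auto
    have z11: "z1 1 \<in> Z.N (t - 1)" if "t > 0"
      using Z.tot_numD[OF z1, of 1 "t - 1"] that by auto
    have s11: "s1 1 \<in> S.N (t - 2)" if "t > 1"
      using S.tot_numD[OF s1, of 1 "t - 2"] that by auto
    define zt where "zt = (if t > 0 then mc_B Z (t - 1) (z1 1) else 0)"
    define st where "st = (if t > 1 then mc_B S (t - 2) (s1 1) else 0)"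
    define e1 where "e1 = z 1 - \<theta> t (s1 0) - (mc_b Z (Suc t) (z1 0) + zt)"
    have zN: "z 0 \<in> Z.N r" "z 1 \<in> Z.N t" 
      using Z.tot_numD[OF less.prems(1), of 0 r] Z.tot_numD[OF less.prems(1), of 1 t] t by auto
    have sN: "s 0 \<in> S.N (Suc t)" using S.tot_numD[OF less.prems(2), of 0 "Suc t"] t by auto
    have e1: "e1 \<in> Z.D t"
      using Z.tot_denD[OF h1, of 0 t] t by (auto simp: tot_diff_def F_def e1_def zt_def)
    have ztN: "zt \<in> Z.N t"
    proof (cases "t > 0")
      case True
      then show ?thesis using Z.B_num[OF z11[OF True]] by (simp add: zt_def)
    qed (simp add: zt_def Z.num0)
    have Bzt: "mc_B Z t zt \<in> Z.D (Suc t)"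
    proof (cases "t > 0")
      case True
      then show ?thesis using Z.B_B[OF z11[OF True]] by (simp add: zt_def)
    qed (simp add: zt_def Z.B_zero Z.den0)
    have z0: "mc_b Z r (z 0) + mc_B Z t (z 1) - \<theta> (Suc t) (s 0) \<in> Z.D (Suc t)"
      using Z.tot_denD[OF less.prems(3), of 0 "Suc t"] t by (auto simp: tot_diff_def F_def)
    have e1N: "e1 \<in> Z.N t"
      using zN ztN th_num[OF s10] Z.b_num[OF z10] by (simp add: e1_def Z.num_diff Z.num_add)
    have s0: "s 1 - (mc_b S t (s1 0) + st) \<in> S.D (t - 1) \<and> s 1 \<in> S.N (t - 1) \<and> st \<in> S.N (t - 1)
        \<and> mc_B S (t - 1) st \<in> S.D t"
      if "t > 0"
    proof (intro conjI)
      show "s 1 \<in> S.N (t - 1)"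
      proof (rule S.tot_numD[OF less.prems(2)])
        show "0 < r" using t by simp
        show "2 * 1 \<le> r - 1" using t \<open>t > 0\<close> by simp
        show "r - 1 - 2 * 1 = t - 1" using t by simp
      qed
      show "st \<in> S.N (t - 1)"
      proof (cases "t > 1")
        case True
        then have "t = Suc (Suc (t - 2))" by simp
        then obtain u where u: "t = Suc (Suc u)" by blast
        then show ?thesis using S.B_num[OF s11[OF True]] by (simp add: st_def)
      qed (simp add: st_def S.num0)
      show "s 1 - (mc_b S t (s1 0) + st) \<in> S.D (t - 1)"
      proof -
        have "(s \<circ> Suc) 0 - tot_diff S t s1 0 \<in> S.D (t - 1)"
          using S.tot_denD[OF h2[OF that], of 0 "t - 1"] by simp
        moreover have "tot_diff S t s1 0 = mc_b S t (s1 0) + st"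
          using that by (auto simp: tot_diff_def st_def)
        ultimately show ?thesis by simp
      qed
      show "mc_B S (t - 1) st \<in> S.D t"
      proof (cases "t > 1")
        case True
        then have "t = Suc (Suc (t - 2))" by simp
        then obtain u where u: "t = Suc (Suc u)" by blast
        then show ?thesis using S.B_B[OF s11[OF True]] by (simp add: st_def)
      qed (simp add: st_def S.B_zero S.den0)
    qed
    have sS: "mc_b S (Suc t) (s 0) + (if t > 0 then mc_B S (t - 1) (s 1) else 0) \<in> S.D t"
      using S.tot_denD[OF less.prems(4), of 0 t] t by (auto simp: tot_diff_def)
    \<comment> \<open>after the tail has been corrected by \<open>s1\<close> and \<open>z1\<close>, this pair is what remains in the first column\<close>
    define zz where "zz = z 0 - mc_B Z (Suc t) (z1 0)"
    define ss where "ss = s 0 - mc_B S t (s1 0)"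
    have "\<exists>s'\<in>S.N (Suc (Suc t)). \<exists>z'\<in>Z.N (Suc (Suc (Suc t))).
         zz - \<theta> (Suc (Suc t)) s' - mc_b Z (Suc (Suc (Suc t))) z' \<in> Z.D (Suc (Suc t)) \<and>
         ss - mc_b S (Suc (Suc t)) s' \<in> S.D (Suc t)"
    proof (rule cone_Suc)
      show "zz \<in> Z.N (Suc (Suc t))" using zN(1) t Z.B_num[OF z10] by (simp add: zz_def Z.num_diff)
      show "ss \<in> S.N (Suc t)" using sN S.B_num[OF s10] by (simp add: ss_def S.num_diff)
      have a: "mc_b Z r (mc_B Z (Suc t) (z1 0)) + mc_B Z t (mc_b Z (Suc t) (z1 0)) \<in> Z.D (Suc t)"
        using Z.anti[OF z10] t by simp
      have Be: "mc_B Z t e1 \<in> Z.D (Suc t)" using Z.B_den[OF e1N e1] .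
      have Bt: "mc_B Z t (\<theta> t (s1 0)) - \<theta> (Suc t) (mc_B S t (s1 0)) \<in> Z.D (Suc t)" by (rule th_B[OF s10])
      have "mc_b Z (Suc (Suc t)) zz - \<theta> (Suc t) ss
          = (mc_b Z r (z 0) + mc_B Z t (z 1) - \<theta> (Suc t) (s 0))
            - (mc_b Z r (mc_B Z (Suc t) (z1 0)) + mc_B Z t (mc_b Z (Suc t) (z1 0)))
            - mc_B Z t e1 - (mc_B Z t (\<theta> t (s1 0)) - \<theta> (Suc t) (mc_B S t (s1 0))) - mc_B Z t zt"
        using t by (simp add: zz_def ss_def e1_def Z.b_diff th_diff Z.B_diff Z.B_add algebra_simps)
      also have "\<dots> \<in> Z.D (Suc t)" using z0 a Be Bt Bzt by (simp only: Z.den_diff)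
      finally show "mc_b Z (Suc (Suc t)) zz - \<theta> (Suc t) ss \<in> Z.D (Suc t)" .
      have "mc_b S (Suc t) ss \<in> S.D t"
      proof (cases "t > 0")
        case True
        have a: "mc_b S (Suc t) (mc_B S t (s1 0)) + mc_B S (t - 1) (mc_b S t (s1 0)) \<in> S.D t"
          using S.anti[OF s10] .
        have st: "Suc (t - 1) = t" using True by simp
        have "mc_b S t (s1 0) \<in> S.N (t - 1)" using S.b_num[of "s1 0" "t - 1"] s10 st by simp
        then have B: "mc_B S (t - 1) (s 1 - (mc_b S t (s1 0) + st)) \<in> S.D t"
          using S.B_den[of "s 1 - (mc_b S t (s1 0) + st)" "t - 1"] s0[OF True] st
          by (simp add: S.num_diff S.num_add)
        have "mc_b S (Suc t) ss = (mc_b S (Suc t) (s 0) + mc_B S (t - 1) (s 1))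
            - (mc_b S (Suc t) (mc_B S t (s1 0)) + mc_B S (t - 1) (mc_b S t (s1 0)))
            - mc_B S (t - 1) (s 1 - (mc_b S t (s1 0) + st)) - mc_B S (t - 1) st"
          by (simp add: ss_def S.b_diff S.B_diff S.B_add algebra_simps)
        also have "\<dots> \<in> S.D t"
          using sS a B s0[OF True] True by (simp only: S.den_diff if_True)
        finally show ?thesis .
      next
        case False
        then have "t = 0" by simp
        have "mc_b S (Suc t) (mc_B S t (s1 0)) \<in> S.D t"
          using S.anti[OF s10] \<open>t = 0\<close> by (simp add: S.b_0 S.B_zero)
        then show ?thesis using sS \<open>t = 0\<close> by (simp add: ss_def S.b_diff S.den_diff)
      qed
      then show "mc_b S (Suc t) ss \<in> S.D (Suc t - 1)" by simp
    qed
    then obtain s0' z0' where n: "s0' \<in> S.N r" "z0' \<in> Z.N (Suc r)"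
      and f: "zz - \<theta> r s0' - mc_b Z (Suc r) z0' \<in> Z.D r" "ss - mc_b S r s0' \<in> S.D (Suc t)"
      using t by blast
    define s' where "s' = (\<lambda>j. case j of 0 \<Rightarrow> s0' | Suc i \<Rightarrow> s1 i)"
    define z' where "z' = (\<lambda>j. case j of 0 \<Rightarrow> z0' | Suc i \<Rightarrow> z1 i)"
    show ?thesis
    proof (intro bexI[of _ s'] bexI[of _ z'] conjI impI)
      show "s' \<in> qnum (tot_space S r)"
        using n s1 t by (auto simp: S.tot_num s'_def split: nat.split)
      show "z' \<in> qnum (tot_space Z (Suc r))"
        using n z1 t by (auto simp: Z.tot_num z'_def split: nat.split)
      define dz where "dz = z - F r s' - tot_diff Z (Suc r) z'"
      define dt where "dt = (z \<circ> Suc) - F t s1 - tot_diff Z (Suc t) z1"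
      have dz0: "dz 0 = zz - \<theta> r s0' - mc_b Z (Suc r) z0'"
        using t by (simp add: dz_def F_def tot_diff_def s'_def z'_def zz_def algebra_simps)
      have dzS: "dz (Suc i) = dt i" for i
        using t by (simp add: dz_def dt_def F_def tot_diff_def s'_def z'_def Suc_diff_le)
      have dt: "dt \<in> qden (tot_space Z t)" using h1 by (simp only: dt_def)
      have "dz \<in> qden (tot_space Z r)"
        unfolding Z.tot_den
      proof (intro conjI allI impI)
        fix j
        show "dz j \<in> Z.D (r - 2 * j)" if "2 * j \<le> r"
        proof (cases j)
          case (Suc i)
          then show ?thesis using Z.tot_denD[OF dt, of i "t - 2 * i"] that t by (simp add: dzS)
        qed (use f in \<open>simp add: dz0\<close>)
        show "dz j = 0" if "r < 2 * j"
        proof (cases j)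
          case (Suc i)
          then show ?thesis using dt[unfolded Z.tot_den, THEN conjunct2, rule_format, of i] that t
            by (simp add: dzS)
        qed (use that in simp)
      qed
      then show "z - F r s' - tot_diff Z (Suc r) z' \<in> qden (tot_space Z r)" by (simp only: dz_def)
      define ds where "ds = s - tot_diff S r s'"
      define du where "du = (s \<circ> Suc) - tot_diff S t s1"
      have ds0: "ds 0 = ss - mc_b S r s0'"
        using t by (simp add: ds_def tot_diff_def s'_def ss_def algebra_simps)
      have dsS: "ds (Suc i) = du i" for i
        using t by (simp add: ds_def du_def tot_diff_def s'_def)
      have du: "du \<in> qden (tot_space S (t - 1))" if "t > 0" using h2[OF that] by (simp only: du_def)
      have "ds \<in> qden (tot_space S (r - 1))"
        unfolding S.tot_den
      proof (intro conjI allI impI)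
        fix j
        show "ds j \<in> S.D (r - 1 - 2 * j)" if "2 * j \<le> r - 1"
        proof (cases j)
          case (Suc i)
          then have i: "t > 0" "2 * i \<le> t - 1" "t - 1 - 2 * i = r - 1 - 2 * j" using that t by auto
          show ?thesis using S.tot_denD[OF du[OF i(1)] i(2,3)] Suc by (simp only: dsS)
        qed (use f t in \<open>simp add: ds0\<close>)
        show "ds j = 0" if "r - 1 < 2 * j"
        proof (cases j)
          case (Suc i)
          show ?thesis
          proof (cases "t = 0")
            case True
            have "s j = 0" using less.prems(2) that t unfolding S.tot_num by auto
            then show ?thesis using that True t Suc by (simp add: ds_def tot_diff_def)
          next
            case False
            then have "t > 0" "t - 1 < 2 * i" using that Suc t by auto
            then show ?thesis using du[unfolded S.tot_den, THEN conjunct2, rule_format, of i] Suc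
              by (simp add: dsS)
          qed
        qed (use that in simp)
      qed
      then show "s - tot_diff S r s' \<in> qden (tot_space S (r - 1))" by (simp only: ds_def)
    qed
  qed
qed

lemma F_num: "z \<in> qnum (tot_space S r) \<Longrightarrow> F r z \<in> qnum (tot_space Z r)"
  by (auto simp: S.tot_num Z.tot_num F_def th_num th_zero)

lemma F_den: "z \<in> qnum (tot_space S r) \<Longrightarrow> z \<in> qden (tot_space S r) \<Longrightarrow> F r z \<in> qden (tot_space Z r)"
  by (auto simp: S.tot_num S.tot_den Z.tot_den F_def th_den th_zero)

lemma F_tot_diff:
  assumes "z \<in> qnum (tot_space S (Suc r))"
  shows "tot_diff Z (Suc r) (F (Suc r) z) - F r (tot_diff S (Suc r) z) \<in> qden (tot_space Z r)"
  unfolding Z.tot_den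
proof (intro conjI allI impI)
  fix j
  show "(tot_diff Z (Suc r) (F (Suc r) z) - F r (tot_diff S (Suc r) z)) j = 0" if "r < 2 * j"
    using that by (simp add: tot_diff_def F_def th_zero)
  show "(tot_diff Z (Suc r) (F (Suc r) z) - F r (tot_diff S (Suc r) z)) j \<in> Z.D (r - 2 * j)" if "2 * j \<le> r"
  proof -
    define t where "t = r - 2 * j"
    have r: "Suc r - 2 * j = Suc t" using that by (simp add: t_def)
    have 1: "mc_b Z (Suc t) (\<theta> (Suc t) (z j)) - \<theta> t (mc_b S (Suc t) (z j)) \<in> Z.D t"
      using assms that r by (intro th_b) (auto simp: S.tot_num dest!: spec[of _ j])
    show ?thesis
    proof (cases t)
      case 0
      with that have "\<not> 2 * j + 2 \<le> Suc r" by (simp add: t_def)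
      with 1 that r 0 show ?thesis by (simp add: tot_diff_def F_def t_def[symmetric])
    next
      case (Suc u)
      then have u: "Suc r - 2 * j - 2 = u" "Suc r - 2 * Suc j = u" "2 * j + 2 \<le> Suc r" "Suc r - Suc (Suc (2 * j)) = u"
        using that by (auto simp: t_def)
      have 2: "mc_B Z u (\<theta> u (z (Suc j))) - \<theta> (Suc u) (mc_B S u (z (Suc j))) \<in> Z.D (Suc u)"
        using assms u by (intro th_B) (auto simp: S.tot_num dest!: spec[of _ "Suc j"])
      have "(tot_diff Z (Suc r) (F (Suc r) z) - F r (tot_diff S (Suc r) z)) j =
         (mc_b Z (Suc t) (\<theta> (Suc t) (z j)) - \<theta> t (mc_b S (Suc t) (z j))) +
         (mc_B Z u (\<theta> u (z (Suc j))) - \<theta> (Suc u) (mc_B S u (z (Suc j))))"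
        using that u r Suc by (simp add: tot_diff_def F_def th_add t_def[symmetric])
      also have "\<dots> \<in> Z.D t" using 1 2 Suc by (simp add: Z.den_add)
      finally show ?thesis by (simp add: t_def)
    qed
  qed
qed

lemma tot_diff_num: "z \<in> qnum (tot_space S (Suc r)) \<Longrightarrow> tot_diff S (Suc r) z \<in> qnum (tot_space S r)"
proof -
  assume z: "z \<in> qnum (tot_space S (Suc r))"
  show ?thesis unfolding S.tot_num
  proof (intro conjI allI impI)
    fix j
    show "tot_diff S (Suc r) z j = 0" if "r < 2 * j" using that by (simp add: tot_diff_def)
    show "tot_diff S (Suc r) z j \<in> S.N (r - 2 * j)" if "2 * j \<le> r"
    proof -
      have 1: "mc_b S (Suc r - 2 * j) (z j) \<in> S.N (r - 2 * j)"
        using z that S.b_num[of "z j" "r - 2 * j"] by (auto simp: S.tot_num Suc_diff_le dest!: spec[of _ j])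
      have 2: "mc_B S (Suc r - 2 * j - 2) (z (Suc j)) \<in> S.N (r - 2 * j)" if "2 * j + 2 \<le> Suc r"
      proof -
        have "Suc (Suc r - 2 * Suc j) = r - 2 * j" "Suc r - 2 * j - 2 = Suc r - 2 * Suc j" using that by auto
        then show ?thesis
          using z that S.B_num[of "z (Suc j)" "Suc r - 2 * Suc j"] by (auto simp: S.tot_num dest!: spec[of _ "Suc j"])
      qed
      show ?thesis using 1 2 that by (auto simp: tot_diff_def intro: S.num_add)
    qed
  qed
qed

lemma F_lin: "F r (x - y) = F r x - F r y" "F r (x + y) = F r x + F r y" "F r (S.sct c x) = Z.sct c (F r x)"
  by (auto simp: F_def th_diff th_add th_scale S.sct_def Z.sct_def)

text \<open>Surjectivity is \<open>tot_cone\<close> for a cycle \<open>z\<close> and \<open>s = 0\<close>; injectivity is \<open>tot_cone\<close> one degree higher, for a chain \<open>z\<close>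
  whose boundary is the image of the cycle \<open>s\<close>.\<close>

theorem cyclic_homology_iso:
  shows "cyclic_homology S r \<cong>\<^sub>q cyclic_homology Z r" and "cyclic_homology Z r \<cong>\<^sub>q cyclic_homology S r"
proof -
  have Fn: "F r x \<in> qnum (cyclic_homology Z r)"
    and Fd: "x \<in> qden (cyclic_homology S r) \<Longrightarrow> F r x \<in> qden (cyclic_homology Z r)"
    and Fi: "F r x \<in> qden (cyclic_homology Z r) \<Longrightarrow> x \<in> qden (cyclic_homology S r)"
    if x: "x \<in> qnum (cyclic_homology S r)" for x
  proof -
    show "F r x \<in> qnum (cyclic_homology Z r)"
    proof (cases r)
      case (Suc t)
      have xn: "x \<in> qnum (tot_space S (Suc t))" and xd: "tot_diff S (Suc t) x \<in> qden (tot_space S t)"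
        using x Suc by (auto simp: S.HC_num)
      have "tot_diff Z (Suc t) (F (Suc t) x) - F t (tot_diff S (Suc t) x) + F t (tot_diff S (Suc t) x)
          \<in> qden (tot_space Z t)"
        by (intro Z.tot_den_add F_tot_diff F_den tot_diff_num xn xd)
      then show ?thesis using Suc xn by (simp add: Z.HC_num F_num)
    qed (use x F_num in \<open>auto simp: S.HC_num Z.HC_num\<close>)
    show "F r x \<in> qden (cyclic_homology Z r)" if xd: "x \<in> qden (cyclic_homology S r)"
    proof -
      obtain y w where yw: "x = tot_diff S (Suc r) y + w" "y \<in> qnum (tot_space S (Suc r))" "w \<in> qden (tot_space S r)"
        using xd[unfolded S.HC_den] by blast
      have w: "w = x - tot_diff S (Suc r) y" using yw by simp
      have "w \<in> qnum (tot_space S r)"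
        unfolding w using x yw(2) by (auto simp: S.HC_num simp del: yw(1) intro!: S.tot_num_diff tot_diff_num)
      then have "F r x = tot_diff Z (Suc r) (F (Suc r) y) +
          (F r w - (tot_diff Z (Suc r) (F (Suc r) y) - F r (tot_diff S (Suc r) y)))"
        and "F r w - (tot_diff Z (Suc r) (F (Suc r) y) - F r (tot_diff S (Suc r) y)) \<in> qden (tot_space Z r)"
        using yw by (auto simp: F_lin intro!: Z.tot_den_diff F_tot_diff F_den)
      then show ?thesis using yw F_num unfolding Z.HC_den by blast
    qed
    show "x \<in> qden (cyclic_homology S r)" if xd: "F r x \<in> qden (cyclic_homology Z r)"
    proof -
      obtain y w where yw: "F r x = tot_diff Z (Suc r) y + w" "y \<in> qnum (tot_space Z (Suc r))" "w \<in> qden (tot_space Z r)"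
        using xd[unfolded Z.HC_den] by blast
      have "tot_diff Z (Suc r) y - F r x = 0 - w" using yw by simp
      then have "tot_diff Z (Suc r) y - F r x \<in> qden (tot_space Z r)"
        using Z.tot_den_diff[OF Z.tot_den0 yw(3)] by (simp only:)
      then obtain s' where "s' \<in> qnum (tot_space S (Suc r))" "x - tot_diff S (Suc r) s' \<in> qden (tot_space S r)"
        using tot_cone[of y "Suc r" x] yw x by (auto simp: S.HC_num)
      then show ?thesis unfolding S.HC_den
        by (intro exI[of _ s'] exI[of _ "x - tot_diff S (Suc r) s'"]) simp
    qed
  qed
  have Fs: "\<exists>x\<in>qnum (cyclic_homology S r). u - F r x \<in> qden (cyclic_homology Z r)"
    if u: "u \<in> qnum (cyclic_homology Z r)" for u
  proof -
    have F0: "F t 0 = 0" for t by (simp add: F_def fun_eq_iff th_zero)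
    obtain s' z' where h: "s' \<in> qnum (tot_space S r)" "z' \<in> qnum (tot_space Z (Suc r))"
      "u - F r s' - tot_diff Z (Suc r) z' \<in> qden (tot_space Z r)"
      "r > 0 \<Longrightarrow> 0 - tot_diff S r s' \<in> qden (tot_space S (r - 1))"
      using tot_cone[of u r 0] u
      by (auto simp: Z.HC_num S.tot_num0 F0 S.tot_diff_zero S.tot_den0)
    have "tot_diff S r s' \<in> qden (tot_space S (r - 1))" if "r > 0"
      using S.tot_den_diff[OF S.tot_den0 h(4)[OF that]] by simp
    then show ?thesis
      using h(1-3) unfolding S.HC_num Z.HC_den
      by (intro bexI[of _ s'] exI[of _ z'] exI[of _ "u - F r s' - tot_diff Z (Suc r) z'"])
        (auto simp: S.HC_num)
  qed
  note [simp] = F_lin S.HC_scale Z.HC_scale S.HC_den0 Z.HC_den0 S.HC_den_diff Z.HC_den_diff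
      S.HC_den_scale[unfolded S.HC_scale] Z.HC_den_scale[unfolded Z.HC_scale] S.HC_num_diff
      S.HC_num_lin[unfolded S.HC_scale] Z.HC_num_lin[unfolded Z.HC_scale]
  show "cyclic_homology S r \<cong>\<^sub>q cyclic_homology Z r"
    by (rule q_iso_induced(1)[where f = "F r"]) (simp_all add: Fn Fd Fi Fs)
  show "cyclic_homology Z r \<cong>\<^sub>q cyclic_homology S r"
    by (rule q_iso_induced(2)[where f = "F r"]) (simp_all add: Fn Fd Fi Fs)
qed

end

section \<open>Twisted commutators\<close>

text \<open>The data behind an algebra defined by \<open>f = x\<^sup>n + l\<close>: the two conditions on \<open>l\<close> make the left
  ideal generated by \<open>f\<close> two-sided.\<close>

locale twisted_algebra = k_algebra scale
  for scale :: "'k::field_char_0 \<Rightarrow> 'a::ring_1 \<Rightarrow> 'a" +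
  fixes \<alpha> :: "'a \<Rightarrow> 'a" and l :: 'a and n :: nat
  assumes endo: "algebra_endo scale \<alpha>"
    and n2: "n \<ge> 2"
    and al_l: "\<alpha> l = l"
    and l_comm: "l * x = (\<alpha> ^^ n) x * l"
begin

abbreviation "TC j \<equiv> twisted_comm scale \<alpha> j"
abbreviation "eig w \<equiv> eigenspace scale \<alpha> w"

lemma al_lin: "Vector_Spaces.linear scale scale \<alpha>"
  and al_1: "\<alpha> 1 = 1" and al_mult: "\<alpha> (x * y) = \<alpha> x * \<alpha> y"
  using endo by (auto simp: algebra_endo_def)

interpretation al: Vector_Spaces.linear scale scale \<alpha> by (rule al_lin)

lemmas al_add = al.add and al_scale = al.scale and al_0 = al.zero and al_diff = al.diff
  and al_neg = al.neg and al_sum = al.sum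

lemma pow_add: "(\<alpha> ^^ i) (x + y) = (\<alpha> ^^ i) x + (\<alpha> ^^ i) y"
  and pow_scale: "(\<alpha> ^^ i) (scale c x) = scale c ((\<alpha> ^^ i) x)"
  and pow_0: "(\<alpha> ^^ i) 0 = 0" and pow_1: "(\<alpha> ^^ i) 1 = 1"
  and pow_mult: "(\<alpha> ^^ i) (x * y) = (\<alpha> ^^ i) x * (\<alpha> ^^ i) y"
  and pow_diff: "(\<alpha> ^^ i) (x - y) = (\<alpha> ^^ i) x - (\<alpha> ^^ i) y"
  and pow_l: "(\<alpha> ^^ i) l = l"
  by (induction i) (auto simp: al_add al_scale al_0 al_1 al_mult al_diff al_neg al_l)

lemma pow_pow: "(\<alpha> ^^ i) ((\<alpha> ^^ j) x) = (\<alpha> ^^ (i + j)) x"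
  by (simp add: funpow_add)

lemma pow_al: "(\<alpha> ^^ i) (\<alpha> x) = \<alpha> ((\<alpha> ^^ i) x)"
  by (simp add: funpow_swap1)

lemma pow_sum: "(\<alpha> ^^ i) (sum f S) = (\<Sum>j\<in>S. (\<alpha> ^^ i) (f j))"
  by (induction S rule: infinite_finite_induct) (auto simp: pow_0 pow_add)

lemma scale_l: "scale c x * l = scale c (x * l)" by (simp add: scale_mult_left)

lemma TC_subspace: "subspace (TC j)"
  unfolding twisted_comm_def by (rule subspace_span)

lemmas TC_0 = subspace_0[OF TC_subspace] and TC_add = subspace_add[OF TC_subspace]
  and TC_diff = subspace_diff[OF TC_subspace] and TC_scale = subspace_scale[OF TC_subspace]
  and TC_neg = subspace_neg[OF TC_subspace] and TC_sum = subspace_sum[OF TC_subspace]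

lemma TC_gen: "x' * (\<alpha> ^^ j) x - x * x' \<in> TC j"
  unfolding twisted_comm_def by (rule span_base) auto

lemma TC_one: "(\<alpha> ^^ j) x - x \<in> TC j"
  using TC_gen[of 1 j x] by simp

lemma TC_induct:
  assumes "x \<in> TC j" and "subspace H" and "\<And>y z. z * (\<alpha> ^^ j) y - y * z \<in> H"
  shows "x \<in> H"
  using assms(1) unfolding twisted_comm_def by (rule span_induct) (auto intro: assms)

lemma TC_al: "x \<in> TC j \<Longrightarrow> \<alpha> x \<in> TC j"
proof (erule TC_induct[where H = "{x. \<alpha> x \<in> TC j}", simplified])
  show "subspace {x. \<alpha> x \<in> TC j}"
    by (auto simp: subspace_def al_0 al_add al_scale TC_0 TC_add TC_scale)
  fix y z
  show "\<alpha> (z * (\<alpha> ^^ j) y - y * z) \<in> TC j"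
    using TC_gen[of "\<alpha> z" j "\<alpha> y"] by (simp add: al_diff al_mult funpow_swap1)
qed

lemma TC_pow: "x \<in> TC j \<Longrightarrow> (\<alpha> ^^ i) x \<in> TC j"
  by (induction i) (auto intro: TC_al)

text \<open>This is where the relation between \<open>l\<close> and \<open>\<alpha>\<close> enters: \<open>\<alpha>\<^sup>n\<close> is absorbed when it
  passes to the other side of \<open>l\<close>.\<close>

lemma TC_l: "x \<in> TC (j + n) \<Longrightarrow> x * l \<in> TC j"
proof (erule TC_induct[where H = "{x. x * l \<in> TC j}", simplified])
  show "subspace {x. x * l \<in> TC j}"
    by (auto simp: subspace_def TC_0 TC_add TC_scale distrib_right scale_l)
  fix y z
  have "l * (\<alpha> ^^ j) y = (\<alpha> ^^ (j + n)) y * l"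
    by (simp add: l_comm pow_pow add.commute)
  then have "(z * (\<alpha> ^^ (j + n)) y - y * z) * l = (z * l) * (\<alpha> ^^ j) y - y * (z * l)"
    by (simp add: left_diff_distrib mult.assoc)
  then show "(z * (\<alpha> ^^ (j + n)) y - y * z) * l \<in> TC j" by (simp add: TC_gen)
qed

lemma TC_l_pow: "x \<in> TC (j + n * m) \<Longrightarrow> x * l ^ m \<in> TC j"
proof (induction m arbitrary: x)
  case (Suc m)
  have "x * l \<in> TC (j + n * m)" using Suc.prems by (intro TC_l) (simp add: algebra_simps)
  then have "x * l * l ^ m \<in> TC j" by (rule Suc.IH)
  then show ?case by (simp add: mult.assoc)
qed simp

lemma TC_l': "x \<in> TC (Suc m * n) \<Longrightarrow> x * l \<in> TC (m * n)"
  using TC_l[of x "m * n"] by (simp add: add.commute)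

definition E :: "'a \<Rightarrow> 'a" where "E x = (\<Sum>i<n. (\<alpha> ^^ i) x)"

lemma E_al: "E x - \<alpha> (E x) = x - (\<alpha> ^^ n) x"
proof -
  have "E x - \<alpha> (E x) = (\<Sum>i<n. (\<alpha> ^^ i) x - (\<alpha> ^^ Suc i) x)"
    by (simp add: E_def al_sum sum_subtractf)
  also have "\<dots> = x - (\<alpha> ^^ n) x"
    by (subst sum_lessThan_telescope') simp
  finally show ?thesis .
qed

lemma geom_pow: "(\<Sum>u\<le>m. (\<alpha> ^^ (n * u)) (x - (\<alpha> ^^ n) x)) = x - (\<alpha> ^^ (n * Suc m)) x"
proof -
  have "(\<Sum>u\<le>m. (\<alpha> ^^ (n * u)) (x - (\<alpha> ^^ n) x)) = (\<Sum>u<Suc m. (\<alpha> ^^ (n * u)) x - (\<alpha> ^^ (n * Suc u)) x)"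
    by (intro sum.cong) (auto simp: pow_diff pow_pow add.commute)
  also have "\<dots> = x - (\<alpha> ^^ (n * Suc m)) x" by (subst sum_lessThan_telescope') simp
  finally show ?thesis .
qed

lemma E_add: "E (x + y) = E x + E y" and E_scale: "E (scale c x) = scale c (E x)"
  and E_diff: "E (x - y) = E x - E y" and E_0: "E 0 = 0" and E_l: "E (x * l) = E x * l"
  by (auto simp: E_def pow_add pow_scale pow_diff pow_0 sum.distrib scale_sum_right sum_subtractf
      pow_mult pow_l sum_distrib_right)

lemma TC_E: "x \<in> TC j \<Longrightarrow> E x \<in> TC j"
  unfolding E_def by (rule TC_sum) (simp add: TC_pow)

section \<open>The small complex on the whole algebra\<close>

text \<open>On the eigenspace of eigenvalue \<open>w\<close> the powers of \<open>\<alpha>\<close> below become powers of \<open>w\<close>, so this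
  mixed complex contains all the small mixed complexes at once.\<close>

definition full_complex :: "('k, 'a) mixed_complex" where
  "full_complex = \<lparr>mc_space = (\<lambda>r. \<lparr>qscale = scale, qnum = UNIV, qden = TC ((r + 1) div 2 * n)\<rparr>),
     mc_b = (\<lambda>r y. if r = 0 then 0 else if even r then E y else (\<alpha> y - y) * l),
     mc_B = (\<lambda>r y. if even r then 0 else (\<Sum>u\<le>r div 2. (\<alpha> ^^ (n * u)) (y - \<alpha> y)))\<rparr>"

lemma vsp: "vector_space scale" by unfold_locales

lemma linearI':
  assumes "\<And>x y. f (x + y) = f x + f y" "\<And>c x. f (scale c x) = scale c (f x)"
  shows "Vector_Spaces.linear scale scale f"
  using assms vsp by (simp add: Vector_Spaces.linear_iff)

lemma full_presented: "presented_mixed full_complex scale"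
proof (rule presented_mixed.intro)
  show "vector_space scale" by (rule vsp)
next
  fix r x
  show "Vector_Spaces.linear scale scale (mc_b full_complex r)"
    by (rule linearI') (auto simp: full_complex_def E_add E_scale al_add al_scale distrib_right
        left_diff_distrib scale_right_diff_distrib scale_right_distrib scale_l)
  show "Vector_Spaces.linear scale scale (mc_B full_complex r)"
    by (rule linearI') (auto simp: full_complex_def pow_add pow_scale pow_diff al_add al_scale
        scale_right_diff_distrib scale_right_distrib sum.distrib sum_subtractf scale_sum_right)
  show "mc_b full_complex (Suc r) x \<in> qden (mc_space full_complex r)"
    if "x \<in> qden (mc_space full_complex (Suc r))"
  proof (cases "even r")
    case True
    then obtain m where "r = 2 * m" by blast
    then show ?thesis using that TC_l'[of "\<alpha> x - x" m]
      by (simp add: full_complex_def TC_diff TC_al)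
  next
    case False
    then obtain m where "r = 2 * m + 1" using oddE by blast
    then show ?thesis using that by (simp add: full_complex_def TC_E)
  qed
  show "mc_B full_complex r x \<in> qden (mc_space full_complex (Suc r))"
    if "x \<in> qden (mc_space full_complex r)"
  proof (cases "even r")
    case False
    then obtain m where "r = 2 * m + 1" using oddE by blast
    then show ?thesis using that
      by (auto simp: full_complex_def intro!: TC_sum TC_pow TC_diff TC_al)
  qed (simp add: full_complex_def TC_0)
  show "mc_b full_complex (Suc r) (mc_B full_complex r x) + mc_B full_complex (r - 1) (mc_b full_complex r x)
      \<in> qden (mc_space full_complex r)"
  proof (cases "even r")
    case True
    then obtain m where m: "r = 2 * m" by blast
    show ?thesis
    proof (cases m)
      case 0
      then show ?thesis using m by (simp add: full_complex_def TC_0 al_0)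
    next
      case (Suc u)
      have "(\<Sum>i\<le>u. (\<alpha> ^^ (n * i)) (E x - \<alpha> (E x))) = x - (\<alpha> ^^ (n * Suc u)) x"
        by (simp only: E_al geom_pow)
      moreover have "x - (\<alpha> ^^ (n * Suc u)) x \<in> TC (n * Suc u)"
        using TC_neg[OF TC_one[of "n * Suc u" x]] by simp
      ultimately show ?thesis using m Suc by (simp add: full_complex_def al_0 mult.commute)
    qed
  next
    case False
    then obtain m where m: "r = 2 * m + 1" using oddE by blast
    have "E (\<Sum>u\<le>m. (\<alpha> ^^ (n * u)) (x - \<alpha> x)) = (\<Sum>u\<le>m. (\<alpha> ^^ (n * u)) (E x - \<alpha> (E x)))"
      unfolding E_def pow_sum pow_diff al_sum pow_al pow_pow sum_subtractf
      by (subst (1 3) sum.swap) (simp add: add.commute pow_al[symmetric] pow_pow)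
    also have "\<dots> = x - (\<alpha> ^^ (n * Suc m)) x" by (simp only: E_al geom_pow)
    also have "\<dots> \<in> TC (n * Suc m)" using TC_neg[OF TC_one[of "n * Suc m" x]] by simp
    finally show ?thesis using m by (simp add: full_complex_def mult.commute)
  qed
qed (auto simp: full_complex_def TC_subspace TC_0 pow_0 al_0 split: if_splits)

section \<open>Cyclic homology of the small complexes\<close>

abbreviation "small w \<equiv> small_mixed_complex scale \<alpha> n (\<lambda>_. l) w"

lemma eig_subspace: "subspace (eig w)"
  by (auto simp: subspace_def eigenspace_def al_0 al_add al_scale scale_right_distrib mult.commute)

lemma eig_pow: "x \<in> eig w \<Longrightarrow> (\<alpha> ^^ i) x = scale (w ^ i) x"
  by (induction i) (auto simp: eigenspace_def al_scale mult.commute)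

lemma eig_l: "x \<in> eig w \<Longrightarrow> x * l \<in> eig w"
  by (simp add: eigenspace_def al_mult al_l scale_mult_left)

lemma eig_l_pow: "x \<in> eig w \<Longrightarrow> x * l ^ m \<in> eig w"
  by (induction m arbitrary: x) (auto simp: eig_l mult.assoc[symmetric])

lemma eig_E: "x \<in> eig w \<Longrightarrow> E x = scale (\<Sum>i<n. w ^ i) x"
  by (simp add: E_def eig_pow scale_sum_left)

lemma small_b: "x \<in> eig w \<Longrightarrow> mc_b (small w) r x = mc_b full_complex r x"
  by (auto simp: small_mixed_complex_def full_complex_def eig_E)
    (auto simp: eigenspace_def scale_left_diff_distrib scale_l left_diff_distrib)

lemma small_B: "x \<in> eig w \<Longrightarrow> mc_B (small w) r x = mc_B full_complex r x"
proof -
  assume x: "x \<in> eig w"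
  then have "x - \<alpha> x = scale (1 - w) x" by (simp add: eigenspace_def scale_left_diff_distrib)
  then show ?thesis using x
    by (auto simp: small_mixed_complex_def full_complex_def pow_scale eig_pow scale_sum_left sum_distrib_left)
qed

lemma small_num: "qnum (mc_space (small w) r) = eig w"
  and small_den: "qden (mc_space (small w) r) = eig w \<inter> TC ((r + 1) div 2 * n)"
  and small_scale: "qscale (mc_space (small w) r) = scale"
  and full_num: "qnum (mc_space full_complex r) = UNIV"
  and full_den: "qden (mc_space full_complex r) = TC ((r + 1) div 2 * n)"
  by (simp_all add: small_mixed_complex_def twisted_comm_eig_def full_complex_def)

lemma small_b_eig: "x \<in> eig w \<Longrightarrow> mc_b (small w) r x \<in> eig w"
  and small_B_eig: "x \<in> eig w \<Longrightarrow> mc_B (small w) r x \<in> eig w"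
  using subspace_scale[OF eig_subspace[of w]] subspace_0[OF eig_subspace[of w]] eig_l
  by (auto simp: small_mixed_complex_def)

lemma small_presented: "presented_mixed (small w) scale"
proof -
  interpret full: presented_mixed full_complex scale by (rule full_presented)
  show ?thesis
  proof (rule presented_mixed.intro)
    show "vector_space scale" by (rule vsp)
  next
    fix r x
    show "Vector_Spaces.linear scale scale (mc_b (small w) r)"
      by (rule linearI') (auto simp: small_mixed_complex_def scale_right_distrib distrib_right mult.commute scale_l)
    show "Vector_Spaces.linear scale scale (mc_B (small w) r)"
      by (rule linearI') (auto simp: small_mixed_complex_def scale_right_distrib distrib_right mult.commute scale_l)
    show "module.subspace scale (qden (mc_space (small w) r))"
      unfolding small_den by (intro subspace_inter eig_subspace TC_subspace)
    show "mc_b (small w) 0 x = 0" by (simp add: small_mixed_complex_def)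
    assume "x \<in> qnum (mc_space (small w) r)"
    then have x: "x \<in> eig w" by (simp add: small_num)
    show "mc_b (small w) (Suc r) (mc_B (small w) r x) + mc_B (small w) (r - 1) (mc_b (small w) r x)
      \<in> qden (mc_space (small w) r)"
      using full.anti[of x r] small_b[OF small_B_eig[OF x]] small_B[OF small_b_eig[OF x]] small_b[OF x] small_B[OF x]
        subspace_add[OF eig_subspace small_b_eig[OF small_B_eig[OF x]] small_B_eig[OF small_b_eig[OF x]]]
      by (simp add: small_den full_num full_den)
    show "mc_B (small w) r x \<in> qden (mc_space (small w) (Suc r))" if "x \<in> qden (mc_space (small w) r)"
      using that full.B_den[of x r] small_B[OF x] small_B_eig[OF x]
      by (auto simp: small_den full_num full_den)
    show "mc_B (small w) (Suc r) (mc_B (small w) r x) \<in> qden (mc_space (small w) (Suc (Suc r)))"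
      using subspace_0[OF eig_subspace[of w]] by (auto simp: small_mixed_complex_def TC_0 twisted_comm_eig_def)
  next
    fix r x assume x: "x \<in> qnum (mc_space (small w) (Suc r))" "x \<in> qden (mc_space (small w) (Suc r))"
    then have "x \<in> eig w" by (simp add: small_num)
    then show "mc_b (small w) (Suc r) x \<in> qden (mc_space (small w) r)"
      using x full.b_den[of x r] small_b[of x w "Suc r"] small_b_eig[of x w "Suc r"]
      by (auto simp: small_den full_num full_den)
  qed (simp_all add: small_num eig_subspace small_scale small_b_eig small_B_eig)
qed

context
  fixes w :: 'k
begin

interpretation X: presented_mixed "small w" scale by (rule small_presented)

lemmas eig_0 = subspace_0[OF eig_subspace[of w]] and eig_add = subspace_add[OF eig_subspace[of w]]
  and eig_diff = subspace_diff[OF eig_subspace[of w]] and eig_scale = subspace_scale[OF eig_subspace[of w]]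
  and eig_sum = subspace_sum[OF eig_subspace[of w]]

lemma small_tot_num: "z \<in> qnum (tot_space (small w) r) \<longleftrightarrow> (\<forall>j. z j \<in> eig w) \<and> (\<forall>j. r < 2 * j \<longrightarrow> z j = 0)"
  using eig_0 by (auto simp: X.tot_num small_num) (metis not_le)

lemma small_tot_den: "z \<in> qden (tot_space (small w) r) \<longleftrightarrow>
    (\<forall>j. z j \<in> eig w) \<and> (\<forall>j. 2 * j \<le> r \<longrightarrow> z j \<in> TC ((r - 2 * j + 1) div 2 * n)) \<and> (\<forall>j. r < 2 * j \<longrightarrow> z j = 0)"
  using eig_0 by (auto simp: X.tot_den small_den) (metis not_le)+

lemma den_simple: "z \<in> qden (tot_space (small w) r) \<Longrightarrow> z \<in> qden (cyclic_homology (small w) r)"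
  unfolding X.HC_den by (intro exI[of _ 0] exI[of _ z]) (simp add: X.tot_num0 X.tot_diff_zero)

lemma tot_even: "tot_diff (small w) (2 * m) z j = (if j < m then scale (\<Sum>i<n. w ^ i) (z j) else 0)"
  by (auto simp: tot_diff_def small_mixed_complex_def)

lemma tot_odd: "tot_diff (small w) (Suc (2 * m)) z j = (if j \<le> m then scale (w - 1) (z j * l) +
    (if j < m then scale ((1 - w) * (\<Sum>u<m - j. w ^ (n * u))) (z (Suc j)) else 0) else 0)"
proof -
  have "odd (2 * m - Suc (2 * j))" "{..(2 * m - Suc (2 * j)) div 2} = {..<m - j}" if jm: "j < m"
  proof -
    from jm obtain d where "m = j + Suc d" using less_imp_Suc_add by auto
    then show "odd (2 * m - Suc (2 * j))" "{..(2 * m - Suc (2 * j)) div 2} = {..<m - j}"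
      by (auto simp: lessThan_Suc_atMost)
  qed
  then show ?thesis by (auto simp: tot_diff_def small_mixed_complex_def)
qed

lemma geom_zero_iff: "(\<Sum>i<n. w ^ i) = 0 \<longleftrightarrow> w \<noteq> 1 \<and> w ^ n = 1"
proof (cases "w = 1")
  case False
  then show ?thesis using one_diff_power_eq[of w n] by auto
qed (use n2 in simp)

lemma qd: "x - y \<in> A \<Longrightarrow> subspace A \<Longrightarrow> scale c x - scale c y \<in> A"
  by (simp add: scale_right_diff_distrib[symmetric] subspace_scale)

lemma small_HC_iso:
  fixes f :: "(nat \<Rightarrow> 'a) \<Rightarrow> 'a"
  assumes N: "subspace N" and D: "subspace D"
    and add: "\<And>x y. f (x + y) = f x + f y" and diff: "\<And>x y. f (x - y) = f x - f y"
    and scale: "\<And>c z. f (\<lambda>j. scale c (z j)) = scale c (f z)"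
    and num: "\<And>z. z \<in> qnum (cyclic_homology (small w) r) \<Longrightarrow> f z \<in> N"
    and den: "\<And>z. z \<in> qnum (cyclic_homology (small w) r) \<Longrightarrow> z \<in> qden (cyclic_homology (small w) r) \<Longrightarrow> f z \<in> D"
    and inj: "\<And>z. z \<in> qnum (cyclic_homology (small w) r) \<Longrightarrow> f z \<in> D \<Longrightarrow> z \<in> qden (cyclic_homology (small w) r)"
    and surj: "\<And>u. u \<in> N \<Longrightarrow> \<exists>z\<in>qnum (cyclic_homology (small w) r). f z = u"
  shows "cyclic_homology (small w) r \<cong>\<^sub>q \<lparr>qscale = scale, qnum = N, qden = D\<rparr>"
proof (rule q_iso_induced(1)[where f = f])
  fix c x y
  assume "x \<in> qnum (cyclic_homology (small w) r)" "y \<in> qnum (cyclic_homology (small w) r)"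
  then show "qscale (cyclic_homology (small w) r) c x + y \<in> qnum (cyclic_homology (small w) r)"
    "x - y \<in> qnum (cyclic_homology (small w) r)"
    by (rule X.HC_num_lin X.HC_num_diff)+
  show "f (qscale (cyclic_homology (small w) r) c x + y) =
      qscale \<lparr>qscale = scale, qnum = N, qden = D\<rparr> c (f x) + f y"
    by (simp add: X.HC_scale X.sct_def add scale)
next
  fix u assume "u \<in> qnum \<lparr>qscale = scale, qnum = N, qden = D\<rparr>"
  then obtain z where "z \<in> qnum (cyclic_homology (small w) r)" "f z = u" using surj by auto
  then show "\<exists>z\<in>qnum (cyclic_homology (small w) r). u - f z \<in> qden \<lparr>qscale = scale, qnum = N, qden = D\<rparr>"
    using subspace_0[OF D] by (intro bexI[of _ z]) auto
qed (use N D in \<open>simp_all add: subspace_0 subspace_diff subspace_add subspace_scale qd diff num den inj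
      X.HC_den0 X.HC_den_diff X.HC_den_scale\<close>)

lemma subspace_sum_image:
  assumes "subspace U" "subspace V" and g: "\<And>x y. g (x + y) = g x + g y" "\<And>c x. g (scale c x) = scale c (g x)"
  shows "subspace {u + g v | u v. u \<in> U \<and> v \<in> V}" (is "subspace ?D")
proof (rule subspaceI)
  have "g 0 = 0" using g(1)[of 0 0] by simp
  then show "0 \<in> ?D" using assms(1,2) by (intro CollectI exI[of _ 0]) (auto simp: subspace_0)
  fix x assume "x \<in> ?D"
  then obtain u v where x: "x = u + g v" "u \<in> U" "v \<in> V" by auto
  show "scale c x \<in> ?D" for c
    using assms(1,2) x
    by (intro CollectI exI[of _ "scale c u"] exI[of _ "scale c v"]) (auto simp: subspace_scale g scale_right_distrib)
  fix y assume "y \<in> ?D"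
  then obtain u' v' where y: "y = u' + g v'" "u' \<in> U" "v' \<in> V" by auto
  show "x + y \<in> ?D"
    using assms(1,2) x y
    by (intro CollectI exI[of _ "u + u'"] exI[of _ "v + v'"]) (auto simp: subspace_add g algebra_simps)
qed


lemma even_den_subspace:
  "subspace {u + v * l ^ p | u v. u \<in> twisted_comm_eig scale \<alpha> w 0 \<and> v \<in> eig w}" (is "subspace ?D")
proof -
  have "subspace (twisted_comm_eig scale \<alpha> w 0)"
    unfolding twisted_comm_eig_def by (intro subspace_inter eig_subspace TC_subspace)
  then show ?thesis
    by (rule subspace_sum_image[OF _ eig_subspace]) (auto simp: distrib_right scale_mult_left)
qed

text \<open>When \<open>1 + w + \<dots> + w\<^bsup>n-1\<^esup>\<close> is nonzero, the boundary from even to odd degree is bijective up to the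
  denominators, so that the odd homology vanishes and only the last component \<open>z m\<close> of an even cycle, the one in
  \<open>X\<^sub>0\<close>, survives.\<close>

lemma small_HC_regular:
  assumes g: "(\<Sum>i<n. w ^ i) \<noteq> 0"
  shows "cyclic_homology (small w) (2 * m) \<cong>\<^sub>q
      \<lparr>qscale = scale, qnum = eig w,
        qden = {u + scale (w - 1) v * l | u v. u \<in> twisted_comm_eig scale \<alpha> w 0 \<and> v \<in> eig w}\<rparr>"
    and "cyclic_homology (small w) (2 * m + 1) \<cong>\<^sub>q q_zero scale"
proof -
  let ?D = "{u + scale (w - 1) v * l | u v. u \<in> twisted_comm_eig scale \<alpha> w 0 \<and> v \<in> eig w}"
  have sub: "subspace ?D"
  proof -
    have "subspace (twisted_comm_eig scale \<alpha> w 0)"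
      unfolding twisted_comm_eig_def by (intro subspace_inter eig_subspace TC_subspace)
    then show ?thesis
      by (rule subspace_sum_image[OF _ eig_subspace])
        (auto simp: distrib_right scale_right_distrib scale_mult_left mult.commute)
  qed
  show "cyclic_homology (small w) (2 * m) \<cong>\<^sub>q \<lparr>qscale = scale, qnum = eig w, qden = ?D\<rparr>"
  proof (rule small_HC_iso[where f = "\<lambda>z. z m"])
    fix z assume z: "z \<in> qnum (cyclic_homology (small w) (2 * m))"
    then have ze: "z j \<in> eig w" "2 * m < 2 * j \<Longrightarrow> z j = 0" for j
      by (auto simp: X.HC_num small_tot_num)
    have zT: "z j \<in> TC ((m - j) * n)" if "j < m" for j
    proof -
      have "tot_diff (small w) (2 * m) z \<in> qden (tot_space (small w) (2 * m - 1))"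
        using z that by (auto simp: X.HC_num)
      then have "2 * j \<le> 2 * m - 1 \<longrightarrow> tot_diff (small w) (2 * m) z j \<in> TC ((2 * m - 1 - 2 * j + 1) div 2 * n)"
        unfolding small_tot_den by blast
      moreover have "(2 * m - 1 - 2 * j + 1) div 2 = m - j" "2 * j \<le> 2 * m - 1" using that by auto
      ultimately have "tot_diff (small w) (2 * m) z j \<in> TC ((m - j) * n)" by (simp only: simp_thms)
      then have "scale (\<Sum>i<n. w ^ i) (z j) \<in> TC ((m - j) * n)" using that by (simp add: tot_even)
      from TC_scale[OF this, of "inverse (\<Sum>i<n. w ^ i)"] show ?thesis using g by simp
    qed
    show "z m \<in> eig w" using ze by simp
    show "z m \<in> ?D"
      if zd: "z \<in> qden (cyclic_homology (small w) (2 * m))"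
    proof -
      obtain y v where yv: "z = tot_diff (small w) (Suc (2 * m)) y + v"
        "y \<in> qnum (tot_space (small w) (Suc (2 * m)))" "v \<in> qden (tot_space (small w) (2 * m))"
        using zd[unfolded X.HC_den] by blast
      have "z m = v m + scale (w - 1) (y m) * l" using yv(1) by (simp add: tot_odd scale_l)
      moreover have "v m \<in> TC 0" "v m \<in> eig w" "y m \<in> eig w"
        using yv by (auto simp: small_tot_den small_tot_num dest!: spec[of _ m])
      ultimately show ?thesis by (auto simp: twisted_comm_eig_def)
    qed
    show "z \<in> qden (cyclic_homology (small w) (2 * m))"
      if zd: "z m \<in> ?D"
    proof -
      obtain u v where uv: "z m = u + scale (w - 1) v * l" "u \<in> eig w" "u \<in> TC 0" "v \<in> eig w"
        using zd by (auto simp: twisted_comm_eig_def)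

      define y where "y j = (if j = m then v else 0)" for j :: nat
      define z' where "z' = z - tot_diff (small w) (Suc (2 * m)) y"
      have yn: "y \<in> qnum (tot_space (small w) (Suc (2 * m)))"
        using uv eig_0 by (auto simp: small_tot_num y_def)
      have z'm: "z' m = u" using uv by (simp add: z'_def tot_odd y_def scale_l)
      have z'j: "z' j = z j" if "j < m" "Suc j \<noteq> m" for j
        using that by (simp add: z'_def tot_odd y_def)
      have z'p: "z' j = z j - scale ((1 - w) * (\<Sum>u<1. w ^ (n * u))) v" if "Suc j = m" for j
        using that by (auto simp: z'_def tot_odd y_def)

      \<comment> \<open>the correction \<open>y\<close> also changes the component before the last one by \<open>(1 - w) v\<close>, which is a commutator because \<open>(1 - w\<^sup>n) v = v - \<alpha>\<^sup>n v\<close>\<close>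
      have gw: "scale ((1 - w) * (\<Sum>i<n. w ^ i)) v \<in> TC n"
      proof -
        have "(1 - w) * (\<Sum>i<n. w ^ i) = 1 - w ^ n" using one_diff_power_eq[of w n] by simp
        moreover have "scale (1 - w ^ n) v = - ((\<alpha> ^^ n) v - v)"
          using uv(4) by (simp add: eig_pow scale_left_diff_distrib)
        ultimately show ?thesis using TC_neg[OF TC_one[of n v]] by simp
      qed
      have "scale (inverse (\<Sum>i<n. w ^ i)) (scale ((1 - w) * (\<Sum>i<n. w ^ i)) v) \<in> TC n"
        by (rule TC_scale[OF gw])
      moreover have "inverse (\<Sum>i<n. w ^ i) * ((1 - w) * (\<Sum>i<n. w ^ i)) = 1 - w" using g by simp
      ultimately have gv: "scale (1 - w) v \<in> TC n" by (simp only: scale_scale)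
      have "z' j \<in> TC ((2 * m - 2 * j + 1) div 2 * n)" if jm: "j \<le> m" for j
      proof -
        have e: "(2 * m - 2 * j + 1) div 2 = m - j" using that by auto
        from jm consider "j = m" | "j < m" "Suc j \<noteq> m" | "Suc j = m" by linarith
        then show ?thesis
        proof cases
          case 1 then show ?thesis using z'm uv by simp
        next
          case 2 then show ?thesis using z'j zT e by simp
        next
          case 3
          then have "j < m" "m - j = 1" by simp_all
          then have "z j \<in> TC n" using zT[of j] by (simp only: mult_1)
          then show ?thesis using 3 z'p[OF 3] gv e by (auto intro: TC_diff)
        qed
      qed
      moreover have "z' j \<in> eig w" for j
      proof -
        have "tot_diff (small w) (Suc (2 * m)) y j \<in> eig w"
          using uv(4) eig_0 by (auto simp: tot_odd y_def scale_l[symmetric] intro!: eig_add eig_scale eig_l)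
        then show ?thesis using ze eig_diff by (simp add: z'_def)
      qed
      moreover have "z' j = 0" if "2 * m < 2 * j" for j using ze that by (simp add: z'_def tot_odd)
      ultimately have "z' \<in> qden (tot_space (small w) (2 * m))" by (auto simp: small_tot_den)
      moreover have "z = tot_diff (small w) (Suc (2 * m)) y + z'" by (simp add: z'_def)
      ultimately show ?thesis using yn unfolding X.HC_den by blast
    qed
  next
    fix u assume u: "u \<in> eig w"
    show "\<exists>z\<in>qnum (cyclic_homology (small w) (2 * m)). z m = u"
    proof (rule bexI[of _ "\<lambda>j. if j = m then u else 0"])
      show "(\<lambda>j. if j = m then u else 0) \<in> qnum (cyclic_homology (small w) (2 * m))"
        using u eig_0 by (auto simp: X.HC_num small_tot_num small_tot_den tot_even TC_0)
    qed simp
  qed (simp_all add: sub eig_subspace del: mem_Collect_eq)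
  show "cyclic_homology (small w) (2 * m + 1) \<cong>\<^sub>q q_zero scale"
    unfolding q_zero_def
  proof (rule small_HC_iso[where f = "\<lambda>z. 0"])
    fix z assume z: "z \<in> qnum (cyclic_homology (small w) (2 * m + 1))"
    define y where "y j = scale (inverse (\<Sum>i<n. w ^ i)) (z j)" for j
    have "y \<in> qnum (tot_space (small w) (2 * Suc m))"
      using z by (auto simp: y_def X.HC_num small_tot_num eig_scale)
    moreover have "z = tot_diff (small w) (2 * Suc m) y + 0"
      using z g by (auto simp: tot_even[of "Suc m", simplified] y_def X.HC_num small_tot_num fun_eq_iff)
    ultimately show "z \<in> qden (cyclic_homology (small w) (2 * m + 1))"
      unfolding X.HC_den using X.tot_den0 by (intro exI[of _ y] exI[of _ 0]) simp
  next
    show "\<exists>x\<in>qnum (cyclic_homology (small w) (2 * m + 1)). 0 = u" if "u \<in> {0}" for u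
      using that by (intro bexI[of _ 0]) (auto simp: X.HC_num X.tot_num0 X.tot_diff_zero X.tot_den0)
  qed (simp_all add: subspace_def)
qed

text \<open>If \<open>w \<noteq> 1\<close> and \<open>w\<^sup>n = 1\<close>, then the boundaries of odd chains identify \<open>[\<lambda> l]\<close> in degree
  \<open>2(p - 1)\<close> with \<open>p [\<lambda>]\<close> in degree \<open>2p\<close>. Hence everything can be moved to degree \<open>0\<close>, with divided powers of
  \<open>l\<close>; the sum \<open>tail\<close> is the result.\<close>

definition tail :: "nat \<Rightarrow> (nat \<Rightarrow> 'a) \<Rightarrow> 'a" where
  "tail m z = (\<Sum>j\<le>m. scale (1 / fact (m - j)) (z j * l ^ (m - j)))"

lemma tail_add: "tail m (x + y) = tail m x + tail m y" and tail_diff: "tail m (x - y) = tail m x - tail m y"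
  and tail_scale: "tail m (\<lambda>j. scale c (z j)) = scale c (tail m z)"
  by (simp_all add: tail_def distrib_right left_diff_distrib scale_right_distrib scale_right_diff_distrib
      sum.distrib sum_subtractf scale_sum_right scale_mult_left[symmetric] mult.commute)

lemma tail_eig: "(\<And>j. z j \<in> eig w) \<Longrightarrow> tail m z \<in> eig w"
  unfolding tail_def by (intro eig_sum eig_scale eig_l_pow)

lemma tail_TC:
  assumes "\<And>j. j \<le> m \<Longrightarrow> z j \<in> TC ((m - j) * n)"
  shows "tail m z \<in> TC 0"
  unfolding tail_def using assms by (intro TC_sum TC_scale TC_l_pow) (auto simp: mult.commute)

lemma tail_single: "tail m (\<lambda>j. if j = m then u else 0) = u"
proof -
  have "tail m (\<lambda>j. if j = m then u else 0) = (\<Sum>j\<le>m. if j = m then u else 0)"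
    unfolding tail_def by (intro sum.cong) auto
  then show ?thesis by simp
qed

lemma tail_last: "(\<And>j. j < m \<Longrightarrow> z j = 0) \<Longrightarrow> tail m z = z m"
proof -
  assume "\<And>j. j < m \<Longrightarrow> z j = 0"
  then have "tail m z = (\<Sum>j\<le>m. if j = m then z m else 0)"
    unfolding tail_def by (intro sum.cong) auto
  then show ?thesis by simp
qed

context
  assumes w1: "w \<noteq> 1" and wn: "w ^ n = 1"
begin

lemma tot_odd': "tot_diff (small w) (Suc (2 * m)) z j =
    (if j \<le> m then scale (w - 1) (z j * l - scale (of_nat (m - j)) (z (Suc j))) else 0)"
proof -
  have "w ^ (n * u) = 1" for u by (simp add: power_mult wn)
  then have "scale ((1 - w) * (\<Sum>u<m - j. w ^ (n * u))) (z (Suc j)) =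
      - scale (w - 1) (scale (of_nat (m - j)) (z (Suc j)))"
    by (simp add: scale_minus_left[symmetric] algebra_simps)
  then show ?thesis by (auto simp: tot_odd scale_right_diff_distrib)
qed

text \<open>With the divided powers in \<open>tail\<close> the sum over a boundary telescopes, and only the contribution of \<open>y 0\<close> is left.\<close>

lemma tail_tot_diff:
  "tail m (tot_diff (small w) (Suc (2 * m)) y) = scale ((w - 1) / fact m) (y 0 * l ^ Suc m)"
proof -
  define g where "g j = (if j \<le> m then scale (1 / fact (m - j)) (y j * l ^ (Suc m - j)) else 0)" for j
  have "scale (1 / fact (m - j)) (tot_diff (small w) (Suc (2 * m)) y j * l ^ (m - j)) =
      scale (w - 1) (g j - g (Suc j))" if "j \<le> m" for j
  proof -
    have 1: "Suc m - j = Suc (m - j)" using that by simp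
    have "scale (1 / fact (m - j)) (scale (of_nat (m - j)) (y (Suc j) * l ^ (m - j))) = g (Suc j)"
    proof (cases "j = m")
      case False
      then obtain d where d: "m = j + Suc d" using \<open>j \<le> m\<close> less_imp_Suc_add[of j m] by auto
      have e: "m - j = Suc d" using d by simp
      have "1 / fact (m - j) * of_nat (m - j) = (1 / fact d :: 'k)"
        unfolding e by (simp only: fact_Suc of_nat_mult of_nat_fact) (simp del: of_nat_Suc)
      then show ?thesis using d by (simp add: g_def)
    qed (simp add: g_def)
    then show ?thesis using that 1
      by (simp add: tot_odd' g_def scale_mult_left[symmetric] left_diff_distrib scale_right_diff_distrib
          mult.assoc mult.commute[of "1 / fact (m - j)"] scale_left_commute power_commutes
          flip: scale_scale)
  qed
  then have "tail m (tot_diff (small w) (Suc (2 * m)) y) = scale (w - 1) (\<Sum>j\<le>m. g j - g (Suc j))"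
    by (simp add: tail_def scale_sum_right)
  also have "(\<Sum>j\<le>m. g j - g (Suc j)) = g 0" unfolding sum_telescope by (simp add: g_def)
  finally show ?thesis by (simp add: g_def)
qed

lemma singular_cycle: "z \<in> qnum (cyclic_homology (small w) (2 * m)) \<longleftrightarrow> z \<in> qnum (tot_space (small w) (2 * m))"
proof -
  have "(\<Sum>i<n. w ^ i) = 0" using w1 wn geom_zero_iff by simp
  then have "tot_diff (small w) (2 * m) z = 0" by (auto simp: tot_even fun_eq_iff)
  then show ?thesis by (simp add: X.HC_num X.tot_den0)
qed

text \<open>All even chains are cycles here. Given \<open>tail m z\<close>, a chain \<open>y\<close> that kills the components \<open>z 0, \<dots>, z (m - 1)\<close> is
  found by solving the recursion for its components; the free choice of \<open>y 0\<close> realizes the multiples of \<open>l\<^bsup>m+1\<^esup>\<close>.\<close>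

lemma small_HC_singular_even:
  "cyclic_homology (small w) (2 * m) \<cong>\<^sub>q
      \<lparr>qscale = scale, qnum = eig w,
        qden = {u + v * l ^ (m + 1) | u v. u \<in> twisted_comm_eig scale \<alpha> w 0 \<and> v \<in> eig w}\<rparr>"
proof -
  let ?D = "{u + v * l ^ (m + 1) | u v. u \<in> twisted_comm_eig scale \<alpha> w 0 \<and> v \<in> eig w}"
  note sub = even_den_subspace[of "m + 1"]
  show ?thesis
  proof (rule small_HC_iso[where f = "tail m"])
    fix z assume z: "z \<in> qnum (cyclic_homology (small w) (2 * m))"
    then have ze: "z j \<in> eig w" "2 * m < 2 * j \<Longrightarrow> z j = 0" for j
      by (auto simp: X.HC_num small_tot_num)
    show "tail m z \<in> eig w" using ze tail_eig by simp
    show "tail m z \<in> ?D"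
      if zd: "z \<in> qden (cyclic_homology (small w) (2 * m))"
    proof -
      obtain y v where yv: "z = tot_diff (small w) (Suc (2 * m)) y + v"
        "y \<in> qnum (tot_space (small w) (Suc (2 * m)))" "v \<in> qden (tot_space (small w) (2 * m))"
        using zd[unfolded X.HC_den] by blast
      have "v j \<in> TC ((m - j) * n)" if "j \<le> m" for j
      proof -
        have "v j \<in> TC ((2 * m - 2 * j + 1) div 2 * n)" using yv(3) that by (simp add: small_tot_den)
        moreover have "(2 * m - 2 * j + 1) div 2 = m - j" using that by simp
        ultimately show ?thesis by simp
      qed
      then have "tail m v \<in> TC 0" by (rule tail_TC)
      moreover have "tail m v \<in> eig w" using yv(3) by (intro tail_eig) (simp add: small_tot_den)
      moreover have "scale ((w - 1) / fact m) (y 0) \<in> eig w" using yv(2) by (simp add: small_tot_num eig_scale)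
      moreover have "tail m z = tail m v + scale ((w - 1) / fact m) (y 0) * l ^ (m + 1)"
        by (simp add: yv(1) tail_add tail_tot_diff scale_mult_left)
      ultimately show ?thesis by (auto simp: twisted_comm_eig_def)
    qed
    show "z \<in> qden (cyclic_homology (small w) (2 * m))"
      if zd: "tail m z \<in> ?D"
    proof -
      obtain u v where uv: "tail m z = u + v * l ^ (m + 1)" "u \<in> eig w" "u \<in> TC 0" "v \<in> eig w"
        using zd by (auto simp: twisted_comm_eig_def)
      define Y where "Y = rec_nat (scale (fact m / (w - 1)) v)
        (\<lambda>j y. scale (1 / of_nat (m - j)) (y * l - scale (1 / (w - 1)) (z j)))"
      have Y0: "Y 0 = scale (fact m / (w - 1)) v"
        and YS: "Y (Suc j) = scale (1 / of_nat (m - j)) (Y j * l - scale (1 / (w - 1)) (z j))" for j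
        by (simp_all add: Y_def)
      have Ye: "Y j \<in> eig w" for j
      proof (induction j)
        case 0 show ?case unfolding Y0 using uv(4) by (rule eig_scale)
      next
        case (Suc j) show ?case unfolding YS by (intro eig_scale eig_diff eig_l Suc ze)
      qed
      define y where "y j = (if j \<le> m then Y j else 0)" for j
      have yn: "y \<in> qnum (tot_space (small w) (Suc (2 * m)))"
        using Ye eig_0 by (auto simp: small_tot_num y_def)
      define z' where "z' = z - tot_diff (small w) (Suc (2 * m)) y"
      have z'j: "z' j = 0" if "j < m" for j
      proof -
        have "(of_nat (m - j) :: 'k) \<noteq> 0" using that by simp
        then have "scale (of_nat (m - j)) (y (Suc j)) = y j * l - scale (1 / (w - 1)) (z j)"
          using that by (simp add: y_def YS)
        then show ?thesis using that w1 by (simp add: z'_def tot_odd')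
      qed
      have "tail m z' = u"
        using w1 by (simp add: z'_def tail_diff tail_tot_diff uv(1) y_def Y0 scale_mult_left[symmetric])
      then have z'm: "z' m = u" using tail_last[of m z'] z'j by simp
      have "z' j = 0" if "m < j" for j using that ze by (simp add: z'_def tot_odd')
      with z'j z'm have z'e: "z' j = (if j = m then u else 0)" for j by (metis not_less_iff_gr_or_eq)
      have "z' \<in> qden (tot_space (small w) (2 * m))"
        using uv eig_0 TC_0 by (auto simp: small_tot_den z'e)
      moreover have "z = tot_diff (small w) (Suc (2 * m)) y + z'" by (simp add: z'_def)
      ultimately show ?thesis using yn unfolding X.HC_den by blast
    qed
  next
    fix u assume u: "u \<in> eig w"
    show "\<exists>z\<in>qnum (cyclic_homology (small w) (2 * m)). tail m z = u"
    proof (rule bexI[of _ "\<lambda>j. if j = m then u else 0"])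
      show "(\<lambda>j. if j = m then u else 0) \<in> qnum (cyclic_homology (small w) (2 * m))"
        unfolding singular_cycle using u eig_0 by (auto simp: small_tot_num)
    qed (simp add: tail_single)
  qed (simp_all add: tail_add tail_diff tail_scale sub eig_subspace del: mem_Collect_eq One_nat_def add_Suc_right)
qed

text \<open>A cycle is determined modulo the denominators by its first component \<open>z 0\<close>, since the cycle condition
  expresses \<open>z (j + 1)\<close> by \<open>z j l\<close>. The recursion can be continued to the end exactly if \<open>z 0 l\<^bsup>m+1\<^esup>\<close> is a sum of commutators.\<close>

lemma small_HC_singular_odd:
  "cyclic_homology (small w) (2 * m + 1) \<cong>\<^sub>q
      \<lparr>qscale = scale, qnum = {v \<in> eig w. v * l ^ (m + 1) \<in> twisted_comm_eig scale \<alpha> w 0},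
        qden = twisted_comm_eig scale \<alpha> w ((m + 1) * n)\<rparr>" (is "_ \<cong>\<^sub>q \<lparr>qscale = scale, qnum = ?N, qden = ?D\<rparr>")
proof -
  have subN: "subspace ?N"
    by (auto simp: subspace_def twisted_comm_eig_def eig_0 eig_add eig_scale TC_0 TC_add TC_scale
        distrib_right scale_mult_left[symmetric])
  have subD: "subspace ?D"
    unfolding twisted_comm_eig_def by (simp add: subspace_inter eig_subspace TC_subspace)
  have cyc: "(z \<in> qnum (cyclic_homology (small w) (Suc (2 * m)))) \<longleftrightarrow>
      z \<in> qnum (tot_space (small w) (Suc (2 * m))) \<and>
      (\<forall>j\<le>m. z j * l - scale (of_nat (m - j)) (z (Suc j)) \<in> TC ((m - j) * n))" for z
  proof -
    have "scale (w - 1) x \<in> TC i \<longleftrightarrow> x \<in> TC i" for x i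
      using TC_scale[of "scale (w - 1) x" i "1 / (w - 1)"] TC_scale[of x i "w - 1"] w1 by auto
    moreover have "tot_diff (small w) (Suc (2 * m)) z j \<in> eig w"
      if "z \<in> qnum (tot_space (small w) (Suc (2 * m)))" for j
      using that eig_0 by (auto simp: tot_odd' small_tot_num intro!: eig_scale eig_diff eig_l)
    moreover have "tot_diff (small w) (Suc (2 * m)) z j = 0" if "m < j" for j
      using that by (simp add: tot_odd')
    moreover have "(2 * m - 2 * j + 1) div 2 = m - j" "2 * j \<le> 2 * m \<longleftrightarrow> j \<le> m" for j by auto
    ultimately have "tot_diff (small w) (Suc (2 * m)) z \<in> qden (tot_space (small w) (2 * m)) \<longleftrightarrow>
        (\<forall>j\<le>m. tot_diff (small w) (Suc (2 * m)) z j \<in> TC ((m - j) * n))"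
      if "z \<in> qnum (tot_space (small w) (Suc (2 * m)))"
      using that unfolding small_tot_den by (auto simp only: not_le mult_less_cancel1)
    moreover have "tot_diff (small w) (Suc (2 * m)) z j \<in> TC i \<longleftrightarrow>
        z j * l - scale (of_nat (m - j)) (z (Suc j)) \<in> TC i" if "j \<le> m" for i j
      using that \<open>\<And>x i. scale (w - 1) x \<in> TC i \<longleftrightarrow> x \<in> TC i\<close> by (simp only: tot_odd' if_True)
    ultimately show ?thesis by (auto simp: X.HC_num simp del: of_nat_diff)
  qed
  show ?thesis unfolding Suc_eq_plus1[symmetric, of "2 * m"]
  proof (rule small_HC_iso[where f = "\<lambda>z. z 0"])
    fix z assume z: "z \<in> qnum (cyclic_homology (small w) (Suc (2 * m)))"
    then have zt: "z \<in> qnum (tot_space (small w) (Suc (2 * m)))"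
      and zc: "\<And>j. j \<le> m \<Longrightarrow> z j * l - scale (of_nat (m - j)) (z (Suc j)) \<in> TC ((m - j) * n)"
      by (auto simp: cyc)
    have ze: "z j \<in> eig w" for j using zt by (simp add: small_tot_num)
    have "tail m (tot_diff (small w) (Suc (2 * m)) z) \<in> TC 0"
      by (rule tail_TC) (simp add: tot_odd' TC_scale zc del: of_nat_diff)
    then have "scale ((w - 1) / fact m) (z 0 * l ^ Suc m) \<in> TC 0" by (simp add: tail_tot_diff)
    from TC_scale[OF this, of "fact m / (w - 1)"] have "z 0 * l ^ Suc m \<in> TC 0" using w1 by simp
    then show "z 0 \<in> ?N" using ze eig_l_pow[OF ze, of 0 "Suc m"] by (simp add: twisted_comm_eig_def)
    show "z 0 \<in> ?D" if zd: "z \<in> qden (cyclic_homology (small w) (Suc (2 * m)))"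
    proof -
      obtain y v where yv: "z = tot_diff (small w) (Suc (Suc (2 * m))) y + v" "v \<in> qden (tot_space (small w) (Suc (2 * m)))"
        using zd[unfolded X.HC_den] by blast
      have "(\<Sum>i<n. w ^ i) = 0" using w1 wn geom_zero_iff by simp
      then have "z 0 = v 0" using tot_even[of "Suc m" y 0] by (simp add: yv(1))
      moreover have "v 0 \<in> eig w" "v 0 \<in> TC ((Suc (2 * m) - 2 * 0 + 1) div 2 * n)"
        using yv(2)[unfolded small_tot_den, THEN conjunct2, THEN conjunct1, rule_format, of 0] yv(2)
        by (simp_all add: small_tot_den)
      ultimately show ?thesis by (simp add: twisted_comm_eig_def)
    qed
    show "z \<in> qden (cyclic_homology (small w) (Suc (2 * m)))" if zd: "z 0 \<in> ?D"
    proof (rule den_simple)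
      have "z j \<in> TC ((m + 1 - j) * n)" if "j \<le> m" for j
        using that
      proof (induction j)
        case 0
        then show ?case using zd by (simp add: twisted_comm_eig_def)
      next
        case (Suc j)
        then have "z j \<in> TC (Suc (m - j) * n)" by (simp add: Suc_diff_le)
        then have "z j * l \<in> TC ((m - j) * n)" by (rule TC_l')
        from TC_diff[OF this zc[of j]] Suc have "scale (of_nat (m - j)) (z (Suc j)) \<in> TC ((m - j) * n)" by simp
        from TC_scale[OF this, of "1 / of_nat (m - j)"] show ?case using Suc.prems by simp
      qed
      moreover have "(Suc (2 * m) - 2 * j + 1) div 2 = m + 1 - j" if "j \<le> m" for j using that by auto
      ultimately have "z j \<in> TC ((Suc (2 * m) - 2 * j + 1) div 2 * n)" if "2 * j \<le> Suc (2 * m)" for j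
        using that by simp
      then show "z \<in> qden (tot_space (small w) (Suc (2 * m)))"
        using zt by (simp add: small_tot_den small_tot_num)
    qed
  next
    fix u assume "u \<in> ?N"
    then have u: "u \<in> eig w" "u * l ^ Suc m \<in> TC 0" by (simp_all add: twisted_comm_eig_def)
    \<comment> \<open>the solution of \<open>z j l = (m - j) z (j + 1)\<close> with \<open>z 0 = u\<close>\<close>
    define z where "z j = (if j \<le> m then scale (fact (m - j) / fact m) (u * l ^ j) else 0)" for j
    have "z \<in> qnum (cyclic_homology (small w) (Suc (2 * m)))"
      unfolding cyc
    proof (intro conjI allI impI)
      show "z \<in> qnum (tot_space (small w) (Suc (2 * m)))"
        using eig_scale[OF eig_l_pow[OF u(1)]] eig_0 by (auto simp: small_tot_num z_def)
      fix j assume j: "j \<le> m"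
      show "z j * l - scale (of_nat (m - j)) (z (Suc j)) \<in> TC ((m - j) * n)"
      proof (cases "j = m")
        case True
        then show ?thesis using u(2) by (simp add: z_def scale_l mult.assoc power_commutes TC_scale)
      next
        case False
        then obtain d where d: "m = j + Suc d" using j less_imp_Suc_add[of j m] by auto
        then have "z j * l - scale (of_nat (m - j)) (z (Suc j)) = 0"
          by (simp add: z_def scale_l mult.assoc power_commutes)
        then show ?thesis by (simp only: TC_0)
      qed
    qed
    moreover have "z 0 = u" by (simp add: z_def)
    ultimately show "\<exists>z\<in>qnum (cyclic_homology (small w) (Suc (2 * m))). z 0 = u" by auto
  qed (rule subN subD | simp)+
qed

end

end

end

section \<open>Functional calculus for a diagonalizable endomorphism\<close>

locale diag_algebra = twisted_algebra +
  assumes diag: "diagonalizable scale \<alpha>" and fin: "finite (eigenvalues scale \<alpha>)"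
begin

abbreviation "W \<equiv> eigenvalues scale \<alpha>"

text \<open>Lagrange interpolation: the projection onto an eigenspace is a polynomial in \<open>\<alpha>\<close>. Therefore it preserves
  every subspace that \<open>\<alpha>\<close> preserves and commutes with right multiplication by \<open>l\<close>.\<close>

fun lagr :: "'a list \<Rightarrow> 'a \<Rightarrow> 'b \<Rightarrow> 'b" where
  "lagr [] w x = x"
| "lagr (u # us) w x = scale (1 / (w - u)) (\<alpha> (lagr us w x) - scale u (lagr us w x))"

lemma lagr_add: "lagr us w (x + y) = lagr us w x + lagr us w y"
  by (induction us) (simp_all add: al_add scale_right_distrib scale_right_diff_distrib)

lemma lagr_scale: "lagr us w (scale c x) = scale c (lagr us w x)"
  by (induction us) (simp_all add: al_scale scale_right_diff_distrib mult.commute)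

lemma lagr_l: "lagr us w (x * l) = lagr us w x * l"
  by (induction us) (simp_all add: al_mult al_l scale_l left_diff_distrib)

lemma lagr_al: "lagr us w (\<alpha> x) = \<alpha> (lagr us w x)"
  by (induction us) (simp_all add: al_scale al_diff)

lemma lagr_TC: "x \<in> TC j \<Longrightarrow> lagr us w x \<in> TC j"
  by (induction us) (simp_all add: TC_scale TC_diff TC_al)

lemma lagr_eig:
  assumes "x \<in> eig c"
  shows "lagr us w x = scale (\<Prod>u\<leftarrow>us. (c - u) / (w - u)) x"
proof (induction us)
  case (Cons u us)
  have "\<alpha> x = scale c x" using assms by (simp add: eigenspace_def)
  then have "lagr (u # us) w x = scale (1 / (w - u)) (scale ((\<Prod>u\<leftarrow>us. (c - u) / (w - u)) * c) x
      - scale (u * (\<Prod>u\<leftarrow>us. (c - u) / (w - u))) x)"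
    by (simp add: Cons al_scale)
  also have "\<dots> = scale (\<Prod>u\<leftarrow>u # us. (c - u) / (w - u)) x"
    by (simp add: scale_left_diff_distrib[symmetric]) (simp add: field_simps)
  finally show ?case .
qed simp

definition proj :: "'a \<Rightarrow> 'b \<Rightarrow> 'b" where
  "proj w = lagr (SOME us. set us = W - {w}) w"

lemma proj_add: "proj w (x + y) = proj w x + proj w y"
  and proj_scale: "proj w (scale c x) = scale c (proj w x)"
  and proj_l: "proj w (x * l) = proj w x * l"
  and proj_al: "proj w (\<alpha> x) = \<alpha> (proj w x)"
  and proj_TC: "x \<in> TC j \<Longrightarrow> proj w x \<in> TC j"
  by (simp_all add: proj_def lagr_add lagr_scale lagr_l lagr_al lagr_TC)

lemma proj_eig:
  assumes "x \<in> eig c" "c \<in> W" "w \<in> W"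
  shows "proj w x = (if c = w then x else 0)"
proof -
  define us where "us = (SOME us. set us = W - {w})"
  have us: "set us = W - {w}"
    unfolding us_def using fin by (intro someI_ex[of "\<lambda>us. set us = W - {w}"] finite_list) simp
  have "(\<Prod>u\<leftarrow>us. (c - u) / (w - u)) = (if c = w then 1 else 0)"
  proof (cases "c = w")
    case True
    have "prod_list (map (\<lambda>u. (c - u) / (w - u)) us) = prod_list (map (\<lambda>u. 1) us)"
      using us True by (intro arg_cong[of _ _ prod_list] map_cong) auto
    then show ?thesis using True by (simp add: map_replicate_const)
  next
    case False
    then have "c \<in> set us" using us assms by auto
    then show ?thesis using False by (auto simp: prod_list_zero_iff intro!: bexI[of _ c])
  qed
  then show ?thesis using lagr_eig[OF assms(1), of us w] by (simp add: proj_def us_def[symmetric])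
qed

lemma proj_spec: "(\<Sum>w\<in>W. proj w x) = x \<and> (\<forall>w\<in>W. proj w x \<in> eig w)"
proof -
  obtain B where ind: "\<not> dependent B" and sp: "span B = UNIV" and ev: "\<And>b. b \<in> B \<Longrightarrow> \<exists>c. \<alpha> b = scale c b"
    using diag unfolding diagonalizable_def by blast
  have "x \<in> span B" using sp by simp
  then show ?thesis
  proof (rule span_induct[where P = "\<lambda>x. (\<Sum>w\<in>W. proj w x) = x \<and> (\<forall>w\<in>W. proj w x \<in> eig w)"])
    have "proj w 0 = 0" for w using proj_add[of w 0 0] by simp
    then show "subspace {x. (\<Sum>w\<in>W. proj w x) = x \<and> (\<forall>w\<in>W. proj w x \<in> eig w)}"
      by (auto simp: subspace_def proj_add proj_scale sum.distrib scale_sum_right[symmetric] eig_0 eig_add eig_scale)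
    fix b assume b: "b \<in> B"
    then obtain c where c: "\<alpha> b = scale c b" using ev by blast
    have "b \<noteq> 0" using ind b dependent_zero by blast
    with c have "c \<in> W" "b \<in> eig c" by (auto simp: eigenvalues_def eigenspace_def)
    then show "(\<Sum>w\<in>W. proj w b) = b \<and> (\<forall>w\<in>W. proj w b \<in> eig w)"
      using fin by (auto simp: proj_eig eig_0)
  qed
qed

lemma proj_in: "w \<in> W \<Longrightarrow> proj w x \<in> eig w" and proj_sum: "(\<Sum>w\<in>W. proj w x) = x"
  using proj_spec by auto

text \<open>The operator that acts on the eigenspace of \<open>w\<close> as multiplication by \<open>F w\<close>.\<close>

definition fc :: "('a \<Rightarrow> 'a) \<Rightarrow> 'b \<Rightarrow> 'b" where
  "fc F x = (\<Sum>w\<in>W. scale (F w) (proj w x))"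

lemma fc_add: "fc F (x + y) = fc F x + fc F y" and fc_scale: "fc F (scale c x) = scale c (fc F x)"
  and fc_l: "fc F (x * l) = fc F x * l" and fc_al: "fc F (\<alpha> x) = \<alpha> (fc F x)"
  by (simp_all add: fc_def proj_add proj_scale proj_l proj_al scale_right_distrib sum.distrib
      scale_sum_right mult.commute scale_mult_left sum_distrib_right al_sum al_scale)

lemma fc_TC: "x \<in> TC j \<Longrightarrow> fc F x \<in> TC j"
  unfolding fc_def by (intro TC_sum TC_scale proj_TC)

lemma fc_eig: "x \<in> eig c \<Longrightarrow> c \<in> W \<Longrightarrow> fc F x = scale (F c) x"
proof -
  assume "x \<in> eig c" "c \<in> W"
  then have "fc F x = (\<Sum>w\<in>W. if w = c then scale (F c) x else 0)"
    unfolding fc_def by (intro sum.cong) (auto simp: proj_eig)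
  then show ?thesis using fin \<open>c \<in> W\<close> by simp
qed

lemma fc_ext:
  assumes "\<And>x y. g (x + y) = g x + g y" and "\<And>w x. w \<in> W \<Longrightarrow> x \<in> eig w \<Longrightarrow> g x = scale (F w) x"
  shows "g x = fc F x"
proof -
  have g0: "g 0 = 0" using assms(1)[of 0 0] by simp
  have "g (\<Sum>w\<in>W. proj w x) = (\<Sum>w\<in>W. g (proj w x))"
    using sum_comp_morphism[of g "\<lambda>w. proj w x" W, OF g0 assms(1)] by (simp add: o_def)
  also have "\<dots> = fc F x" unfolding fc_def by (intro sum.cong) (auto simp: assms(2) proj_in)
  finally show ?thesis by (simp only: proj_sum)
qed

lemma fc_comp: "fc F (fc G x) = fc (\<lambda>w. F w * G w) x"
  by (rule fc_ext) (auto simp: fc_add fc_eig fc_scale mult.commute)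

lemma fc_plus: "fc F x + fc G x = fc (\<lambda>w. F w + G w) x"
  and fc_minus: "fc F x - fc G x = fc (\<lambda>w. F w - G w) x"
  by (simp_all add: fc_def sum.distrib[symmetric] sum_subtractf[symmetric] scale_left_distrib scale_left_diff_distrib)

lemma fc_id: "x = fc (\<lambda>w. 1) x" by (rule fc_ext) auto

lemma fc_pow: "(\<alpha> ^^ i) x = fc (\<lambda>w. w ^ i) x"
  by (rule fc_ext) (auto simp: pow_add eig_pow)

lemma fc_alpha: "\<alpha> x = fc (\<lambda>w. w) x"
  using fc_pow[of 1 x] by simp

lemma fc_E: "E x = fc (\<lambda>w. \<Sum>i<n. w ^ i) x"
  by (rule fc_ext) (auto simp: E_add eig_E)

lemma fc_cong: "(\<And>w. w \<in> W \<Longrightarrow> F w = G w) \<Longrightarrow> fc F x = fc G x"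
  by (simp add: fc_def)

lemma fc_zero: "(\<And>w. w \<in> W \<Longrightarrow> F w = 0) \<Longrightarrow> fc F x = 0"
  by (simp add: fc_def)

section \<open>Splitting the cyclic homology along the eigenvalues\<close>

text \<open>All maps of \<open>full_complex\<close> commute with the projections onto the eigenspaces, and the projections preserve the denominators, so
  the complex is the direct sum of the small complexes.\<close>

theorem full_HC_split:
  fixes \<omega> :: "nat \<Rightarrow> 'a"
  assumes inj: "inj_on \<omega> I" and img: "\<omega> ` I = W" and finI: "finite I"
  shows "cyclic_homology full_complex r \<cong>\<^sub>q q_sum I (\<lambda>h. cyclic_homology (small (\<omega> h)) r)"
proof -
  interpret F: presented_mixed full_complex scale by (rule full_presented)
  have S: "presented_mixed (small w) scale" for w by (rule small_presented)
  interpret S: presented_mixed "small (\<omega> h)" scale for h by (rule small_presented)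
  define pr where "pr h z = (\<lambda>j::nat. proj (\<omega> h) (z j))" for h and z :: "nat \<Rightarrow> 'b"
  define f where "f z = (\<lambda>h. if h \<in> I then pr h z else 0)" for z
  have om: "\<omega> h \<in> W" if "h \<in> I" for h using that img by blast
  have psum: "(\<Sum>h\<in>I. proj (\<omega> h) x) = x" for x
    using proj_sum[of x] sum.reindex[OF inj, of "\<lambda>w. proj w x"] by (simp add: img o_def)
  have pr_add: "pr h (x + y) = pr h x + pr h y" and pr_scale: "pr h (F.sct c x) = F.sct c (pr h x)"
    and pr_diff: "pr h (x - y) = pr h x - pr h y" for h x y c
  proof -
    have "proj w (a - b) = proj w a - proj w b" for w a b
      using proj_add[of w "a - b" b] by simp
    then show "pr h (x + y) = pr h x + pr h y" "pr h (F.sct c x) = F.sct c (pr h x)" "pr h (x - y) = pr h x - pr h y"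
      by (auto simp: pr_def F.sct_def proj_add proj_scale)
  qed
  have tot: "tot_diff (small (\<omega> h)) t z = tot_diff full_complex t z" if "\<And>j. z j \<in> eig (\<omega> h)" for h t z
    using that by (auto simp: tot_diff_def small_b small_B)
  have pb: "proj w (mc_b full_complex t x) = mc_b full_complex t (proj w x)"
    and pB: "proj w (mc_B full_complex t x) = mc_B full_complex t (proj w x)" for w t x
  proof -
    have 0: "proj w 0 = 0" for w using proj_add[of w 0 0] by simp
    have d: "proj w (a - b) = proj w a - proj w b" for w a b
      using proj_add[of w "a - b" b] by simp
    have s: "proj w (sum g A) = (\<Sum>i\<in>A. proj w (g i))" for g and A :: "nat set"
      by (induction A rule: infinite_finite_induct) (auto simp: 0 proj_add)
    have p: "proj w ((\<alpha> ^^ i) a) = (\<alpha> ^^ i) (proj w a)" for i a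
      by (induction i) (auto simp: proj_al)
    show "proj w (mc_b full_complex t x) = mc_b full_complex t (proj w x)"
      "proj w (mc_B full_complex t x) = mc_B full_complex t (proj w x)"
      by (auto simp: full_complex_def 0 s p d proj_l proj_al E_def)
  qed
  have pr_tot: "tot_diff full_complex t (pr h z) = pr h (tot_diff full_complex t z)" for t h z
  proof -
    have 0: "proj w 0 = 0" for w using proj_add[of w 0 0] by simp
    show ?thesis by (auto simp: tot_diff_def pr_def pb pB 0 proj_add)
  qed
  have pr_num: "pr h z \<in> qnum (tot_space (small (\<omega> h)) t)" if "z \<in> qnum (tot_space full_complex t)" "h \<in> I" for h z t
    using that om proj_in proj_add[of "\<omega> h" 0 0] by (auto simp: F.tot_num S.tot_num small_num pr_def)
  have pr_den: "pr h z \<in> qden (tot_space (small (\<omega> h)) t)" if "z \<in> qden (tot_space full_complex t)" "h \<in> I" for h z t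
    using that om proj_in proj_add[of "\<omega> h" 0 0] proj_TC
    by (auto simp: F.tot_den S.tot_den small_den full_den pr_def)
  have small_full_num: "z \<in> qnum (tot_space (small (\<omega> h)) t) \<Longrightarrow> z \<in> qnum (tot_space full_complex t)"
    and small_full_den: "z \<in> qden (tot_space (small (\<omega> h)) t) \<Longrightarrow> z \<in> qden (tot_space full_complex t)" for z h t
    by (auto simp: F.tot_num F.tot_den S.tot_num S.tot_den small_den full_den full_num)
  have peig: "pr h z j \<in> eig (\<omega> h)" if "h \<in> I" for h z j
    using om[OF that] proj_in by (simp add: pr_def)
  have neig: "z j \<in> eig (\<omega> h)" if "z \<in> qnum (tot_space (small (\<omega> h)) t)" for z h t j
    using that eig_0 by (cases "2 * j \<le> t") (auto simp: S.tot_num small_num)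
  have sum_num: "(\<Sum>h\<in>J. y h) \<in> qnum (tot_space full_complex t)" if "\<And>h. h \<in> J \<Longrightarrow> y h \<in> qnum (tot_space full_complex t)"
    for y :: "nat \<Rightarrow> nat \<Rightarrow> 'b" and J t
    using that by (induction J rule: infinite_finite_induct) (auto simp: F.tot_num0 F.tot_num_add)
  have sum_den: "(\<Sum>h\<in>J. y h) \<in> qden (tot_space full_complex t)" if "\<And>h. h \<in> J \<Longrightarrow> y h \<in> qden (tot_space full_complex t)"
    for y :: "nat \<Rightarrow> nat \<Rightarrow> 'b" and J t
    using that by (induction J rule: infinite_finite_induct) (auto simp: F.tot_den0 F.tot_den_add)
  have sum_tot: "tot_diff full_complex t (\<Sum>h\<in>J. y h) = (\<Sum>h\<in>J. tot_diff full_complex t (y h))"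
    for y :: "nat \<Rightarrow> nat \<Rightarrow> 'b" and J t
    using sum_comp_morphism[of "tot_diff full_complex t" y J, OF F.tot_diff_zero F.tot_diff_add] by (simp add: o_def)
  have prsum: "(\<Sum>h\<in>I. pr h z) = z" for z
  proof
    have "(\<Sum>h\<in>J. y h) j = (\<Sum>h\<in>J. y h j)" for y :: "nat \<Rightarrow> nat \<Rightarrow> 'b" and J j
      by (induction J rule: infinite_finite_induct) auto
    then show "(\<Sum>h\<in>I. pr h z) j = z j" for j by (simp add: pr_def psum)
  qed
  let ?Q = "q_sum I (\<lambda>h. cyclic_homology (small (\<omega> h)) r)"
  have Qn: "u \<in> qnum ?Q \<longleftrightarrow> (\<forall>h\<in>I. u h \<in> qnum (cyclic_homology (small (\<omega> h)) r)) \<and> (\<forall>h. h \<notin> I \<longrightarrow> u h = 0)"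
    and Qd: "u \<in> qden ?Q \<longleftrightarrow> (\<forall>h\<in>I. u h \<in> qden (cyclic_homology (small (\<omega> h)) r)) \<and> (\<forall>h. h \<notin> I \<longrightarrow> u h = 0)"
    and Qs: "qscale ?Q c u = (\<lambda>h. F.sct c (u h))" for u c
    by (auto simp: q_sum_def S.HC_scale)
  have sctx: "F.sct c z j = scale c (z j)" for c and z :: "nat \<Rightarrow> 'b" and j by (simp add: F.sct_def)
  show ?thesis
  proof (rule q_iso_induced(1)[where f = f])
    fix z assume z: "z \<in> qnum (cyclic_homology full_complex r)"
    show "f z \<in> qnum ?Q"
      using z pr_num pr_den by (auto simp: Qn f_def F.HC_num S.HC_num tot peig pr_tot)
    show "f z \<in> qden ?Q" if zd: "z \<in> qden (cyclic_homology full_complex r)"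
    proof -
      obtain y v where yv: "z = tot_diff full_complex (Suc r) y + v" "y \<in> qnum (tot_space full_complex (Suc r))"
        "v \<in> qden (tot_space full_complex r)" using zd[unfolded F.HC_den] by blast
      have "pr h z \<in> qden (cyclic_homology (small (\<omega> h)) r)" if h: "h \<in> I" for h
        unfolding S.HC_den
        using pr_num[OF yv(2) h] pr_den[OF yv(3) h]
        by (intro exI[of _ "pr h y"] exI[of _ "pr h v"]) (simp add: yv(1) pr_add tot peig h pr_tot)
      then show ?thesis by (auto simp: Qd f_def)
    qed
    show "z \<in> qden (cyclic_homology full_complex r)" if zd: "f z \<in> qden ?Q"
    proof -
      have "\<forall>h\<in>I. \<exists>y v. pr h z = tot_diff (small (\<omega> h)) (Suc r) y + v \<and>
          y \<in> qnum (tot_space (small (\<omega> h)) (Suc r)) \<and> v \<in> qden (tot_space (small (\<omega> h)) r)"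
        using zd by (auto simp: Qd f_def S.HC_den)
      then obtain y v where yv: "\<And>h. h \<in> I \<Longrightarrow> pr h z = tot_diff (small (\<omega> h)) (Suc r) (y h) + v h"
          "\<And>h. h \<in> I \<Longrightarrow> y h \<in> qnum (tot_space (small (\<omega> h)) (Suc r))"
          "\<And>h. h \<in> I \<Longrightarrow> v h \<in> qden (tot_space (small (\<omega> h)) r)" by metis
      have "z = (\<Sum>h\<in>I. pr h z)" by (simp add: prsum)
      also have "\<dots> = (\<Sum>h\<in>I. tot_diff full_complex (Suc r) (y h) + v h)"
      proof (rule sum.cong[OF refl])
        fix h assume h: "h \<in> I"
        show "pr h z = tot_diff full_complex (Suc r) (y h) + v h"
          using yv(1)[OF h] tot[of "y h" h "Suc r", OF neig[OF yv(2)[OF h]]] by simp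
      qed
      also have "\<dots> = tot_diff full_complex (Suc r) (\<Sum>h\<in>I. y h) + (\<Sum>h\<in>I. v h)"
        by (simp add: sum.distrib sum_tot)
      finally show ?thesis
        unfolding F.HC_den
        using sum_num[of I y "Suc r", OF small_full_num[OF yv(2)]] sum_den[of I v r, OF small_full_den[OF yv(3)]]
        by blast
    qed
  next
    fix u assume u: "u \<in> qnum ?Q"
    define z where "z = (\<Sum>h\<in>I. u h)"
    have un: "u h \<in> qnum (tot_space (small (\<omega> h)) r)" if "h \<in> I" for h
      using u that by (simp add: Qn S.HC_num)
    have "z \<in> qnum (cyclic_homology full_complex r)"
      unfolding F.HC_num z_def
    proof (intro conjI)
      show "(\<Sum>h\<in>I. u h) \<in> qnum (tot_space full_complex r)"
        using un small_full_num by (intro sum_num) blast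
      have "tot_diff full_complex r (u h) \<in> qden (tot_space full_complex (r - 1))" if "h \<in> I" "r \<noteq> 0" for h
        using u that small_full_den[of "tot_diff (small (\<omega> h)) r (u h)" h "r - 1"] tot[of "u h" h r] neig[OF un]
        by (auto simp: Qn S.HC_num)
      then show "r = 0 \<or> tot_diff full_complex r (\<Sum>h\<in>I. u h) \<in> qden (tot_space full_complex (r - 1))"
        unfolding sum_tot by (cases "r = 0") (auto intro!: sum_den)
    qed
    moreover have "f z = u"
    proof
      fix h
      show "f z h = u h"
      proof (cases "h \<in> I")
        case True
        have p0: "proj w 0 = 0" for w using proj_add[of w 0 0] by simp
        have "pr h (u g) = (if g = h then u h else 0)" if "g \<in> I" for g
          using neig[OF un[OF that]] proj_eig[OF _ om[OF that] om[OF True]] that True inj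
          by (auto simp: pr_def fun_eq_iff inj_on_def)
        moreover have "pr h (\<Sum>g\<in>J. u g) = (\<Sum>g\<in>J. pr h (u g))" for J
        proof -
          have "pr h 0 = 0" by (simp add: pr_def fun_eq_iff p0)
          from sum_comp_morphism[of "pr h" u J, OF this pr_add] show ?thesis by (simp add: o_def)
        qed
        ultimately have "pr h z = (\<Sum>g\<in>I. if g = h then u h else 0)" by (simp add: z_def)
        then show ?thesis using True finI by (simp add: f_def)
      qed (use u in \<open>simp add: f_def Qn\<close>)
    qed
    ultimately show "\<exists>z\<in>qnum (cyclic_homology full_complex r). u - f z \<in> qden ?Q"
      using S.HC_den0 by (intro bexI[of _ z]) (auto simp: Qd)
  qed (auto simp: sctx F.HC_num_lin[unfolded F.HC_scale] F.HC_den_scale[unfolded F.HC_scale] F.HC_num_diff F.HC_den0 F.HC_den_diff F.HC_den_scale Qn Qd Qs f_def fun_eq_iff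
      pr_add pr_diff pr_scale F.HC_scale S.HC_den0 S.HC_den_diff
      S.HC_num_lin[unfolded S.HC_scale] S.HC_den_scale[unfolded S.HC_scale] intro: S.HC_den_diff)
qed

end

section \<open>Additive extension from generators\<close>

text \<open>Additive, but not necessarily linear, extension: the coefficients are elements of a noncommutative ring, and the
  maps below twist them by powers of \<open>\<alpha>\<close>.\<close>

definition ext :: "('x \<Rightarrow> 'a::zero \<Rightarrow> 'g::comm_monoid_add) \<Rightarrow> ('x \<Rightarrow>\<^sub>0 'a) \<Rightarrow> 'g" where
  "ext \<beta> v = (\<Sum>x\<in>Poly_Mapping.keys v. \<beta> x (Poly_Mapping.lookup v x))"

abbreviation sg :: "'x \<Rightarrow> 'a::zero \<Rightarrow> ('x \<Rightarrow>\<^sub>0 'a)" where "sg \<equiv> Poly_Mapping.single"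
abbreviation lk :: "('x \<Rightarrow>\<^sub>0 'a::zero) \<Rightarrow> 'x \<Rightarrow> 'a" where "lk \<equiv> Poly_Mapping.lookup"
abbreviation ks :: "('x \<Rightarrow>\<^sub>0 'a::zero) \<Rightarrow> 'x set" where "ks \<equiv> Poly_Mapping.keys"

lemmas additiveD = additive.add and additive_0 = additive.zero and additive_neg = additive.minus
  and additive_diff = additive.diff and additive_sum = additive.sum

lemma ext_superset:
  assumes "finite S" "ks v \<subseteq> S" "\<And>x. x \<in> S \<Longrightarrow> \<beta> x 0 = 0"
  shows "ext \<beta> v = (\<Sum>x\<in>S. \<beta> x (lk v x))"
  unfolding ext_def using assms by (intro sum.mono_neutral_left) (auto simp: in_keys_iff)

lemma ext_additive:
  fixes \<beta> :: "'x \<Rightarrow> 'a::ab_group_add \<Rightarrow> 'g::ab_group_add"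
  assumes "\<And>x. additive (\<beta> x)"
  shows "additive (ext \<beta>)"
  proof (rule additive.intro)
  fix u v :: "'x \<Rightarrow>\<^sub>0 'a"
  have 0: "\<beta> x 0 = 0" for x by (rule additive_0[OF assms])
  have "ext \<beta> w = (\<Sum>x\<in>ks u \<union> ks v. \<beta> x (lk w x))" if "ks w \<subseteq> ks u \<union> ks v" for w
    using that by (intro ext_superset) (auto simp: 0)
  from this[of u] this[of v] this[of "u + v"] show "ext \<beta> (u + v) = ext \<beta> u + ext \<beta> v"
    using keys_add[of u v] by (simp add: lookup_add additiveD[OF assms] sum.distrib)
qed

lemma ext_single: "\<beta> x 0 = 0 \<Longrightarrow> ext \<beta> (sg x a) = \<beta> x a"
  by (auto simp: ext_def)

lemma pm_expand: "v = (\<Sum>x\<in>ks v. sg x (lk v x))"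
  by (rule poly_mapping_eqI) (auto simp: lookup_sum lookup_single when_def in_keys_iff)

lemma additive_expand:
  fixes F :: "('x \<Rightarrow>\<^sub>0 'a::ab_group_add) \<Rightarrow> 'g::ab_group_add"
  assumes "additive F"
  shows "F v = (\<Sum>x\<in>ks v. F (sg x (lk v x)))"
  using additive_sum[OF assms, of "\<lambda>x. sg x (lk v x)" "ks v"] pm_expand[of v] by simp

lemma additive_mem:
  fixes F :: "('x \<Rightarrow>\<^sub>0 'a::ab_group_add) \<Rightarrow> 'g::ab_group_add"
  assumes "additive F" and "0 \<in> H" and "\<And>a b. a \<in> H \<Longrightarrow> b \<in> H \<Longrightarrow> a + b \<in> H"
    and "\<And>x. x \<in> ks v \<Longrightarrow> F (sg x (lk v x)) \<in> H"
  shows "F v \<in> H"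
proof -
  have "(\<Sum>x\<in>S. F (sg x (lk v x))) \<in> H" if "S \<subseteq> ks v" for S
    using finite_subset[OF that finite_keys] that
    by (induction S rule: finite_induct) (auto intro: assms)
  then show ?thesis by (subst additive_expand[OF assms(1)]) auto
qed

lemma additive_eq:
  fixes F :: "('x \<Rightarrow>\<^sub>0 'a::ab_group_add) \<Rightarrow> 'g::ab_group_add"
  assumes "additive F" "additive G" "\<And>x. x \<in> ks v \<Longrightarrow> F (sg x (lk v x)) = G (sg x (lk v x))"
  shows "F v = G v"
  by (subst (1 2) additive_expand) (use assms in auto)

lemma keys_sum: "ks (\<Sum>x\<in>S. h x) \<subseteq> (\<Union>x\<in>S. ks (h x))"
proof (induction S rule: infinite_finite_induct)
  case (insert x S)
  then show ?case using keys_add[of "h x" "sum h S"] by auto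
qed auto

lemma keys_ext: "ks (ext \<beta> v) \<subseteq> (\<Union>x\<in>ks v. ks (\<beta> x (lk v x)))"
  unfolding ext_def by (rule keys_sum)

lemma keys_diff: "ks (a - b) \<subseteq> ks a \<union> ks (b :: 'x \<Rightarrow>\<^sub>0 'a::ab_group_add)"
  by (auto simp: in_keys_iff lookup_minus)

lemma keys_neg: "ks (- b) = ks (b :: 'x \<Rightarrow>\<^sub>0 'a::ab_group_add)"
  by (auto simp: in_keys_iff)

lemma additive_comp: "additive f \<Longrightarrow> additive g \<Longrightarrow> additive (\<lambda>x. f (g x))"
  by (simp add: additive_def)

lemma free_extend_ext: "free_extend h = ext (\<lambda>x c. fscale c (h x))"
  by (simp add: fun_eq_iff free_extend_def ext_def)

lemma fs_additive: "additive (\<lambda>c. fscale c v)" and fs_additive': "additive (fscale c)"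
  by (simp_all add: additive_def free_space.scale_left_distrib free_space.scale_right_distrib)

lemma free_extend_additive: "additive (free_extend h)"
  unfolding free_extend_ext by (rule ext_additive[OF fs_additive])

lemmas fe_add = additiveD[OF free_extend_additive]
  and fe_0 = additive_0[OF free_extend_additive] and fe_sum = additive_sum[OF free_extend_additive]

lemma fe_single: "free_extend h (sg x c) = fscale c (h x)"
  unfolding free_extend_ext by (rule ext_single) simp

lemma fe_gen: "free_extend h (gen x) = h x"
  by (simp add: fe_single)

lemma sg_fscale: "sg x c = fscale c (gen x)"
  by (rule poly_mapping_eqI) (simp add: lookup_fscale lookup_single when_def)

lemma fe_scale: "free_extend h (fscale c v) = fscale c (free_extend h v)"
proof (rule additive_eq[where F = "\<lambda>v. free_extend h (fscale c v)" and G = "\<lambda>v. fscale c (free_extend h v)"])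
  fix x assume "x \<in> ks v"
  have "fscale c (sg x (lk v x)) = sg x (c * lk v x)"
    by (rule poly_mapping_eqI) (simp add: lookup_fscale lookup_single when_def)
  then show "free_extend h (fscale c (sg x (lk v x))) = fscale c (free_extend h (sg x (lk v x)))"
    by (simp add: fe_single)
qed (rule additive_comp[OF free_extend_additive fs_additive'] additive_comp[OF fs_additive' free_extend_additive])+

lemma fe_linear: "Vector_Spaces.linear fscale fscale (free_extend h)"
  by (simp add: Vector_Spaces.linear_iff free_space.vector_space_axioms fe_add fe_scale)

section \<open>The identities between \<open>b\<close> and \<open>B\<close>\<close>

lemma sum_periodic_shift:
  fixes f :: "nat \<Rightarrow> 'a::ab_group_add"
  assumes "\<And>i. f (i + m) = f i"
  shows "(\<Sum>i<m. f (i + c)) = (\<Sum>i<m. f i)"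
proof (induction c)
  case (Suc c)
  have "(\<Sum>i<m. f (i + Suc c)) = (\<Sum>i<Suc m. f (i + c)) - f c"
    by (subst sum.lessThan_Suc_shift) simp
  also have "\<dots> = (\<Sum>i<m. f (i + c)) + f (m + c) - f c" by simp
  also have "f (m + c) = f c" using assms[of c] by (simp add: add.commute)
  finally show ?case using Suc by simp
qed simp

lemma sum_periodic_reverse:
  fixes f :: "nat \<Rightarrow> 'a::ab_group_add"
  assumes "\<And>i. f (i + m) = f i"
  shows "(\<Sum>i<m. f (m - i)) = (\<Sum>i<m. f i)"
proof -
  have "(\<Sum>i<m. f (m - i)) = (\<Sum>i<m. f (m - Suc i + 1))"
    by (intro sum.cong) (auto simp: Suc_diff_Suc)
  also have "\<dots> = (\<Sum>i<m. f (i + 1))"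
    by (rule sum.nat_diff_reindex[of "\<lambda>j. f (j + 1)" m])
  also have "\<dots> = (\<Sum>i<m. f i)" by (rule sum_periodic_shift) (rule assms)
  finally show ?thesis .
qed

lemma neg_one_cong: "even (a + b) \<Longrightarrow> (- 1 :: 'a::ring_1) ^ a = (- 1) ^ b"
  by (cases "even a") auto

context
  fixes A :: "('b, 'm) ring_scheme" (structure)
  assumes ringA: "ring A"
begin

interpretation ring A by (rule ringA)

text \<open>The faces of a cyclic tensor are all obtained from the merging of the first two entries by rotation. This puts
  the wrap-around face of \<open>b\<close> on the same footing as the others.\<close>

definition merge_hd :: "'b list \<Rightarrow> 'b list" where
  "merge_hd as = (as ! 0 \<otimes> as ! 1) # drop 2 as"

definition face :: "nat \<Rightarrow> 'b list \<Rightarrow> 'b list" where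
  "face i as = rotate (length as - Suc i) (merge_hd (rotate i as))"

lemma rotate_take_drop: "i \<le> length as \<Longrightarrow> rotate i as = drop i as @ take i as"
  by (cases "i = length as") (auto simp: rotate_drop_take)

lemma face_inner:
  assumes "Suc i < length as"
  shows "face i as = take i as @ (as ! i \<otimes> as ! Suc i) # drop (i + 2) as"
proof -
  have "rotate i as = as ! i # as ! Suc i # drop (i + 2) as @ take i as"
    using assms by (simp add: rotate_take_drop Cons_nth_drop_Suc[symmetric])
  then have "face i as = rotate (length as - Suc i) (((as ! i \<otimes> as ! Suc i) # drop (i + 2) as) @ take i as)"
    by (simp only: face_def merge_hd_def) simp
  also have "length as - Suc i = length ((as ! i \<otimes> as ! Suc i) # drop (i + 2) as)"
    using assms by simp
  finally show ?thesis by (simp only: rotate_append)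
qed

lemma face_wrap:
  assumes "length as = Suc r" "r > 0"
  shows "face r as = (as ! r \<otimes> as ! 0) # take (r - 1) (tl as)"
proof -
  have "rotate r as = as ! r # take r as"
    using assms by (simp add: rotate_take_drop Cons_nth_drop_Suc[symmetric])
  moreover have "take r as ! 0 = as ! 0" "drop 1 (take r as) = take (r - 1) (tl as)"
    using assms by (auto simp: drop_take drop_Suc)
  ultimately show ?thesis using assms by (simp add: face_def merge_hd_def numeral_2_eq_2 take_tl drop_Suc)
qed

lemma length_face: "i < length as \<Longrightarrow> length as \<ge> 2 \<Longrightarrow> length (face i as) = length as - 1"
  by (simp add: face_def merge_hd_def)

lemma hochschild_b_faces:
  assumes "length as = Suc r" "r > 0"
  shows "hochschild_b A r as = (\<Sum>i\<le>r. fscale ((- 1 :: 'k::field) ^ i) (gen (face i as)))"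
proof -
  have "(\<Sum>i\<le>r. fscale ((- 1 :: 'k) ^ i) (gen (face i as))) =
      (\<Sum>i<r. fscale ((- 1) ^ i) (gen (face i as))) + fscale ((- 1) ^ r) (gen (face r as))"
    by (simp add: lessThan_Suc_atMost[symmetric])
  then show ?thesis using assms by (simp add: hochschild_b_def face_inner face_wrap)
qed

lemma connes_B_rotate:
  assumes "length as = Suc r"
  shows "connes_B A r as = (\<Sum>i<Suc r. fscale ((- 1) ^ (i * r)) (gen (\<one> # rotate i as)))"
  using assms by (simp add: connes_B_def lessThan_Suc_atMost[symmetric] rotate_take_drop del: sum.lessThan_Suc)

lemma tuples_face:
  assumes "as \<in> tuples A (Suc r)" "i \<le> Suc r"
  shows "face i as \<in> tuples A r"
proof -
  have l: "length as = Suc (Suc r)" and s: "set as \<subseteq> carrier A" using assms by (auto simp: tuples_def)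
  have "length (rotate i as) = Suc (Suc r)" "set (rotate i as) \<subseteq> carrier A" using l s by auto
  then have "rotate i as ! 0 \<in> carrier A" "rotate i as ! 1 \<in> carrier A"
    by (metis One_nat_def Suc_less_eq nth_mem subsetD zero_less_Suc)+
  then have "set (merge_hd (rotate i as)) \<subseteq> carrier A"
    using s set_drop_subset[of 2 "rotate i as"] by (auto simp: merge_hd_def)
  then show ?thesis using assms l by (auto simp: tuples_def face_def merge_hd_def)
qed

lemma rotate_tuples: "as \<in> tuples A r \<Longrightarrow> rotate i as \<in> tuples A r"
  by (simp add: tuples_def)

text \<open>In terms of rotations the two double sums that make up \<open>bB\<close> and \<open>Bb\<close> run over the same terms, except for
  those where \<open>b\<close> merges the new entry \<open>1\<close> with one of its neighbours; the latter cancel among themselves.\<close>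

lemma bB_Bb:
  assumes as: "as \<in> tuples A r"
  shows "free_extend (hochschild_b A (Suc r)) (connes_B A r as) +
    free_extend (connes_B A (r - 1)) (hochschild_b A r as) = (0 :: 'b list \<Rightarrow>\<^sub>0 'k::field)"
proof -
  have l: "length as = Suc r" and s: "set as \<subseteq> carrier A" using as by (auto simp: tuples_def)
  define G :: "nat \<Rightarrow> 'b list \<Rightarrow>\<^sub>0 'k" where "G k = fscale ((- 1) ^ (k * r)) (gen (rotate k as))" for k
  define H :: "nat \<Rightarrow> nat \<Rightarrow> 'b list \<Rightarrow>\<^sub>0 'k" where
    "H p q = fscale ((- 1) ^ (p * (r - 1) + q * r)) (gen (\<one> # rotate p (merge_hd (rotate q as))))" for p q
  have rper: "rotate (k + length xs) xs = rotate k xs" for k and xs :: "'b list"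
    by (simp add: rotate_conv_mod[of "k + length xs"] rotate_conv_mod[of k xs])
  have sg_per: "(- 1 :: 'k) ^ ((k + Suc r) * r) = (- 1) ^ (k * r)" for k
    by (rule neg_one_cong) (auto simp: algebra_simps)
  have Gper: "G (k + Suc r) = G k" for k
    unfolding G_def sg_per using rper[of k as] l by simp
  have lm: "length (merge_hd (rotate q as)) = r" if "r > 0" for q using l that by (simp add: merge_hd_def)
  have Hp: "H (p + r) q = H p q" for p q
  proof (cases "r = 0")
    case False
    obtain t where "r = Suc t" using False by (cases r) auto
    then have "(- 1 :: 'k) ^ ((p + r) * (r - 1) + q * r) = (- 1) ^ (p * (r - 1) + q * r)"
      by (intro neg_one_cong) (auto simp: algebra_simps)
    then show ?thesis using rper[of p "merge_hd (rotate q as)"] lm False by (simp add: H_def)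
  qed simp
  have Hq: "H p (q + Suc r) = H p q" for p q
  proof -
    have "(- 1 :: 'k) ^ (p * (r - 1) + (q + Suc r) * r) = (- 1) ^ (p * (r - 1) + q * r)"
      by (intro neg_one_cong) (auto simp: algebra_simps)
    then show ?thesis using rper[of q as] l by (simp add: H_def)
  qed
  have b1: "hochschild_b A (Suc r) (\<one> # c) = gen c - (\<Sum>i<r. fscale ((- 1 :: 'k) ^ i) (gen (\<one> # face i c)))
      + fscale ((- 1) ^ Suc r) (gen (rotate r c))" if c: "c \<in> tuples A r" for c
  proof -
    have lc: "length c = Suc r" and sc: "set c \<subseteq> carrier A" using c by (auto simp: tuples_def)
    have c0: "c ! i \<in> carrier A" if "i \<le> r" for i using sc lc that by (metis le_imp_less_Suc nth_mem subsetD)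
    have "hochschild_b A (Suc r) (\<one> # c) = (\<Sum>i<Suc r. fscale ((- 1) ^ i) (gen (face i (\<one> # c))))
        + fscale ((- 1) ^ Suc r) (gen (face (Suc r) (\<one> # c)))"
      using lc by (subst hochschild_b_faces) (simp_all add: lessThan_Suc_atMost[symmetric])
    also have "(\<Sum>i<Suc r. fscale ((- 1) ^ i) (gen (face i (\<one> # c)))) =
        gen c - (\<Sum>i<r. fscale ((- 1 :: 'k) ^ i) (gen (\<one> # face i c)))"
    proof -
      have "face 0 (\<one> # c) = c"
        using lc c0[of 0] Cons_nth_drop_Suc[of 0 c] by (subst face_inner) auto
      moreover have "face (Suc i) (\<one> # c) = \<one> # face i c" if "i < r" for i
        using lc that by (subst (1 2) face_inner) auto
      ultimately show ?thesis
        by (simp add: sum.lessThan_Suc_shift free_space.scale_minus_left sum_negf del: sum.lessThan_Suc)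
    qed
    also have "face (Suc r) (\<one> # c) = rotate r c"
      using lc c0[of r] by (subst face_wrap) (auto simp: rotate_take_drop Cons_nth_drop_Suc[symmetric])
    finally show ?thesis by simp
  qed
  have "free_extend (hochschild_b A (Suc r)) (connes_B A r as) =
      (\<Sum>k<Suc r. fscale ((- 1) ^ (k * r)) (hochschild_b A (Suc r) (\<one> # rotate k as)))"
    by (simp add: connes_B_rotate[OF l] fe_sum fe_scale fe_gen del: sum.lessThan_Suc)
  also have "\<dots> = (\<Sum>k<Suc r. G k - (\<Sum>i<r. H (r - i) (i + k)) - G (k + r))"
  proof (rule sum.cong[OF refl])
    fix k
    have 1: "fscale ((- 1) ^ (k * r)) (fscale ((- 1) ^ i) (gen (\<one> # face i (rotate k as)))) = H (r - i) (i + k)"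
      if "i < r" for i
    proof -
      have "even ((r - i) * (r - 1) + (i + k) * r + (k * r + i))"
      proof -
        obtain d where d: "r = i + Suc d" using less_imp_Suc_add[OF \<open>i < r\<close>] by auto
        show ?thesis unfolding d by (auto simp: algebra_simps)
      qed
      then have "(- 1 :: 'k) ^ (k * r) * (- 1) ^ i = (- 1) ^ ((r - i) * (r - 1) + (i + k) * r)"
        unfolding power_add[symmetric] by (intro neg_one_cong) (simp add: add.commute)
      then show ?thesis using l that by (simp add: H_def face_def rotate_rotate)
    qed
    have 2: "fscale ((- 1) ^ (k * r)) (fscale ((- 1) ^ Suc r) (gen (rotate r (rotate k as)))) = - G (k + r)"
    proof -
      have "(- 1 :: 'k) ^ (k * r) * (- 1) ^ r = (- 1) ^ ((k + r) * r)"
        unfolding power_add[symmetric] by (intro neg_one_cong) (auto simp: algebra_simps)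
      then show ?thesis
        by (simp add: G_def rotate_rotate add.commute free_space.scale_minus_left)
    qed
    show "fscale ((- 1) ^ (k * r)) (hochschild_b A (Suc r) (\<one> # rotate k as)) =
        G k - (\<Sum>i<r. H (r - i) (i + k)) - G (k + r)"
      unfolding b1[OF rotate_tuples[OF as]]
      by (simp only: free_space.scale_right_distrib free_space.scale_right_diff_distrib free_space.scale_sum_right 2)
        (simp add: G_def 1[unfolded free_space.scale_scale])
  qed
  also have "\<dots> = - (\<Sum>i<r. \<Sum>k<Suc r. H (r - i) (k + i))"
    using sum_periodic_shift[of G "Suc r" r, OF Gper]
    by (simp add: sum_subtractf add.commute sum.swap[of _ "{..<r}"] del: sum.lessThan_Suc)
  also have "\<dots> = - (\<Sum>q<Suc r. \<Sum>p<r. H p q)"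
  proof -
    have "(\<Sum>k<Suc r. H p (k + i)) = (\<Sum>q<Suc r. H p q)" for p i
      by (rule sum_periodic_shift) (rule Hq)
    moreover have "(\<Sum>i<r. H (r - i) q) = (\<Sum>p<r. H p q)" for q
      by (rule sum_periodic_reverse) (rule Hp)
    ultimately have "(\<Sum>q<Suc r. \<Sum>i<r. H (r - i) q) = (\<Sum>q<Suc r. \<Sum>p<r. H p q)"
      and "(\<Sum>i<r. \<Sum>k<Suc r. H (r - i) (k + i)) = (\<Sum>i<r. \<Sum>q<Suc r. H (r - i) q)" by simp_all
    moreover have "(\<Sum>i<r. \<Sum>q<Suc r. H (r - i) q) = (\<Sum>q<Suc r. \<Sum>i<r. H (r - i) q)"
      by (rule sum.swap)
    ultimately show ?thesis by (simp only:)
  qed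
  also have "(\<Sum>q<Suc r. \<Sum>p<r. H p q) = free_extend (connes_B A (r - 1)) (hochschild_b A r as)"
  proof (cases "r = 0")
    case False
    then obtain t where t: "r = Suc t" by (cases r) auto
    have "free_extend (connes_B A (r - 1)) (hochschild_b A r as) =
        (\<Sum>i<Suc r. fscale ((- 1) ^ i) (connes_B A (r - 1) (face i as)))"
      using False l by (simp add: hochschild_b_faces fe_sum fe_scale fe_gen lessThan_Suc_atMost[symmetric]
          del: sum.lessThan_Suc)
    also have "\<dots> = (\<Sum>i<Suc r. \<Sum>k<r. H (k + (r - i)) i)"
    proof (rule sum.cong[OF refl])
      fix i assume "i \<in> {..<Suc r}"
      then have i: "i \<le> r" by simp
      have "length (face i as) = Suc t" using i l t by (simp add: length_face)
      then have "fscale ((- 1 :: 'k) ^ i) (connes_B A (r - 1) (face i as)) =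
          (\<Sum>k<r. fscale ((- 1) ^ i * (- 1) ^ (k * t)) (gen (\<one> # rotate k (face i as))))"
        using t by (simp add: connes_B_rotate free_space.scale_sum_right del: sum.lessThan_Suc)
      also have "\<dots> = (\<Sum>k<r. H (k + (r - i)) i)"
      proof (rule sum.cong[OF refl])
        fix k
        have "even ((k + (r - i)) * (r - 1) + i * r + (i + k * t))"
        proof -
          obtain d where d: "r = i + d" using i le_Suc_ex by blast
          show ?thesis
          proof (cases i)
            case 0
            then show ?thesis using t d by auto
          next
            case (Suc j)
            then show ?thesis using t d by (auto simp: algebra_simps)
          qed
        qed
        then have "(- 1 :: 'k) ^ i * (- 1) ^ (k * t) = (- 1) ^ ((k + (r - i)) * (r - 1) + i * r)"
          unfolding power_add[symmetric] by (intro neg_one_cong) (simp add: add.commute)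
        then show "fscale ((- 1 :: 'k) ^ i * (- 1) ^ (k * t)) (gen (\<one> # rotate k (face i as))) = H (k + (r - i)) i"
          using l by (simp add: H_def face_def rotate_rotate)
      qed
      finally show "fscale ((- 1 :: 'k) ^ i) (connes_B A (r - 1) (face i as)) = (\<Sum>k<r. H (k + (r - i)) i)" .
    qed
    also have "\<dots> = (\<Sum>i<Suc r. \<Sum>p<r. H p i)"
      by (intro sum.cong refl sum_periodic_shift) (rule Hp)
    finally show ?thesis by simp
  next
    case True
    then show ?thesis by (simp add: hochschild_b_def fe_0)
  qed
  finally show ?thesis by simp
qed

lemma nth_face:
  assumes "length as = Suc r" "r > 0" "i \<le> r" "k < r"
  shows "face i as ! k = (if i = r then (if k = 0 then as ! r \<otimes> as ! 0 else as ! k)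
    else if k < i then as ! k else if k = i then as ! i \<otimes> as ! Suc i else as ! Suc k)"
proof (cases "i = r")
  case True
  show ?thesis unfolding True face_wrap[OF assms(1,2)] using assms by (cases k) (auto simp: nth_tl)
next
  case False
  then have "Suc i < length as" using assms by simp
  from face_inner[OF this] show ?thesis using assms False
    by (auto simp: nth_append nth_Cons' min_def)
qed

lemma face_face:
  assumes as: "as \<in> tuples A (Suc r)" and "r > 0" "j < i" "i \<le> Suc r"
  shows "face j (face i as) = face (i - 1) (face j as)"
proof (rule nth_equalityI)
  have l: "length as = Suc (Suc r)" and s: "set as \<subseteq> carrier A" using as by (auto simp: tuples_def)
  have l1: "length (face i' as) = Suc r" if "i' \<le> Suc r" for i' using that l by (simp add: length_face)
  have l2: "length (face j' (face i' as)) = r" if "i' \<le> Suc r" "j' \<le> r" for i' j'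
    using that l1 assms(2) by (simp add: length_face)
  show "length (face j (face i as)) = length (face (i - 1) (face j as))" using assms l2 by simp
  fix k assume "k < length (face j (face i as))"
  then have k: "k < r" using assms l2 by simp
  have c: "as ! p \<in> carrier A" if "p \<le> Suc r" for p using s l that by (metis le_imp_less_Suc nth_mem subsetD)
  show "face j (face i as) ! k = face (i - 1) (face j as) ! k"
    using assms k c
    by (auto simp: nth_face[OF l1] nth_face[OF l] m_assoc)
qed

lemma b_b:
  assumes as: "as \<in> tuples A (Suc r)"
  shows "free_extend (hochschild_b A r) (hochschild_b A (Suc r) as) = (0 :: 'b list \<Rightarrow>\<^sub>0 'k::field)"
proof (cases "r = 0")
  case True
  have "hochschild_b A 0 = (\<lambda>_. 0 :: 'b list \<Rightarrow>\<^sub>0 'k)" by (simp add: hochschild_b_def fun_eq_iff)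
  then show ?thesis using True by (simp add: free_extend_def)
next
  case False
  have l: "length as = Suc (Suc r)" using as by (simp add: tuples_def)
  have lf: "length (face i as) = Suc r" if "i \<le> Suc r" for i using that l by (simp add: length_face)
  define g where "g j i = fscale ((- 1 :: 'k) ^ (i + j)) (gen (face j (face i as)))" for i j
  have "free_extend (hochschild_b A r) (hochschild_b A (Suc r) as) = (\<Sum>i\<le>Suc r. \<Sum>j\<le>r. g j i)"
    using False l lf
    by (simp add: hochschild_b_faces fe_sum fe_scale fe_gen g_def power_add free_space.scale_sum_right
        del: sum.atMost_Suc)
  also have "\<dots> = (\<Sum>(i, j)\<in>{..Suc r} \<times> {..r}. g j i)" by (rule sum.cartesian_product)
  also have "\<dots> = (\<Sum>(i, j)\<in>{(i, j). j < i \<and> i \<le> Suc r}. g j i) + (\<Sum>(i, j)\<in>{(i, j). i \<le> j \<and> j \<le> r}. g j i)"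
  proof (subst sum.union_disjoint[symmetric])
    show "finite {(i, j). j < i \<and> i \<le> Suc r}" "finite {(i, j). i \<le> j \<and> j \<le> r}"
      by (rule finite_subset[of _ "{..Suc r} \<times> {..Suc r}"]; auto)+
  qed (auto intro!: sum.cong)
  also have "(\<Sum>(i, j)\<in>{(i, j). j < i \<and> i \<le> Suc r}. g j i) = (\<Sum>(i, j)\<in>{(i, j). i \<le> j \<and> j \<le> r}. - g j i)"
  proof (rule sum.reindex_bij_witness[where i = "\<lambda>(i, j). (Suc j, i)" and j = "\<lambda>(i, j). (j, i - 1)"])
    fix a assume "a \<in> {(i, j). j < i \<and> i \<le> Suc r}"
    then obtain i j where a: "a = (i, j)" "j < i" "i \<le> Suc r" by auto
    then obtain t where t: "i = Suc t" by (cases i) auto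
    show "(case case a of (i, j) \<Rightarrow> (j, i - 1) of (i, j) \<Rightarrow> - g j i) = (case a of (i, j) \<Rightarrow> g j i)"
      using a t face_face[OF as _ a(2,3)] False
      by (simp add: g_def add.commute free_space.scale_minus_left)
  qed auto
  also have "\<dots> = - (\<Sum>(i, j)\<in>{(i, j). i \<le> j \<and> j \<le> r}. g j i)"
    unfolding sum_negf[symmetric] by (rule sum.cong) auto
  finally show ?thesis by simp
qed

end

section \<open>The monogenic extension defined by \<open>x\<^sup>n + l\<close>\<close>

context twisted_algebra
begin

abbreviation om :: "'a poly \<Rightarrow> 'a poly \<Rightarrow> 'a poly" where "om \<equiv> ore_mult \<alpha>"

lemma coeff_om: "coeff (om p q) k = (\<Sum>i\<le>k. coeff p i * (\<alpha> ^^ i) (coeff q (k - i)))"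
  by (rule coeff_ore_mult[OF endo])

lemma om_add_left: "om (p + q) r = om p r + om q r" and om_add_right: "om r (p + q) = om r p + om r q"
  by (simp_all add: poly_eq_iff coeff_om distrib_right distrib_left pow_add sum.distrib)

lemma om_additive: "additive (\<lambda>p. om p q)" "additive (om p)"
  by (simp_all add: additive_def om_add_left om_add_right)

lemma om_monom: "om (monom a i) (monom b j) = monom (a * (\<alpha> ^^ i) b) (i + j)"
proof (rule poly_eqI)
  fix k
  have "coeff (om (monom a i) (monom b j)) k =
      (\<Sum>m\<le>k. if m = i then (if k = i + j then a * (\<alpha> ^^ i) b else 0) else 0)"
    unfolding coeff_om by (rule sum.cong) (auto simp: pow_0)
  then show "coeff (om (monom a i) (monom b j)) k = coeff (monom (a * (\<alpha> ^^ i) b) (i + j)) k"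
    by auto
qed

lemma om_assoc: "om (om p q) r = om p (om q r)"
proof -
  interpret ring "ore_ring \<alpha>" by (rule ring_ore_ring[OF endo])
  show ?thesis using m_assoc[of p q r] by (simp add: ore_ring_def)
qed

lemma poly_monoms: "p = (\<Sum>i\<le>degree p. monom (coeff p i) i)"
  by (rule poly_as_sum_of_monoms[symmetric])

lemma additive_poly_mem:
  fixes F :: "'a poly \<Rightarrow> 'g::ab_group_add"
  assumes "additive F" "0 \<in> H" "\<And>a b. a \<in> H \<Longrightarrow> b \<in> H \<Longrightarrow> a + b \<in> H" "\<And>c m. F (monom c m) \<in> H"
  shows "F p \<in> H"
proof -
  have "(\<Sum>i\<le>N. F (monom (coeff p i) i)) \<in> H" for N
    by (induction N) (auto intro: assms)
  moreover have "F p = (\<Sum>i\<le>degree p. F (monom (coeff p i) i))"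
    using additive_sum[OF assms(1), of "\<lambda>i. monom (coeff p i) i" "{..degree p}"] poly_monoms[of p] by simp
  ultimately show ?thesis by simp
qed

text \<open>Under the hypothesis on the central element all inner coefficients of the defining polynomial vanish, and it has this form.\<close>

definition fpol :: "'a poly" where "fpol = monom 1 n + monom l 0"

definition J :: "'a poly set" where "J = range (\<lambda>p. om p fpol)"

lemma J_0: "0 \<in> J" and J_add: "p \<in> J \<Longrightarrow> q \<in> J \<Longrightarrow> p + q \<in> J" and J_neg: "p \<in> J \<Longrightarrow> - p \<in> J"
  and J_left: "p \<in> J \<Longrightarrow> om q p \<in> J"
  using additive_0[OF om_additive(1)[of fpol]] additive_neg[OF om_additive(1)[of fpol]]
  by (auto simp: J_def om_add_left[symmetric] om_assoc[symmetric] intro: range_eqI[of _ _ 0])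
    (metis rangeI)+

lemma J_diff: "p \<in> J \<Longrightarrow> q \<in> J \<Longrightarrow> p - q \<in> J"
  using J_add[of p "- q"] J_neg[of q] by simp

lemma monom_fpol: "om (monom c m) fpol = monom c (m + n) + monom (c * l) m"
  by (simp add: fpol_def om_add_right om_monom pow_1 pow_l)

text \<open>Since \<open>\<alpha>\<^sup>n(b) (x\<^sup>n + l) = (x\<^sup>n + l) b\<close>, right multiples of the polynomial are left multiples.\<close>

lemma fpol_normal: "om fpol q \<in> J"
proof (rule additive_poly_mem[OF om_additive(2) J_0 J_add])
  fix b j
  have "om fpol (monom b j) = om (monom ((\<alpha> ^^ n) b) j) fpol"
    by (simp add: monom_fpol) (simp add: fpol_def om_add_left om_monom l_comm add.commute)
  then show "om fpol (monom b j) \<in> J" by (simp add: J_def)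
qed

lemma J_right: "p \<in> J \<Longrightarrow> om p q \<in> J"
  using fpol_normal[of q] J_left by (auto simp: J_def om_assoc)

lemma J_ideal: "ideal J (ore_ring \<alpha>)"
proof (rule idealI[OF ring_ore_ring[OF endo]])
  interpret ring "ore_ring \<alpha>" by (rule ring_ore_ring[OF endo])
  show "subgroup J (add_monoid (ore_ring \<alpha>))"
  proof (rule group.subgroupI)
    show "group (add_monoid (ore_ring \<alpha>))" using add.group_axioms .
    show "inv\<^bsub>add_monoid (ore_ring \<alpha>)\<^esub> p \<in> J" if "p \<in> J" for p
    proof -
      have "inv\<^bsub>add_monoid (ore_ring \<alpha>)\<^esub> p = - p"
        by (rule group.inv_equality[OF add.group_axioms]) (auto simp: ore_ring_def)
      then show ?thesis using J_neg that by simp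
    qed
  qed (use J_0 J_add in \<open>auto simp: ore_ring_def\<close>)
qed (auto simp: ore_ring_def J_left J_right)

lemma genideal_fpol: "genideal (ore_ring \<alpha>) {fpol} = J"
proof
  interpret ring "ore_ring \<alpha>" by (rule ring_ore_ring[OF endo])
  have "fpol = om (monom 1 0) fpol" by (simp add: monom_fpol) (simp add: fpol_def)
  then have "fpol \<in> J" unfolding J_def by blast
  then show "genideal (ore_ring \<alpha>) {fpol} \<subseteq> J" by (intro genideal_minimal J_ideal) simp
  have c: "{fpol} \<subseteq> carrier (ore_ring \<alpha>)" by (simp add: ore_ring_def)
  interpret G: ideal "genideal (ore_ring \<alpha>) {fpol}" "ore_ring \<alpha>" by (rule genideal_ideal[OF c])
  have "om p fpol \<in> genideal (ore_ring \<alpha>) {fpol}" for p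
    using G.I_l_closed[of fpol p] genideal_self[OF c] by (simp add: ore_ring_def)
  then show "J \<subseteq> genideal (ore_ring \<alpha>) {fpol}" by (auto simp: J_def)
qed

text \<open>The remainder of a polynomial modulo \<open>x\<^sup>n = -l\<close>.\<close>

definition red :: "'a poly \<Rightarrow> nat \<Rightarrow> 'a" where
  "red p i = (\<Sum>m\<le>degree p. if m mod n = i then coeff p m * (- l) ^ (m div n) else 0)"

lemma red_bound: "degree p \<le> N \<Longrightarrow> red p i = (\<Sum>m\<le>N. if m mod n = i then coeff p m * (- l) ^ (m div n) else 0)"
  unfolding red_def by (rule sum.mono_neutral_left) (auto simp: coeff_eq_0)

lemma red_additive: "additive (\<lambda>p. red p i)"
proof (rule additive.intro)
  fix p q :: "'a poly"
  let ?N = "max (degree p) (degree q)"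
  have "red (p + q) i = (\<Sum>m\<le>?N. if m mod n = i then coeff (p + q) m * (- l) ^ (m div n) else 0)"
    by (rule red_bound) (rule degree_add_le_max)
  then show "red (p + q) i = red p i + red q i"
    by (simp add: red_bound[of p ?N] red_bound[of q ?N] sum.distrib[symmetric] distrib_right)
      (auto intro!: sum.cong simp: distrib_right)
qed

lemma red_monom: "red (monom c m) i = (if m mod n = i then c * (- l) ^ (m div n) else 0)"
proof -
  have "red (monom c m) i = (\<Sum>k\<le>m. if k = m then (if m mod n = i then c * (- l) ^ (m div n) else 0) else 0)"
    unfolding red_bound[OF degree_monom_le] by (rule sum.cong) auto
  then show ?thesis by simp
qed

lemma n_pos: "n > 0" using n2 by simp

lemma red_J: "p \<in> J \<Longrightarrow> red p i = 0"
proof -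
  have "red (om p fpol) i \<in> {0}" for p
  proof (rule additive_poly_mem[where F = "\<lambda>p. red (om p fpol) i"])
    show "additive (\<lambda>p. red (om p fpol) i)"
      by (simp add: additive_def om_add_left additiveD[OF red_additive])
    fix c m
    have "(m + n) mod n = m mod n" "(m + n) div n = Suc (m div n)" using n_pos by auto
    then show "red (om (monom c m) fpol) i \<in> {0}"
      by (simp add: monom_fpol additiveD[OF red_additive] red_monom mult.assoc)
  qed auto
  then show "p \<in> J \<Longrightarrow> red p i = 0" by (auto simp: J_def)
qed

lemma red_rep: "p - (\<Sum>i<n. monom (red p i) i) \<in> J"
proof (rule additive_poly_mem[where F = "\<lambda>p. p - (\<Sum>i<n. monom (red p i) i)", OF _ J_0 J_add])
  show "additive (\<lambda>p. p - (\<Sum>i<n. monom (red p i) i))"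
    by (simp add: additive_def additiveD[OF red_additive] add_monom[symmetric] sum.distrib)
  fix c m
  have *: "monom c (d * n + i) - monom (c * (- l) ^ d) i \<in> J" for d i c
  proof (induction d arbitrary: c)
    case (Suc d)
    have "om (monom c (d * n + i)) fpol \<in> J" by (simp add: J_def)
    from J_add[OF this Suc[of "- (c * l)"]] show ?case
      by (simp add: monom_fpol minus_monom[symmetric] mult.assoc add.commute add.left_commute)
  qed (simp add: J_0)
  have "(\<Sum>i<n. monom (red (monom c m) i) i) = (\<Sum>i<n. if i = m mod n then monom (c * (- l) ^ (m div n)) (m mod n) else 0)"
    by (intro sum.cong) (auto simp: red_monom)
  also have "\<dots> = monom (c * (- l) ^ (m div n)) (m mod n)" using n_pos by simp
  finally show "monom c m - (\<Sum>i<n. monom (red (monom c m) i) i) \<in> J"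
    using *[of c "m div n" "m mod n"] by simp
qed

definition A :: "'a poly set ring" where "A = ore_ring \<alpha> Quot J"

definition cl :: "'a poly \<Rightarrow> 'a poly set" where "cl p = J +>\<^bsub>ore_ring \<alpha>\<^esub> p"

abbreviation io :: "'a \<Rightarrow> 'a poly set" where "io x \<equiv> cl [:x:]"

lemma A_ring: "ring A"
  unfolding A_def by (rule ideal.quotient_is_ring[OF J_ideal])

lemma cl_hom: "cl \<in> ring_hom (ore_ring \<alpha>) A"
  using ideal.rcos_ring_hom[OF J_ideal] unfolding A_def cl_def[abs_def] .

lemma A_carrier: "carrier A = range cl"
  by (auto simp: A_def FactRing_def A_RCOSETS_def' cl_def ore_ring_def)

lemma cl_in [simp]: "cl p \<in> carrier A" by (simp add: A_carrier)

lemma cl_add: "cl p \<oplus>\<^bsub>A\<^esub> cl q = cl (p + q)" and cl_mult: "cl p \<otimes>\<^bsub>A\<^esub> cl q = cl (om p q)"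
  and cl_one: "\<one>\<^bsub>A\<^esub> = io 1"
  using ring_hom_add[OF cl_hom, of p q] ring_hom_mult[OF cl_hom, of p q] ring_hom_one[OF cl_hom]
  by (simp_all add: ore_ring_def)

lemma cl_eq: "cl p = cl q \<longleftrightarrow> p - q \<in> J"
proof -
  have cs: "cl p = {j + p | j. j \<in> J}" for p
    by (auto simp: cl_def a_r_coset_def' ore_ring_def)
  show ?thesis
  proof
    assume "cl p = cl q"
    moreover have "p \<in> cl p" using J_0 by (force simp: cs)
    ultimately obtain j where "j \<in> J" "p = j + q" by (auto simp: cs)
    then show "p - q \<in> J" by simp
  next
    assume d: "p - q \<in> J"
    have "j + p = (j + (p - q)) + q" "j + q = (j - (p - q)) + p" for j by simp_all
    then show "cl p = cl q" unfolding cs using J_add[OF _ d] J_diff[OF _ d] by blast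
  qed
qed

lemma cl_eq_red: "(\<And>i. i < n \<Longrightarrow> red p i = red q i) \<Longrightarrow> cl p = cl q"
  using red_rep[of p] red_rep[of q] J_diff[of "p - (\<Sum>i<n. monom (red p i) i)" "q - (\<Sum>i<n. monom (red q i) i)"]
  by (simp add: cl_eq)

text \<open>The coordinates of an element of the quotient with respect to the left basis \<open>1, x, \<dots>, x\<^bsup>n-1\<^esup>\<close> over \<open>K\<close>.\<close>

definition cf :: "'a poly set \<Rightarrow> nat \<Rightarrow> 'a" where "cf a = red (SOME p. a = cl p)"

lemma cf_cl: "cf (cl p) i = red p i"
proof -
  have "cl p = cl (SOME q. cl p = cl q)" by (rule someI[of "\<lambda>q. cl p = cl q" p]) simp
  then have "p - (SOME q. cl p = cl q) \<in> J" by (simp add: cl_eq)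
  from red_J[OF this, of i] show ?thesis by (simp add: cf_def additive_diff[OF red_additive])
qed

lemma A_expand: "a \<in> carrier A \<Longrightarrow> a = cl (\<Sum>i<n. monom (cf a i) i)"
proof -
  assume "a \<in> carrier A"
  then obtain p where a: "a = cl p" by (auto simp: A_carrier)
  show ?thesis unfolding a cf_cl cl_eq by (rule red_rep)
qed

lemma A_eqI: "a \<in> carrier A \<Longrightarrow> b \<in> carrier A \<Longrightarrow> (\<And>i. i < n \<Longrightarrow> cf a i = cf b i) \<Longrightarrow> a = b"
  by (auto simp: A_carrier cf_cl intro!: cl_eq_red)

lemma cf_add: "a \<in> carrier A \<Longrightarrow> b \<in> carrier A \<Longrightarrow> cf (a \<oplus>\<^bsub>A\<^esub> b) i = cf a i + cf b i"
  by (auto simp: A_carrier cf_cl cl_add additiveD[OF red_additive])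

lemma cf_monom: "i < n \<Longrightarrow> cf (cl (monom c i)) j = (if i = j then c else 0)"
  by (simp add: cf_cl red_monom)

lemma cf_io: "cf (io x) i = (if i = 0 then x else 0)"
  using cf_monom[of 0 x i] n_pos by (auto simp: monom_0)

lemma io_expand_l: "a \<in> carrier A \<Longrightarrow> i < n \<Longrightarrow> cf (io x \<otimes>\<^bsub>A\<^esub> a) i = x * cf a i"
proof -
  assume "a \<in> carrier A" "i < n"
  then obtain p where a: "a = cl p" by (auto simp: A_carrier)
  have "red (om [:x:] p) i - x * red p i \<in> {0}"
  proof (rule additive_poly_mem[where F = "\<lambda>p. red (om [:x:] p) i - x * red p i"])
    show "additive (\<lambda>p. red (om [:x:] p) i - x * red p i)"
      by (simp add: additive_def om_add_right additiveD[OF red_additive] distrib_left)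
    fix c m show "red (om [:x:] (monom c m)) i - x * red (monom c m) i \<in> {0}"
      by (simp add: monom_0[symmetric] om_monom red_monom mult.assoc)
  qed auto
  then show ?thesis by (simp add: a cl_mult cf_cl)
qed

lemma l_pow_comm: "(- l) ^ d * x = (\<alpha> ^^ (d * n)) x * (- l) ^ d"
proof (induction d arbitrary: x)
  case (Suc d)
  have "(- l) ^ Suc d * x = (- l) ^ d * (- l * x)" by (simp only: power_Suc2 mult.assoc)
  also have "- l * x = (\<alpha> ^^ n) x * (- l)" by (simp add: l_comm)
  also have "(- l) ^ d * ((\<alpha> ^^ n) x * (- l)) = ((- l) ^ d * (\<alpha> ^^ n) x) * (- l)" by (simp add: mult.assoc)
  also have "\<dots> = (\<alpha> ^^ (Suc d * n)) x * (- l) ^ Suc d"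
    by (simp add: Suc pow_pow pow_l mult.assoc power_commutes add.commute)
  finally show ?case .
qed simp

lemma io_expand_r: "a \<in> carrier A \<Longrightarrow> i < n \<Longrightarrow> cf (a \<otimes>\<^bsub>A\<^esub> io x) i = cf a i * (\<alpha> ^^ i) x"
proof -
  assume "a \<in> carrier A" "i < n"
  then obtain p where a: "a = cl p" by (auto simp: A_carrier)
  have "red (om p [:x:]) i - red p i * (\<alpha> ^^ i) x \<in> {0}"
  proof (rule additive_poly_mem[where F = "\<lambda>p. red (om p [:x:]) i - red p i * (\<alpha> ^^ i) x"])
    show "additive (\<lambda>p. red (om p [:x:]) i - red p i * (\<alpha> ^^ i) x)"
      by (simp add: additive_def om_add_left additiveD[OF red_additive] distrib_right)
    fix c m
    have "c * (\<alpha> ^^ m) x * (- l) ^ (m div n) = c * (- l) ^ (m div n) * (\<alpha> ^^ (m mod n)) x"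
      by (simp add: mult.assoc l_pow_comm pow_pow)
    then show "red (om (monom c m) [:x:]) i - red (monom c m) i * (\<alpha> ^^ i) x \<in> {0}"
      by (simp add: monom_0[symmetric] om_monom red_monom)
  qed auto
  then show ?thesis by (simp add: a cl_mult cf_cl)
qed

lemma cf_mult:
  assumes "a \<in> carrier A" "b \<in> carrier A" "k < n"
  shows "cf (a \<otimes>\<^bsub>A\<^esub> b) k = (\<Sum>i<n. \<Sum>j<n. if i + j = k then cf a i * (\<alpha> ^^ i) (cf b j)
      else if i + j = k + n then - (cf a i * (\<alpha> ^^ i) (cf b j) * l) else 0)"
proof -
  have "a \<otimes>\<^bsub>A\<^esub> b = cl (om (\<Sum>i<n. monom (cf a i) i) (\<Sum>j<n. monom (cf b j) j))"
    by (subst A_expand[OF assms(1)], subst A_expand[OF assms(2)]) (rule cl_mult)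
  also have "om (\<Sum>i<n. monom (cf a i) i) (\<Sum>j<n. monom (cf b j) j) =
      (\<Sum>i<n. \<Sum>j<n. monom (cf a i * (\<alpha> ^^ i) (cf b j)) (i + j))"
    by (simp add: additive_sum[OF om_additive(1)] additive_sum[OF om_additive(2)] om_monom) (rule sum.swap)
  finally have "cf (a \<otimes>\<^bsub>A\<^esub> b) k = (\<Sum>i<n. \<Sum>j<n. red (monom (cf a i * (\<alpha> ^^ i) (cf b j)) (i + j)) k)"
    by (simp add: cf_cl additive_sum[OF red_additive])
  also have "\<dots> = (\<Sum>i<n. \<Sum>j<n. if i + j = k then cf a i * (\<alpha> ^^ i) (cf b j)
      else if i + j = k + n then - (cf a i * (\<alpha> ^^ i) (cf b j) * l) else 0)"
  proof (intro sum.cong refl)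
    fix i j assume "i \<in> {..<n}" "j \<in> {..<n}"
    then have ij: "i < n" "j < n" by auto
    show "red (monom (cf a i * (\<alpha> ^^ i) (cf b j)) (i + j)) k = (if i + j = k then cf a i * (\<alpha> ^^ i) (cf b j)
      else if i + j = k + n then - (cf a i * (\<alpha> ^^ i) (cf b j) * l) else 0)"
    proof (cases "i + j < n")
      case True
      then show ?thesis using assms(3) by (auto simp: red_monom)
    next
      case False
      define d where "d = i + j - n"
      have d: "i + j = d + n" "d < n" using False ij by (auto simp: d_def)
      then have "(i + j) mod n = d" "(i + j) div n = 1" by auto
      then show ?thesis using d assms(3) by (auto simp: red_monom)
    qed
  qed
  finally show ?thesis .
qed

end

section \<open>Normal forms of cyclic tensors\<close>

context twisted_algebra
begin

text \<open>A chain in normal form is a combination of words \<open>[i\<^sub>0, \<dots>, i\<^sub>r]\<close>, with coefficients \<open>\<mu>\<close> in \<open>K\<close>, standing for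
  \<open>\<mu> x\<^bsup>i\<^sub>0\<^esup> \<otimes> x\<^bsup>i\<^sub>1\<^esup> \<otimes> \<dots> \<otimes> x\<^bsup>i\<^sub>r\<^esup>\<close>. The following functions act on all coefficients by \<open>g\<close>, respectively prefix an
  entry to all words.\<close>

definition cm :: "('a \<Rightarrow> 'a) \<Rightarrow> ('x \<Rightarrow>\<^sub>0 'a) \<Rightarrow> ('x \<Rightarrow>\<^sub>0 'a)" where
  "cm g = ext (\<lambda>t \<mu>. sg t (g \<mu>))"

definition pre :: "nat \<Rightarrow> (nat list \<Rightarrow>\<^sub>0 'a) \<Rightarrow> (nat list \<Rightarrow>\<^sub>0 'a)" where
  "pre i = ext (\<lambda>t \<mu>. sg (i # t) \<mu>)"

definition lc :: "'a \<Rightarrow> nat \<Rightarrow> 'a \<Rightarrow> 'a" where "lc c i \<mu> = c * (\<alpha> ^^ i) \<mu>"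

text \<open>Tensoring on the left with \<open>a\<close>, in normal form: \<open>a = \<Sum> c\<^sub>i x\<^sup>i\<close>, and \<open>x\<^sup>i\<close> is moved past the coefficient \<open>\<mu>\<close> by means
  of \<open>x\<^sup>i \<mu> = \<alpha>\<^sup>i(\<mu>) x\<^sup>i\<close>.\<close>

definition star :: "'a poly set \<Rightarrow> (nat list \<Rightarrow>\<^sub>0 'a) \<Rightarrow> (nat list \<Rightarrow>\<^sub>0 'a)" where
  "star a v = (\<Sum>i<n. pre i (cm (lc (cf a i) i) v))"

fun phi :: "'a poly set list \<Rightarrow> (nat list \<Rightarrow>\<^sub>0 'a)" where
  "phi [] = sg [] 1"
| "phi (a # as) = star a (phi as)"

text \<open>The product \<open>x\<^sup>i x\<^sup>j\<close> is \<open>x\<^bsup>i+j\<^esup>\<close>, or \<open>- l x\<^bsup>i+j-n\<^esup>\<close> if there is an overflow; the factor \<open>l\<close> commutes with \<open>x\<close> and is collected on the right of the coefficient.\<close>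

definition hm :: "nat \<Rightarrow> nat \<Rightarrow> nat list \<Rightarrow> 'a \<Rightarrow> (nat list \<Rightarrow>\<^sub>0 'a)" where
  "hm i j t \<mu> = (if i + j < n then sg ((i + j) # t) \<mu> else sg ((i + j - n) # t) (- (\<mu> * l)))"

fun mrg :: "nat list \<Rightarrow> 'a \<Rightarrow> (nat list \<Rightarrow>\<^sub>0 'a)" where
  "mrg (i # j # t) \<mu> = hm i j t \<mu>"
| "mrg _ \<mu> = 0"

text \<open>The part of the Hochschild boundary that merges neighbours, without the wrap-around term. The rotation
  \<open>rt\<close> below turns the latter into a merging of the first two entries.\<close>

fun bpu :: "nat list \<Rightarrow> 'a \<Rightarrow> (nat list \<Rightarrow>\<^sub>0 'a)" where
  "bpu (i # j # t) \<mu> = hm i j t \<mu> - pre i (bpu (j # t) \<mu>)"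
| "bpu _ \<mu> = 0"

definition rt :: "nat list \<Rightarrow> 'a \<Rightarrow> (nat list \<Rightarrow>\<^sub>0 'a)" where
  "rt t \<mu> = (if t = [] then sg [] \<mu> else sg (last t # butlast t) ((\<alpha> ^^ last t) \<mu>))"

definition sgp :: "nat \<Rightarrow> 'g::ab_group_add \<Rightarrow> 'g" where "sgp r x = (if even r then x else - x)"

definition bun :: "nat list \<Rightarrow> 'a \<Rightarrow> (nat list \<Rightarrow>\<^sub>0 'a)" where
  "bun t \<mu> = bpu t \<mu> + sgp (length t - 1) (ext mrg (rt t \<mu>))"

text \<open>Words with an entry \<open>x\<^sup>0\<close> after the first position represent zero, because that entry lies in \<open>K\<close>.\<close>

definition Rz :: "(nat list \<Rightarrow>\<^sub>0 'a) \<Rightarrow> (nat list \<Rightarrow>\<^sub>0 'a)" where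
  "Rz = ext (\<lambda>t \<mu>. if 0 \<in> set (tl t) then 0 else sg t \<mu>)"

definition Bun :: "nat \<Rightarrow> (nat list \<Rightarrow>\<^sub>0 'a) \<Rightarrow> (nat list \<Rightarrow>\<^sub>0 'a)" where
  "Bun r v = (\<Sum>i<Suc r. sgp (i * r) (pre 0 ((ext rt ^^ (Suc r - i)) v)))"

definition bY :: "(nat list \<Rightarrow>\<^sub>0 'a) \<Rightarrow> (nat list \<Rightarrow>\<^sub>0 'a)" where "bY v = Rz (ext bun v)"
definition BY :: "nat \<Rightarrow> (nat list \<Rightarrow>\<^sub>0 'a) \<Rightarrow> (nat list \<Rightarrow>\<^sub>0 'a)" where "BY r v = Rz (Bun r v)"

text \<open>Moving a scalar once around a word of total degree \<open>j\<close> applies \<open>\<alpha>\<^sup>j\<close> to it, so that the coefficient of the word is only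
  determined modulo the \<open>\<alpha>\<^sup>j\<close>-commutators.\<close>

definition denY :: "(nat list \<Rightarrow>\<^sub>0 'a) set" where "denY = {v. \<forall>t. lk v t \<in> TC (sum_list t)}"

definition ysc :: "'k \<Rightarrow> ('x \<Rightarrow>\<^sub>0 'a) \<Rightarrow> ('x \<Rightarrow>\<^sub>0 'a)" where "ysc c = cm (scale c)"

definition PhiU :: "('a poly set list \<Rightarrow>\<^sub>0 'k) \<Rightarrow> (nat list \<Rightarrow>\<^sub>0 'a)" where
  "PhiU = ext (\<lambda>as c. ysc c (phi as))"

definition Phi :: "('a poly set list \<Rightarrow>\<^sub>0 'k) \<Rightarrow> (nat list \<Rightarrow>\<^sub>0 'a)" where "Phi v = Rz (PhiU v)"

subsection \<open>Additivity\<close>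

lemma sg_additive: "additive (sg t :: 'a \<Rightarrow> _)"
  by (simp add: additive_def single_add)

lemma add_plus: "additive f \<Longrightarrow> additive g \<Longrightarrow> additive (\<lambda>x. f x + g x)"
  and add_minus: "additive f \<Longrightarrow> additive g \<Longrightarrow> additive (\<lambda>x. f x - g x)"
  and add_zero: "additive (\<lambda>x. 0)"
  and add_sgp: "additive f \<Longrightarrow> additive (\<lambda>x. sgp r (f x))"
  by (auto simp: additive_def sgp_def)

lemma add_sum: "(\<And>i. i \<in> S \<Longrightarrow> additive (f i)) \<Longrightarrow> additive (\<lambda>x. \<Sum>i\<in>S. f i x)"
  by (simp add: additive_def sum.distrib[symmetric])

lemma add_id: "additive (\<lambda>x. x)" by (simp add: additive_def)

lemma scale_additive: "additive (scale c)" by (simp add: additive_def scale_right_distrib)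
lemma lc_additive: "additive (lc c i)" by (simp add: additive_def lc_def pow_add distrib_left)
lemma mult_additive: "additive ((*) (x::'a))" by (simp add: additive_def distrib_left)
lemma al_additive: "additive (\<alpha> ^^ i)" by (simp add: additive_def pow_add)

lemma cm_additive: "additive g \<Longrightarrow> additive (cm g)"
  unfolding cm_def by (rule ext_additive) (rule additive_comp[OF sg_additive])

lemma cm_sg: "additive g \<Longrightarrow> cm g (sg t \<mu>) = sg t (g \<mu>)"
  unfolding cm_def by (rule ext_single) (simp add: additive_0)

lemma lk_cm: "additive g \<Longrightarrow> lk (cm g v) t = g (lk v t)"
  by (auto simp: cm_def ext_def lookup_sum lookup_single when_def additive_0 in_keys_iff)

lemma pre_additive: "additive (pre i)"
  unfolding pre_def by (rule ext_additive) (rule sg_additive)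

lemma pre_sg: "pre i (sg t \<mu>) = sg (i # t) \<mu>"
  unfolding pre_def by (rule ext_single) simp

lemma lk_pre: "lk (pre i v) t = (case t of [] \<Rightarrow> 0 | j # u \<Rightarrow> if j = i then lk v u else 0)"
  by (auto simp: pre_def ext_def lookup_sum lookup_single when_def in_keys_iff split: list.split)

lemma star_additive: "additive (star a)"
  unfolding star_def
  by (intro add_sum additive_comp[OF pre_additive] cm_additive lc_additive)

lemma lk_star: "lk (star a v) t = (case t of [] \<Rightarrow> 0 | i # u \<Rightarrow> if i < n then cf a i * (\<alpha> ^^ i) (lk v u) else 0)"
  by (auto simp: star_def lookup_sum lk_pre lk_cm[OF lc_additive] lc_def split: list.split)

lemma hm_additive: "additive (hm i j t)"
  by (auto simp: additive_def hm_def single_add[symmetric] distrib_right)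

lemma mrg_additive: "additive (mrg t)"
  by (induction t rule: induct_list012) (simp_all add: additive_def additiveD[OF hm_additive])

lemma bpu_additive: "additive (bpu t)"
proof (induction t rule: induct_list012)
  case (3 i j t)
  have "bpu (i # j # t) = (\<lambda>\<mu>. hm i j t \<mu> - pre i (bpu (j # t) \<mu>))" by (simp add: fun_eq_iff)
  then show ?case by (simp only:) (intro add_minus hm_additive additive_comp[OF pre_additive] 3)
qed (simp_all add: add_zero)

lemma rt_additive: "additive (rt t)"
  by (simp add: additive_def rt_def single_add pow_add)

lemma bun_additive: "additive (bun t)"
  unfolding bun_def
  by (intro add_plus bpu_additive add_sgp additive_comp[OF ext_additive rt_additive] mrg_additive)

lemmas E_mrg = ext_additive[of mrg, OF mrg_additive] and E_bpu = ext_additive[of bpu, OF bpu_additive]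
  and E_rt = ext_additive[of rt, OF rt_additive] and E_bun = ext_additive[of bun, OF bun_additive]

lemma E_mrg_sg: "ext mrg (sg t \<mu>) = mrg t \<mu>" and E_bpu_sg: "ext bpu (sg t \<mu>) = bpu t \<mu>"
  and E_rt_sg: "ext rt (sg t \<mu>) = rt t \<mu>" and E_bun_sg: "ext bun (sg t \<mu>) = bun t \<mu>"
  by (simp_all add: ext_single additive_0 mrg_additive bpu_additive rt_additive bun_additive)

lemma Rz_additive: "additive Rz"
  unfolding Rz_def by (rule ext_additive) (auto simp: additive_def single_add)

lemma Rz_sg: "Rz (sg t \<mu>) = (if 0 \<in> set (tl t) then 0 else sg t \<mu>)"
  unfolding Rz_def by (simp add: ext_single)

lemma lk_Rz: "lk (Rz v) t = (if 0 \<in> set (tl t) then 0 else lk v t)"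
  by (rule additive_eq[where F = "\<lambda>v. lk (Rz v) t" and G = "\<lambda>v. if 0 \<in> set (tl t) then 0 else lk v t"])
    (auto simp: additive_def additiveD[OF Rz_additive] lookup_add Rz_sg lookup_single when_def)

lemma pow_additive: "additive (f :: 'g::ab_group_add \<Rightarrow> 'g) \<Longrightarrow> additive (f ^^ k)"
  by (induction k) (auto simp: additive_def)

lemma Bun_additive: "additive (Bun r)"
  unfolding Bun_def by (intro add_sum add_sgp additive_comp[OF pre_additive] pow_additive E_rt)

lemma bY_additive: "additive bY" and BY_additive: "additive (BY r)"
  unfolding bY_def[abs_def] BY_def[abs_def]
  by (intro additive_comp[OF Rz_additive] E_bun Bun_additive)+

lemma lk_ysc: "lk (ysc c v) t = scale c (lk v t)"
  unfolding ysc_def by (rule lk_cm[OF scale_additive])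

lemma ysc_sg: "ysc c (sg t \<mu>) = sg t (scale c \<mu>)"
  unfolding ysc_def by (rule cm_sg[OF scale_additive])

lemma ysc_additive: "additive (ysc c)"
  unfolding ysc_def by (rule cm_additive[OF scale_additive])

lemma ysc_vs: "vector_space (ysc :: 'k \<Rightarrow> ('x \<Rightarrow>\<^sub>0 'a) \<Rightarrow> _)"
  by unfold_locales (auto intro!: poly_mapping_eqI simp: lk_ysc lookup_add scale_left_distrib scale_right_distrib)

lemma ysc_left: "additive (\<lambda>c. ysc c v)"
  by (auto simp: additive_def lk_ysc lookup_add scale_left_distrib intro!: poly_mapping_eqI)

lemma PhiU_additive: "additive PhiU"
  unfolding PhiU_def by (rule ext_additive[OF ysc_left])

lemma Phi_additive: "additive Phi"
  unfolding Phi_def[abs_def] by (intro additive_comp[OF Rz_additive] PhiU_additive)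

lemma ysc_0: "ysc 0 v = 0" and ysc_1: "ysc 1 v = v"
  by (auto intro!: poly_mapping_eqI simp: lk_ysc)

lemma PhiU_gen: "PhiU (gen as) = phi as"
  unfolding PhiU_def by (simp add: ext_single ysc_0 ysc_1)

lemma PhiU_fscale: "PhiU (fscale c v) = ysc c (PhiU v)"
proof (rule additive_eq[where F = "\<lambda>v. PhiU (fscale c v)" and G = "\<lambda>v. ysc c (PhiU v)"])
  fix x assume "x \<in> ks v"
  have "fscale c (sg x (lk v x)) = sg x (c * lk v x)"
    by (rule poly_mapping_eqI) (simp add: lookup_fscale lookup_single when_def)
  then show "PhiU (fscale c (sg x (lk v x))) = ysc c (PhiU (sg x (lk v x)))"
    unfolding PhiU_def by (auto simp: ext_single ysc_0 lk_ysc intro!: poly_mapping_eqI)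
qed (rule additive_comp[OF PhiU_additive fs_additive'] additive_comp[OF ysc_additive PhiU_additive])+

text \<open>Homogeneity: the operators above commute with every operation on coefficients that commutes with \<open>\<alpha>\<close> and
  with multiplication by \<open>l\<close> on the right.\<close>

lemma pre_cm: "additive g \<Longrightarrow> pre i (cm g v) = cm g (pre i v)"
  by (rule additive_eq[where F = "\<lambda>v. pre i (cm g v)" and G = "\<lambda>v. cm g (pre i v)"])
    (simp_all add: additive_comp[OF pre_additive cm_additive] additive_comp[OF cm_additive pre_additive] cm_sg pre_sg)

lemma hm_cm: "additive g \<Longrightarrow> (\<And>x. g (x * l) = g x * l) \<Longrightarrow> hm i j t (g \<mu>) = cm g (hm i j t \<mu>)"
  by (simp add: hm_def cm_sg additive_neg)

lemma bpu_cm: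
  assumes "additive g" "\<And>x. g (x * l) = g x * l"
  shows "bpu t (g \<mu>) = cm g (bpu t \<mu>)"
proof (induction t rule: induct_list012)
  case (3 i j t)
  then show ?case using assms by (simp add: hm_cm pre_cm additive_diff[OF cm_additive])
qed (simp_all add: additive_0[OF cm_additive] assms)

lemma bun_scale: "bun t (scale c \<mu>) = ysc c (bun t \<mu>)"
proof -
  have 1: "mrg t (scale c \<mu>) = ysc c (mrg t \<mu>)" for t \<mu>
    by (cases "(t, \<mu>)" rule: mrg.cases)
      (simp_all add: ysc_def hm_cm[OF scale_additive] scale_l additive_0[OF cm_additive] scale_additive)
  have "ext mrg (rt t (scale c \<mu>)) = ysc c (ext mrg (rt t \<mu>))"
    by (simp add: rt_def E_mrg_sg pow_scale 1)
  then show ?thesis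
    unfolding bun_def using bpu_cm[OF scale_additive, of c t \<mu>] scale_l
    by (simp add: ysc_def sgp_def additiveD[OF cm_additive] additive_neg[OF cm_additive] scale_additive)
qed

lemma ext_ysc:
  assumes "\<And>t. additive (\<beta> t)" "\<And>t \<mu>. \<beta> t (scale c \<mu>) = ysc c (\<beta> t \<mu>)"
  shows "ext \<beta> (ysc c v) = ysc c (ext \<beta> v)"
proof (rule additive_eq[where F = "\<lambda>v. ext \<beta> (ysc c v)" and G = "\<lambda>v. ysc c (ext \<beta> v)"])
  fix x
  show "ext \<beta> (ysc c (sg x (lk v x))) = ysc c (ext \<beta> (sg x (lk v x)))"
    by (simp add: ysc_sg ext_single additive_0[OF assms(1)] assms(2))
qed (intro additive_comp[OF ext_additive ysc_additive] additive_comp[OF ysc_additive ext_additive] assms)+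

lemma Rz_ysc: "Rz (ysc c v) = ysc c (Rz v)"
  by (rule poly_mapping_eqI) (simp add: lk_Rz lk_ysc)

lemma pre_ysc: "pre i (ysc c v) = ysc c (pre i v)"
  unfolding ysc_def by (rule pre_cm[OF scale_additive])

lemma rt_ysc: "ext rt (ysc c v) = ysc c (ext rt v)"
  by (rule ext_ysc[OF rt_additive]) (simp add: rt_def pow_scale ysc_sg)

lemma bY_ysc: "bY (ysc c v) = ysc c (bY v)"
  by (simp add: bY_def ext_ysc[OF bun_additive bun_scale] Rz_ysc)

lemma BY_ysc: "BY r (ysc c v) = ysc c (BY r v)"
proof -
  have "(ext rt ^^ k) (ysc c v) = ysc c ((ext rt ^^ k) v)" for k
    by (induction k) (simp_all add: rt_ysc)
  then show ?thesis
    by (simp add: BY_def Bun_def pre_ysc additive_sum[OF ysc_additive] Rz_ysc[symmetric]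
        sgp_def additive_neg[OF ysc_additive] if_distrib[of "ysc c"] cong: if_cong del: sum.lessThan_Suc)
qed

lemma star_ysc: "star a (ysc c v) = ysc c (star a v)"
  by (rule poly_mapping_eqI) (simp add: lk_star lk_ysc pow_scale scale_mult_right split: list.split)

subsection \<open>The denominators\<close>

lemma denY_0: "0 \<in> denY" and denY_add: "u \<in> denY \<Longrightarrow> v \<in> denY \<Longrightarrow> u + v \<in> denY"
  and denY_diff: "u \<in> denY \<Longrightarrow> v \<in> denY \<Longrightarrow> u - v \<in> denY" and denY_neg: "u \<in> denY \<Longrightarrow> - u \<in> denY"
  and denY_ysc: "u \<in> denY \<Longrightarrow> ysc c u \<in> denY" and denY_Rz: "u \<in> denY \<Longrightarrow> Rz u \<in> denY"
  and denY_sgp: "u \<in> denY \<Longrightarrow> sgp r u \<in> denY"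
  by (auto simp: denY_def lookup_add lookup_minus TC_0 TC_add TC_diff TC_neg TC_scale lk_ysc lk_Rz sgp_def)

lemma denY_sg: "sg t \<mu> \<in> denY \<longleftrightarrow> \<mu> \<in> TC (sum_list t)"
  by (auto simp: denY_def lookup_single when_def TC_0 split: if_splits)

lemma denY_sum: "(\<And>i. i \<in> S \<Longrightarrow> f i \<in> denY) \<Longrightarrow> (\<Sum>i\<in>S. f i) \<in> denY"
  by (induction S rule: infinite_finite_induct) (auto simp: denY_0 denY_add)

lemma denY_mem:
  assumes "additive F" "v \<in> denY" "\<And>t \<mu>. \<mu> \<in> TC (sum_list t) \<Longrightarrow> F (sg t \<mu>) \<in> denY"
  shows "F v \<in> denY"
  by (rule additive_mem[OF assms(1) denY_0 denY_add]) (use assms in \<open>auto simp: denY_def\<close>)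

lemma denY_pre0: "v \<in> denY \<Longrightarrow> pre 0 v \<in> denY"
  by (rule denY_mem[OF pre_additive]) (simp_all add: pre_sg denY_sg)

lemma denY_hm: "\<mu> \<in> TC (i + j + sum_list t) \<Longrightarrow> hm i j t \<mu> \<in> denY"
  using TC_neg[OF TC_l[of \<mu> "i + j - n + sum_list t"]] by (auto simp: hm_def denY_sg)

lemma denY_mrg: "v \<in> denY \<Longrightarrow> ext mrg v \<in> denY"
proof (rule denY_mem[OF E_mrg])
  fix t \<mu> assume "\<mu> \<in> TC (sum_list t)"
  then show "ext mrg (sg t \<mu>) \<in> denY"
    by (cases "(t, \<mu>)" rule: mrg.cases) (auto simp: E_mrg_sg denY_0 add.assoc intro!: denY_hm)
qed

lemma sum_list_rt: "t \<noteq> [] \<Longrightarrow> sum_list (last t # butlast t) = sum_list (t :: nat list)"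
  by (induction t rule: rev_induct) auto

lemma denY_rt1: "\<mu> \<in> TC (sum_list t) \<Longrightarrow> rt t \<mu> \<in> denY"
  using sum_list_rt[of t] by (auto simp: rt_def denY_sg TC_pow simp del: sum_list.Cons)

lemma denY_rt: "v \<in> denY \<Longrightarrow> ext rt v \<in> denY"
  by (rule denY_mem[OF E_rt]) (simp_all add: E_rt_sg denY_rt1)

text \<open>Shifting by \<open>s\<close> lets \<open>bpu\<close> act on a word with a prefix of weight \<open>s\<close>.\<close>

lemma denY_bpu_shift: "\<mu> \<in> TC (s + sum_list t) \<Longrightarrow> u \<in> ks (bpu t \<mu>) \<Longrightarrow> lk (bpu t \<mu>) u \<in> TC (s + sum_list u)"
proof (induction t arbitrary: s u rule: induct_list012)
  case (3 i j t)
  have a: "lk (hm i j t \<mu>) u \<in> TC (s + sum_list u)"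
  proof (cases "i + j < n")
    case False
    then obtain d where d: "i + j = d + n" by (metis add.commute le_Suc_ex not_less)
    then have e: "s + sum_list (i # j # t) = s + sum_list (d # t) + n" by simp
    have "- (\<mu> * l) \<in> TC (s + sum_list (d # t))"
      using 3(3) unfolding e by (intro TC_neg TC_l)
    moreover have "hm i j t \<mu> = sg (d # t) (- (\<mu> * l))" using d by (simp add: hm_def)
    ultimately show ?thesis by (auto simp: lookup_single when_def TC_0)
  qed (use 3(3) in \<open>auto simp: hm_def lookup_single when_def TC_0 add.assoc\<close>)
  have b: "lk (pre i (bpu (j # t) \<mu>)) u \<in> TC (s + sum_list u)"
  proof (cases u)
    case (Cons k w)
    show ?thesis
    proof (cases "k = i \<and> w \<in> ks (bpu (j # t) \<mu>)")
      case True
      then have "lk (bpu (j # t) \<mu>) w \<in> TC ((s + i) + sum_list w)"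
        using 3(3) by (intro "3.IH"(2)) (auto simp: add.assoc)
      then show ?thesis using True Cons by (simp add: lk_pre add.assoc)
    qed (auto simp: Cons lk_pre TC_0 in_keys_iff)
  qed (simp add: lk_pre TC_0)
  show ?case using TC_diff[OF a b] by (simp add: lookup_minus)
qed simp_all

lemma denY_bun: "v \<in> denY \<Longrightarrow> ext bun v \<in> denY"
proof (rule denY_mem[OF E_bun])
  fix t \<mu> assume m: "\<mu> \<in> TC (sum_list t)"
  have "lk (bpu t \<mu>) u \<in> TC (sum_list u)" for u
    using denY_bpu_shift[of \<mu> 0 t u] m by (cases "u \<in> ks (bpu t \<mu>)") (auto simp: in_keys_iff TC_0)
  then have "bpu t \<mu> \<in> denY" by (simp add: denY_def)
  then show "ext bun (sg t \<mu>) \<in> denY"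
    unfolding E_bun_sg bun_def using m by (intro denY_add denY_sgp denY_mrg denY_rt1)
qed

lemma denY_rt_pow: "v \<in> denY \<Longrightarrow> (ext rt ^^ k) v \<in> denY"
  by (induction k) (auto simp: denY_rt)

lemma denY_Bun: "v \<in> denY \<Longrightarrow> Bun r v \<in> denY"
  unfolding Bun_def by (intro denY_sum denY_sgp denY_pre0 denY_rt_pow)

lemma denY_bY: "v \<in> denY \<Longrightarrow> bY v \<in> denY" and denY_BY: "v \<in> denY \<Longrightarrow> BY r v \<in> denY"
  by (simp_all add: bY_def BY_def denY_Rz denY_bun denY_Bun)

subsection \<open>The boundary of a normal form\<close>

lemma star_sg: "star a (sg t \<mu>) = (\<Sum>i<n. sg (i # t) (cf a i * (\<alpha> ^^ i) \<mu>))"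
  by (simp add: star_def cm_sg[OF lc_additive] pre_sg lc_def)

lemma mrg_star:
  assumes "a \<in> carrier A" "c \<in> carrier A"
  shows "ext mrg (star a (star c v)) = star (a \<otimes>\<^bsub>A\<^esub> c) v"
proof (rule additive_eq[where F = "\<lambda>v. ext mrg (star a (star c v))" and G = "star (a \<otimes>\<^bsub>A\<^esub> c)"])
  fix t
  define \<mu> where "\<mu> = lk v t"
  define x where "x i j = cf a i * (\<alpha> ^^ i) (cf c j)" for i j
  have "ext mrg (star a (star c (sg t \<mu>))) = (\<Sum>j<n. \<Sum>i<n. hm i j t (cf a i * (\<alpha> ^^ i) (cf c j * (\<alpha> ^^ j) \<mu>)))"
    by (simp add: star_sg additive_sum[OF star_additive] additive_sum[OF E_mrg] E_mrg_sg)
  also have "\<dots> = (\<Sum>j<n. \<Sum>i<n. \<Sum>k<n. sg (k # t) ((if i + j = k then x i j else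
      if i + j = k + n then - (x i j * l) else 0) * (\<alpha> ^^ k) \<mu>))"
  proof (intro sum.cong refl)
    fix i j assume "i \<in> {..<n}" "j \<in> {..<n}"
    then have ij: "i < n" "j < n" by auto
    have x: "cf a i * (\<alpha> ^^ i) (cf c j * (\<alpha> ^^ j) \<mu>) = x i j * (\<alpha> ^^ (i + j)) \<mu>"
      by (simp add: x_def pow_mult pow_pow mult.assoc)
    show "hm i j t (cf a i * (\<alpha> ^^ i) (cf c j * (\<alpha> ^^ j) \<mu>)) = (\<Sum>k<n. sg (k # t) ((if i + j = k then x i j else
      if i + j = k + n then - (x i j * l) else 0) * (\<alpha> ^^ k) \<mu>))"
    proof (cases "i + j < n")
      case True
      have "(\<Sum>k<n. sg (k # t) ((if i + j = k then x i j else
          if i + j = k + n then - (x i j * l) else 0) * (\<alpha> ^^ k) \<mu>)) =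
          (\<Sum>k<n. if k = i + j then sg ((i + j) # t) (x i j * (\<alpha> ^^ (i + j)) \<mu>) else 0)"
        using True by (intro sum.cong) auto
      then show ?thesis using True by (simp add: hm_def x)
    next
      case False
      define d where "d = i + j - n"
      have d: "i + j = d + n" "d < n" using False ij by (auto simp: d_def)
      have "(\<Sum>k<n. sg (k # t) ((if i + j = k then x i j else
          if i + j = k + n then - (x i j * l) else 0) * (\<alpha> ^^ k) \<mu>)) =
          (\<Sum>k<n. if k = d then sg (d # t) (- (x i j * l) * (\<alpha> ^^ d) \<mu>) else 0)"
        using d by (intro sum.cong) auto
      also have "\<dots> = sg (d # t) (- (x i j * l) * (\<alpha> ^^ d) \<mu>)" using d by simp
      also have "- (x i j * l) * (\<alpha> ^^ d) \<mu> = - (x i j * (\<alpha> ^^ (i + j)) \<mu> * l)"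
        by (simp add: d mult.assoc l_comm pow_pow add.commute)
      finally show ?thesis using d by (simp add: hm_def x)
    qed
  qed
  also have "\<dots> = (\<Sum>k<n. \<Sum>i<n. \<Sum>j<n. sg (k # t) ((if i + j = k then x i j else
      if i + j = k + n then - (x i j * l) else 0) * (\<alpha> ^^ k) \<mu>))"
    by (subst (2) sum.swap, subst (1) sum.swap, rule sum.cong[OF refl], rule sum.swap)
  also have "\<dots> = star (a \<otimes>\<^bsub>A\<^esub> c) (sg t \<mu>)"
    by (simp add: star_sg cf_mult[OF assms] x_def sum_distrib_right additive_sum[OF sg_additive]
        cong: if_cong)
  finally show "ext mrg (star a (star c (sg t (lk v t)))) = star (a \<otimes>\<^bsub>A\<^esub> c) (sg t (lk v t))"
    by (simp add: \<mu>_def)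
qed (intro star_additive additive_comp[OF E_mrg] additive_comp[OF star_additive star_additive])+

lemma bpu_star:
  assumes "a \<in> carrier A" "c \<in> carrier A"
  shows "ext bpu (star a (star c v)) = star (a \<otimes>\<^bsub>A\<^esub> c) v - star a (ext bpu (star c v))"
proof -
  have "ext bpu (star a (star c v)) - ext mrg (star a (star c v)) + star a (ext bpu (star c v)) = 0"
  proof (rule additive_eq[where F = "\<lambda>v. ext bpu (star a (star c v)) - ext mrg (star a (star c v)) + star a (ext bpu (star c v))"
        and G = "\<lambda>v. 0"])
    fix t
    define \<mu> where "\<mu> = lk v t"
    have 1: "star a (bpu u \<nu>) = (\<Sum>i<n. pre i (bpu u (cf a i * (\<alpha> ^^ i) \<nu>)))" for u \<nu>
    proof -
      have "lc c i (x * l) = lc c i x * l" for c i x by (simp add: lc_def pow_mult pow_l mult.assoc)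
      then have "star a (bpu u \<nu>) = (\<Sum>i<n. pre i (bpu u (lc (cf a i) i \<nu>)))"
        by (simp add: star_def bpu_cm[OF lc_additive])
      then show ?thesis by (simp add: lc_def)
    qed
    show "ext bpu (star a (star c (sg t (lk v t)))) - ext mrg (star a (star c (sg t (lk v t)))) +
        star a (ext bpu (star c (sg t (lk v t)))) = 0"
      by (simp add: star_sg[of c] additive_sum[OF star_additive] star_sg[of a] additive_sum[OF E_bpu]
          additive_sum[OF E_mrg] E_bpu_sg E_mrg_sg 1 sum_subtractf[symmetric] sum.distrib[symmetric])
  qed (intro add_plus add_minus add_zero additive_comp[OF E_mrg] additive_comp[OF E_bpu]
      additive_comp[OF star_additive star_additive] additive_comp[OF star_additive] star_additive)+
  then show ?thesis by (simp add: mrg_star[OF assms] algebra_simps)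
qed

lemma ysc_sign: "ysc ((- 1) ^ i) v = sgp i v"
  by (cases "even i") (auto simp: sgp_def ysc_1 lk_ysc intro!: poly_mapping_eqI)

lemma sgp_Suc: "sgp (Suc i) v = - sgp i v"
  and sgp_0: "sgp 0 v = v" and sgp_zero: "sgp i 0 = 0"
  by (auto simp: sgp_def)

text \<open>Already at the level of normal forms, before the relation that makes the tensors cyclic, the inner
  faces correspond to the mergings of neighbours.\<close>

lemma phi_faces: "set as \<subseteq> carrier A \<Longrightarrow> (\<Sum>i<length as - 1. sgp i (phi (face A i as))) = ext bpu (phi as)"
proof (induction as rule: induct_list012)
  case (3 a c as)
  have car: "a \<in> carrier A" "c \<in> carrier A" using 3(3) by auto
  have f0: "face A 0 (a # c # as) = (a \<otimes>\<^bsub>A\<^esub> c) # as" by (subst face_inner[OF A_ring]) auto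
  have fS: "face A (Suc i) (a # c # as) = a # face A i (c # as)" if "i < length as" for i
    using that by (subst (1 2) face_inner[OF A_ring]) auto
  have "(\<Sum>i<length (a # c # as) - 1. sgp i (phi (face A i (a # c # as)))) =
      star (a \<otimes>\<^bsub>A\<^esub> c) (phi as) - star a (\<Sum>i<length as. sgp i (phi (face A i (c # as))))"
    by (simp add: sum.lessThan_Suc_shift f0 fS sgp_Suc sgp_0 additive_sum[OF star_additive] sum_negf
        del: sum.lessThan_Suc)
      (auto simp: sgp_def additive_neg[OF star_additive] intro!: sum.cong)
  also have "(\<Sum>i<length as. sgp i (phi (face A i (c # as)))) = ext bpu (star c (phi as))"
    using "3.IH"(2) 3(3) by simp
  finally show ?case by (simp add: bpu_star[OF car])
qed (simp_all add: E_bpu_sg additive_0[OF E_bpu] star_sg additive_sum[OF E_bpu])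

text \<open>Tensoring on the right with \<open>a\<close>: its coefficients have to travel past the whole word to the left.\<close>

definition snoc :: "'a poly set \<Rightarrow> (nat list \<Rightarrow>\<^sub>0 'a) \<Rightarrow> (nat list \<Rightarrow>\<^sub>0 'a)" where
  "snoc a = ext (\<lambda>t \<mu>. \<Sum>j<n. sg (t @ [j]) (\<mu> * (\<alpha> ^^ sum_list t) (cf a j)))"

lemma snoc_additive: "additive (snoc a)"
  unfolding snoc_def by (rule ext_additive) (intro add_sum, simp add: additive_def distrib_right single_add)

lemma snoc_sg: "snoc a (sg t \<mu>) = (\<Sum>j<n. sg (t @ [j]) (\<mu> * (\<alpha> ^^ sum_list t) (cf a j)))"
  unfolding snoc_def by (simp add: ext_single)

lemma star_snoc: "star b (snoc a v) = snoc a (star b v)"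
proof (rule additive_eq[where F = "\<lambda>v. star b (snoc a v)" and G = "\<lambda>v. snoc a (star b v)"])
  fix t
  show "star b (snoc a (sg t (lk v t))) = snoc a (star b (sg t (lk v t)))"
    by (simp add: snoc_sg star_sg additive_sum[OF star_additive] additive_sum[OF snoc_additive] pow_mult pow_pow mult.assoc)
      (rule sum.swap)
qed (intro additive_comp[OF snoc_additive star_additive] additive_comp[OF star_additive snoc_additive])+

lemma phi_snoc: "phi (as @ [a]) = snoc a (phi as)"
  by (induction as) (simp_all add: star_snoc snoc_sg star_sg pow_1)

text \<open>Moving the last tensor factor to the front changes the normal form by \<open>rt\<close>, up to twisted commutators.\<close>

lemma phi_rot1: "phi (a # as) - ext rt (phi (as @ [a])) \<in> denY"
  unfolding phi_snoc phi.simps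
proof (rule additive_mem[where F = "\<lambda>v. star a v - ext rt (snoc a v)", OF _ denY_0 denY_add])
  fix t
  define \<mu> where "\<mu> = lk (phi as) t"
  have "star a (sg t \<mu>) - ext rt (snoc a (sg t \<mu>)) = (\<Sum>j<n. sg (j # t)
      (cf a j * (\<alpha> ^^ j) \<mu> - (\<alpha> ^^ j) \<mu> * (\<alpha> ^^ (j + sum_list t)) (cf a j)))"
    by (simp add: star_sg snoc_sg additive_sum[OF E_rt] E_rt_sg rt_def pow_mult pow_pow sum_subtractf[symmetric]
        additive_diff[OF sg_additive])
  also have "\<dots> \<in> denY"
  proof (rule denY_sum)
    fix j
    show "sg (j # t) (cf a j * (\<alpha> ^^ j) \<mu> - (\<alpha> ^^ j) \<mu> * (\<alpha> ^^ (j + sum_list t)) (cf a j)) \<in> denY"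
      using TC_neg[OF TC_gen[of "(\<alpha> ^^ j) \<mu>" "j + sum_list t" "cf a j"]] by (simp add: denY_sg)
  qed
  finally show "star a (sg t (lk (phi as) t)) - ext rt (snoc a (sg t (lk (phi as) t))) \<in> denY" by (simp add: \<mu>_def)
qed (intro add_minus star_additive additive_comp[OF E_rt snoc_additive])

lemma phi_rot: "k \<le> length as \<Longrightarrow> phi (rotate k as) - (ext rt ^^ (length as - k)) (phi as) \<in> denY"
proof (induction "length as - k" arbitrary: k)
  case 0
  then have "k = length as" by simp
  then show ?case by (simp add: denY_0)
next
  case (Suc d)
  define bs where "bs = rotate k as"
  have ne: "bs \<noteq> []" using Suc by (auto simp: bs_def)
  then obtain b cs where bs: "bs = b # cs" by (cases bs) auto
  have d: "d = length as - Suc k" "Suc k \<le> length as" using Suc by auto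
  have "phi (rotate (Suc k) as) - (ext rt ^^ d) (phi as) \<in> denY" using Suc(1)[of "Suc k"] d by simp
  then have "ext rt (phi (cs @ [b]) - (ext rt ^^ d) (phi as)) \<in> denY"
    using bs by (intro denY_rt) (simp add: bs_def)
  with phi_rot1[of b cs] have "phi (b # cs) - ext rt (phi (cs @ [b])) + ext rt (phi (cs @ [b]) - (ext rt ^^ d) (phi as)) \<in> denY"
    by (rule denY_add)
  then show ?case
    using Suc(2)[symmetric] bs by (simp add: additive_diff[OF E_rt] bs_def)
qed

lemma phi_b:
  assumes "as \<in> tuples A r"
  shows "PhiU (hochschild_b A r as) - ext bun (phi as) \<in> denY"
proof (cases "r = 0")
  case True
  then obtain a where "as = [a]" using assms by (auto simp: tuples_def length_Suc_conv)
  then show ?thesis using True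
    by (simp add: hochschild_b_def additive_0[OF PhiU_additive] star_sg additive_sum[OF E_bun] E_bun_sg bun_def
        rt_def E_mrg_sg sgp_zero denY_0)
next
  case False
  have len: "length as = Suc r" and car: "set as \<subseteq> carrier A" using assms by (auto simp: tuples_def)
  obtain bs c where as: "as = bs @ [c]" using len by (cases as rule: rev_cases) auto
  obtain a cs where bs: "bs = a # cs" using as len False by (cases bs) auto
  have "face A r as = (c \<otimes>\<^bsub>A\<^esub> a) # cs"
    using len False as bs by (subst face_wrap[OF A_ring len]) (auto simp: nth_append)
  then have w: "phi (face A r as) = ext mrg (phi (c # bs))"
    using car as bs by (simp add: mrg_star)
  have "PhiU (hochschild_b A r as) = (\<Sum>i<r. sgp i (phi (face A i as))) + sgp r (phi (face A r as))"
    using False len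
    by (simp add: hochschild_b_faces[OF A_ring] additiveD[OF PhiU_additive] additive_sum[OF PhiU_additive] PhiU_fscale PhiU_gen ysc_sign
        lessThan_Suc_atMost[symmetric])
  also have "(\<Sum>i<r. sgp i (phi (face A i as))) = ext bpu (phi as)"
    using phi_faces[OF car] len by simp
  finally have 1: "PhiU (hochschild_b A r as) = ext bpu (phi as) + sgp r (ext mrg (phi (c # bs)))" by (simp add: w)
  have kl: "length t = Suc r" if "t \<in> ks (phi as)" for t
  proof -
    have "length t = length as" if "t \<in> ks (phi as)" for t as
      using that
      by (induction as arbitrary: t)
        (auto simp: in_keys_iff lk_star pow_0 split: list.splits if_splits, metis mult_zero_right pow_0)
    then show ?thesis using that len by simp
  qed
  have "ext bun (phi as) = ext bpu (phi as) + sgp r (ext mrg (ext rt (phi as)))"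
  proof (rule additive_eq[where F = "ext bun" and G = "\<lambda>v. ext bpu v + sgp r (ext mrg (ext rt v))"])
    fix t assume "t \<in> ks (phi as)"
    then show "ext bun (sg t (lk (phi as) t)) = ext bpu (sg t (lk (phi as) t)) + sgp r (ext mrg (ext rt (sg t (lk (phi as) t))))"
      using kl by (simp add: E_bun_sg E_bpu_sg E_rt_sg bun_def)
  qed (intro E_bun add_plus E_bpu add_sgp additive_comp[OF E_mrg E_rt])+
  with 1 have "PhiU (hochschild_b A r as) - ext bun (phi as) = sgp r (ext mrg (phi (c # bs) - ext rt (phi (bs @ [c]))))"
    by (simp add: as additive_diff[OF E_mrg] sgp_def)
  then show ?thesis by (simp only: denY_sgp denY_mrg phi_rot1)
qed

lemma star_one: "star \<one>\<^bsub>A\<^esub> v = pre 0 v"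
  by (rule poly_mapping_eqI) (auto simp: lk_star lk_pre cl_one cf_io n_pos split: list.split)

lemma phi_B:
  assumes "as \<in> tuples A r"
  shows "PhiU (connes_B A r as) - Bun r (phi as) \<in> denY"
proof -
  have len: "length as = Suc r" using assms by (auto simp: tuples_def)
  have "PhiU (connes_B A r as) - Bun r (phi as) =
      (\<Sum>i<Suc r. sgp (i * r) (pre 0 (phi (rotate i as) - (ext rt ^^ (Suc r - i)) (phi as))))"
    by (simp add: connes_B_rotate[OF A_ring len] additive_sum[OF PhiU_additive] PhiU_fscale PhiU_gen ysc_sign
        star_one Bun_def sum_subtractf[symmetric] additive_diff[OF pre_additive] del: sum.lessThan_Suc)
      (auto simp: sgp_def intro!: sum.cong)
  also have "\<dots> \<in> denY"
    using phi_rot[of _ as] len by (intro denY_sum denY_sgp denY_pre0) auto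
  finally show ?thesis .
qed

end

section \<open>The relative complex and its normal form are isomorphic\<close>

context twisted_algebra
begin

definition un :: "nat \<Rightarrow> nat list set" where "un r = {t. length t = Suc r \<and> set t \<subseteq> {..<n}}"
definition Wd :: "nat \<Rightarrow> nat list set" where "Wd m = {t. length t = m \<and> set t \<subseteq> {1..<n}}"
definition Wt :: "nat \<Rightarrow> nat list set" where "Wt r = {t. length t = Suc r \<and> hd t < n \<and> set (tl t) \<subseteq> {1..<n}}"

lemma Wt_un: "Wt r = {t \<in> un r. 0 \<notin> set (tl t)}"
proof -
  have "t \<in> Wt r \<longleftrightarrow> t \<in> un r \<and> 0 \<notin> set (tl t)" for t
    by (cases t) (auto simp: Wt_def un_def subset_iff Suc_le_eq intro: gr0I)
  then show ?thesis by auto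
qed

lemma finite_Wd: "finite (Wd m)"
  using finite_lists_length_eq[of "{1..<n}" m] by (simp add: Wd_def conj_commute)

lemma Wt_image: "Wt r = (\<lambda>(i, t). i # t) ` ({..<n} \<times> Wd r)"
proof -
  have "t \<in> Wt r \<Longrightarrow> t \<in> (\<lambda>(i, t). i # t) ` ({..<n} \<times> Wd r)" for t
    by (cases t) (auto simp: Wt_def Wd_def)
  then show ?thesis by (auto simp: Wt_def Wd_def)
qed

lemma finite_Wt: "finite (Wt r)"
  unfolding Wt_image using finite_Wd by blast

subsection \<open>Entries of degree zero\<close>

text \<open>In the unreduced formula for the boundary, an entry \<open>x\<^sup>0\<close> in a position other than the first is merged
  with both of its neighbours; the two results are equal and have opposite signs.\<close>

definition Rw :: "(nat list \<Rightarrow>\<^sub>0 'a) \<Rightarrow> (nat list \<Rightarrow>\<^sub>0 'a)" where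
  "Rw = ext (\<lambda>t \<mu>. if 0 \<in> set t then 0 else sg t \<mu>)"

lemma Rw_additive: "additive Rw"
  unfolding Rw_def by (rule ext_additive) (auto simp: additive_def single_add)

lemma Rw_sg: "Rw (sg t \<mu>) = (if 0 \<in> set t then 0 else sg t \<mu>)"
  unfolding Rw_def by (simp add: ext_single)

lemma lk_Rw: "lk (Rw v) t = (if 0 \<in> set t then 0 else lk v t)"
  by (rule additive_eq[where F = "\<lambda>v. lk (Rw v) t" and G = "\<lambda>v. if 0 \<in> set t then 0 else lk v t"])
    (auto simp: additive_def additiveD[OF Rw_additive] lookup_add Rw_sg lookup_single when_def)

lemma Rz_pre: "Rz (pre i v) = pre i (Rw v)"
  by (rule poly_mapping_eqI) (auto simp: lk_Rz lk_pre lk_Rw split: list.split)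

lemma Rw_pre: "Rw (pre i v) = (if i = 0 then 0 else pre i (Rw v))"
  by (rule poly_mapping_eqI) (auto simp: lk_pre lk_Rw split: list.split)

lemma Rz_hm: "Rz (hm i j t \<mu>) = (if 0 \<in> set t then 0 else hm i j t \<mu>)"
  by (simp add: hm_def Rz_sg)

text \<open>If there is an inner entry \<open>0\<close>, then it cancels between its two neighbours; only at the ends of the word
  a single term remains.\<close>

lemma Rw_bpu_zero:
  assumes "0 \<in> set u" "set u \<subseteq> {..<n}"
  shows "Rw (bpu u \<mu>) = (if hd u = 0 \<and> 0 \<notin> set (tl u) \<and> tl u \<noteq> [] then sg (tl u) \<mu> else 0) +
    (if last u = 0 \<and> 0 \<notin> set (butlast u) \<and> butlast u \<noteq> [] then sgp (length u) (sg (butlast u) \<mu>) else 0)"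
  using assms
proof (induction u rule: induct_list012)
  case (3 i j t)
  have lt: "i < n" "j < n" using 3(4) by auto
  show ?case
  proof (cases "i = 0")
    case True
    then show ?thesis using lt
      by (simp add: additive_diff[OF Rw_additive] Rw_pre hm_def Rw_sg)
  next
    case False
    then have z: "0 \<in> set (j # t)" using 3(3) by auto
    have IH: "Rw (bpu (j # t) \<mu>) = (if j = 0 \<and> 0 \<notin> set t \<and> t \<noteq> [] then sg t \<mu> else 0) +
      (if last (j # t) = 0 \<and> 0 \<notin> set (butlast (j # t)) \<and> butlast (j # t) \<noteq> []
        then sgp (Suc (length t)) (sg (butlast (j # t)) \<mu>) else 0)"
      using "3.IH"(2) z 3(4) by simp
    have h: "Rw (hm i j t \<mu>) = (if j = 0 \<and> 0 \<notin> set t then sg (i # t) \<mu> else 0)"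
      using z False lt by (auto simp: hm_def Rw_sg)
    have c: "sg (i # t) \<mu> = sgp (Suc (Suc 0)) (sg [i] \<mu>)" if "t = []" using that by (simp add: sgp_def)
    show ?thesis
    proof (cases "t = []")
      case True
      then show ?thesis using z False
        using lt by (simp add: additive_diff[OF Rw_additive] Rw_pre hm_def Rw_sg IH additive_0[OF pre_additive] sgp_def)
    next
      case tne: False
      then have bl: "butlast (j # t) = j # butlast t" "butlast (j # t) \<noteq> []" "last (j # t) = last t" by auto
      show ?thesis
      proof (cases "j = 0")
        case True
        note h0 = h[unfolded True] and IH0 = IH[unfolded True] and bl0 = bl[unfolded True]
        show ?thesis using tne False True
          by (auto simp: additive_diff[OF Rw_additive] Rw_pre h0 IH0 bl0 pre_sg additive_0[OF pre_additive])
      next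
        case jne: False
        then show ?thesis using tne False
          by (auto simp: additive_diff[OF Rw_additive] Rw_pre h IH bl pre_sg additive_0[OF pre_additive] sgp_def
              additive_neg[OF pre_additive])
      qed
    qed
  qed
qed (simp_all add: additive_0[OF Rw_additive])

lemma Rz_bun_zero:
  assumes "0 \<in> set (tl t)" "set t \<subseteq> {..<n}"
  shows "Rz (bun t \<mu>) = 0"
proof -
  obtain i j w where t: "t = i # j # w" using assms by (cases t; cases "tl t") auto
  define u where "u = j # w"
  have u: "0 \<in> set u" "set u \<subseteq> {..<n}" "i < n" "u \<noteq> []" using assms t by (auto simp: u_def)
  have z: "Rw (bpu u \<mu>) = (if hd u = 0 \<and> 0 \<notin> set (tl u) \<and> tl u \<noteq> [] then sg (tl u) \<mu> else 0) +
    (if last u = 0 \<and> 0 \<notin> set (butlast u) \<and> butlast u \<noteq> [] then sgp (length u) (sg (butlast u) \<mu>) else 0)"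
    by (rule Rw_bpu_zero) (rule u)+
  have bp: "bpu t \<mu> = hm i j w \<mu> - pre i (bpu u \<mu>)" by (simp add: t u_def)
  have tu: "t = i # u" by (simp add: t u_def)
  have "Rz (bun t \<mu>) = Rz (hm i j w \<mu>) - pre i (Rw (bpu u \<mu>)) +
      sgp (length u) (Rz (hm (last u) i (butlast u) ((\<alpha> ^^ last u) \<mu>)))"
    using u
    by (simp add: bun_def bp) (simp add: tu rt_def E_mrg_sg additiveD[OF Rz_additive] additive_diff[OF Rz_additive]
        Rz_pre sgp_def additive_neg[OF Rz_additive])
  also have "Rz (hm i j w \<mu>) = (if hd u = 0 \<and> 0 \<notin> set (tl u) then sg (i # tl u) \<mu> else 0)"
    using u by (auto simp: Rz_sg u_def hm_def)
  also have "Rz (hm (last u) i (butlast u) ((\<alpha> ^^ last u) \<mu>)) =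
      (if last u = 0 \<and> 0 \<notin> set (butlast u) then sg (i # butlast u) \<mu> else 0)"
  proof (cases "last u = 0")
    case True
    then show ?thesis using u by (simp add: Rz_sg hm_def)
  next
    case False
    then have "0 \<in> set (butlast u)" using u(1,4) by (cases u rule: rev_cases) auto
    then show ?thesis using False by (simp add: Rz_hm)
  qed
  finally have e: "Rz (bun t \<mu>) = (if hd u = 0 \<and> 0 \<notin> set (tl u) then sg (i # tl u) \<mu> else 0) - pre i (Rw (bpu u \<mu>)) +
      sgp (length u) (if last u = 0 \<and> 0 \<notin> set (butlast u) then sg (i # butlast u) \<mu> else 0)" .
  show ?thesis
  proof (cases "tl u = []")
    case True
    then have "u = [0]" using u by (cases u) auto
    then show ?thesis using e by (simp add: z additive_0[OF pre_additive] additive_0[OF Rw_additive] sgp_def)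
  next
    case False
    then have "butlast u \<noteq> []" by (cases u) auto
    then show ?thesis using e False
      by (auto simp: z additiveD[OF pre_additive] pre_sg additive_0[OF pre_additive] sgp_def additive_neg[OF pre_additive])
  qed
qed

lemma rt_pow_sg: "\<exists>t' \<nu>. (ext rt ^^ k) (sg t \<mu>) = sg t' \<nu> \<and> set t' = set t \<and> length t' = length t"
proof (induction k)
  case (Suc k)
  then obtain t' \<nu> where t': "(ext rt ^^ k) (sg t \<mu>) = sg t' \<nu>" "set t' = set t" "length t' = length t" by blast
  show ?case
  proof (cases "t' = []")
    case False
    have "set (last t' # butlast t') = set t'"
      using False by (cases t' rule: rev_cases) auto
    moreover have "length (last t' # butlast t') = length t'" using False by simp
    moreover have "(ext rt ^^ Suc k) (sg t \<mu>) = sg (last t' # butlast t') ((\<alpha> ^^ last t') \<nu>)"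
      using False t' by (simp add: E_rt_sg rt_def)
    ultimately show ?thesis using t' by metis
  next
    case True
    have "rt [] \<nu> = sg [] \<nu>" by (simp add: rt_def)
    then show ?thesis using t' True by (auto simp: E_rt_sg)
  qed
qed auto

lemma Bun_sg: "ks (Bun r (sg t \<mu>)) \<subseteq> {0 # t' | t'. set t' = set t \<and> length t' = length t}"
proof -
  have "ks (sgp (i * r) (pre 0 ((ext rt ^^ (Suc r - i)) (sg t \<mu>)))) \<subseteq> {0 # t' | t'. set t' = set t \<and> length t' = length t}" for i
  proof -
    obtain t' \<nu> where "(ext rt ^^ (Suc r - i)) (sg t \<mu>) = sg t' \<nu>" "set t' = set t" "length t' = length t"
      using rt_pow_sg by blast
    then show ?thesis by (auto simp: pre_sg sgp_def keys_neg split: if_splits)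
  qed
  then show ?thesis unfolding Bun_def by (intro order.trans[OF keys_sum] UN_least)
qed

lemma Rz_zero: "(\<And>t. t \<in> ks v \<Longrightarrow> 0 \<in> set (tl t)) \<Longrightarrow> Rz v = 0"
  by (rule poly_mapping_eqI) (auto simp: lk_Rz in_keys_iff)

lemma BY_zero: "(\<And>t. t \<in> ks v \<Longrightarrow> 0 \<in> set t) \<Longrightarrow> BY r v = 0"
  unfolding BY_def
proof (rule additive_eq[where F = "\<lambda>v. Rz (Bun r v)" and G = "\<lambda>v. 0"])
  fix t assume "\<And>t. t \<in> ks v \<Longrightarrow> 0 \<in> set t" "t \<in> ks v"
  then have "0 \<in> set t" by blast
  then show "Rz (Bun r (sg t (lk v t))) = 0"
    using Bun_sg[of r t "lk v t"] by (intro Rz_zero) auto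
qed (auto intro: additive_comp[OF Rz_additive Bun_additive] add_zero)

lemma keys_Bun: "ks (Bun r v) \<subseteq> (\<Union>x\<in>ks v. {0 # t' | t'. set t' = set x \<and> length t' = length x})"
proof -
  have "ks (Bun r v) \<subseteq> (\<Union>x\<in>ks v. ks (Bun r (sg x (lk v x))))"
    by (subst additive_expand[OF Bun_additive]) (rule keys_sum)
  also have "\<dots> \<subseteq> (\<Union>x\<in>ks v. {0 # t' | t'. set t' = set x \<and> length t' = length x})"
    by (rule UN_mono[OF order_refl Bun_sg])
  finally show ?thesis .
qed

lemma keys_BY: "t \<in> ks (BY r v) \<Longrightarrow> 0 \<in> set t"
proof -
  assume "t \<in> ks (BY r v)"
  then have "t \<in> ks (Bun r v)" by (auto simp: BY_def in_keys_iff lk_Rz split: if_splits)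
  with keys_Bun[of r v] have "t \<in> (\<Union>x\<in>ks v. {0 # t' | t'. set t' = set x \<and> length t' = length x})" by (rule subsetD)
  then show ?thesis by auto
qed

lemma BY_BY: "BY (Suc r) (BY r v) = 0"
  by (rule BY_zero) (rule keys_BY)

lemma bY_Rz: "ks v \<subseteq> un r \<Longrightarrow> Rz (ext bun v) = bY (Rz v)"
  unfolding bY_def
proof (rule additive_eq[where F = "\<lambda>v. Rz (ext bun v)" and G = "\<lambda>v. Rz (ext bun (Rz v))"])
  fix t assume "ks v \<subseteq> un r" "t \<in> ks v"
  then have "set t \<subseteq> {..<n}" by (auto simp: un_def)
  then show "Rz (ext bun (sg t (lk v t))) = Rz (ext bun (Rz (sg t (lk v t))))"
    by (simp add: E_bun_sg Rz_sg Rz_bun_zero additive_0[OF E_bun] additive_0[OF Rz_additive])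
qed (intro additive_comp[OF Rz_additive] additive_comp[OF E_bun] E_bun Rz_additive)+

lemma BY_Rz: "Rz (Bun r v) = BY r (Rz v)"
proof (rule additive_eq[where F = "\<lambda>v. Rz (Bun r v)" and G = "\<lambda>v. BY r (Rz v)"])
  fix t
  have "Rz (Bun r (sg t (lk v t))) = 0" if z: "0 \<in> set (tl t)"
  proof -
    have "0 \<in> set t" using z by (cases t) auto
    then have "BY r (sg t (lk v t)) = 0" by (intro BY_zero) (simp split: if_splits)
    then show ?thesis by (simp add: BY_def)
  qed
  then show "Rz (Bun r (sg t (lk v t))) = BY r (Rz (sg t (lk v t)))"
    by (auto simp: Rz_sg additive_0[OF BY_additive], auto simp: BY_def)
qed (intro additive_comp[OF Rz_additive] additive_comp[OF BY_additive] Bun_additive Rz_additive)+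

lemma keys_hm: "ks (hm i j t \<mu>) \<subseteq> {(if i + j < n then i + j else i + j - n) # t}"
  by (auto simp: hm_def)

lemma keys_pre: "ks (pre i v) = (#) i ` ks v"
  by (auto simp: in_keys_iff lk_pre split: list.splits if_splits)

lemma keys_bpu: "set t \<subseteq> {..<n} \<Longrightarrow> ks (bpu t \<mu>) \<subseteq> {u. length u = length t - 1 \<and> set u \<subseteq> {..<n}}"
proof (induction t rule: induct_list012)
  case (3 i j t)
  then have ij: "i < n" "j < n" and IH: "ks (bpu (j # t) \<mu>) \<subseteq> {u. length u = length t \<and> set u \<subseteq> {..<n}}" by auto
  have "ks (hm i j t \<mu>) \<subseteq> {u. length u = Suc (length t) \<and> set u \<subseteq> {..<n}}"
    by (rule order.trans[OF keys_hm]) (use 3(3) in \<open>auto split: if_splits\<close>)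
  moreover have "(#) i ` ks (bpu (j # t) \<mu>) \<subseteq> {u. length u = Suc (length t) \<and> set u \<subseteq> {..<n}}"
    by (rule order.trans[OF image_mono[OF IH]]) (use ij in auto)
  ultimately have "ks (hm i j t \<mu>) \<union> ks (pre i (bpu (j # t) \<mu>)) \<subseteq> {u. length u = Suc (length t) \<and> set u \<subseteq> {..<n}}"
    by (simp add: keys_pre)
  from order.trans[OF keys_diff this] show ?case by simp
qed simp_all

lemma keys_bun: "t \<in> un (Suc r) \<Longrightarrow> ks (bun t \<mu>) \<subseteq> un r"
proof -
  assume t: "t \<in> un (Suc r)"
  then obtain x j u where xju: "t = x # u @ [j]"
    by (cases t; cases "tl t" rule: rev_cases) (auto simp: un_def)
  have "ks (ext mrg (rt t \<mu>)) \<subseteq> un r"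
  proof -
    have "ks (hm j x u ((\<alpha> ^^ j) \<mu>)) \<subseteq> un r"
      by (rule order.trans[OF keys_hm]) (use t in \<open>auto simp: xju un_def split: if_splits\<close>)
    then show ?thesis by (simp add: xju rt_def E_mrg_sg)
  qed
  moreover have "ks (bpu t \<mu>) \<subseteq> un r" using keys_bpu[of t \<mu>] t by (auto simp: un_def)
  ultimately show ?thesis using keys_add[of "bpu t \<mu>" "sgp (length t - 1) (ext mrg (rt t \<mu>))"]
    by (auto simp: bun_def sgp_def keys_neg split: if_splits)
qed

lemma ks_Rz: "ks (Rz v) = {t \<in> ks v. 0 \<notin> set (tl t)}"
  by (auto simp: in_keys_iff lk_Rz split: if_splits)

lemma keys_bY: "ks v \<subseteq> Wt (Suc r) \<Longrightarrow> ks (bY v) \<subseteq> Wt r"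
proof -
  assume v: "ks v \<subseteq> Wt (Suc r)"
  have "ks (bun x (lk v x)) \<subseteq> un r" if "x \<in> ks v" for x
    using that v by (intro keys_bun) (auto simp: Wt_un)
  then have "ks (ext bun v) \<subseteq> un r" by (intro order.trans[OF keys_ext] UN_least)
  then show ?thesis by (auto simp: bY_def ks_Rz Wt_un)
qed

lemma keys_BYr: "ks v \<subseteq> Wt r \<Longrightarrow> ks (BY r v) \<subseteq> Wt (Suc r)"
proof -
  assume v: "ks v \<subseteq> Wt r"
  have "{0 # t' | t'. set t' = set x \<and> length t' = length x} \<subseteq> un (Suc r)" if "x \<in> ks v" for x
  proof -
    have "x \<in> un r" using that v by (auto simp: Wt_un)
    then show ?thesis using n_pos by (auto simp: un_def)
  qed
  then have "ks (Bun r v) \<subseteq> un (Suc r)" by (intro order.trans[OF keys_Bun] UN_least)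
  then show ?thesis by (auto simp: BY_def ks_Rz Wt_un)
qed

lemma keys_star: "ks (star a v) \<subseteq> {i # t | i t. i < n \<and> t \<in> ks v}"
  by (auto simp: in_keys_iff lk_star pow_0 split: list.splits if_splits)

lemma keys_phi: "ks (phi as) \<subseteq> {t. length t = length as \<and> set t \<subseteq> {..<n}}"
proof (induction as)
  case (Cons a as)
  show ?case
  proof
    fix t assume "t \<in> ks (phi (a # as))"
    then obtain i u where u: "t = i # u" "i < n" "u \<in> ks (phi as)" using keys_star[of a "phi as"] by auto
    from subsetD[OF Cons u(3)] u(1,2) show "t \<in> {t. length t = length (a # as) \<and> set t \<subseteq> {..<n}}" by auto
  qed
qed auto

lemma keys_phi_un: "as \<in> tuples A r \<Longrightarrow> ks (phi as) \<subseteq> un r"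
  using keys_phi[of as] by (auto simp: tuples_def un_def)

lemma ks_ysc: "ks (ysc c v) \<subseteq> ks v"
  by (auto simp: in_keys_iff lk_ysc)

lemma keys_Phi: "ks v \<subseteq> tuples A r \<Longrightarrow> ks (Phi v) \<subseteq> Wt r"
proof -
  assume v: "ks v \<subseteq> tuples A r"
  have "ks (PhiU v) \<subseteq> un r"
  proof -
    have "ks (ysc c (phi as)) \<subseteq> un r" if "as \<in> ks v" for c as
      using that v ks_ysc[of c "phi as"] keys_phi_un[of as r] by auto
    then show ?thesis unfolding PhiU_def by (intro order.trans[OF keys_ext] UN_least)
  qed
  then show ?thesis by (auto simp: Phi_def ks_Rz Wt_un)
qed

lemma Phi_gen: "Phi (gen as) = Rz (phi as)"
  by (simp add: Phi_def PhiU_gen)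

lemma Phi_fscale: "Phi (fscale c v) = ysc c (Phi v)"
  by (simp add: Phi_def PhiU_fscale Rz_ysc)

lemma Phi_b: "ks v \<subseteq> tuples A r \<Longrightarrow> Phi (free_extend (hochschild_b A r) v) - bY (Phi v) \<in> denY"
proof (rule additive_mem[where F = "\<lambda>v. Phi (free_extend (hochschild_b A r) v) - bY (Phi v)", OF _ denY_0 denY_add])
  fix as assume "ks v \<subseteq> tuples A r" "as \<in> ks v"
  then have as: "as \<in> tuples A r" by blast
  have "Rz (PhiU (hochschild_b A r as) - ext bun (phi as)) \<in> denY" by (rule denY_Rz[OF phi_b[OF as]])
  then have "Phi (hochschild_b A r as) - bY (Phi (gen as)) \<in> denY"
    by (simp add: Phi_def PhiU_gen additive_diff[OF Rz_additive] bY_Rz[OF keys_phi_un[OF as]])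
  from denY_ysc[OF this, of "lk v as"]
  show "Phi (free_extend (hochschild_b A r) (sg as (lk v as))) - bY (Phi (sg as (lk v as))) \<in> denY"
    by (simp add: sg_fscale[of as "lk v as"] fe_scale fe_gen Phi_fscale bY_ysc additive_diff[OF ysc_additive])
qed (intro add_minus additive_comp[OF Phi_additive] additive_comp[OF bY_additive] free_extend_additive Phi_additive)

lemma Phi_B: "ks v \<subseteq> tuples A r \<Longrightarrow> Phi (free_extend (connes_B A r) v) - BY r (Phi v) \<in> denY"
proof (rule additive_mem[where F = "\<lambda>v. Phi (free_extend (connes_B A r) v) - BY r (Phi v)", OF _ denY_0 denY_add])
  fix as assume "ks v \<subseteq> tuples A r" "as \<in> ks v"
  then have as: "as \<in> tuples A r" by blast
  have "Rz (PhiU (connes_B A r as) - Bun r (phi as)) \<in> denY" by (rule denY_Rz[OF phi_B[OF as]])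
  then have "Phi (connes_B A r as) - BY r (Phi (gen as)) \<in> denY"
    by (simp add: Phi_def PhiU_gen additive_diff[OF Rz_additive] BY_Rz)
  from denY_ysc[OF this, of "lk v as"]
  show "Phi (free_extend (connes_B A r) (sg as (lk v as))) - BY r (Phi (sg as (lk v as))) \<in> denY"
    by (simp add: sg_fscale[of as "lk v as"] fe_scale fe_gen Phi_fscale BY_ysc additive_diff[OF ysc_additive])
qed (intro add_minus additive_comp[OF Phi_additive] additive_comp[OF BY_additive] free_extend_additive Phi_additive)

subsection \<open>The relations are respected\<close>

text \<open>Prefixing several tensor factors at once, in order to change a factor in the middle of a tensor.\<close>

definition stars :: "'a poly set list \<Rightarrow> (nat list \<Rightarrow>\<^sub>0 'a) \<Rightarrow> (nat list \<Rightarrow>\<^sub>0 'a)" where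
  "stars as v = foldr star as v"

lemma stars_additive: "additive (stars as)"
proof (induction as)
  case (Cons a as)
  have "stars (a # as) = (\<lambda>v. star a (stars as v))" by (simp add: stars_def fun_eq_iff)
  then show ?case using additive_comp[OF star_additive Cons] by simp
qed (simp add: stars_def additive_def)

lemma phi_stars: "phi (xs @ ys) = stars xs (phi ys)"
  by (induction xs) (simp_all add: stars_def)

lemma stars_ysc: "stars xs (ysc c v) = ysc c (stars xs v)"
  by (induction xs) (simp_all add: stars_def star_ysc)

lemma star_add: "a \<in> carrier A \<Longrightarrow> b \<in> carrier A \<Longrightarrow> star (a \<oplus>\<^bsub>A\<^esub> b) v = star a v + star b v"
  by (rule poly_mapping_eqI) (auto simp: lk_star cf_add lookup_add distrib_right split: list.split)

lemma star_io_l: "a \<in> carrier A \<Longrightarrow> star (io x \<otimes>\<^bsub>A\<^esub> a) v = cm ((*) x) (star a v)"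
  by (rule poly_mapping_eqI) (auto simp: lk_star io_expand_l lk_cm[OF mult_additive] mult.assoc split: list.split)

lemma star_io_r: "a \<in> carrier A \<Longrightarrow> star (a \<otimes>\<^bsub>A\<^esub> io x) v = star a (cm ((*) x) v)"
  by (rule poly_mapping_eqI)
    (auto simp: lk_star io_expand_r lk_cm[OF mult_additive] mult.assoc pow_mult split: list.split)

lemma star_io: "star (io x) v = pre 0 (cm ((*) x) v)"
  by (rule poly_mapping_eqI) (auto simp: lk_star cf_io lk_pre lk_cm[OF mult_additive] n_pos split: list.split)

lemma cm_scale_one: "cm ((*) (scale c 1)) v = ysc c v"
  by (rule poly_mapping_eqI) (simp add: lk_cm[OF mult_additive] lk_ysc scale_mult_left[symmetric])

lemma Rz_stars_pre0: "Rz (stars (a # xs) (pre 0 v)) = 0"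
proof (rule Rz_zero)
  have "ks (stars xs (pre 0 v)) \<subseteq> {t. 0 \<in> set t}" for xs
  proof (induction xs)
    case (Cons b xs)
    have e: "stars (b # xs) (pre 0 v) = star b (stars xs (pre 0 v))" by (simp add: stars_def)
    have "{i # t | i t. i < n \<and> t \<in> ks (stars xs (pre 0 v))} \<subseteq> {t. 0 \<in> set t}" using Cons by auto
    then show ?case unfolding e by (rule order.trans[OF keys_star])
  qed (auto simp: stars_def keys_pre)
  note z = this
  fix t assume "t \<in> ks (stars (a # xs) (pre 0 v))"
  then obtain i u where "t = i # u" "u \<in> ks (stars xs (pre 0 v))"
    using keys_star[of a "stars xs (pre 0 v)"] by (auto simp: stars_def)
  with subsetD[OF z] show "0 \<in> set (tl t)" by auto
qed

text \<open>Right multiplication of a word by the scalar \<open>x\<close>, in normal form.\<close>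

definition rm :: "'a \<Rightarrow> (nat list \<Rightarrow>\<^sub>0 'a) \<Rightarrow> (nat list \<Rightarrow>\<^sub>0 'a)" where
  "rm x = ext (\<lambda>t \<mu>. sg t (\<mu> * (\<alpha> ^^ sum_list t) x))"

lemma rm_additive: "additive (rm x)"
  unfolding rm_def by (rule ext_additive) (simp add: additive_def distrib_right single_add)

lemma rm_sg: "rm x (sg t \<mu>) = sg t (\<mu> * (\<alpha> ^^ sum_list t) x)"
  unfolding rm_def by (simp add: ext_single)

lemma star_rm: "star a (rm x v) = rm x (star a v)"
proof (rule additive_eq[where F = "\<lambda>v. star a (rm x v)" and G = "\<lambda>v. rm x (star a v)"])
  fix t show "star a (rm x (sg t (lk v t))) = rm x (star a (sg t (lk v t)))"
    by (simp add: rm_sg star_sg additive_sum[OF rm_additive] pow_mult pow_pow mult.assoc)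
qed (rule additive_comp[OF star_additive rm_additive] additive_comp[OF rm_additive star_additive])+

lemma phi_cyclic: "a \<in> carrier A \<Longrightarrow> phi (xs @ [a \<otimes>\<^bsub>A\<^esub> io x]) = rm x (phi (xs @ [a]))"
  by (induction xs) (simp_all add: star_io_r cm_sg[OF mult_additive] star_rm[symmetric] rm_sg)

lemma rm_cm: "rm x v - cm ((*) x) v \<in> denY"
proof (rule additive_mem[where F = "\<lambda>v. rm x v - cm ((*) x) v", OF _ denY_0 denY_add])
  fix t show "rm x (sg t (lk v t)) - cm ((*) x) (sg t (lk v t)) \<in> denY"
    using TC_gen[of "lk v t" "sum_list t" x]
    by (simp add: rm_sg cm_sg[OF mult_additive] additive_diff[OF sg_additive, symmetric] denY_sg)
qed (intro add_minus rm_additive cm_additive mult_additive)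

text \<open>The relations of the tensor product over \<open>K\<close> hold exactly for normal forms, reducedness holds after \<open>Rz\<close>, and
  cyclicity produces the twisted commutators in \<open>denY\<close>.\<close>

lemma Phi_rel:
  assumes "v \<in> cyclic_tensor_rel scale A io r"
  shows "Phi v \<in> denY"
  using assms
proof (induction rule: cyclic_tensor_rel.induct)
  case (add xs a ys a')
  then have "a \<in> carrier A" by (auto simp: tuples_def)
  with add show ?case
    by (simp add: additive_diff[OF Phi_additive] Phi_gen phi_stars star_add additiveD[OF stars_additive]
        additiveD[OF Rz_additive] denY_0)
next
  case (smult xs a ys c)
  then have "a \<in> carrier A" by (auto simp: tuples_def)
  then show ?case
    by (simp add: additive_diff[OF Phi_additive] Phi_gen Phi_fscale phi_stars star_io_l cm_scale_one stars_ysc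
        Rz_ysc denY_0)
next
  case (balanced xs a a' ys x)
  then have "a \<in> carrier A" "a' \<in> carrier A" by (auto simp: tuples_def)
  then show ?case
    by (simp add: additive_diff[OF Phi_additive] Phi_gen phi_stars star_io_l star_io_r denY_0)
next
  case (reduced a0 xs a ys x)
  then have "a \<in> carrier A" by (auto simp: tuples_def)
  then have "phi (a0 # xs @ (a \<oplus>\<^bsub>A\<^esub> io x) # ys) = phi (a0 # xs @ a # ys) + stars (a0 # xs) (pre 0 (cm ((*) x) (phi ys)))"
    using phi_stars[of "a0 # xs" "(a \<oplus>\<^bsub>A\<^esub> io x) # ys"] phi_stars[of "a0 # xs" "a # ys"]
    by (simp add: star_add star_io additiveD[OF stars_additive])
  then have "Rz (phi (a0 # xs @ (a \<oplus>\<^bsub>A\<^esub> io x) # ys)) = Rz (phi (a0 # xs @ a # ys))"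
    by (simp only: additiveD[OF Rz_additive] Rz_stars_pre0 add_0_right)
  then show ?case by (simp add: additive_diff[OF Phi_additive] Phi_gen denY_0)
next
  case (cyclic as x)
  then have len: "length as = Suc r" and car: "set as \<subseteq> carrier A" by (auto simp: tuples_def)
  obtain bs c where as: "as = bs @ [c]" using len by (cases as rule: rev_cases) auto
  have 1: "phi (as[r := (as ! r) \<otimes>\<^bsub>A\<^esub> io x]) = rm x (phi as)"
  proof -
    have r: "r = length bs" using as len by simp
    have "as[r := (as ! r) \<otimes>\<^bsub>A\<^esub> io x] = bs @ [c \<otimes>\<^bsub>A\<^esub> io x]" by (simp add: as r)
    then show ?thesis using as car by (simp add: phi_cyclic)
  qed
  obtain b cs where as': "as = b # cs" using len by (cases as) auto
  have 2: "phi (as[0 := io x \<otimes>\<^bsub>A\<^esub> (as ! 0)]) = cm ((*) x) (phi as)"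
    using as' car by (simp add: star_io_l)
  show ?case
    using denY_Rz[OF rm_cm[of x "phi as"]]
    by (simp add: additive_diff[OF Phi_additive] Phi_gen 1 2 additive_diff[OF Rz_additive])
qed

abbreviation "Dn r \<equiv> module.span fscale (cyclic_tensor_rel scale A io r)"

lemma Dn_sub: "module.subspace fscale (Dn r)"
  by (rule free_space.subspace_span)

lemmas Dn_0 = free_space.subspace_0[OF Dn_sub] and Dn_add = free_space.subspace_add[OF Dn_sub]
  and Dn_diff = free_space.subspace_diff[OF Dn_sub] and Dn_scale = free_space.subspace_scale[OF Dn_sub]
  and Dn_neg = free_space.subspace_neg[OF Dn_sub] and Dn_sum = free_space.subspace_sum[OF Dn_sub]
  and Dn_base = free_space.span_base

lemma Phi_Dn: "v \<in> Dn r \<Longrightarrow> Phi v \<in> denY"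
proof (erule free_space.span_induct[where P = "\<lambda>v. Phi v \<in> denY"])
  show "module.subspace fscale {v. Phi v \<in> denY}"
    by (rule free_space.subspaceI)
      (auto simp: additive_0[OF Phi_additive] additiveD[OF Phi_additive] Phi_fscale denY_0 denY_add denY_ysc)
qed (rule Phi_rel)


definition X :: "nat \<Rightarrow> 'a poly set" where "X i = cl (monom 1 i)"

text \<open>The tensor represented by a word and a coefficient.\<close>

definition bt :: "nat list \<Rightarrow> 'a \<Rightarrow> 'a poly set list" where
  "bt t \<mu> = cl (monom \<mu> (hd t)) # map X (tl t)"

definition Psi :: "nat \<Rightarrow> (nat list \<Rightarrow>\<^sub>0 'a) \<Rightarrow> ('a poly set list \<Rightarrow>\<^sub>0 'k)" where
  "Psi r v = (\<Sum>t\<in>Wt r. gen (bt t (lk v t)))"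

lemma bt_tuples: "t \<in> Wt r \<Longrightarrow> bt t \<mu> \<in> tuples A r"
  by (auto simp: bt_def tuples_def X_def Wt_def)

lemma keys_Psi: "ks (Psi r v) \<subseteq> tuples A r"
  unfolding Psi_def by (rule order.trans[OF keys_sum]) (auto simp: bt_tuples)

lemma star_monom: "i < n \<Longrightarrow> star (cl (monom \<mu> i)) v = pre i (cm (lc \<mu> i) v)"
  by (rule poly_mapping_eqI) (auto simp: lk_star lk_pre lk_cm[OF lc_additive] lc_def cf_monom split: list.split)

lemma phi_X: "set u \<subseteq> {..<n} \<Longrightarrow> phi (map X u) = sg u 1"
  by (induction u) (auto simp: X_def star_monom cm_sg[OF lc_additive] lc_def pre_sg pow_1)

lemma phi_bt: "t \<in> un r \<Longrightarrow> phi (bt t \<mu>) = sg t \<mu>"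
  by (cases t) (auto simp: un_def bt_def phi_X star_monom cm_sg[OF lc_additive] lc_def pre_sg pow_1)

lemma Phi_bt: "t \<in> Wt r \<Longrightarrow> Phi (gen (bt t \<mu>)) = sg t \<mu>"
  by (simp add: Phi_gen Wt_un phi_bt[of t r] Rz_sg)

lemma Phi_Psi: "ks v \<subseteq> Wt r \<Longrightarrow> Phi (Psi r v) = v"
proof -
  assume v: "ks v \<subseteq> Wt r"
  have "Phi (Psi r v) = (\<Sum>t\<in>Wt r. sg t (lk v t))"
    by (simp add: Psi_def additive_sum[OF Phi_additive] Phi_bt)
  also have "\<dots> = (\<Sum>t\<in>ks v. sg t (lk v t))"
    by (rule sum.mono_neutral_right[OF finite_Wt v]) (auto simp: in_keys_iff)
  finally show ?thesis using pm_expand[of v] by simp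
qed

subsection \<open>Every tensor is congruent to its normal form\<close>

lemma slot_add:
  assumes "xs @ cl p # ys \<in> tuples A r"
  shows "gen (xs @ cl (p + q) # ys) - gen (xs @ cl p # ys) - gen (xs @ cl q # ys) \<in> Dn r"
  using Dn_base[OF cyclic_tensor_rel.add[OF assms cl_in[of q], where scale = scale and \<iota> = io]] by (simp add: cl_add)

lemma slot_zero:
  assumes "xs @ cl p # ys \<in> tuples A r"
  shows "gen (xs @ cl 0 # ys) \<in> Dn r"
proof -
  have "xs @ cl 0 # ys \<in> tuples A r" using assms by (auto simp: tuples_def)
  from Dn_neg[OF slot_add[OF this, of 0]] show ?thesis by simp
qed

lemma slot_sum:
  assumes "xs @ cl 0 # ys \<in> tuples A r"
  shows "gen (xs @ cl (\<Sum>i\<in>S. p i) # ys) - (\<Sum>i\<in>S. gen (xs @ cl (p i) # ys)) \<in> Dn r"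
proof (induction S rule: infinite_finite_induct)
  case (insert x S)
  have "xs @ cl (p x) # ys \<in> tuples A r" using assms by (auto simp: tuples_def)
  from Dn_add[OF insert.IH slot_add[OF this, of "sum p S"]] insert.hyps show ?case
    by (simp add: algebra_simps)
qed (simp_all add: slot_zero[OF assms])

lemma slot_reduced:
  assumes "a0 # xs @ cl p # ys \<in> tuples A r"
  shows "gen (a0 # xs @ io x # ys) \<in> Dn r"
proof -
  have t: "a0 # xs @ cl 0 # ys \<in> tuples A r" using assms by (auto simp: tuples_def)
  have "gen (a0 # xs @ cl 0 # ys) \<in> Dn r" using slot_zero[of "a0 # xs" 0 ys r] t by simp
  with Dn_base[OF cyclic_tensor_rel.reduced[OF t, where scale = scale and \<iota> = io and l = x]]
  have "gen (a0 # xs @ (cl 0 \<oplus>\<^bsub>A\<^esub> io x) # ys) - gen (a0 # xs @ cl 0 # ys) + gen (a0 # xs @ cl 0 # ys) \<in> Dn r"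
    by (rule Dn_add)
  then show ?thesis by (simp add: cl_add)
qed

lemma io_mult_X: "io c \<otimes>\<^bsub>A\<^esub> X i = cl (monom c i)"
  by (simp add: X_def cl_mult monom_0[symmetric] om_monom)

lemma slot_balanced:
  assumes "xs @ a # X i # ys \<in> tuples A r"
  shows "gen (xs @ a # cl (monom c i) # ys) - gen (xs @ (a \<otimes>\<^bsub>A\<^esub> io c) # X i # ys) \<in> Dn r"
  using Dn_neg[OF Dn_base[OF cyclic_tensor_rel.balanced[OF assms, where scale = scale and \<iota> = io and l = c]]] by (simp add: io_mult_X)

lemma mult_io_expand:
  assumes "y \<in> carrier A"
  shows "y \<otimes>\<^bsub>A\<^esub> io \<mu> = cl (\<Sum>i<n. monom (cf y i * (\<alpha> ^^ i) \<mu>) i)"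
proof (rule A_eqI)
  interpret ring A by (rule A_ring)
  show "y \<otimes>\<^bsub>A\<^esub> io \<mu> \<in> carrier A" using assms by simp
  fix i assume i: "i < n"
  have "cf (cl (\<Sum>j<n. monom (cf y j * (\<alpha> ^^ j) \<mu>) j)) i = (\<Sum>j<n. if j = i then cf y i * (\<alpha> ^^ i) \<mu> else 0)"
    unfolding cf_cl additive_sum[OF red_additive] by (intro sum.cong) (auto simp: red_monom)
  then show "cf (y \<otimes>\<^bsub>A\<^esub> io \<mu>) i = cf (cl (\<Sum>i<n. monom (cf y i * (\<alpha> ^^ i) \<mu>) i)) i"
    using i by (simp add: io_expand_r[OF assms])
qed simp

lemma Wd_Suc: "Wd (Suc m) = (\<lambda>(t, i). i # t) ` (Wd m \<times> {1..<n})"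
proof -
  have "t \<in> Wd (Suc m) \<Longrightarrow> t \<in> (\<lambda>(t, i). i # t) ` (Wd m \<times> {1..<n})" for t
    by (cases t) (auto simp: Wd_def image_iff)
  then show ?thesis by (auto simp: Wd_def)
qed

text \<open>The factors are expanded in powers of \<open>x\<close> from right to left; the coefficients that appear are handed over to the factor on the
  left by the balancing relation, and the terms with \<open>x\<^sup>0\<close> vanish by reducedness.\<close>

lemma suffix_normal:
  "xs @ a # ys \<in> tuples A r \<Longrightarrow>
   gen (xs @ a # ys) - (\<Sum>t\<in>Wd (length ys). gen (xs @ (a \<otimes>\<^bsub>A\<^esub> io (lk (phi ys) t)) # map X t)) \<in> Dn r"
proof (induction ys arbitrary: xs a)
  case Nil
  interpret ring A by (rule A_ring)
  have "a \<in> carrier A" using Nil by (auto simp: tuples_def)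
  then have "a \<otimes>\<^bsub>A\<^esub> io 1 = a" using r_one[of a] by (simp add: cl_one)
  moreover have "Wd 0 = {[]}" by (auto simp: Wd_def)
  ultimately show ?case by (simp add: Dn_0)
next
  case (Cons y ys)
  have y: "y \<in> carrier A" using Cons.prems by (auto simp: tuples_def)
  define \<mu> where "\<mu> t = lk (phi ys) t" for t
  define \<nu> where "\<nu> t i = cf y i * (\<alpha> ^^ i) (\<mu> t)" for t i
  have 1: "gen (xs @ a # y # ys) - (\<Sum>t\<in>Wd (length ys). gen (xs @ a # (y \<otimes>\<^bsub>A\<^esub> io (\<mu> t)) # map X t)) \<in> Dn r"
    using Cons.IH[of "xs @ [a]" y] Cons.prems by (simp add: \<mu>_def)
  have 2: "gen (xs @ a # (y \<otimes>\<^bsub>A\<^esub> io (\<mu> t)) # map X t) -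
      (\<Sum>i\<in>{1..<n}. gen (xs @ (a \<otimes>\<^bsub>A\<^esub> io (\<nu> t i)) # map X (i # t))) \<in> Dn r"
    if t: "t \<in> Wd (length ys)" for t
  proof -
    have tup: "xs @ a # cl p # map X t \<in> tuples A r" for p
      using Cons.prems t by (auto simp: tuples_def X_def Wd_def)
    have "gen (xs @ a # (y \<otimes>\<^bsub>A\<^esub> io (\<mu> t)) # map X t) - (\<Sum>i<n. gen (xs @ a # cl (monom (\<nu> t i) i) # map X t)) \<in> Dn r"
      using slot_sum[of "xs @ [a]" "map X t" r "\<lambda>i. monom (\<nu> t i) i" "{..<n}"] tup[of 0]
      by (simp add: mult_io_expand[OF y] \<nu>_def)
    moreover have "{..<n} = insert 0 {1..<n}" using n_pos by auto
    ultimately have 3: "gen (xs @ a # (y \<otimes>\<^bsub>A\<^esub> io (\<mu> t)) # map X t) - (gen (xs @ a # cl (monom (\<nu> t 0) 0) # map X t) +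
        (\<Sum>i\<in>{1..<n}. gen (xs @ a # cl (monom (\<nu> t i) i) # map X t))) \<in> Dn r" by simp
    have 4: "gen (xs @ a # cl (monom (\<nu> t 0) 0) # map X t) \<in> Dn r"
    proof (cases xs)
      case Nil
      then show ?thesis using slot_reduced[of a "[]" 0 "map X t" r "\<nu> t 0"] tup[of 0] by (simp add: monom_0)
    next
      case (Cons x0 xs')
      then show ?thesis using slot_reduced[of x0 "xs' @ [a]" 0 "map X t" r "\<nu> t 0"] tup[of 0] by (simp add: monom_0)
    qed
    have 5: "(\<Sum>i\<in>{1..<n}. gen (xs @ a # cl (monom (\<nu> t i) i) # map X t)) -
        (\<Sum>i\<in>{1..<n}. gen (xs @ (a \<otimes>\<^bsub>A\<^esub> io (\<nu> t i)) # map X (i # t))) \<in> Dn r"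
      unfolding sum_subtractf[symmetric]
      using slot_balanced tup by (intro Dn_sum) (simp add: X_def)
    from Dn_add[OF Dn_add[OF 3 4] 5] show ?thesis by (simp add: algebra_simps)
  qed
  have "(\<Sum>t\<in>Wd (length ys). gen (xs @ a # (y \<otimes>\<^bsub>A\<^esub> io (\<mu> t)) # map X t)) -
      (\<Sum>t\<in>Wd (length ys). \<Sum>i\<in>{1..<n}. gen (xs @ (a \<otimes>\<^bsub>A\<^esub> io (\<nu> t i)) # map X (i # t))) \<in> Dn r"
    unfolding sum_subtractf[symmetric] using 2 by (rule Dn_sum)
  from Dn_add[OF 1 this] have "gen (xs @ a # y # ys) -
      (\<Sum>t\<in>Wd (length ys). \<Sum>i\<in>{1..<n}. gen (xs @ (a \<otimes>\<^bsub>A\<^esub> io (\<nu> t i)) # map X (i # t))) \<in> Dn r" by simp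
  also have "(\<Sum>t\<in>Wd (length ys). \<Sum>i\<in>{1..<n}. gen (xs @ (a \<otimes>\<^bsub>A\<^esub> io (\<nu> t i)) # map X (i # t))) =
      (\<Sum>t\<in>Wd (Suc (length ys)). gen (xs @ (a \<otimes>\<^bsub>A\<^esub> io (lk (phi (y # ys)) t)) # map X t) :: _ \<Rightarrow>\<^sub>0 'k)"
    unfolding Wd_Suc sum.cartesian_product
    by (subst sum.reindex) (auto simp: inj_on_def lk_star \<nu>_def \<mu>_def intro!: sum.cong)
  finally show ?case by simp
qed

lemma Psi_eq_gen: "Psi r v = (\<Sum>t\<in>Wd r. \<Sum>i<n. gen (bt (i # t) (lk v (i # t))))"
proof -
  have "(\<Sum>t\<in>Wd r. \<Sum>i<n. gen (bt (i # t) (lk v (i # t)))) =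
      (\<Sum>i<n. \<Sum>t\<in>Wd r. gen (bt (i # t) (lk v (i # t))) :: _ \<Rightarrow>\<^sub>0 'k)" by (rule sum.swap)
  also have "\<dots> = Psi r v"
    unfolding Psi_def Wt_image sum.cartesian_product by (subst sum.reindex) (auto simp: inj_on_def intro!: sum.cong)
  finally show ?thesis by simp
qed

lemma Psi_phi: "as \<in> tuples A r \<Longrightarrow> gen as - Psi r (phi as) \<in> Dn r"
proof -
  assume as: "as \<in> tuples A r"
  then obtain a0 ys where a: "as = a0 # ys" "length ys = r" "a0 \<in> carrier A" by (cases as) (auto simp: tuples_def)
  have 1: "gen as - (\<Sum>t\<in>Wd r. gen ((a0 \<otimes>\<^bsub>A\<^esub> io (lk (phi ys) t)) # map X t)) \<in> Dn r"
    using suffix_normal[of "[]" a0 ys r] as a by simp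
  have "(\<Sum>t\<in>Wd r. gen ((a0 \<otimes>\<^bsub>A\<^esub> io (lk (phi ys) t)) # map X t)) - Psi r (phi as) \<in> Dn r"
    unfolding Psi_eq_gen sum_subtractf[symmetric]
  proof (rule Dn_sum)
    fix t assume t: "t \<in> Wd r"
    have "[] @ cl 0 # map X t \<in> tuples A r" using t by (auto simp: tuples_def X_def Wd_def)
    from slot_sum[OF this, of "\<lambda>i. monom (cf a0 i * (\<alpha> ^^ i) (lk (phi ys) t)) i" "{..<n}"]
    show "gen ((a0 \<otimes>\<^bsub>A\<^esub> io (lk (phi ys) t)) # map X t) - (\<Sum>i<n. gen (bt (i # t) (lk (phi as) (i # t)))) \<in> Dn r"
      by (simp add: mult_io_expand[OF a(3)] a(1) lk_star bt_def)
  qed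
  from Dn_add[OF 1 this] show ?thesis by simp
qed

text \<open>The map \<open>Psi\<close> is additive only up to the defining relations of the tensor product.\<close>

lemma bt_add: "t \<in> Wt r \<Longrightarrow> gen (bt t (\<mu> + \<nu>)) - gen (bt t \<mu>) - gen (bt t \<nu>) \<in> Dn r"
  using slot_add[of "[]" "monom \<mu> (hd t)" "map X (tl t)" r "monom \<nu> (hd t)"] bt_tuples[of t r \<mu>]
  by (simp add: bt_def add_monom)

lemma bt_scale: "t \<in> Wt r \<Longrightarrow> gen (bt t (scale c \<mu>)) - fscale c (gen (bt t \<mu>)) \<in> Dn r"
  using Dn_base[OF cyclic_tensor_rel.smult[where xs = "[]" and a = "cl (monom \<mu> (hd t))" and ys = "map X (tl t)"
      and A = A and r = r and \<iota> = io and scale = scale and c = c]] bt_tuples[of t r \<mu>]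
  by (simp add: bt_def cl_mult monom_0[symmetric] om_monom scale_mult_left[symmetric])

lemma Psi_add: "Psi r (u + v) - Psi r u - Psi r v \<in> Dn r"
  unfolding Psi_def sum_subtractf[symmetric] by (rule Dn_sum) (simp add: lookup_add bt_add)

lemma Psi_scale: "Psi r (ysc c v) - fscale c (Psi r v) \<in> Dn r"
  unfolding Psi_def free_space.scale_sum_right sum_subtractf[symmetric]
  by (rule Dn_sum) (simp add: lk_ysc bt_scale)

lemma Psi_Rz: "Psi r (Rz v) = Psi r v"
  unfolding Psi_def by (intro sum.cong) (auto simp: Wt_un lk_Rz)

lemma Psi_Phi: "ks z \<subseteq> tuples A r \<Longrightarrow> z - Psi r (Phi z) \<in> Dn r"
proof -
  assume z: "ks z \<subseteq> tuples A r"
  have P0: "Psi r 0 \<in> Dn r" using Dn_neg[OF Psi_add[of r 0 0]] by simp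
  have "(\<Sum>x\<in>S. sg x (lk z x)) - Psi r (Phi (\<Sum>x\<in>S. sg x (lk z x))) \<in> Dn r" if "S \<subseteq> ks z" for S
    using finite_subset[OF that finite_keys] that
  proof (induction S rule: finite_induct)
    case empty
    then show ?case using Dn_neg[OF P0] by (simp add: additive_0[OF Phi_additive])
  next
    case (insert x S)
    define u where "u = (\<Sum>x\<in>S. sg x (lk z x))"
    define c where "c = lk z x"
    have x: "x \<in> tuples A r" using insert z by blast
    have 1: "u - Psi r (Phi u) \<in> Dn r" using insert by (simp add: u_def)
    have 2: "gen x - Psi r (Phi (gen x)) \<in> Dn r" using Psi_phi[OF x] by (simp add: Phi_gen Psi_Rz)
    have 3: "Psi r (Phi (fscale c (gen x))) - fscale c (Psi r (Phi (gen x))) \<in> Dn r"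
      using Psi_scale by (simp add: Phi_fscale)
    have 4: "Psi r (Phi (sg x c + u)) - Psi r (Phi (sg x c)) - Psi r (Phi u) \<in> Dn r"
      using Psi_add by (simp add: additiveD[OF Phi_additive])
    have 5: "sg x c - Psi r (Phi (sg x c)) \<in> Dn r"
      using Dn_diff[OF Dn_scale[OF 2, of c] 3]
      by (simp add: sg_fscale[of x c] free_space.scale_right_diff_distrib)
    from Dn_diff[OF Dn_add[OF 5 1] 4] have "(sg x c + u) - Psi r (Phi (sg x c + u)) \<in> Dn r"
      by (simp add: algebra_simps)
    then show ?case using insert by (simp add: u_def c_def)
  qed
  from this[OF order_refl] show ?thesis using pm_expand[of z] by simp
qed

text \<open>The cyclic relation, applied to \<open>x' x\<^bsup>i\<^sub>0\<^esup> \<otimes> \<dots> \<otimes> x\<^bsup>i\<^sub>r\<^esup>\<close> and a scalar \<open>y\<close>, is exactly a generator of the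
  twisted commutators after \<open>y\<close> has been moved to the front.\<close>

lemma bt_TC:
  assumes t: "t \<in> Wt r" and m: "\<mu> \<in> TC (sum_list t)"
  shows "gen (bt t \<mu>) \<in> Dn r"
proof (rule TC_induct[OF m, of "{\<mu>. gen (bt t \<mu>) \<in> Dn r}", simplified])
  have z: "gen (bt t 0) \<in> Dn r" using Dn_neg[OF bt_add[OF t, of 0 0]] by simp
  show "subspace {\<mu>. gen (bt t \<mu>) \<in> Dn r}"
  proof (rule subspaceI, simp_all add: z)
    fix x y assume "gen (bt t x) \<in> Dn r" "gen (bt t y) \<in> Dn r"
    from Dn_add[OF Dn_add[OF bt_add[OF t, of x y] this(1)] this(2)] show "gen (bt t (x + y)) \<in> Dn r"
      by (simp add: algebra_simps)
  next
    fix c x assume "gen (bt t x) \<in> Dn r"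
    from Dn_add[OF bt_scale[OF t, of c x] Dn_scale[OF this, of c]] show "gen (bt t (scale c x)) \<in> Dn r" by simp
  qed
  fix y x'
  define as where "as = bt t x'"
  have as: "as \<in> tuples A r" using bt_tuples[OF t] by (simp add: as_def)
  have tu: "t \<in> un r" using t by (simp add: Wt_un)
  interpret ring A by (rule A_ring)
  have len: "length as = Suc r" and car: "set as \<subseteq> carrier A" using as by (auto simp: tuples_def)
  obtain bs c where bc: "as = bs @ [c]" using len by (cases as rule: rev_cases) auto
  have rb: "r = length bs" using bc len by simp
  have cc: "c \<in> carrier A" and cb: "set bs \<subseteq> carrier A" using car bc by auto
  define as1 where "as1 = bs @ [c \<otimes>\<^bsub>A\<^esub> io y]"
  have as1: "as1 \<in> tuples A r" using cc cb rb by (auto simp: as1_def tuples_def)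
  have p1: "phi as1 = sg t (x' * (\<alpha> ^^ sum_list t) y)"
    using phi_cyclic[OF cc, of bs y] bc phi_bt[OF tu, of x'] by (simp add: as1_def as_def rm_sg)
  have "gen (as[r := (as ! r) \<otimes>\<^bsub>A\<^esub> io y]) - gen (as[0 := io y \<otimes>\<^bsub>A\<^esub> (as ! 0)]) \<in> Dn r"
    by (rule Dn_base[OF cyclic_tensor_rel.cyclic[OF as, where scale = scale and \<iota> = io and l = y]])
  moreover have "as[r := (as ! r) \<otimes>\<^bsub>A\<^esub> io y] = as1" by (simp add: bc rb as1_def)
  moreover have "as[0 := io y \<otimes>\<^bsub>A\<^esub> (as ! 0)] = bt t (y * x')"
    by (simp add: as_def bt_def cl_mult monom_0[symmetric] om_monom)
  ultimately have 1: "gen as1 - gen (bt t (y * x')) \<in> Dn r" by simp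
  have z: "gen (bt s 0) \<in> Dn r" if "s \<in> Wt r" for s using Dn_neg[OF bt_add[OF that, of 0 0]] by simp
  have "Psi r (phi as1) = gen (bt t (x' * (\<alpha> ^^ sum_list t) y)) + (\<Sum>s\<in>Wt r - {t}. gen (bt s 0))"
    unfolding Psi_def p1 by (subst sum.remove[OF finite_Wt t]) (auto simp: lookup_single when_def intro!: sum.cong split: if_splits)
  moreover have S: "(\<Sum>s\<in>Wt r - {t}. gen (bt s 0)) \<in> Dn r" using z by (intro Dn_sum) auto
  ultimately have 2: "gen as1 - gen (bt t (x' * (\<alpha> ^^ sum_list t) y)) \<in> Dn r"
    using Dn_add[OF Psi_phi[OF as1] S] by (simp add: algebra_simps)
  have 3: "gen (bt t (x' * (\<alpha> ^^ sum_list t) y - y * x')) - gen (bt t (x' * (\<alpha> ^^ sum_list t) y)) + gen (bt t (y * x')) \<in> Dn r"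
    using Dn_neg[OF bt_add[OF t, of "x' * (\<alpha> ^^ sum_list t) y - y * x'" "y * x'"]] by (simp add: algebra_simps)
  from Dn_add[OF 3 Dn_diff[OF 1 2]] show "gen (bt t (x' * (\<alpha> ^^ sum_list t) y - y * x')) \<in> Dn r"
    by (simp add: algebra_simps)
qed

lemma Phi_kernel: "ks z \<subseteq> tuples A r \<Longrightarrow> Phi z \<in> denY \<Longrightarrow> z \<in> Dn r"
proof -
  assume z: "ks z \<subseteq> tuples A r" "Phi z \<in> denY"
  have "Psi r (Phi z) \<in> Dn r"
    unfolding Psi_def using z(2) by (intro Dn_sum bt_TC) (auto simp: denY_def)
  from Dn_add[OF Psi_Phi[OF z(1)] this] show ?thesis by simp
qed

subsection \<open>The comparison of the two mixed complexes\<close>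

abbreviation "relative_complex \<equiv> relative_mixed_complex scale A io"

definition normal_complex :: "('k, nat list \<Rightarrow>\<^sub>0 'a) mixed_complex" where
  "normal_complex = \<lparr>mc_space = (\<lambda>r. \<lparr>qscale = ysc, qnum = {v. ks v \<subseteq> Wt r}, qden = denY\<rparr>),
     mc_b = (\<lambda>r v. if r = 0 then 0 else bY v), mc_B = BY\<rparr>"

lemma keys_fscale: "ks (fscale c v) \<subseteq> ks v"
  by (auto simp: in_keys_iff lookup_fscale)

lemma keys_fe: "(\<And>x. x \<in> ks v \<Longrightarrow> ks (h x) \<subseteq> S) \<Longrightarrow> ks (free_extend h v) \<subseteq> S"
  unfolding free_extend_def by (intro order.trans[OF keys_sum] UN_least order.trans[OF keys_fscale])

lemma keys_hochschild: "as \<in> tuples A (Suc r) \<Longrightarrow> ks (hochschild_b A (Suc r) as :: _ \<Rightarrow>\<^sub>0 'k) \<subseteq> tuples A r"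
proof -
  assume as: "as \<in> tuples A (Suc r)"
  then have l: "length as = Suc (Suc r)" by (simp add: tuples_def)
  show ?thesis
    unfolding hochschild_b_faces[OF A_ring l zero_less_Suc]
    using tuples_face[OF A_ring as]
    by (intro order.trans[OF keys_sum] UN_least order.trans[OF keys_fscale]) auto
qed

lemma keys_connes: "as \<in> tuples A r \<Longrightarrow> ks (connes_B A r as :: _ \<Rightarrow>\<^sub>0 'k) \<subseteq> tuples A (Suc r)"
proof -
  assume as: "as \<in> tuples A r"
  then have l: "length as = Suc r" by (simp add: tuples_def)
  have "\<one>\<^bsub>A\<^esub> # rotate i as \<in> tuples A (Suc r)" for i
    using as by (auto simp: tuples_def cl_one)
  then show ?thesis
    unfolding connes_B_rotate[OF A_ring l]
    by (intro order.trans[OF keys_sum] UN_least order.trans[OF keys_fscale]) auto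
qed

lemma rel_num: "qnum (mc_space relative_complex r) = {v. ks v \<subseteq> tuples A r}"
  and rel_den: "qden (mc_space relative_complex r) = Dn r"
  and rel_scale: "qscale (mc_space relative_complex r) = fscale"
  and rel_b: "mc_b relative_complex r = free_extend (hochschild_b A r)"
  and rel_B: "mc_B relative_complex r = free_extend (connes_B A r)"
  by (simp_all add: relative_mixed_complex_def cyclic_tensor_def)

lemma keys_rel_b: "ks v \<subseteq> tuples A (Suc r) \<Longrightarrow> ks (free_extend (hochschild_b A (Suc r)) v :: _ \<Rightarrow>\<^sub>0 'k) \<subseteq> tuples A r"
  and keys_rel_B: "ks v \<subseteq> tuples A r \<Longrightarrow> ks (free_extend (connes_B A r) v :: _ \<Rightarrow>\<^sub>0 'k) \<subseteq> tuples A (Suc r)"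
  using keys_hochschild keys_connes by (blast intro!: keys_fe)+

lemma rel_anti: "ks v \<subseteq> tuples A r \<Longrightarrow> free_extend (hochschild_b A (Suc r)) (free_extend (connes_B A r) v) +
    free_extend (connes_B A (r - 1)) (free_extend (hochschild_b A r) v) = (0 :: _ \<Rightarrow>\<^sub>0 'k)"
proof (rule additive_eq[where F = "\<lambda>v. free_extend (hochschild_b A (Suc r)) (free_extend (connes_B A r) v) +
    free_extend (connes_B A (r - 1)) (free_extend (hochschild_b A r) v)" and G = "\<lambda>v. 0"])
  fix as assume "ks v \<subseteq> tuples A r" "as \<in> ks v"
  then have as: "as \<in> tuples A r" by blast
  show "free_extend (hochschild_b A (Suc r)) (free_extend (connes_B A r) (sg as (lk v as))) +
    free_extend (connes_B A (r - 1)) (free_extend (hochschild_b A r) (sg as (lk v as))) = (0 :: _ \<Rightarrow>\<^sub>0 'k)"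
    unfolding fe_single fe_scale free_space.scale_right_distrib[symmetric] bB_Bb[OF A_ring as] by simp
qed (intro add_plus add_zero additive_comp[OF free_extend_additive free_extend_additive])+

lemma rel_bb: "ks v \<subseteq> tuples A (Suc r) \<Longrightarrow>
   free_extend (hochschild_b A r) (free_extend (hochschild_b A (Suc r)) v) = (0 :: _ \<Rightarrow>\<^sub>0 'k)"
proof (rule additive_eq[where F = "\<lambda>v. free_extend (hochschild_b A r) (free_extend (hochschild_b A (Suc r)) v)" and G = "\<lambda>v. 0"])
  fix as assume "ks v \<subseteq> tuples A (Suc r)" "as \<in> ks v"
  then have as: "as \<in> tuples A (Suc r)" by blast
  show "free_extend (hochschild_b A r) (free_extend (hochschild_b A (Suc r)) (sg as (lk v as))) = (0 :: _ \<Rightarrow>\<^sub>0 'k)"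
    unfolding fe_single fe_scale b_b[OF A_ring as] by simp
qed (intro add_zero additive_comp[OF free_extend_additive free_extend_additive])+

lemma denY_cong: "u - v \<in> denY \<Longrightarrow> v \<in> denY \<Longrightarrow> u \<in> denY" and denY_cong': "u - v \<in> denY \<Longrightarrow> u \<in> denY \<Longrightarrow> v \<in> denY"
  using denY_add[of "u - v" v] denY_diff[of u "u - v"] by auto

text \<open>That \<open>b b\<close> vanishes is not checked on normal forms, where overflows and coefficients interfere, but transported from the
  tensors themselves; the same applies to \<open>bB + Bb\<close>.\<close>

lemma normal_bb: "ks v \<subseteq> Wt (Suc (Suc r)) \<Longrightarrow> bY (bY v) \<in> denY"
proof -
  assume v: "ks v \<subseteq> Wt (Suc (Suc r))"
  define z where "z = Psi (Suc (Suc r)) v"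
  have z: "ks z \<subseteq> tuples A (Suc (Suc r))" "Phi z = v" using keys_Psi Phi_Psi[OF v] by (simp_all add: z_def)
  define b where "b = (free_extend (hochschild_b A (Suc (Suc r))) z :: _ \<Rightarrow>\<^sub>0 'k)"
  have 1: "Phi b - bY v \<in> denY" using Phi_b[OF z(1)] z(2) by (simp add: b_def)
  have 2: "Phi (free_extend (hochschild_b A (Suc r)) b) - bY (Phi b) \<in> denY"
    by (rule Phi_b) (simp add: b_def keys_rel_b z)
  have "free_extend (hochschild_b A (Suc r)) b = 0" unfolding b_def by (rule rel_bb[OF z(1)])
  with 2 have "bY (Phi b) \<in> denY" using denY_neg[of "0 - bY (Phi b)"] by (simp add: additive_0[OF Phi_additive])
  moreover have "bY (Phi b) - bY (bY v) \<in> denY"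
    using denY_bY[OF 1] by (simp add: additive_diff[OF bY_additive])
  ultimately show ?thesis by (rule denY_cong'[rotated])
qed

lemma normal_anti: "ks v \<subseteq> Wt r \<Longrightarrow> bY (BY r v) + (if r = 0 then 0 else BY (r - 1) (bY v)) \<in> denY"
proof -
  assume v: "ks v \<subseteq> Wt r"
  define z where "z = Psi r v"
  have z: "ks z \<subseteq> tuples A r" "Phi z = v" using keys_Psi Phi_Psi[OF v] by (simp_all add: z_def)
  define B where "B = (free_extend (connes_B A r) z :: _ \<Rightarrow>\<^sub>0 'k)"
  define b where "b = (free_extend (hochschild_b A r) z :: _ \<Rightarrow>\<^sub>0 'k)"
  have B: "Phi B - BY r v \<in> denY" using Phi_B[OF z(1)] z(2) by (simp add: B_def)
  have b: "Phi b - bY v \<in> denY" using Phi_b[OF z(1)] z(2) by (simp add: b_def)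
  have 1: "Phi (free_extend (hochschild_b A (Suc r)) B) - bY (Phi B) \<in> denY"
    by (rule Phi_b) (simp add: B_def keys_rel_B z)
  have 2: "Phi (free_extend (connes_B A (r - 1)) b) - (if r = 0 then 0 else BY (r - 1) (Phi b)) \<in> denY"
  proof (cases r)
    case 0
    have "b = 0" by (simp add: b_def 0 hochschild_b_def free_extend_def)
    then show ?thesis using 0 by (simp add: fe_0 additive_0[OF Phi_additive] denY_0)
  next
    case (Suc t)
    have "ks b \<subseteq> tuples A t" using keys_rel_b z(1) Suc by (simp add: b_def)
    then show ?thesis using Phi_B[of b t] Suc by simp
  qed
  have "Phi (free_extend (hochschild_b A (Suc r)) B) + Phi (free_extend (connes_B A (r - 1)) b) = 0"
    using rel_anti[OF z(1)] by (simp add: B_def b_def additiveD[OF Phi_additive, symmetric] additive_0[OF Phi_additive])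
  with denY_add[OF 1 2] have 3: "- (bY (Phi B) + (if r = 0 then 0 else BY (r - 1) (Phi b))) \<in> denY"
    by (simp add: algebra_simps)
  have 4: "bY (Phi B) - bY (BY r v) \<in> denY" using denY_bY[OF B] by (simp add: additive_diff[OF bY_additive])
  have 5: "(if r = 0 then 0 else BY (r - 1) (Phi b)) - (if r = 0 then 0 else BY (r - 1) (bY v)) \<in> denY"
    using denY_BY[OF b] by (simp add: additive_diff[OF BY_additive] denY_0)
  from denY_neg[OF denY_add[OF 3 denY_add[OF 4 5]]] show ?thesis by (simp add: algebra_simps)
qed

lemma denY_subspace: "module.subspace ysc denY"
proof -
  interpret v: vector_space ysc by (rule ysc_vs)
  show ?thesis by (rule v.subspaceI) (auto simp: denY_0 denY_add denY_ysc)
qed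

lemma ysc_linearI: "additive f \<Longrightarrow> (\<And>c v. f (ysc c v) = ysc c (f v)) \<Longrightarrow> Vector_Spaces.linear ysc ysc f"
  by (simp add: Vector_Spaces.linear_iff additiveD ysc_vs)

lemma normal_presented: "presented_mixed normal_complex ysc"
proof (rule presented_mixed.intro)
  interpret v: vector_space ysc by (rule ysc_vs)
  fix r v
  show "vector_space ysc" by (rule ysc_vs)
  show "qscale (mc_space normal_complex r) = ysc" by (simp add: normal_complex_def)
  show "module.subspace ysc (qnum (mc_space normal_complex r))"
    unfolding normal_complex_def
    by (rule v.subspaceI) (auto dest!: subsetD[OF keys_add] subsetD[OF ks_ysc])
  show "module.subspace ysc (qden (mc_space normal_complex r))" by (simp add: normal_complex_def denY_subspace)
  show "Vector_Spaces.linear ysc ysc (mc_b normal_complex r)"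
    by (cases "r = 0"; rule ysc_linearI)
      (simp_all add: normal_complex_def bY_ysc bY_additive add_zero additive_0[OF ysc_additive])
  show "Vector_Spaces.linear ysc ysc (mc_B normal_complex r)"
    by (rule ysc_linearI) (auto simp: normal_complex_def BY_ysc intro: BY_additive)
  show "mc_b normal_complex (Suc r) v \<in> qnum (mc_space normal_complex r)"
    if "v \<in> qnum (mc_space normal_complex (Suc r))" using that by (simp add: normal_complex_def keys_bY)
  show "mc_B normal_complex r v \<in> qnum (mc_space normal_complex (Suc r))"
    if "v \<in> qnum (mc_space normal_complex r)" using that by (simp add: normal_complex_def keys_BYr)
  show "mc_b normal_complex (Suc r) v \<in> qden (mc_space normal_complex r)"
    if "v \<in> qden (mc_space normal_complex (Suc r))" using that by (simp add: normal_complex_def denY_bY)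
  show "mc_B normal_complex r v \<in> qden (mc_space normal_complex (Suc r))"
    if "v \<in> qden (mc_space normal_complex r)" using that by (simp add: normal_complex_def denY_BY)
  show "mc_b normal_complex 0 v = 0" by (simp add: normal_complex_def)
  show "mc_b normal_complex (Suc r) (mc_B normal_complex r v) + mc_B normal_complex (r - 1) (mc_b normal_complex r v)
      \<in> qden (mc_space normal_complex r)" if "v \<in> qnum (mc_space normal_complex r)"
    using that normal_anti[of v r] by (simp add: normal_complex_def additive_0[OF BY_additive] split: if_splits)
  show "mc_B normal_complex (Suc r) (mc_B normal_complex r v) \<in> qden (mc_space normal_complex (Suc (Suc r)))"
    by (simp add: normal_complex_def BY_BY denY_0)
qed

lemma relative_presented: "presented_mixed relative_complex fscale"
proof (rule presented_mixed.intro)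
  fix r and v :: "'a poly set list \<Rightarrow>\<^sub>0 'k"
  show "vector_space (fscale :: 'k \<Rightarrow> ('a poly set list \<Rightarrow>\<^sub>0 'k) \<Rightarrow> _)" by (rule free_space.vector_space_axioms)
  show "qscale (mc_space relative_complex r) = fscale" by (rule rel_scale)
  show "module.subspace fscale (qnum (mc_space relative_complex r))"
    unfolding rel_num by (rule free_space.subspaceI) (auto dest!: subsetD[OF keys_add] subsetD[OF keys_fscale])
  show "module.subspace fscale (qden (mc_space relative_complex r))" unfolding rel_den by (rule Dn_sub)
  show "Vector_Spaces.linear fscale fscale (mc_b relative_complex r)" unfolding rel_b by (rule fe_linear)
  show "Vector_Spaces.linear fscale fscale (mc_B relative_complex r)" unfolding rel_B by (rule fe_linear)
  show "mc_b relative_complex (Suc r) v \<in> qnum (mc_space relative_complex r)"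
    if "v \<in> qnum (mc_space relative_complex (Suc r))" using that by (simp add: rel_num rel_b keys_rel_b)
  show "mc_B relative_complex r v \<in> qnum (mc_space relative_complex (Suc r))"
    if "v \<in> qnum (mc_space relative_complex r)" using that by (simp add: rel_num rel_B keys_rel_B)
  show "mc_b relative_complex (Suc r) v \<in> qden (mc_space relative_complex r)"
    if "v \<in> qnum (mc_space relative_complex (Suc r))" "v \<in> qden (mc_space relative_complex (Suc r))"
    using that Phi_Dn[of v] Phi_b[of v "Suc r"] denY_bY[of "Phi v"] denY_cong
    unfolding rel_num rel_den rel_b by (intro Phi_kernel) (auto simp: keys_rel_b)
  show "mc_B relative_complex r v \<in> qden (mc_space relative_complex (Suc r))"
    if "v \<in> qnum (mc_space relative_complex r)" "v \<in> qden (mc_space relative_complex r)"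
    using that Phi_Dn[of v] Phi_B[of v r] denY_BY[of "Phi v" r] denY_cong
    unfolding rel_num rel_den rel_B by (intro Phi_kernel) (auto simp: keys_rel_B)
  show "mc_b relative_complex 0 v = 0"
    unfolding rel_b by (simp add: free_extend_def hochschild_b_def)
  show "mc_b relative_complex (Suc r) (mc_B relative_complex r v) + mc_B relative_complex (r - 1) (mc_b relative_complex r v)
      \<in> qden (mc_space relative_complex r)" if "v \<in> qnum (mc_space relative_complex r)"
    using that rel_anti[of v r] unfolding rel_num rel_den rel_b rel_B by (simp add: Dn_0)
  show "mc_B relative_complex (Suc r) (mc_B relative_complex r v) \<in> qden (mc_space relative_complex (Suc (Suc r)))"
    if "v \<in> qnum (mc_space relative_complex r)"
    unfolding rel_den rel_B
  proof (rule Phi_kernel)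
    have v: "ks v \<subseteq> tuples A r" using that by (simp add: rel_num)
    note k = keys_rel_B[OF v]
    show "ks (free_extend (connes_B A (Suc r)) (free_extend (connes_B A r) v) :: _ \<Rightarrow>\<^sub>0 'k) \<subseteq> tuples A (Suc (Suc r))"
      by (rule keys_rel_B[OF k])
    have "BY (Suc r) (Phi (free_extend (connes_B A r) v)) - BY (Suc r) (BY r (Phi v)) \<in> denY"
      using denY_BY[OF Phi_B[OF v], of "Suc r"] by (simp add: additive_diff[OF BY_additive])
    then have "BY (Suc r) (Phi (free_extend (connes_B A r) v)) \<in> denY" by (simp add: BY_BY)
    with Phi_B[OF k] show "Phi (free_extend (connes_B A (Suc r)) (free_extend (connes_B A r) v)) \<in> denY"
      by (rule denY_cong)
  qed
qed

text \<open>The map \<open>Phi\<close> is already an isomorphism of mixed complexes, which makes the cone condition trivial: one takes \<open>s' = Psi z\<close>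
  and \<open>z' = 0\<close>.\<close>

theorem relative_HC_normal: "cyclic_homology relative_complex r \<cong>\<^sub>q cyclic_homology normal_complex r"
proof -
  interpret mixed_quasi_iso relative_complex fscale normal_complex ysc "\<lambda>r. Phi"
  proof (intro mixed_quasi_iso.intro mixed_quasi_iso_axioms.intro relative_presented normal_presented)
    fix r
    show "Vector_Spaces.linear fscale ysc Phi"
      using ysc_vs free_space.vector_space_axioms
      by (auto simp: Vector_Spaces.linear_iff additiveD[OF Phi_additive] Phi_fscale)
    fix z :: "nat list \<Rightarrow>\<^sub>0 'a" and s :: "'a poly set list \<Rightarrow>\<^sub>0 'k"
    assume "z \<in> qnum (mc_space normal_complex (Suc r))" "s \<in> qnum (mc_space relative_complex r)"
      and c: "mc_b normal_complex (Suc r) z - Phi s \<in> qden (mc_space normal_complex r)"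
    then have z: "ks z \<subseteq> Wt (Suc r)" and s: "ks s \<subseteq> tuples A r" and c: "bY z - Phi s \<in> denY"
      by (simp_all add: normal_complex_def rel_num)
    define s' where "s' = Psi (Suc r) z"
    have s': "ks s' \<subseteq> tuples A (Suc r)" "Phi s' = z" using keys_Psi Phi_Psi[OF z] by (simp_all add: s'_def)
    have "s - free_extend (hochschild_b A (Suc r)) s' \<in> Dn r"
    proof (rule Phi_kernel)
      show "ks (s - free_extend (hochschild_b A (Suc r)) s') \<subseteq> tuples A r"
        using keys_diff[of s] keys_rel_b[OF s'(1)] s by blast
      have "- ((bY z - Phi s) + (Phi (free_extend (hochschild_b A (Suc r)) s') - bY z)) \<in> denY"
        using Phi_b[OF s'(1)] s'(2) c by (intro denY_neg denY_add) auto
      then show "Phi (s - free_extend (hochschild_b A (Suc r)) s') \<in> denY"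
        by (simp add: additive_diff[OF Phi_additive])
    qed
    then show "\<exists>s'\<in>qnum (mc_space relative_complex (Suc r)). \<exists>z'\<in>qnum (mc_space normal_complex (Suc (Suc r))).
         z - Phi s' - mc_b normal_complex (Suc (Suc r)) z' \<in> qden (mc_space normal_complex (Suc r)) \<and>
         s - mc_b relative_complex (Suc r) s' \<in> qden (mc_space relative_complex r)"
      using s' by (intro bexI[of _ s'] bexI[of _ 0])
        (auto simp: normal_complex_def rel_num rel_den rel_b additive_0[OF bY_additive] denY_0)
  next
    fix z :: "nat list \<Rightarrow>\<^sub>0 'a"
    assume "z \<in> qnum (mc_space normal_complex 0)"
    then have z: "ks z \<subseteq> Wt 0" by (simp add: normal_complex_def)
    show "\<exists>s'\<in>qnum (mc_space relative_complex 0). \<exists>z'\<in>qnum (mc_space normal_complex 1).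
        z - Phi s' - mc_b normal_complex 1 z' \<in> qden (mc_space normal_complex 0)"
      using keys_Psi Phi_Psi[OF z] by (intro bexI[of _ "Psi 0 z"] bexI[of _ 0])
        (auto simp: normal_complex_def rel_num additive_0[OF bY_additive] denY_0)
  qed (simp_all add: normal_complex_def rel_num rel_den rel_b rel_B keys_Phi Phi_Dn
      denY_neg[OF Phi_b, simplified] denY_neg[OF Phi_B, simplified])
  show ?thesis by (rule cyclic_homology_iso(1))
qed

end

section \<open>Words and their merging complex\<close>

context twisted_algebra
begin

text \<open>A word has the weight \<open>i\<^sub>0 + \<dots> + i\<^sub>r\<close>. Merging preserves the weight, or lowers it by \<open>n\<close> when there is an overflow;
  the functions \<open>mg0\<close> and \<open>bp\<close> keep only the part that preserves it. This part is the reduced bar differential of the algebra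
  \<open>k[x]/(x\<^sup>n)\<close>.\<close>

definition mg0 :: "nat list \<Rightarrow> 'a \<Rightarrow> (nat list \<Rightarrow>\<^sub>0 'a)" where
  "mg0 t \<mu> = (case t of i # j # u \<Rightarrow> if i + j < n then sg ((i + j) # u) \<mu> else 0 | _ \<Rightarrow> 0)"

fun bp :: "nat list \<Rightarrow> 'a \<Rightarrow> (nat list \<Rightarrow>\<^sub>0 'a)" where
  "bp (i # j # t) \<mu> = mg0 (i # j # t) \<mu> - pre i (bp (j # t) \<mu>)"
| "bp _ \<mu> = 0"

lemma mg0_additive: "additive (mg0 t)"
  by (auto simp: additive_def mg0_def single_add split: list.split)

lemma bp_additive: "additive (bp t)"
proof (induction t rule: induct_list012)
  case (3 i j t)
  have "bp (i # j # t) = (\<lambda>\<mu>. mg0 (i # j # t) \<mu> - pre i (bp (j # t) \<mu>))" by (simp add: fun_eq_iff)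
  then show ?case by (simp only:) (intro add_minus mg0_additive additive_comp[OF pre_additive] 3)
qed (simp_all add: add_zero)

lemmas E_mg0 = ext_additive[of mg0, OF mg0_additive] and E_bp = ext_additive[of bp, OF bp_additive]

lemma E_mg0_sg: "ext mg0 (sg t \<mu>) = mg0 t \<mu>" and E_bp_sg: "ext bp (sg t \<mu>) = bp t \<mu>"
  by (simp_all add: ext_single additive_0[OF mg0_additive] additive_0[OF bp_additive])

lemma bp_pre: "ext bp (pre i v) = ext mg0 (pre i v) - pre i (ext bp v)"
proof (rule additive_eq[where F = "\<lambda>v. ext bp (pre i v)" and G = "\<lambda>v. ext mg0 (pre i v) - pre i (ext bp v)"])
  fix t show "ext bp (pre i (sg t (lk v t))) = ext mg0 (pre i (sg t (lk v t))) - pre i (ext bp (sg t (lk v t)))"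
    by (cases t) (simp_all add: pre_sg E_bp_sg E_mg0_sg mg0_def additive_0[OF pre_additive])
qed (intro add_minus additive_comp[OF E_bp pre_additive] additive_comp[OF E_mg0 pre_additive] additive_comp[OF pre_additive E_bp])+

lemma mg0_pre_pre: "ext mg0 (pre i (pre j v)) = (if i + j < n then pre (i + j) v else 0)"
proof (rule additive_eq[where F = "\<lambda>v. ext mg0 (pre i (pre j v))" and G = "\<lambda>v. if i + j < n then pre (i + j) v else 0"])
  show "additive (\<lambda>v. if i + j < n then pre (i + j) v else 0)"
    by (cases "i + j < n") (simp_all add: pre_additive add_zero)
qed (auto simp: pre_sg E_mg0_sg mg0_def intro: additive_comp[OF E_mg0] additive_comp[OF pre_additive pre_additive])

lemma bp_bp: "ext bp (bp t \<mu>) = 0"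
proof (induction t rule: induct_list012)
  case (3 i j t)
  show ?case
  proof (cases t)
    case Nil
    then show ?thesis
      by (simp add: additive_diff[OF E_bp] mg0_def E_bp_sg bp_pre additive_0[OF pre_additive] additive_0[OF E_bp])
  next
    case (Cons k s)
    define z where "z = bp (k # s) \<mu>"
    have 1: "ext bp (pre i (bp (j # t) \<mu>)) = ext mg0 (pre i (mg0 (j # k # s) \<mu>)) - (if i + j < n then pre (i + j) z else 0)"
    proof -
      have "ext bp (bp (j # t) \<mu>) = 0" using "3.IH"(2) by simp
      then have "ext bp (pre i (bp (j # t) \<mu>)) = ext mg0 (pre i (bp (j # t) \<mu>))"
        by (simp only: bp_pre additive_0[OF pre_additive] diff_zero)
      then show ?thesis
        by (simp add: Cons additive_diff[OF pre_additive] additive_diff[OF E_mg0] mg0_pre_pre z_def)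
    qed
    have 2: "ext bp (mg0 (i # j # t) \<mu>) = (if i + j < n then mg0 ((i + j) # k # s) \<mu> - pre (i + j) z else 0)"
    proof -
      have "mg0 (i # j # t) \<mu> = (if i + j < n then sg ((i + j) # t) \<mu> else 0)" by (simp add: mg0_def)
      then show ?thesis by (simp add: Cons E_bp_sg z_def additive_0[OF E_bp])
    qed
    have 3: "ext mg0 (pre i (mg0 (j # k # s) \<mu>)) = (if i + j < n then mg0 ((i + j) # k # s) \<mu> else 0)"
      by (auto simp: mg0_def pre_sg E_mg0_sg additive_0[OF pre_additive] additive_0[OF E_mg0] add.assoc)
    show ?thesis by (simp add: additive_diff[OF E_bp] 1 2 3)
  qed
qed (simp_all add: additive_0[OF E_bp])

lemma bp_bp': "ext bp (ext bp v) = 0"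
  by (rule additive_eq[where F = "\<lambda>v. ext bp (ext bp v)" and G = "\<lambda>v. 0"])
    (simp_all add: E_bp_sg bp_bp additive_comp[OF E_bp E_bp] add_zero)

definition Ww :: "nat \<Rightarrow> nat \<Rightarrow> nat list set" where
  "Ww m M = {t. length t = m \<and> set t \<subseteq> {1..<n} \<and> sum_list t = M}"

lemma keys_mg0: "ks (mg0 t \<mu>) \<subseteq> {u. \<exists>i j w. t = i # j # w \<and> i + j < n \<and> u = (i + j) # w}"
  by (auto simp: mg0_def split: list.splits)

lemma keys_bp_gen: "ks (bp t \<mu>) \<subseteq> {u. Suc (length u) = length t \<and> sum_list u = sum_list t \<and>
    (set t \<subseteq> {1..<n} \<longrightarrow> set u \<subseteq> {1..<n})}"
proof (induction t rule: induct_list012)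
  case (3 i j t)
  show ?case
  proof
    fix u assume "u \<in> ks (bp (i # j # t) \<mu>)"
    then have "u \<in> ks (mg0 (i # j # t) \<mu>) \<or> u \<in> (#) i ` ks (bp (j # t) \<mu>)"
      using keys_diff[of "mg0 (i # j # t) \<mu>" "pre i (bp (j # t) \<mu>)"] by (auto simp: keys_pre)
    then show "u \<in> {u. Suc (length u) = length (i # j # t) \<and> sum_list u = sum_list (i # j # t) \<and>
        (set (i # j # t) \<subseteq> {1..<n} \<longrightarrow> set u \<subseteq> {1..<n})}"
    proof
      assume "u \<in> ks (mg0 (i # j # t) \<mu>)"
      with subsetD[OF keys_mg0] show ?thesis by fastforce
    next
      assume "u \<in> (#) i ` ks (bp (j # t) \<mu>)"
      then obtain w where "u = i # w" "w \<in> ks (bp (j # t) \<mu>)" by blast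
      with subsetD[OF "3.IH"(2)] show ?thesis by auto
    qed
  qed
qed simp_all

lemma keys_bp: "t \<in> Ww (Suc m) M \<Longrightarrow> ks (bp t \<mu>) \<subseteq> Ww m M"
  using keys_bp_gen[of t \<mu>] by (auto simp: Ww_def)

text \<open>Chains with all coefficients in \<open>D\<close>. In a fixed weight \<open>j\<close> the denominators have this form, with \<open>D\<close> the space of
  \<open>\<alpha>\<^sup>j\<close>-commutators.\<close>

definition dd :: "'a set \<Rightarrow> ('x \<Rightarrow>\<^sub>0 'a) set" where "dd D = {v. \<forall>t. lk v t \<in> D}"

lemma dd_0: "subspace D \<Longrightarrow> 0 \<in> dd D"
  and dd_add: "subspace D \<Longrightarrow> u \<in> dd D \<Longrightarrow> v \<in> dd D \<Longrightarrow> u + v \<in> dd D"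
  and dd_diff: "subspace D \<Longrightarrow> u \<in> dd D \<Longrightarrow> v \<in> dd D \<Longrightarrow> u - v \<in> dd D"
  and dd_neg: "subspace D \<Longrightarrow> u \<in> dd D \<Longrightarrow> - u \<in> dd D"
  by (auto simp: dd_def lookup_add lookup_minus subspace_0 subspace_add subspace_diff subspace_neg)

lemma dd_sg: "subspace D \<Longrightarrow> \<mu> \<in> D \<Longrightarrow> sg t \<mu> \<in> dd D"
  by (auto simp: dd_def lookup_single when_def subspace_0)

lemma dd_pre: "subspace D \<Longrightarrow> pre i v \<in> dd D \<longleftrightarrow> v \<in> dd D"
proof
  assume D: "subspace D"
  show "v \<in> dd D" if "pre i v \<in> dd D"
    unfolding dd_def
  proof (intro CollectI allI)
    fix t
    have "lk (pre i v) (i # t) \<in> D" using that unfolding dd_def by blast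
    then show "lk v t \<in> D" by (simp add: lk_pre)
  qed
  show "pre i v \<in> dd D" if "v \<in> dd D"
    using that D by (auto simp: dd_def lk_pre subspace_0 split: list.split)
qed

lemma dd_mem:
  assumes "subspace D" "additive F" "v \<in> dd D" "\<And>t \<mu>. \<mu> \<in> D \<Longrightarrow> F (sg t \<mu>) \<in> dd D"
  shows "F v \<in> dd D"
  by (rule additive_mem[OF assms(2) dd_0[OF assms(1)] dd_add[OF assms(1)]]) (use assms in \<open>auto simp: dd_def\<close>)

lemma dd_bp1: "subspace D \<Longrightarrow> \<mu> \<in> D \<Longrightarrow> bp t \<mu> \<in> dd D"
proof (induction t rule: induct_list012)
  case (3 i j t)
  have "mg0 (i # j # t) \<mu> \<in> dd D" using 3 by (simp add: mg0_def dd_sg dd_0)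
  then show ?case using 3 by (simp add: dd_diff dd_pre)
qed (simp_all add: dd_0)

lemma dd_bp: "subspace D \<Longrightarrow> v \<in> dd D \<Longrightarrow> ext bp v \<in> dd D"
  by (rule dd_mem[OF _ E_bp]) (auto simp: E_bp_sg dd_bp1)

text \<open>The predicate \<open>chi\<close> singles out the words that represent a nontrivial cohomology class: it sees a word of length
  \<open>2m\<close> only if its consecutive pairs all have sum at least \<open>n\<close>.\<close>

fun chi :: "nat list \<Rightarrow> bool" where
  "chi (i # j # t) = (n \<le> i + j \<and> chi t)"
| "chi _ = True"

text \<open>These functionals compute the homology of the merging complex. It is nonzero only in length \<open>2k\<close> and weight \<open>n k\<close>, and in
  length \<open>2k + 1\<close> and weight \<open>n k + 1\<close>; in odd length the first entry has to be \<open>1\<close> then and is left out.\<close>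

definition chs :: "(nat list \<Rightarrow>\<^sub>0 'a) \<Rightarrow> 'a" where "chs = ext (\<lambda>t \<mu>. if chi t then \<mu> else 0)"
definition chf :: "nat \<Rightarrow> (nat list \<Rightarrow>\<^sub>0 'a) \<Rightarrow> 'a" where
  "chf m = ext (\<lambda>t \<mu>. if (if even m then chi t else chi (tl t)) then \<mu> else 0)"

lemma chs_additive: "additive chs" and chf_additive: "additive (chf m)"
  unfolding chs_def chf_def by (rule ext_additive; simp add: additive_def)+

lemma chs_sg: "chs (sg t \<mu>) = (if chi t then \<mu> else 0)"
  and chf_sg: "chf m (sg t \<mu>) = (if (if even m then chi t else chi (tl t)) then \<mu> else 0)"
  unfolding chs_def chf_def by (simp_all add: ext_single)

lemma chf_dd: "subspace D \<Longrightarrow> v \<in> dd D \<Longrightarrow> chf m v \<in> D"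
proof (rule additive_mem[OF chf_additive])
  fix t assume D: "subspace D" and "v \<in> dd D"
  then have "lk v t \<in> D" by (simp add: dd_def)
  then show "chf m (sg t (lk v t)) \<in> D" using subspace_0[OF D] by (simp add: chf_sg)
qed (simp_all add: subspace_0 subspace_add)

lemma chf_even: "even m \<Longrightarrow> chf m v = chs v" by (simp add: chf_def chs_def)

lemma chi_sum: "even (length t) \<Longrightarrow> chi t \<Longrightarrow> n * (length t div 2) \<le> sum_list t"
  by (induction t rule: induct_list012) auto

lemma chs_pre_pre: "chs (pre i (pre j v)) = (if n \<le> i + j then chs v else 0)"
proof (rule additive_eq[where F = "\<lambda>v. chs (pre i (pre j v))" and G = "\<lambda>v. if n \<le> i + j then chs v else 0"])
  show "additive (\<lambda>v. if n \<le> i + j then chs v else 0)"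
    by (cases "n \<le> i + j") (simp_all add: chs_additive add_zero)
qed (auto simp: pre_sg chs_sg intro: additive_comp[OF chs_additive] additive_comp[OF pre_additive pre_additive])

text \<open>The contributions of the two mergings that involve a common entry cancel, except at the two ends of the word.\<close>

lemma chs_bp: "odd (length t) \<Longrightarrow> chs (bp t \<mu>) = (if chi (tl t) then \<mu> else 0) - (if chi (butlast t) then \<mu> else 0)"
proof (induction t rule: length_induct)
  case (1 t)
  show ?case
  proof (cases "length t = 1")
    case True
    then obtain a where "t = [a]" by (auto simp: length_Suc_conv)
    then show ?thesis by (simp add: additive_0[OF chs_additive])
  next
    case False
    then obtain a b c u where t: "t = a # b # c # u"
      using 1(2) by (cases t; cases "tl t"; cases "tl (tl t)") auto
    have IH: "chs (bp (c # u) \<mu>) = (if chi u then \<mu> else 0) - (if chi (butlast (c # u)) then \<mu> else 0)"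
      using 1 t by simp
    have "bp t \<mu> = mg0 t \<mu> - pre a (mg0 (b # c # u) \<mu>) + pre a (pre b (bp (c # u) \<mu>))"
      by (simp add: t additive_diff[OF pre_additive])
    then have "chs (bp t \<mu>) = chs (mg0 t \<mu>) - chs (pre a (mg0 (b # c # u) \<mu>)) + (if n \<le> a + b then chs (bp (c # u) \<mu>) else 0)"
      by (simp add: additiveD[OF chs_additive] additive_diff[OF chs_additive] chs_pre_pre)
    also have "chs (mg0 t \<mu>) = (if a + b < n \<and> n \<le> a + b + c \<and> chi u then \<mu> else 0)"
      by (simp add: t mg0_def chs_sg additive_0[OF chs_additive])
    also have "chs (pre a (mg0 (b # c # u) \<mu>)) = (if b + c < n \<and> n \<le> a + b + c \<and> chi u then \<mu> else 0)"
      by (simp add: mg0_def pre_sg chs_sg additive_0[OF chs_additive] additive_0[OF pre_additive] add.assoc)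
    finally show ?thesis unfolding IH by (auto simp: t)
  qed
qed

text \<open>In the exceptional weights a word that remains after removing an end entry has too small a weight for \<open>chi\<close>.\<close>

lemma chf_bp_exceptional:
  assumes t: "t \<in> Ww (Suc m) (n * (m div 2) + m mod 2)"
  shows "chf m (bp t \<mu>) = 0"
proof (cases "even m")
  case True
  have len: "length t = Suc m" and pos: "set t \<subseteq> {1..<n}" and sm: "sum_list t = n * (m div 2)"
    using t True by (auto simp: Ww_def)
  obtain a u where au: "t = a # u" using len by (cases t) auto
  obtain w b where wb: "t = w @ [b]" using len by (cases t rule: rev_cases) auto
  have "a \<in> set t" "b \<in> set t" unfolding au by (simp, simp add: wb[unfolded au])
  then have "a \<ge> 1" "b \<ge> 1" using pos by (auto simp: subset_iff)
  then have "\<not> chi (tl t)" "\<not> chi (butlast t)"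
  proof -
    have "length u = m" using len au by simp
    moreover have "length w = m" using arg_cong[OF wb, of length] len by simp
    moreover have "a + sum_list u = n * (m div 2)" using sm au by simp
    moreover have "sum_list w + b = n * (m div 2)" using arg_cong[OF wb, of sum_list] sm by simp
    ultimately have "\<not> chi u" "\<not> chi w" using chi_sum[of u] chi_sum[of w] True \<open>a \<ge> 1\<close> \<open>b \<ge> 1\<close> by auto
    moreover have "tl t = u" "butlast t = w" unfolding au by (simp, simp add: wb[unfolded au])
    ultimately show "\<not> chi (tl t)" "\<not> chi (butlast t)" by simp_all
  qed
  then show ?thesis using chs_bp[of t \<mu>] True len by (simp add: chf_even)
next
  case False
  then obtain k where k: "m = 2 * k + 1" using oddE by blast
  have len: "length t = 2 * k + 2" and pos: "set t \<subseteq> {1..<n}" and sm: "sum_list t = n * k + 1"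
    using t k by (auto simp: Ww_def)
  obtain a b u where t': "t = a # b # u" using len by (cases t; cases "tl t") auto
  obtain w c where wc: "b # u = w @ [c]" by (cases "b # u" rule: rev_cases) auto
  have "c \<in> set (b # u)" by (simp add: wc)
  then have "c \<in> set t" "a \<in> set t" "b \<in> set t" by (auto simp: t')
  then have p: "a \<ge> 1" "b \<ge> 1" "c \<ge> 1" using pos by (auto simp: subset_iff)
  have lw: "length w = 2 * k" using arg_cong[OF wc, of length] len t' by simp
  have sw: "sum_list w + c = b + sum_list u" using arg_cong[OF wc, of sum_list] by simp
  have nu: "\<not> chi u" using chi_sum[of u] len t' sm p by auto
  have nw: "\<not> chi w" using chi_sum[of w] lw sm t' sw p by auto
  have z: "chs (bp (b # u) \<mu>) = 0"
  proof -
    have "butlast (b # u) = w" by (simp only: wc butlast_snoc)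
    then show ?thesis using chs_bp[of "b # u" \<mu>] len t' nu nw by (simp del: butlast.simps bp.simps)
  qed
  have "chf m (pre a v) = chs v" for v
    by (rule additive_eq[where F = "\<lambda>v. chf m (pre a v)" and G = chs])
      (auto simp: pre_sg chf_sg chs_sg False intro: additive_comp[OF chf_additive pre_additive] chs_additive)
  then show ?thesis
    using nu False by (simp add: t' additive_diff[OF chf_additive] z mg0_def chf_sg additive_0[OF chf_additive])
qed

lemma chf_Ebp_exceptional:
  assumes "ks v \<subseteq> Ww (Suc m) (n * (m div 2) + m mod 2)"
  shows "chf m (ext bp v) = 0"
proof (rule additive_eq[where F = "\<lambda>v. chf m (ext bp v)" and G = "\<lambda>v. 0"])
  fix t assume "t \<in> ks v"
  then show "chf m (ext bp (sg t (lk v t))) = 0" using assms by (auto simp: E_bp_sg chf_bp_exceptional)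
qed (auto intro: additive_comp[OF chf_additive E_bp] add_zero)

text \<open>The homology of the merging complex. A first entry \<open>i > 1\<close> is removed by splitting it into \<open>1, i - 1\<close>; after that a
  cycle has to begin with \<open>1, n - 1\<close>, and these two entries can be stripped. Only the
  words \<open>1, n - 1, 1, n - 1, \<dots>\<close> survive.\<close>

lemma words_acyclic:
  assumes D: "subspace D"
  shows "ks v \<subseteq> Ww m M \<Longrightarrow> ext bp v \<in> dd D \<Longrightarrow> (M = n * (m div 2) + m mod 2 \<Longrightarrow> chf m v \<in> D) \<Longrightarrow>
    \<exists>v'. ks v' \<subseteq> Ww (Suc m) M \<and> v - ext bp v' \<in> dd D"
proof (induction m arbitrary: v M rule: less_induct)
  case (less m)
  note v = less.prems(1) and cyc = less.prems(2) and exc = less.prems(3)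
  consider "m = 0" | "m = 1" | k where "m = Suc (Suc k)" by (metis One_nat_def not0_implies_Suc)
  then show ?case
  proof cases
    case 1
    have v0: "v = sg [] (lk v [])"
    proof (rule poly_mapping_eqI)
      fix t show "lk v t = lk (sg [] (lk v [])) t"
        using v 1 by (cases "t \<in> ks v") (auto simp: Ww_def lookup_single when_def in_keys_iff)
    qed
    have "lk v [] \<in> D"
    proof (cases "lk v [] = 0")
      case False
      then have "M = 0" using v by (auto simp: Ww_def in_keys_iff subset_iff)
      then have "chf m v \<in> D" using exc 1 by simp
      then show ?thesis using 1 by (subst (asm) v0) (simp add: chf_sg)
    qed (simp add: D subspace_0)
    then have "v \<in> dd D" by (subst v0) (rule dd_sg[OF D])
    then show ?thesis by (intro exI[of _ 0]) (simp add: additive_0[OF E_bp])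
  next
    case 2
    have v0: "v = sg [M] (lk v [M])"
    proof (rule poly_mapping_eqI)
      fix t show "lk v t = lk (sg [M] (lk v [M])) t"
        using v 2 by (cases "t \<in> ks v") (auto simp: Ww_def lookup_single when_def in_keys_iff length_Suc_conv)
    qed
    show ?thesis
    proof (cases "lk v [M] = 0 \<or> M = 1")
      case True
      then have "lk v [M] \<in> D"
      proof
        assume M: "M = 1"
        then have "chf m v \<in> D" using exc 2 by simp
        then show ?thesis using 2 by (subst (asm) v0) (simp add: chf_sg)
      qed (simp add: D subspace_0)
      then have "v \<in> dd D" by (subst v0) (rule dd_sg[OF D])
      then show ?thesis by (intro exI[of _ 0]) (simp add: additive_0[OF E_bp])
    next
      case False
      then have M: "1 < M" "M < n" using v 2 by (auto simp: Ww_def in_keys_iff subset_iff)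
      have "v - ext bp (sg [1, M - 1] (lk v [M])) = 0"
        using M by (subst v0) (simp add: E_bp_sg mg0_def additive_0[OF pre_additive])
      moreover have "ks (sg [1, M - 1] (lk v [M])) \<subseteq> Ww (Suc m) M" using M 2 by (auto simp: Ww_def)
      ultimately show ?thesis using dd_0[OF D] by metis
    qed
  next
    case k: 3
    \<comment> \<open>\<open>u\<close> splits first entries greater than \<open>1\<close>; subtracting its boundary leaves words with first entry \<open>1\<close>\<close>
    define h where "h t \<mu> = (if hd t = 1 then 0 else sg (1 # (hd t - 1) # tl t) \<mu>)" for t :: "nat list" and \<mu> :: 'a
    define g where "g t \<mu> = (if hd t = 1 then sg (tl t) \<mu> else bp ((hd t - 1) # tl t) \<mu>)" for t :: "nat list" and \<mu> :: 'a
    have ha: "additive (h t)" and ga: "additive (g t)" for t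
      by (auto simp: additive_def h_def g_def single_add additiveD[OF bp_additive])
    define u where "u = ext h v"
    define y where "y = ext g v"
    have hd2: "\<exists>i w. t = i # w \<and> 1 \<le> i \<and> i < n" if "t \<in> Ww m M" for t
      using that k by (cases t) (auto simp: Ww_def)
    have uk: "ks u \<subseteq> Ww (Suc m) M"
      unfolding u_def
    proof (intro order.trans[OF keys_ext] UN_least)
      fix t assume "t \<in> ks v"
      then have t: "t \<in> Ww m M" using v by blast
      then obtain i w where "t = i # w" "1 \<le> i" "i < n" using hd2 by blast
      then show "ks (h t (lk v t)) \<subseteq> Ww (Suc m) M" using t by (auto simp: h_def Ww_def)
    qed
    have yk: "ks y \<subseteq> {t. 1 # t \<in> Ww m M}"
      unfolding y_def
    proof (intro order.trans[OF keys_ext] UN_least)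
      fix t assume "t \<in> ks v"
      then have t: "t \<in> Ww m M" using v by blast
      then obtain i w where iw: "t = i # w" "1 \<le> i" "i < n" using hd2 by blast
      show "ks (g t (lk v t)) \<subseteq> {t. 1 # t \<in> Ww m M}"
      proof (cases "i = 1")
        case False
        then have "(i - 1) # w \<in> Ww (Suc (Suc k)) (M - 1)" "M > 0" using t iw k by (auto simp: Ww_def)
        from this(2) have "Ww (Suc k) (M - 1) \<subseteq> {t. 1 # t \<in> Ww m M}" using k n2 by (auto simp: Ww_def)
        from order.trans[OF keys_bp this] \<open>(i - 1) # w \<in> Ww (Suc (Suc k)) (M - 1)\<close>
        show ?thesis using False iw by (simp add: g_def)
      qed (use t iw in \<open>auto simp: g_def\<close>)
    qed
    have w: "v - ext bp u = pre 1 y"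
      unfolding u_def y_def
    proof (rule additive_eq[where F = "\<lambda>v. v - ext bp (ext h v)" and G = "\<lambda>v. pre 1 (ext g v)"])
      fix t assume "t \<in> ks v"
      then obtain i w where iw: "t = i # w" "1 \<le> i" "i < n" using hd2 v by blast
      have "ext h (sg t (lk v t)) = h t (lk v t)" "ext g (sg t (lk v t)) = g t (lk v t)"
        by (simp_all add: ext_single additive_0[OF ha] additive_0[OF ga])
      then show "sg t (lk v t) - ext bp (ext h (sg t (lk v t))) = pre 1 (ext g (sg t (lk v t)))"
        using iw by (simp add: h_def g_def E_bp_sg pre_sg mg0_def additive_0[OF E_bp])
    qed (intro add_minus add_id additive_comp[OF E_bp] additive_comp[OF pre_additive] ext_additive ha ga)+
    have "ext bp (v - ext bp u) \<in> dd D"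
      using cyc by (simp add: additive_diff[OF E_bp] bp_bp')
    then have cy: "ext bp (pre 1 y) \<in> dd D" by (simp only: w)
    define z where "z = ext (\<lambda>t \<mu>. if hd t = n - 1 then sg (tl t) \<mu> else 0) y"
    have za: "additive (\<lambda>\<mu>. if hd t = n - 1 then sg (tl t) (\<mu>::'a) else 0)" for t
      by (simp add: additive_def single_add)
    have ylen: "\<exists>j s. t = j # s \<and> 1 \<le> j \<and> j < n" if "t \<in> ks y" for t
      using that yk k by (cases t) (auto simp: Ww_def subset_iff)
    have lkbp: "lk (ext mg0 (pre 1 y)) (1 # s) = 0" for s
    proof (rule additive_eq[where F = "\<lambda>y. lk (ext mg0 (pre 1 y)) (1 # s)" and G = "\<lambda>y. 0"])
      fix t assume "t \<in> ks y"
      then obtain j w where "t = j # w" "1 \<le> j" using ylen by blast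
      then show "lk (ext mg0 (pre 1 (sg t (lk y t)))) (1 # s) = 0"
        by (simp add: pre_sg E_mg0_sg mg0_def lookup_single when_def)
    qed (auto simp: additive_def lookup_add additiveD[OF E_mg0] additiveD[OF pre_additive])
    have ybp: "ext bp y \<in> dd D"
      unfolding dd_def
    proof (intro CollectI allI)
      fix s
      have "lk (ext bp (pre 1 y)) (1 # s) \<in> D" using cy unfolding dd_def by blast
      then show "lk (ext bp y) s \<in> D"
        using subspace_neg[OF D] lkbp[of s] by (simp add: bp_pre lookup_minus lk_pre) force
    qed
    \<comment> \<open>the merging of \<open>1, j\<close> to \<open>1 + j\<close> is the only source of words with first entry \<open>1 + j\<close>\<close>
    have ysmall: "lk y (j # s) \<in> D" if j: "j \<noteq> n - 1" for j s
    proof (cases "j # s \<in> ks y")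
      case True
      then have j1: "1 \<le> j" "j < n" using ylen by auto
      then have jn: "1 + j < n" using j by simp
      have "lk (ext bp (pre 1 y)) ((1 + j) # s) = lk y (j # s)"
      proof -
        have "lk (ext mg0 (pre 1 y)) ((1 + j) # s) = lk y (j # s)"
        proof (rule additive_eq[where F = "\<lambda>y. lk (ext mg0 (pre 1 y)) ((1 + j) # s)" and G = "\<lambda>y. lk y (j # s)"])
          fix t assume "t \<in> ks y"
          then obtain j' w where "t = j' # w" using ylen by blast
          then show "lk (ext mg0 (pre 1 (sg t (lk y t)))) ((1 + j) # s) = lk (sg t (lk y t)) (j # s)"
            using jn by (auto simp: pre_sg E_mg0_sg mg0_def lookup_single when_def)
        qed (auto simp: additive_def lookup_add additiveD[OF E_mg0] additiveD[OF pre_additive])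
        then show ?thesis using j1 by (simp add: bp_pre lookup_minus lk_pre)
      qed
      then show ?thesis using cy unfolding dd_def by (metis (no_types, lifting) mem_Collect_eq)
    qed (simp add: in_keys_iff D subspace_0)
    have lkz: "lk z s = lk y ((n - 1) # s)" for s
      unfolding z_def
    proof (rule additive_eq[where F = "\<lambda>y. lk (ext (\<lambda>t \<mu>. if hd t = n - 1 then sg (tl t) \<mu> else 0) y) s" and G = "\<lambda>y. lk y ((n - 1) # s)"])
      fix t assume "t \<in> ks y"
      then obtain j w where "t = j # w" using ylen by blast
      then show "lk (ext (\<lambda>t \<mu>. if hd t = n - 1 then sg (tl t) \<mu> else 0) (sg t (lk y t))) s = lk (sg t (lk y t)) ((n - 1) # s)"
        by (auto simp: ext_single lookup_single when_def)
    qed (auto simp: additive_def lookup_add additiveD[OF ext_additive[OF za]] simp del: One_nat_def)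
    have yz: "y - pre (n - 1) z \<in> dd D"
      unfolding dd_def
    proof (intro CollectI allI)
      fix t
      show "lk (y - pre (n - 1) z) t \<in> D"
      proof (cases t)
        case Nil
        then have "t \<notin> ks y" using ylen by blast
        then show ?thesis using Nil D by (simp add: lookup_minus lk_pre in_keys_iff subspace_0)
      next
        case (Cons j s)
        then show ?thesis using ysmall[of j s] D by (cases "j = n - 1") (auto simp: lookup_minus lk_pre lkz subspace_0)
      qed
    qed
    have zk: "ks z \<subseteq> {s. 1 # (n - 1) # s \<in> Ww m M}"
    proof
      fix s assume "s \<in> ks z"
      then have "(n - 1) # s \<in> ks y" by (simp add: in_keys_iff lkz)
      then show "s \<in> {s. 1 # (n - 1) # s \<in> Ww m M}" using yk by blast
    qed
    have big: "ext mg0 (pre (n - 1) x) = 0" if "\<And>t. t \<in> ks x \<Longrightarrow> set t \<subseteq> {1..<n}" for x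
    proof (rule additive_eq[where F = "\<lambda>x. ext mg0 (pre (n - 1) x)" and G = "\<lambda>x. 0"])
      fix t assume "t \<in> ks x"
      with that[OF this] show "ext mg0 (pre (n - 1) (sg t (lk x t))) = 0"
        by (auto simp: pre_sg E_mg0_sg mg0_def split: list.split)
    qed (auto intro: additive_comp[OF E_mg0 pre_additive] add_zero)
    have zbp: "ext bp z \<in> dd D"
    proof -
      have "ext bp (y - pre (n - 1) z) \<in> dd D" by (rule dd_bp[OF D yz])
      from dd_diff[OF D ybp this] have "ext bp (pre (n - 1) z) \<in> dd D" by (simp add: additive_diff[OF E_bp])
      moreover have "ext mg0 (pre (n - 1) z) = 0" using zk by (intro big) (auto simp: Ww_def)
      ultimately have "- pre (n - 1) (ext bp z) \<in> dd D" by (simp add: bp_pre)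
      from dd_neg[OF D this] show ?thesis using D by (simp add: dd_pre)
    qed
    have chz: "chf m v \<in> D \<Longrightarrow> M = n * (m div 2) + m mod 2 \<Longrightarrow> chf k z \<in> D"
    proof -
      assume c: "chf m v \<in> D" and M: "M = n * (m div 2) + m mod 2"
      have "chf m (ext bp u) = 0" using chf_Ebp_exceptional[of u m] uk M by simp
      then have "chf m (v - ext bp u) \<in> D" using c by (simp add: additive_diff[OF chf_additive])
      then have 1: "chf m (pre 1 y) \<in> D" by (simp only: w)
      have "pre 1 (y - pre (n - 1) z) \<in> dd D" using yz D by (simp add: dd_pre)
      then have "chf m (pre 1 (y - pre (n - 1) z)) \<in> D"
        by (rule chf_dd[OF D])
      from subspace_diff[OF D 1 this] have 2: "chf m (pre 1 (pre (n - 1) z)) \<in> D"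
        by (simp add: additive_diff[OF chf_additive] additive_diff[OF pre_additive])
      have "chf m (pre 1 (pre (n - 1) z)) = chf k z"
      proof (rule additive_eq[where F = "\<lambda>z. chf m (pre 1 (pre (n - 1) z))" and G = "chf k"])
        fix t assume t: "t \<in> ks z"
        then have tW: "length t = k" "set t \<subseteq> {1..<n}" using zk k by (auto simp: Ww_def)
        show "chf m (pre 1 (pre (n - 1) (sg t (lk z t)))) = chf k (sg t (lk z t))"
        proof (cases "even k")
          case False
          then obtain i s where "t = i # s" "1 \<le> i" using tW by (cases t) auto
          moreover have "n \<le> n + i - Suc 0" using \<open>1 \<le> i\<close> by linarith
          ultimately show ?thesis using False k n2 by (simp add: pre_sg chf_sg)
        qed (use k n2 in \<open>simp add: pre_sg chf_sg\<close>)
      qed (intro additive_comp[OF chf_additive] additive_comp[OF pre_additive pre_additive] chf_additive)+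
      with 2 show ?thesis by simp
    qed
    show ?thesis
    proof (cases "n \<le> M")
      case True
      have "\<exists>z'. ks z' \<subseteq> Ww (Suc k) (M - n) \<and> z - ext bp z' \<in> dd D"
      proof (rule less.IH)
        show "k < m" using k by simp
        show "ks z \<subseteq> Ww k (M - n)" using zk k n2 by (auto simp: Ww_def)
        show "ext bp z \<in> dd D" by (rule zbp)
        assume "M - n = n * (k div 2) + k mod 2"
        then have "M = n * (m div 2) + m mod 2" using True k by simp
        then show "chf k z \<in> D" using chz exc by simp
      qed
      then obtain z' where z': "ks z' \<subseteq> Ww (Suc k) (M - n)" "z - ext bp z' \<in> dd D" by blast
      have "ks (pre 1 (pre (n - 1) z')) \<subseteq> Ww (Suc m) M"
      proof
        fix t assume "t \<in> ks (pre 1 (pre (n - 1) z'))"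
        then obtain s where s: "t = 1 # (n - 1) # s" "s \<in> ks z'" by (auto simp: keys_pre)
        have "s \<in> Ww (Suc k) (M - n)" using s(2) z'(1) by blast
        then show "t \<in> Ww (Suc m) M" using True k n2 s(1) by (auto simp: Ww_def)
      qed
      then have k1: "ks (u + pre 1 (pre (n - 1) z')) \<subseteq> Ww (Suc m) M"
        using uk keys_add[of u] by blast
      have "ext mg0 (pre (n - 1) z') = 0" using z'(1) by (intro big) (auto simp: Ww_def)
      then have "ext bp (pre 1 (pre (n - 1) z')) = pre 1 (pre (n - 1) (ext bp z'))"
        using n2 by (simp add: bp_pre mg0_pre_pre additive_neg[OF pre_additive])
      then have "v - ext bp (u + pre 1 (pre (n - 1) z')) = pre 1 (y - pre (n - 1) z) + pre 1 (pre (n - 1) (z - ext bp z'))"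
        using w by (simp add: additiveD[OF E_bp] additive_diff[OF pre_additive] algebra_simps)
      also have "\<dots> \<in> dd D" using yz z'(2) D by (intro dd_add) (simp_all add: dd_pre)
      finally show ?thesis using k1 by blast
    next
      case False
      then have "ks z = {}" using zk n2 by (auto simp: Ww_def)
      then have "z = 0" by simp
      then have "v - ext bp u \<in> dd D" using yz D by (simp add: w dd_pre additive_0[OF pre_additive])
      then show ?thesis using uk by blast
    qed
  qed
qed

end

section \<open>Hochschild homology weight by weight\<close>

context twisted_algebra
begin

text \<open>The part of the wrap-around face that preserves the weight, and with it the part \<open>b0\<close> of the whole boundary.\<close>

definition W0 :: "nat list \<Rightarrow> 'a \<Rightarrow> (nat list \<Rightarrow>\<^sub>0 'a)" where
  "W0 t \<mu> = (if 2 \<le> length t \<and> last t + hd t < n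
     then sg ((last t + hd t) # butlast (tl t)) ((\<alpha> ^^ last t) \<mu>) else 0)"

definition b0 :: "nat list \<Rightarrow> 'a \<Rightarrow> (nat list \<Rightarrow>\<^sub>0 'a)" where
  "b0 t \<mu> = bp t \<mu> + sgp (length t - 1) (W0 t \<mu>)"

lemma W0_additive: "additive (W0 t)" by (auto simp: additive_def W0_def pow_add single_add)

lemma b0_additive: "additive (b0 t)"
  unfolding b0_def by (intro add_plus bp_additive add_sgp W0_additive)

lemmas E_b0 = ext_additive[of b0, OF b0_additive]

lemma E_b0_sg: "ext b0 (sg t \<mu>) = b0 t \<mu>"
  by (simp add: ext_single additive_0[OF b0_additive])

definition prt :: "nat \<Rightarrow> (nat list \<Rightarrow>\<^sub>0 'a) \<Rightarrow> (nat list \<Rightarrow>\<^sub>0 'a)" where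
  "prt I = ext (\<lambda>t \<mu>. if sum_list t = I then sg t \<mu> else 0)"

lemma prt_additive: "additive (prt I)"
  unfolding prt_def by (rule ext_additive) (auto simp: additive_def single_add)

lemma prt_sg: "prt I (sg t \<mu>) = (if sum_list t = I then sg t \<mu> else 0)"
  unfolding prt_def by (simp add: ext_single)

lemma lk_prt: "lk (prt I v) t = (if sum_list t = I then lk v t else 0)"
  by (rule additive_eq[where F = "\<lambda>v. lk (prt I v) t" and G = "\<lambda>v. if sum_list t = I then lk v t else 0"])
    (auto simp: additive_def additiveD[OF prt_additive] lookup_add prt_sg lookup_single when_def)

lemma ks_prt: "ks (prt I v) = {t \<in> ks v. sum_list t = I}"
  by (auto simp: in_keys_iff lk_prt split: if_splits)

lemma prt_id: "(\<And>t. t \<in> ks v \<Longrightarrow> sum_list t = I) \<Longrightarrow> prt I v = v"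
  by (rule poly_mapping_eqI) (auto simp: lk_prt in_keys_iff)

lemma prt_null: "(\<And>t. t \<in> ks v \<Longrightarrow> sum_list t \<noteq> I) \<Longrightarrow> prt I v = 0"
  by (rule poly_mapping_eqI) (auto simp: lk_prt in_keys_iff)

lemma keys_diff_sub: "ks a \<subseteq> S \<Longrightarrow> ks b \<subseteq> S \<Longrightarrow> ks (a - b :: 'x \<Rightarrow>\<^sub>0 'a) \<subseteq> S"
  and keys_add_sub: "ks a \<subseteq> S \<Longrightarrow> ks b \<subseteq> S \<Longrightarrow> ks (a + b :: 'x \<Rightarrow>\<^sub>0 'a) \<subseteq> S"
  using keys_diff[of a b] keys_add[of a b] by blast+

lemma bpu_bp: "ks (bpu t \<mu> - bp t \<mu>) \<subseteq> {u. sum_list u + n = sum_list t}"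
proof (induction t rule: induct_list012)
  case (3 i j t)
  have "bpu (i # j # t) \<mu> - bp (i # j # t) \<mu> = (hm i j t \<mu> - mg0 (i # j # t) \<mu>) - pre i (bpu (j # t) \<mu> - bp (j # t) \<mu>)"
    by (simp add: additive_diff[OF pre_additive])
  moreover have "ks (hm i j t \<mu> - mg0 (i # j # t) \<mu>) \<subseteq> {u. sum_list u + n = sum_list (i # j # t)}"
    by (auto simp: hm_def mg0_def)
  moreover have "ks (pre i (bpu (j # t) \<mu> - bp (j # t) \<mu>)) \<subseteq> {u. sum_list u + n = sum_list (i # j # t)}"
    using "3.IH"(2) by (auto simp: keys_pre)
  ultimately show ?case by (simp only: keys_diff_sub)
qed simp_all

lemma wrap_W0:
  "ks (ext mrg (rt t \<mu>) - W0 t \<mu>) \<subseteq> {u. sum_list u + n = sum_list t}"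
proof (cases "2 \<le> length t")
  case True
  then obtain x u j where t: "t = x # u @ [j]" by (cases t; cases "tl t" rule: rev_cases) auto
  show ?thesis by (auto simp: t rt_def W0_def E_mrg_sg hm_def)
next
  case False
  then show ?thesis by (cases t; cases "tl t") (auto simp: rt_def W0_def E_mrg_sg)
qed

lemma keys_W0: "t \<in> Wt (Suc r) \<Longrightarrow> ks (W0 t \<mu>) \<subseteq> {u \<in> Wt r. sum_list u = sum_list t}"
proof -
  assume t: "t \<in> Wt (Suc r)"
  then obtain x u j where xuj: "t = x # u @ [j]"
    by (cases t; cases "tl t" rule: rev_cases) (auto simp: Wt_def)
  show ?thesis using t by (auto simp: xuj W0_def Wt_def)
qed

lemma keys_bp_Wt: "t \<in> Wt (Suc r) \<Longrightarrow> ks (bp t \<mu>) \<subseteq> {u \<in> Wt r. sum_list u = sum_list t}"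
proof -
  assume t: "t \<in> Wt (Suc r)"
  then obtain i j s where ijs: "t = i # j # s" by (cases t; cases "tl t") (auto simp: Wt_def)
  have s: "i < n" "set (j # s) \<subseteq> {1..<n}" "length s = r" using t by (auto simp: ijs Wt_def)
  have "ks (mg0 t \<mu>) \<subseteq> {u \<in> Wt r. sum_list u = sum_list t}"
    using s by (auto simp: ijs mg0_def Wt_def)
  moreover have "ks (pre i (bp (j # s) \<mu>)) \<subseteq> {u \<in> Wt r. sum_list u = sum_list t}"
  proof
    fix u assume "u \<in> ks (pre i (bp (j # s) \<mu>))"
    then obtain w where "u = i # w" "w \<in> ks (bp (j # s) \<mu>)" by (auto simp: keys_pre)
    with subsetD[OF keys_bp_gen this(2)] s show "u \<in> {u \<in> Wt r. sum_list u = sum_list t}"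
      by (auto simp: ijs Wt_def)
  qed
  moreover have "ks (bp t \<mu>) \<subseteq> ks (mg0 t \<mu>) \<union> ks (pre i (bp (j # s) \<mu>))" unfolding ijs bp.simps by (rule keys_diff)
  ultimately show ?thesis by blast
qed

lemma ks_sgp: "ks (sgp r v) = ks (v :: 'x \<Rightarrow>\<^sub>0 'a)" by (simp add: sgp_def keys_neg)

lemma keys_b0: "t \<in> Wt (Suc r) \<Longrightarrow> ks (b0 t \<mu>) \<subseteq> {u \<in> Wt r. sum_list u = sum_list t}"
  using keys_add[of "bp t \<mu>" "sgp (length t - 1) (W0 t \<mu>)"] keys_bp_Wt[of t r \<mu>] keys_W0[of t r \<mu>]
  unfolding b0_def ks_sgp by blast

lemma bY_b0: "t \<in> Wt (Suc r) \<Longrightarrow> ks (bY (sg t \<mu>) - b0 t \<mu>) \<subseteq> {u. sum_list u + n = sum_list t}"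
proof -
  assume t: "t \<in> Wt (Suc r)"
  have "Rz (b0 t \<mu>) = b0 t \<mu>"
  proof (rule poly_mapping_eqI)
    fix u show "lk (Rz (b0 t \<mu>)) u = lk (b0 t \<mu>) u"
      using subsetD[OF keys_b0[OF t, of \<mu>], of u] by (auto simp: lk_Rz in_keys_iff Wt_un)
  qed
  then have "bY (sg t \<mu>) - b0 t \<mu> = Rz (bun t \<mu> - b0 t \<mu>)"
    by (simp add: bY_def E_bun_sg additive_diff[OF Rz_additive])
  moreover have "bun t \<mu> - b0 t \<mu> = (bpu t \<mu> - bp t \<mu>) + sgp (length t - 1) (ext mrg (rt t \<mu>) - W0 t \<mu>)"
    by (simp add: bun_def b0_def sgp_def)
  ultimately have "bY (sg t \<mu>) - b0 t \<mu> = Rz ((bpu t \<mu> - bp t \<mu>) + sgp (length t - 1) (ext mrg (rt t \<mu>) - W0 t \<mu>))"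
    by (simp only:)
  moreover have "ks ((bpu t \<mu> - bp t \<mu>) + sgp (length t - 1) (ext mrg (rt t \<mu>) - W0 t \<mu>)) \<subseteq> {u. sum_list u + n = sum_list t}"
    by (intro keys_add_sub) (simp_all only: ks_sgp bpu_bp wrap_W0)
  ultimately show ?thesis by (auto simp: ks_Rz)
qed

text \<open>The boundary preserves the weight or lowers it by \<open>n\<close>.\<close>

lemma prt_bY:
  assumes "ks v \<subseteq> Wt (Suc r)"
  shows "prt I (bY v) = ext b0 (prt I v) + prt I (bY (prt (I + n) v))"
proof (rule additive_eq[where F = "\<lambda>v. prt I (bY v)" and G = "\<lambda>v. ext b0 (prt I v) + prt I (bY (prt (I + n) v))"])
  fix t assume "t \<in> ks v"
  then have t: "t \<in> Wt (Suc r)" using assms by blast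
  define o' where "o' = bY (sg t (lk v t)) - b0 t (lk v t)"
  have b: "bY (sg t (lk v t)) = b0 t (lk v t) + o'" by (simp add: o'_def)
  have o: "ks o' \<subseteq> {u. sum_list u + n = sum_list t}" unfolding o'_def by (rule bY_b0[OF t])
  have k: "ks (b0 t (lk v t)) \<subseteq> {u \<in> Wt r. sum_list u = sum_list t}" by (rule keys_b0[OF t])
  have 1: "prt I (b0 t (lk v t)) = (if sum_list t = I then b0 t (lk v t) else 0)"
    using subsetD[OF k] by (auto intro!: prt_id prt_null)
  have 2: "prt I o' = (if sum_list t = I + n then o' else 0)"
    using subsetD[OF o] by (auto intro!: prt_id prt_null)
  have 3: "prt I (bY (sg t (lk v t))) = (if sum_list t = I then b0 t (lk v t) else 0) + (if sum_list t = I + n then o' else 0)"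
    unfolding b additiveD[OF prt_additive] 1 2 ..
  have 4: "prt I (bY (if sum_list t = I + n then sg t (lk v t) else 0)) = (if sum_list t = I + n then o' else 0)"
    using 3 n2 by (simp add: additive_0[OF bY_additive] additive_0[OF prt_additive])
  show "prt I (bY (sg t (lk v t))) = ext b0 (prt I (sg t (lk v t))) + prt I (bY (prt (I + n) (sg t (lk v t))))"
    unfolding 3 prt_sg 4 by (simp add: E_b0_sg additive_0[OF E_b0])
qed (intro add_plus additive_comp[OF prt_additive] additive_comp[OF E_b0] additive_comp[OF bY_additive] bY_additive prt_additive)+

lemma keys_Eb0: "ks v \<subseteq> {t \<in> Wt (Suc r). sum_list t = I} \<Longrightarrow> ks (ext b0 v) \<subseteq> {t \<in> Wt r. sum_list t = I}"
proof (intro order.trans[OF keys_ext] UN_least)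
  fix t assume "ks v \<subseteq> {t \<in> Wt (Suc r). sum_list t = I}" "t \<in> ks v"
  then have "t \<in> Wt (Suc r)" "sum_list t = I" by auto
  then show "ks (b0 t (lk v t)) \<subseteq> {t \<in> Wt r. sum_list t = I}" using keys_b0[of t r "lk v t"] by simp
qed

text \<open>The leading part of \<open>bY bY\<close>, which vanishes modulo the denominators.\<close>

lemma b0_b0:
  assumes "ks v \<subseteq> {t \<in> Wt (Suc (Suc r)). sum_list t = I}"
  shows "ext b0 (ext b0 v) \<in> dd (TC I)"
proof -
  have kv: "ks v \<subseteq> Wt (Suc (Suc r))" and v1: "prt I v = v" and v2: "prt (I + n) v = 0" and v3: "prt (I + n + n) v = 0"
    using assms n2 by (auto intro!: prt_id prt_null)
  have z: "prt I' (bY 0) = 0" for I' by (simp add: additive_0[OF bY_additive] additive_0[OF prt_additive])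
  have 1: "prt I (bY v) = ext b0 v" using prt_bY[OF kv, of I] v1 v2 z by simp
  have 2: "prt (I + n) (bY v) = 0" using prt_bY[OF kv, of "I + n"] v2 v3 z by (simp add: additive_0[OF E_b0])
  have 3: "prt I (bY (bY v)) = ext b0 (ext b0 v)" using prt_bY[OF keys_bY[OF kv], of I] 1 2 z by simp
  have d: "bY (bY v) \<in> denY" by (rule normal_bb[OF kv])
  have "lk (prt I (bY (bY v))) t \<in> TC I" for t
  proof -
    have "lk (bY (bY v)) t \<in> TC (sum_list t)" using d unfolding denY_def by blast
    then show ?thesis by (auto simp: lk_prt TC_0)
  qed
  then show ?thesis unfolding 3 dd_def by blast
qed

text \<open>The coefficient of \<open>b0\<close> at words with a given first entry only sees words whose first entry is not larger.\<close>

lemma lk_b0_head: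
  assumes "t \<in> Wt (Suc r)" "k \<le> hd t"
  shows "lk (b0 t \<mu>) (k # s) = (if hd t = k then - lk (bp (tl t) \<mu>) s else 0)"
proof -
  obtain i j w where t: "t = i # j # w" using assms(1) by (cases t; cases "tl t") (auto simp: Wt_def)
  have p: "set (j # w) \<subseteq> {1..<n}" using assms(1) by (simp add: t Wt_def)
  from subsetD[OF this last_in_set] have "last (j # w) \<in> {1..<n}" by simp
  then have l: "1 \<le> last t" by (simp add: t)
  have "lk (mg0 t \<mu>) (k # s) = 0"
    using p assms(2) by (auto simp: t mg0_def lookup_single when_def)
  moreover have "lk (W0 t \<mu>) (k # s) = 0"
    using l assms(2) by (auto simp: W0_def lookup_single when_def)
  moreover have "b0 t \<mu> = mg0 t \<mu> - pre i (bp (tl t) \<mu>) + sgp (length t - 1) (W0 t \<mu>)" by (simp add: b0_def t)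
  ultimately show ?thesis by (simp add: lookup_add lookup_minus lk_pre sgp_def t)
qed

lemma dd_b0:
  assumes D: "subspace D" and al: "\<And>x i. x \<in> D \<Longrightarrow> (\<alpha> ^^ i) x \<in> D" and v: "v \<in> dd D"
  shows "ext b0 v \<in> dd D"
proof (rule dd_mem[OF D E_b0 v])
  fix t and \<mu> :: 'a assume m: "\<mu> \<in> D"
  have "W0 t \<mu> \<in> dd D" using m al by (simp add: W0_def dd_sg[OF D] dd_0[OF D])
  then have "sgp (length t - 1) (W0 t \<mu>) \<in> dd D" by (simp add: sgp_def dd_neg[OF D])
  then show "ext b0 (sg t \<mu>) \<in> dd D"
    unfolding E_b0_sg b0_def by (intro dd_add[OF D] dd_bp1[OF D m])
qed

subsection \<open>The two invariants\<close>

text \<open>Truncations of the norm operator \<open>E\<close>.\<close>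

definition gs :: "nat \<Rightarrow> 'a \<Rightarrow> 'a" where "gs i x = (\<Sum>c<i. (\<alpha> ^^ c) x)"

lemma gs_additive: "additive (gs i)" by (simp add: additive_def gs_def pow_add sum.distrib)

lemma gs_plus: "gs (i + j) x = gs j x + (\<alpha> ^^ j) (gs i x)"
  unfolding gs_def pow_sum pow_pow
  by (induction i) (simp_all add: add.commute add.left_commute)

lemma gs_n: "gs n x = E x" by (simp add: gs_def E_def)
lemma gs_1: "gs 1 x = x" by (simp add: gs_def)

text \<open>In weight \<open>n N\<close> the complex with boundary \<open>b0\<close> has homology in the degrees \<open>2N\<close> and \<open>2N - 1\<close> only, where \<open>qf\<close> and \<open>pf\<close>
  detect it.\<close>

definition qf :: "(nat list \<Rightarrow>\<^sub>0 'a) \<Rightarrow> 'a" where "qf = ext (\<lambda>t \<mu>. if chi (tl t) then \<mu> else 0)"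

definition pf :: "(nat list \<Rightarrow>\<^sub>0 'a) \<Rightarrow> 'a" where
  "pf = ext (\<lambda>t \<mu>. if chi (tl (tl t)) then (\<alpha> ^^ (n - hd t - hd (tl t))) (gs (hd (tl t)) \<mu>) else 0)"

lemma qf_additive: "additive qf" and pf_additive: "additive pf"
  unfolding qf_def pf_def
  by (rule ext_additive; simp add: additive_def additiveD[OF gs_additive] pow_add)+

lemma qf_sg: "qf (sg t \<mu>) = (if chi (tl t) then \<mu> else 0)"
  and pf_sg: "pf (sg t \<mu>) = (if chi (tl (tl t)) then (\<alpha> ^^ (n - hd t - hd (tl t))) (gs (hd (tl t)) \<mu>) else 0)"
  unfolding qf_def pf_def by (simp_all add: ext_single additive_0[OF gs_additive] pow_0)

lemma qf_pre: "qf (pre i v) = chs v"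
  by (rule additive_eq[where F = "\<lambda>v. qf (pre i v)" and G = chs])
    (auto simp: pre_sg qf_sg chs_sg intro: additive_comp[OF qf_additive pre_additive] chs_additive)

lemma pf_pre: "pf (pre i (pre j v)) = (\<alpha> ^^ (n - i - j)) (gs j (chs v))"
  by (rule additive_eq[where F = "\<lambda>v. pf (pre i (pre j v))" and G = "\<lambda>v. (\<alpha> ^^ (n - i - j)) (gs j (chs v))"])
    (auto simp: pre_sg pf_sg chs_sg additive_0[OF gs_additive] pow_0
      intro: additive_comp[OF pf_additive] additive_comp[OF pre_additive pre_additive]
        additive_comp[OF al_additive] additive_comp[OF gs_additive chs_additive])

text \<open>The contributions of all words with \<open>chi (i\<^sub>3 \<dots>)\<close> telescope by \<open>gs (i + j) = gs j + \<alpha>^j gs i\<close>, and those of the words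
  with \<open>chi (i\<^sub>2 \<dots>)\<close> cancel in pairs. The only term without a partner occurs for first entry \<open>0\<close>, where \<open>gs n = E\<close> is left.\<close>

lemma pf_b0:
  assumes t: "t \<in> Wt (2 * N)" and s: "sum_list t = n * N" and N: "N \<ge> 1"
  shows "pf (b0 t \<mu>) = E (qf (sg t \<mu>))"
proof -
  have lt: "length t = Suc (2 * N)" using t by (simp add: Wt_def)
  then obtain a b c u where t': "t = a # b # c # u"
    using N by (cases t; cases "tl t"; cases "tl (tl t)") auto
  define e where "e = last (c # u)"
  define w where "w = butlast (c # u)"
  have we: "c # u = w @ [e]" by (simp add: w_def e_def)
  have p: "a < n" "1 \<le> b" "b < n" "1 \<le> c" "c < n" using t by (auto simp: t' Wt_def)
  have "e \<in> set (c # u)" by (simp add: we)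
  then have pe: "1 \<le> e" using t by (auto simp: t' Wt_def)
  have lu: "length u = 2 * (N - 1)" using lt by (simp add: t')
  have lw: "length w = 2 * (N - 1)" using arg_cong[OF we, of length] lu by simp
  have sw: "sum_list w + e = c + sum_list u" using arg_cong[OF we, of sum_list] by simp
  obtain K where K: "N = Suc K" using N by (cases N) auto
  have su: "a + b + c \<le> n" if "chi u"
    using chi_sum[of u] that lu s by (auto simp: t' K)
  have sw': "a + b + e \<le> n" if "chi w"
    using chi_sum[of w] that lw s sw by (auto simp: t' K)
  have wrap: "W0 t \<mu> = (if e + a < n then sg ((e + a) # b # w) ((\<alpha> ^^ e) \<mu>) else 0)"
    by (simp add: W0_def t' e_def w_def)
  have chb: "chs (bp (c # u) \<mu>) = (if chi u then \<mu> else 0) - (if chi w then \<mu> else 0)"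
    using chs_bp[of "c # u" \<mu>] lu by (simp add: w_def del: bp.simps butlast.simps)
  have "b0 t \<mu> = mg0 t \<mu> - pre a (mg0 (b # c # u) \<mu>) + pre a (pre b (bp (c # u) \<mu>)) + W0 t \<mu>"
    by (simp add: b0_def t' lu sgp_def additive_diff[OF pre_additive])
  then have "pf (b0 t \<mu>) = pf (mg0 t \<mu>) - pf (pre a (mg0 (b # c # u) \<mu>)) + pf (pre a (pre b (bp (c # u) \<mu>))) + pf (W0 t \<mu>)"
    by (simp add: additiveD[OF pf_additive] additive_diff[OF pf_additive])
  also have "pf (mg0 t \<mu>) = (if chi u then (\<alpha> ^^ (n - a - b - c)) (gs c \<mu>) else 0)"
    using su p by (auto simp: t' mg0_def pf_sg additive_0[OF pf_additive] diff_diff_left add.assoc)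
  also have "pf (pre a (mg0 (b # c # u) \<mu>)) = (if chi u \<and> b + c < n then (\<alpha> ^^ (n - a - b - c)) (gs (b + c) \<mu>) else 0)"
    by (auto simp: mg0_def pre_sg pf_sg additive_0[OF pf_additive] additive_0[OF pre_additive] diff_diff_left add.assoc)
  also have "pf (pre a (pre b (bp (c # u) \<mu>))) =
      (if chi u then (\<alpha> ^^ (n - a - b)) (gs b \<mu>) else 0) - (if chi w then (\<alpha> ^^ (n - a - b)) (gs b \<mu>) else 0)"
    unfolding pf_pre chb by (auto simp: additive_diff[OF gs_additive] additive_0[OF gs_additive] pow_diff pow_0 additive_neg[OF gs_additive])
  also have "pf (W0 t \<mu>) = (if chi w then (\<alpha> ^^ (n - a - b)) (gs b \<mu>) else 0)"
  proof (cases "chi w")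
    case True
    have "n - (e + a) - b + e = n - a - b" using sw'[OF True] by simp
    moreover have "e + a < n" using sw'[OF True] p by simp
    ultimately show ?thesis using True
      by (simp add: wrap pf_sg gs_def pow_sum pow_pow ac_simps)
  qed (simp add: wrap pf_sg additive_0[OF pf_additive])
  finally have 1: "pf (b0 t \<mu>) = (if chi u then (\<alpha> ^^ (n - a - b - c)) (gs c \<mu>) else 0)
      - (if chi u \<and> b + c < n then (\<alpha> ^^ (n - a - b - c)) (gs (b + c) \<mu>) else 0)
      + (if chi u then (\<alpha> ^^ (n - a - b)) (gs b \<mu>) else 0)" by simp
  show ?thesis
  proof (cases "chi u")
    case True
    have "n - a - b = (n - a - b - c) + c" using su[OF True] by simp
    then have S: "(\<alpha> ^^ (n - a - b - c)) (gs c \<mu>) + (\<alpha> ^^ (n - a - b)) (gs b \<mu>) = (\<alpha> ^^ (n - a - b - c)) (gs (b + c) \<mu>)"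
      by (simp only: gs_plus pow_add pow_pow)
    have "pf (b0 t \<mu>) = ((\<alpha> ^^ (n - a - b - c)) (gs c \<mu>) + (\<alpha> ^^ (n - a - b)) (gs b \<mu>)) -
        (if b + c < n then (\<alpha> ^^ (n - a - b - c)) (gs (b + c) \<mu>) else 0)"
      using 1 True by (simp add: diff_add_eq del: diff_diff_left)
    then have 2: "pf (b0 t \<mu>) = (if b + c < n then 0 else (\<alpha> ^^ (n - a - b - c)) (gs (b + c) \<mu>))"
      unfolding S by simp
    show ?thesis
    proof (cases "b + c < n")
      case False
      then have "a = 0" "b + c = n" using su[OF True] by auto
      then show ?thesis using 2 True False by (simp add: t' qf_sg gs_n pow_def[symmetric] flip: gs_n)
    qed (use 2 True in \<open>simp add: t' qf_sg E_0\<close>)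
  qed (use 1 in \<open>simp add: t' qf_sg E_0\<close>)
qed


text \<open>The alternating words, which carry the homology. The chains of the comparison map are made of
  them.\<close>

fun Cw :: "nat \<Rightarrow> nat list" where
  "Cw 0 = []"
| "Cw (Suc N) = 1 # (n - 1) # Cw N"

fun Aw :: "nat \<Rightarrow> nat list" where
  "Aw 0 = []"
| "Aw (Suc N) = (n - 1) # 1 # Aw N"

lemma bp_Cw: "bp (Cw N) \<mu> = 0 \<and> bp ((n - 1) # Cw N) \<mu> = 0"
proof (induction N)
  case (Suc N)
  then have 1: "bp ((n - 1) # Cw N) \<mu> = 0" by blast
  have 2: "bp (Cw (Suc N)) \<mu> = 0"
    using n2 unfolding Cw.simps bp.simps 1 by (simp add: mg0_def additive_0[OF pre_additive])
  have "bp ((n - 1) # Cw (Suc N)) \<mu> = mg0 ((n - 1) # Cw (Suc N)) \<mu> - pre (n - 1) (bp (Cw (Suc N)) \<mu>)"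
    by (simp only: Cw.simps bp.simps(1))
  then have "bp ((n - 1) # Cw (Suc N)) \<mu> = 0"
    using n2 unfolding 2 by (simp add: mg0_def additive_0[OF pre_additive])
  with 2 show ?case by blast
qed simp

lemma Cw_Ww: "Cw N \<in> Ww (2 * N) (n * N)" and Aw_Ww: "Aw N \<in> Ww (2 * N) (n * N)"
  using n2 by (induction N) (auto simp: Ww_def)

lemma chi_Cw: "chi (Cw N)" and chi_Aw: "chi (Aw N)"
  using n2 by (induction N) auto

text \<open>The tails of the words with first entry \<open>k\<close>.\<close>

definition hdc :: "nat \<Rightarrow> (nat list \<Rightarrow>\<^sub>0 'a) \<Rightarrow> (nat list \<Rightarrow>\<^sub>0 'a)" where
  "hdc k = ext (\<lambda>t \<mu>. case t of [] \<Rightarrow> 0 | j # s \<Rightarrow> if j = k then sg s \<mu> else 0)"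

lemma hdc_additive: "additive (hdc k)"
  unfolding hdc_def by (rule ext_additive) (auto simp: additive_def single_add split: list.split)

lemma hdc_sg: "hdc k (sg t \<mu>) = (case t of [] \<Rightarrow> 0 | j # s \<Rightarrow> if j = k then sg s \<mu> else 0)"
  unfolding hdc_def by (simp add: ext_single split: list.split)

lemma lk_hdc: "lk (hdc k w) s = lk w (k # s)"
  by (rule additive_eq[where F = "\<lambda>w. lk (hdc k w) s" and G = "\<lambda>w. lk w (k # s)"])
    (auto simp: additive_def additiveD[OF hdc_additive] lookup_add hdc_sg lookup_single when_def split: list.split)

lemma lk_dd: "v \<in> dd D \<Longrightarrow> lk v t \<in> D"
  by (simp add: dd_def)

lemma gs_TC: "x \<in> TC j \<Longrightarrow> gs i x \<in> TC j"
  unfolding gs_def by (intro TC_sum TC_pow)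

lemma pf_Eb0:
  assumes "ks v \<subseteq> {t \<in> Wt (2 * N). sum_list t = n * N}" "N \<ge> 1"
  shows "pf (ext b0 v) = E (qf v)"
proof (rule additive_eq[where F = "\<lambda>v. pf (ext b0 v)" and G = "\<lambda>v. E (qf v)"])
  fix t assume "t \<in> ks v"
  then show "pf (ext b0 (sg t (lk v t))) = E (qf (sg t (lk v t)))"
    using assms pf_b0[of t N "lk v t"] by (auto simp: E_b0_sg)
qed (auto simp: additive_def E_add additiveD[OF qf_additive] additiveD[OF pf_additive] additiveD[OF E_b0])

lemma qf_hdc:
  assumes "ks v \<subseteq> {t \<in> Wt (2 * N). sum_list t = n * N}"
  shows "qf v = chs (hdc 0 v)"
proof (rule additive_eq[where F = qf and G = "\<lambda>v. chs (hdc 0 v)"])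
  fix t assume "t \<in> ks v"
  then have t: "length t = Suc (2 * N)" "sum_list t = n * N" using assms by (auto simp: Wt_def)
  then obtain i s where ts: "t = i # s" by (cases t) auto
  have "chi s \<Longrightarrow> i = 0" using chi_sum[of s] t ts by simp
  then show "qf (sg t (lk v t)) = chs (hdc 0 (sg t (lk v t)))"
    by (auto simp: ts qf_sg hdc_sg chs_sg additive_0[OF chs_additive])
qed (intro qf_additive additive_comp[OF chs_additive hdc_additive])+

lemma pf_hdc:
  assumes v: "ks v \<subseteq> {t \<in> Wt r. sum_list t = n * N}" and r: "r + 1 = 2 * N"
    and sm: "\<And>j s. j < n - 1 \<Longrightarrow> lk v (j # s) \<in> TC i"
  shows "chf r (hdc (n - 1) v) - pf v \<in> TC i"
proof (rule additive_mem[where F = "\<lambda>v. chf r (hdc (n - 1) v) - pf v", OF _ TC_0 TC_add])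
  fix t assume "t \<in> ks v"
  then have t: "t \<in> Wt r" "sum_list t = n * N" using v by auto
  then obtain a b u where t': "t = a # b # u" using r by (cases t; cases "tl t") (auto simp: Wt_def)
  have p: "1 \<le> b" "a < n" "length u = 2 * (N - 1)" using t(1) r by (auto simp: t' Wt_def)
  show "chf r (hdc (n - 1) (sg t (lk v t))) - pf (sg t (lk v t)) \<in> TC i"
  proof (cases "a = n - 1")
    case True
    obtain K where K: "N = Suc K" using r by (cases N) auto
    have "chi u \<Longrightarrow> b = 1"
      using chi_sum[of u] p t(2) True by (auto simp: t' K)
    moreover have "odd r" using r by presburger
    ultimately have "chf r (hdc (n - 1) (sg t (lk v t))) = pf (sg t (lk v t))"
      using True p by (auto simp: t' hdc_sg chf_sg pf_sg gs_1[unfolded One_nat_def])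
    then show ?thesis by (simp add: TC_0)
  next
    case False
    then have "lk v t \<in> TC i" using sm p by (simp add: t')
    then have "pf (sg t (lk v t)) \<in> TC i" by (simp add: pf_sg TC_0 TC_pow gs_TC)
    moreover have "hdc (n - 1) (sg t (lk v t)) = 0" using False by (simp add: t' hdc_sg)
    ultimately show ?thesis by (simp add: additive_0[OF chf_additive] TC_neg)
  qed
qed (intro add_minus additive_comp[OF chf_additive hdc_additive] pf_additive)

lemma Eb0_head:
  assumes w: "ks w \<subseteq> Wt (Suc r)" and sm: "\<And>j s. j < k \<Longrightarrow> lk w (j # s) \<in> TC i"
  shows "lk (ext b0 w) (k # s) + lk (ext bp (hdc k w)) s \<in> TC i"
proof (rule additive_mem[where F = "\<lambda>w. lk (ext b0 w) (k # s) + lk (ext bp (hdc k w)) s", OF _ TC_0 TC_add])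
  show "additive (\<lambda>w. lk (ext b0 w) (k # s) + lk (ext bp (hdc k w)) s)"
    by (simp add: additive_def lookup_add additiveD[OF E_b0] additiveD[OF E_bp] additiveD[OF hdc_additive])
  fix t assume "t \<in> ks w"
  then have t: "t \<in> Wt (Suc r)" using w by blast
  then obtain a u where t': "t = a # u" by (cases t) (auto simp: Wt_def)
  show "lk (ext b0 (sg t (lk w t))) (k # s) + lk (ext bp (hdc k (sg t (lk w t)))) s \<in> TC i"
  proof (cases "a < k")
    case True
    then have "sg t (lk w t) \<in> dd (TC i)" using sm[of a u] by (simp add: t' dd_sg TC_subspace)
    from lk_dd[OF dd_b0[OF TC_subspace TC_pow this]] show ?thesis
      using True by (simp add: t' hdc_sg additive_0[OF E_bp])
  next
    case False
    then have "lk (b0 t (lk w t)) (k # s) = (if a = k then - lk (bp u (lk w t)) s else 0)"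
      using lk_b0_head[OF t, of k "lk w t" s] by (simp add: t')
    then show ?thesis by (simp add: E_b0_sg) (simp add: t' hdc_sg E_bp_sg additive_0[OF E_bp] TC_0)
  qed
qed

lemma Eb0_pre_head:
  assumes y: "ks (pre k y) \<subseteq> Wt (Suc r)" and jk: "j \<le> k"
  shows "lk (ext b0 (pre k y)) (j # s) = (if j = k then - lk (ext bp y) s else 0)"
proof (rule additive_eq[where F = "\<lambda>y. lk (ext b0 (pre k y)) (j # s)" and G = "\<lambda>y. if j = k then - lk (ext bp y) s else 0"])
  fix t assume "t \<in> ks y"
  then have "k # t \<in> Wt (Suc r)" using y by (auto simp: keys_pre)
  from lk_b0_head[OF this, of j "lk y t" s] jk
  show "lk (ext b0 (pre k (sg t (lk y t)))) (j # s) = (if j = k then - lk (ext bp (sg t (lk y t))) s else 0)"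
    by (simp add: pre_sg E_b0_sg E_bp_sg)
qed (auto simp: additive_def lookup_add additiveD[OF E_b0] additiveD[OF E_bp] additiveD[OF pre_additive])

text \<open>The first entries of the words are filtered: on words with first entry \<open>k\<close>, the leading part of \<open>b0\<close> is \<open>- bp\<close> on the tail.
  Hence the coefficients at the words with first entry \<open>0, 1, 2, \<dots>\<close> can be removed successively by \<open>words_acyclic\<close>. This is
  obstructed only for \<open>k = 0\<close> in degree \<open>2N\<close>, where \<open>qf\<close> appears, and for \<open>k = n - 1\<close> in degree \<open>2N - 1\<close>, where
  \<open>pf\<close> appears.\<close>

lemma HH_acyclic:
  assumes v: "ks v \<subseteq> {t \<in> Wt r. sum_list t = n * N}" and cyc: "r > 0 \<Longrightarrow> ext b0 v \<in> dd (TC (n * N))"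
    and q: "r = 2 * N \<Longrightarrow> qf v \<in> TC (n * N)" and p: "r + 1 = 2 * N \<Longrightarrow> pf v \<in> TC (n * N)"
  shows "\<exists>v'. ks v' \<subseteq> {t \<in> Wt (Suc r). sum_list t = n * N} \<and> v - ext b0 v' \<in> dd (TC (n * N))"
proof -
  define D where "D = TC (n * N)"
  define Z where "Z r = {t \<in> Wt r. sum_list t = n * N}" for r
  have D: "subspace D" by (simp add: D_def TC_subspace)
  have step: "k \<le> n \<Longrightarrow> \<exists>v'. ks v' \<subseteq> Z (Suc r) \<and> (k = 0 \<longrightarrow> v' = 0) \<and> (r + 1 = 2 * N \<longrightarrow> qf v' = 0) \<and>
      (\<forall>j<k. \<forall>s. lk (v - ext b0 v') (j # s) \<in> D)" for k
  proof (induction k)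
    case 0
    show ?case by (intro exI[of _ 0]) (simp add: additive_0[OF qf_additive])
  next
    case (Suc k)
    then obtain v' where kv': "ks v' \<subseteq> Z (Suc r)" and v'0: "k = 0 \<Longrightarrow> v' = 0"
      and qv': "r + 1 = 2 * N \<Longrightarrow> qf v' = 0" and sm: "\<And>j s. j < k \<Longrightarrow> lk (v - ext b0 v') (j # s) \<in> D"
      by fastforce
    have kn: "k < n" using Suc by simp
    define w where "w = v - ext b0 v'"
    have kw: "ks w \<subseteq> Z r"
      unfolding w_def Z_def by (intro keys_diff_sub v keys_Eb0 kv'[unfolded Z_def])
    have smw: "\<And>j s. j < k \<Longrightarrow> lk w (j # s) \<in> D" using sm by (simp add: w_def)
    define y where "y = hdc k w"
    have ly: "lk y s = lk w (k # s)" for s by (simp add: y_def lk_hdc)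
    have ky: "s \<in> ks y \<Longrightarrow> k # s \<in> Z r" for s using kw by (auto simp: in_keys_iff ly)
    show ?case
    proof (cases "k \<le> n * N")
      case False
      then have "s \<notin> ks y" for s using ky[of s] by (auto simp: Z_def)
      then have "lk w (k # s) = 0" for s using ly[of s] by (simp add: in_keys_iff)
      then have "lk w (j # s) \<in> D" if "j < Suc k" for j s
        using smw[of j s] that subspace_0[OF D] by (cases "j = k") auto
      then show ?thesis unfolding w_def using kv' qv' by (intro exI[of _ v']) simp
    next
      case kN: True
      have yW: "ks y \<subseteq> Ww r (n * N - k)" 
      proof
        fix s assume "s \<in> ks y"
        from ky[OF this] show "s \<in> Ww r (n * N - k)" by (auto simp: Z_def Wt_def Ww_def)
      qed
      have ybp: "ext bp y \<in> dd D"
      proof (cases r)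
        case 0
        have "ext bp y = 0"
          by (rule additive_eq[where F = "ext bp" and G = "\<lambda>v. 0"])
            (use yW 0 in \<open>auto simp: E_bp_sg E_bp add_zero Ww_def\<close>)
        then show ?thesis by (simp add: dd_0[OF D])
      next
        case (Suc r')
        have "ext b0 (ext b0 v') \<in> dd D"
          unfolding D_def using kv' Suc by (intro b0_b0[of _ r']) (simp add: Z_def)
        then have "ext b0 w \<in> dd D"
          using cyc dd_diff[OF D] Suc by (simp add: w_def additive_diff[OF E_b0] D_def)
        then have b: "lk (ext b0 w) (k # s) \<in> D" for s by (rule lk_dd)
        have "lk (ext b0 w) (k # s) + lk (ext bp y) s \<in> D" for s
          unfolding D_def y_def by (rule Eb0_head[of _ r']) (use kw smw Suc in \<open>auto simp: Z_def D_def\<close>)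
        from subspace_diff[OF D this b] have "lk (ext bp y) s \<in> D" for s
          by (metis add_diff_cancel_left')
        then show ?thesis by (simp add: dd_def)
      qed
      have exc: "chf r y \<in> D" if M: "n * N - k = n * (r div 2) + r mod 2"
      proof (cases "even r")
        case True
        then obtain m where m: "r = 2 * m" by blast
        have e: "n * N = n * m + k" using M kN by (simp add: m)
        have "N = m"
        proof -
          have "N = (n * m + k) div n" using e n2 by (metis nonzero_mult_div_cancel_left not_numeral_le_zero)
          then show ?thesis using kn n2 by simp
        qed
        then have k0: "k = 0" using e by simp
        then have "w = v" using v'0 by (simp add: w_def additive_0[OF E_b0])
        moreover have "qf v = chs (hdc 0 v)" by (rule qf_hdc) (use v m \<open>N = m\<close> in simp)
        ultimately show ?thesis using q m \<open>N = m\<close> k0 by (simp add: y_def chf_even D_def)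
      next
        case False
        then obtain m where m: "r = 2 * m + 1" using oddE by blast
        have e: "n * N = n * m + Suc k" using M kN by (simp add: m)
        have "n * m < n * N" unfolding e by simp
        then have mN: "m < N" by simp
        then obtain d where d: "N = Suc (m + d)" using less_iff_Suc_add by blast
        have "Suc k = n + n * d" using e by (simp add: d algebra_simps)
        then have kk: "k = n - 1" "d = 0" using kn n2 by (simp_all, cases d, simp_all)
        have rN: "r + 1 = 2 * N" by (simp add: m d kk)
        have "pf (ext b0 v') = E (qf v')"
          by (rule pf_Eb0[where N = N]) (use kv' rN d in \<open>simp_all add: Z_def\<close>)
        then have "pf w = pf v" using qv'[OF rN] by (simp add: w_def additive_diff[OF pf_additive] E_0)
        then have pw: "pf w \<in> D" using p[OF rN] by (simp add: D_def)
        have "chf r (hdc (n - 1) w) - pf w \<in> D"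
          unfolding D_def by (rule pf_hdc[OF _ rN]) (use kw smw kk in \<open>simp_all add: Z_def D_def\<close>)
        from subspace_add[OF D this pw] show ?thesis by (simp add: y_def kk)
      qed
      from words_acyclic[OF D yW ybp exc]
      obtain y' where ky': "ks y' \<subseteq> Ww (Suc r) (n * N - k)" and yy': "y - ext bp y' \<in> dd D" by blast
      \<comment> \<open>in degree \<open>2N - 1\<close> the corrections must not change \<open>pf\<close>, so their invariant \<open>qf\<close> is made zero by a multiple of the \<open>bp\<close>-cycle \<open>Cw N\<close>\<close>
      define y'' where "y'' = y' - (if r + 1 = 2 * N \<and> k = 0 then sg (Cw N) (chs y') else 0)"
      have ky'': "ks y'' \<subseteq> Ww (Suc r) (n * N - k)"
        unfolding y''_def using Cw_Ww[of N] by (intro keys_diff_sub ky') auto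
      have "ext bp y'' = ext bp y'"
        using bp_Cw[of N "chs y'"] by (simp add: y''_def additive_diff[OF E_bp] E_bp_sg additive_0[OF E_bp])
      then have yy: "y - ext bp y'' \<in> dd D" using yy' by simp
      have qy: "qf (pre k y'') = 0" if rN: "r + 1 = 2 * N"
      proof (cases "k = 0")
        case True
        then show ?thesis using rN by (simp add: qf_pre y''_def additive_diff[OF chs_additive] chs_sg chi_Cw)
      next
        case False
        have "chs y'' = 0"
        proof (rule additive_eq[where F = chs and G = "\<lambda>v. 0"])
          fix t assume "t \<in> ks y''"
          then have "length t = 2 * N" "sum_list t < n * N" using ky'' rN False kN by (auto simp: Ww_def)
          then have "\<not> chi t" using chi_sum[of t] by auto
          then show "chs (sg t (lk y'' t)) = 0" by (simp add: chs_sg)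
        qed (simp_all add: chs_additive add_zero)
        then show ?thesis by (simp add: qf_pre)
      qed
      have kp: "ks (pre k y'') \<subseteq> Z (Suc r)"
      proof
        fix t assume "t \<in> ks (pre k y'')"
        then obtain s where s: "t = k # s" "s \<in> ks y''" by (auto simp: keys_pre)
        then have "s \<in> Ww (Suc r) (n * N - k)" using ky'' by blast
        then show "t \<in> Z (Suc r)" using s(1) kn kN by (auto simp: Ww_def Z_def Wt_def)
      qed
      have "lk (v - ext b0 (v' - pre k y'')) (j # s) \<in> D" if j: "j < Suc k" for j s
      proof -
        have "lk (v - ext b0 (v' - pre k y'')) (j # s) = lk w (j # s) + lk (ext b0 (pre k y'')) (j # s)"
          by (simp add: w_def additive_diff[OF E_b0] lookup_minus lookup_add)
        also have "lk (ext b0 (pre k y'')) (j # s) = (if j = k then - lk (ext bp y'') s else 0)"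
          by (rule Eb0_pre_head[where r = r]) (use kp j in \<open>auto simp: Z_def\<close>)
        also have "lk w (j # s) + (if j = k then - lk (ext bp y'') s else 0) \<in> D"
          using lk_dd[OF yy, of s] smw[of j s] j by (cases "j = k") (simp_all add: lookup_minus ly)
        finally show ?thesis .
      qed
      moreover have "ks (v' - pre k y'') \<subseteq> Z (Suc r)" by (intro keys_diff_sub kv' kp)
      moreover have "r + 1 = 2 * N \<longrightarrow> qf (v' - pre k y'') = 0"
        using qv' qy by (simp add: additive_diff[OF qf_additive])
      ultimately show ?thesis by (intro exI[of _ "v' - pre k y''"]) simp
    qed
  qed
  from step[of n] obtain v' where v': "ks v' \<subseteq> Z (Suc r)" and sm: "\<And>j s. j < n \<Longrightarrow> lk (v - ext b0 v') (j # s) \<in> D"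
    by fastforce
  have "ks (v - ext b0 v') \<subseteq> Z r"
    unfolding Z_def by (intro keys_diff_sub v keys_Eb0 v'[unfolded Z_def])
  have "lk (v - ext b0 v') t \<in> D" for t
  proof (cases "t \<in> ks (v - ext b0 v')")
    case True
    then have "t \<in> Wt r" using \<open>ks (v - ext b0 v') \<subseteq> Z r\<close> by (auto simp: Z_def)
    then show ?thesis using sm by (cases t) (auto simp: Wt_def)
  qed (simp add: in_keys_iff subspace_0[OF D])
  then show ?thesis using v' by (intro exI[of _ v']) (simp add: dd_def Z_def D_def)
qed

end

section \<open>The comparison map\<close>

text \<open>The additional assumption is what the central element of the theorem provides. It makes all coefficients of words vanish
  modulo the denominators, unless the weight of the word is divisible by \<open>n\<close>.\<close>

locale separated_algebra = diag_algebra scale \<alpha> l n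
  for scale :: "'k::field_char_0 \<Rightarrow> 'a::ring_1 \<Rightarrow> 'a" and \<alpha> l n +
  assumes TC_UNIV: "\<not> n dvd j \<Longrightarrow> twisted_comm scale \<alpha> j = UNIV"
begin

text \<open>\<open>P\<close> is the projection onto the eigenspaces on which the norm operator \<open>E\<close> vanishes, \<open>P'\<close> inverts \<open>1 - \<alpha>\<close> there,
  and \<open>G\<close> inverts \<open>E\<close> on the complement.\<close>

definition P :: "'a \<Rightarrow> 'a" where "P = fc (\<lambda>w. if w \<noteq> 1 \<and> w ^ n = 1 then 1 else 0)"
definition P' :: "'a \<Rightarrow> 'a" where "P' = fc (\<lambda>w. if w \<noteq> 1 \<and> w ^ n = 1 then 1 / (1 - w) else 0)"
definition G :: "'a \<Rightarrow> 'a" where "G = fc (\<lambda>w. if w \<noteq> 1 \<and> w ^ n = 1 then 0 else 1 / (\<Sum>i<n. w ^ i))"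

lemma geom_n: "(\<Sum>i<n. w ^ i) = (0 :: 'k) \<longleftrightarrow> w \<noteq> 1 \<and> w ^ n = 1"
  using geom_zero_iff n2 by simp

lemma P_E: "P (E x) = 0" and P_P: "P (P x) = P x" and P_G: "P (G x) = 0" and pow_P: "(\<alpha> ^^ n) (P x) = P x"
  and P'_diff: "P' (\<alpha> x - x) = - P x" and pow_P': "(\<alpha> ^^ n) (P' x) = P' x"
  and E_G: "E (G x) = x - P x" and G_E: "G (E x) = x - P x" and E_P: "E (P x) = 0"
proof -
  have id: "x - P x = fc (\<lambda>w. 1 - (if w \<noteq> 1 \<and> w ^ n = 1 then 1 else 0)) x"
    by (simp only: P_def fc_minus[symmetric] fc_id[symmetric])
  show "P (E x) = 0" unfolding P_def fc_E fc_comp by (rule fc_zero) (simp add: geom_n)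
  show "E (P x) = 0" unfolding P_def fc_E fc_comp by (rule fc_zero) (simp add: geom_n)
  show "P (P x) = P x" unfolding P_def fc_comp by (rule fc_cong) auto
  show "P (G x) = 0" unfolding P_def G_def fc_comp by (rule fc_zero) auto
  show "(\<alpha> ^^ n) (P x) = P x" unfolding P_def fc_pow fc_comp by (rule fc_cong) auto
  show "(\<alpha> ^^ n) (P' x) = P' x" unfolding P'_def fc_pow fc_comp by (rule fc_cong) auto
  show "E (G x) = x - P x" unfolding id unfolding G_def fc_E fc_comp by (rule fc_cong) (use n2 in \<open>simp add: geom_n\<close>)
  show "G (E x) = x - P x" unfolding id unfolding G_def fc_E fc_comp by (rule fc_cong) (use n2 in \<open>simp add: geom_n\<close>)
  have "P' (\<alpha> x - x) + P x = 0"
  proof -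
    have "\<alpha> x - x = fc (\<lambda>w. w - 1) x" by (simp only: fc_minus[symmetric] fc_id[symmetric] fc_alpha[symmetric])
    then have "P' (\<alpha> x - x) + P x = fc (\<lambda>w. (if w \<noteq> 1 \<and> w ^ n = 1 then 1 / (1 - w) else 0) * (w - 1)
        + (if w \<noteq> 1 \<and> w ^ n = 1 then 1 else 0)) x"
      by (simp only: P'_def P_def fc_comp fc_plus)
    also have "\<dots> = 0" by (rule fc_zero) (auto simp: field_simps)
    finally show ?thesis .
  qed
  then show "P' (\<alpha> x - x) = - P x" by (simp add: eq_neg_iff_add_eq_0)
qed

lemma P_additive: "additive P" and P'_additive: "additive P'"
  by (simp_all add: additive_def P_def P'_def fc_add)

lemma P_scale: "P (scale c x) = scale c (P x)" and P'_scale: "P' (scale c x) = scale c (P' x)"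
  and P'_l: "P' (x * l) = P' x * l"
  and P_TC: "x \<in> TC j \<Longrightarrow> P x \<in> TC j" and P'_TC: "x \<in> TC j \<Longrightarrow> P' x \<in> TC j"
  and G_TC: "x \<in> TC j \<Longrightarrow> G x \<in> TC j" and P'_al: "P' (\<alpha> x) = \<alpha> (P' x)"
  by (simp_all add: P_def P'_def G_def fc_scale fc_l fc_TC fc_al)

text \<open>Off the eigenvalues seen by \<open>P\<close>, the operator \<open>\<alpha> - 1\<close> factors through \<open>\<alpha>^n - 1\<close>, whose values multiplied
  by \<open>l\<close> are commutators.\<close>

lemma diff_P_TC: "(\<alpha> (x - P x) - (x - P x)) * l \<in> TC 0"
proof -
  define F where "F w = (if w ^ n = 1 then 0 else (w - 1) / (w ^ n - 1))" for w :: 'k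
  have "x - P x = fc (\<lambda>w. 1 - (if w \<noteq> 1 \<and> w ^ n = 1 then 1 else 0)) x"
    by (simp only: P_def fc_minus[symmetric] fc_id[symmetric])
  then have "\<alpha> (x - P x) - (x - P x) = fc (\<lambda>w. w * (1 - (if w \<noteq> 1 \<and> w ^ n = 1 then 1 else 0))
      - (1 - (if w \<noteq> 1 \<and> w ^ n = 1 then 1 else 0))) x"
    by (simp only: fc_alpha fc_comp fc_minus)
  also have "\<dots> = fc (\<lambda>w. w ^ n * F w - F w) x"
    by (rule fc_cong) (auto simp: F_def field_simps)
  also have "\<dots> = (\<alpha> ^^ n) (fc F x) - fc F x" by (simp only: fc_pow fc_comp fc_minus)
  finally have "(\<alpha> (x - P x) - (x - P x)) * l = l * fc F x - fc F x * l"
    by (simp add: left_diff_distrib l_comm)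
  moreover have "l * fc F x - fc F x * l \<in> TC 0" using TC_gen[of l 0 "fc F x"] by simp
  ultimately show ?thesis by simp
qed

subsection \<open>Boundaries of alternating words\<close>

lemma Aw_snoc: "Aw (Suc N) = (n - 1) # Cw N @ [1]" and Cw_snoc: "Cw (Suc N) = 1 # Aw N @ [n - 1]"
  by (induction N) simp_all

lemma Aw_pos: "0 \<notin> set (Aw N)" and Cw_pos: "0 \<notin> set (Cw N)"
  using n2 by (induction N) auto

lemma length_Aw: "length (Aw N) = 2 * N" and length_Cw: "length (Cw N) = 2 * N"
  by (induction N) auto

lemma sum_Aw: "sum_list (Aw N) = n * N" and sum_Cw: "sum_list (Cw N) = n * N"
  using Aw_Ww[of N] Cw_Ww[of N] by (simp_all add: Ww_def)

lemma Aw_Wt: "Aw (Suc N) \<in> Wt (Suc (2 * N))" and Aw0_Wt: "0 # Aw N \<in> Wt (2 * N)" and Cw0_Wt: "0 # Cw N \<in> Wt (2 * N)"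
proof -
  have "set (Aw N) \<subseteq> {1..<n}" "set (Cw N) \<subseteq> {1..<n}" for N
    using Aw_Ww[of N] Cw_Ww[of N] by (simp_all add: Ww_def)
  from this(1)[of "Suc N"] this[of N] show "Aw (Suc N) \<in> Wt (Suc (2 * N))" "0 # Aw N \<in> Wt (2 * N)" "0 # Cw N \<in> Wt (2 * N)"
    using n2 length_Aw[of N] length_Cw[of N] by (auto simp: Wt_def)
qed

lemma succ_Aw: "successively (\<lambda>i j. i + j = n) (Aw N)" and succ_Cw: "successively (\<lambda>i j. i + j = n) (Cw N)"
proof -
  have "successively (\<lambda>i j. i + j = n) (Aw N) \<and> successively (\<lambda>i j. i + j = n) (1 # Aw N)"
    using n2 by (induction N) auto
  moreover have "successively (\<lambda>i j. i + j = n) (Cw N) \<and> successively (\<lambda>i j. i + j = n) ((n - 1) # Cw N)"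
    using n2 by (induction N) auto
  ultimately show "successively (\<lambda>i j. i + j = n) (Aw N)" "successively (\<lambda>i j. i + j = n) (Cw N)" by auto
qed

lemma Rw_bpu_alternating: "successively (\<lambda>i j. i + j = n) u \<Longrightarrow> Rw (bpu u \<mu>) = 0"
proof (induction u rule: induct_list012)
  case (3 i j u)
  then show ?case
    by (simp add: additive_diff[OF Rw_additive] hm_def Rw_sg Rw_pre additive_0[OF pre_additive])
qed (simp_all add: additive_0[OF Rw_additive])

text \<open>Every merging inside an alternating word produces an entry \<open>x\<^sup>0\<close>, so that only the merging at the front survives.\<close>

lemma Rz_bpu_alternating:
  "successively (\<lambda>i j. i + j = n) (j # u) \<Longrightarrow> 0 \<notin> set u \<Longrightarrow> Rz (bpu (i # j # u) \<mu>) = hm i j u \<mu>"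
  by (simp only: bpu.simps additive_diff[OF Rz_additive] Rz_pre Rw_bpu_alternating)
    (simp add: Rz_hm additive_0[OF pre_additive])

lemma rt_Aw: "rt (Aw (Suc N)) \<mu> = sg (Cw (Suc N)) (\<alpha> \<mu>)"
  unfolding Aw_snoc by (simp add: rt_def del: One_nat_def) (simp add: pow_1)

lemma rt_Cw: "rt (Cw (Suc N)) \<mu> = sg (Aw (Suc N)) ((\<alpha> ^^ (n - 1)) \<mu>)"
  unfolding Cw_snoc by (simp add: rt_def)

lemma bY_Aw: "bY (sg (Aw (Suc N)) \<mu>) = sg (0 # Cw N) (\<alpha> \<mu> * l) - sg (0 # Aw N) (\<mu> * l)"
proof -
  have "bun (Aw (Suc N)) \<mu> = bpu ((n - 1) # 1 # Aw N) \<mu> - ext mrg (rt (Aw (Suc N)) \<mu>)"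
    by (simp add: bun_def length_Aw sgp_def del: bpu.simps One_nat_def)
  moreover have "ext mrg (rt (Aw (Suc N)) \<mu>) = sg (0 # Cw N) (- (\<alpha> \<mu> * l))"
    using n2 unfolding rt_Aw by (simp add: E_mrg_sg hm_def)
  moreover have "Rz (bpu ((n - 1) # 1 # Aw N) \<mu>) = hm (n - 1) 1 (Aw N) \<mu>"
    by (rule Rz_bpu_alternating[OF _ Aw_pos]) (use succ_Aw[of "Suc N"] in simp)
  moreover have "hm (n - 1) 1 (Aw N) \<mu> = sg (0 # Aw N) (- (\<mu> * l))"
    using n2 by (simp add: hm_def)
  ultimately show ?thesis
    by (simp add: bY_def E_bun_sg additive_diff[OF Rz_additive] additiveD[OF Rz_additive] additive_neg[OF Rz_additive] Rz_sg Cw_pos single_uminus del: Aw.simps bpu.simps One_nat_def)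
qed

lemma bY_0Aw: "bY (sg (0 # Aw (Suc N)) \<mu>) = sg (Aw (Suc N)) \<mu> + sg (Cw (Suc N)) (\<alpha> \<mu>)"
proof -
  have "bun (0 # Aw (Suc N)) \<mu> = bpu (0 # (n - 1) # 1 # Aw N) \<mu> + ext mrg (rt (0 # Aw (Suc N)) \<mu>)"
    by (simp add: bun_def length_Aw sgp_def del: bpu.simps One_nat_def)
  moreover have "rt (0 # Aw (Suc N)) \<mu> = sg (1 # 0 # (n - 1) # Cw N) (\<alpha> \<mu>)"
    unfolding Aw_snoc by (simp add: rt_def del: One_nat_def) (simp add: pow_1)
  moreover have "Rz (bpu (0 # (n - 1) # 1 # Aw N) \<mu>) = hm 0 (n - 1) (1 # Aw N) \<mu>"
    by (rule Rz_bpu_alternating) (use succ_Aw[of "Suc N"] Aw_pos[of N] in simp_all)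
  ultimately show ?thesis using n2 Cw_pos[of N]
    by (simp add: bY_def E_bun_sg additiveD[OF Rz_additive] E_mrg_sg hm_def Rz_sg del: bpu.simps)
qed

lemma bY_0Cw: "bY (sg (0 # Cw (Suc N)) \<mu>) = sg (Cw (Suc N)) \<mu> + sg (Aw (Suc N)) ((\<alpha> ^^ (n - 1)) \<mu>)"
proof -
  have "bun (0 # Cw (Suc N)) \<mu> = bpu (0 # 1 # (n - 1) # Cw N) \<mu> + ext mrg (rt (0 # Cw (Suc N)) \<mu>)"
    by (simp add: bun_def length_Cw sgp_def del: bpu.simps One_nat_def)
  moreover have "rt (0 # Cw (Suc N)) \<mu> = sg ((n - 1) # 0 # 1 # Aw N) ((\<alpha> ^^ (n - 1)) \<mu>)"
    unfolding Cw_snoc by (simp add: rt_def)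
  moreover have "Rz (bpu (0 # 1 # (n - 1) # Cw N) \<mu>) = hm 0 1 ((n - 1) # Cw N) \<mu>"
    by (rule Rz_bpu_alternating) (use succ_Cw[of "Suc N"] Cw_pos[of "Suc N"] in simp_all)
  ultimately show ?thesis using n2 Aw_pos[of N]
    by (simp add: bY_def E_bun_sg additiveD[OF Rz_additive] E_mrg_sg hm_def Rz_sg del: bpu.simps)
qed

lemma rt_pow_Aw:
  assumes "(\<alpha> ^^ n) \<mu> = \<mu>"
  shows "(ext rt ^^ k) (sg (Aw (Suc N)) \<mu>) = (if even k then sg (Aw (Suc N)) \<mu> else sg (Cw (Suc N)) (\<alpha> \<mu>))"
proof (induction k)
  case (Suc k)
  have "(\<alpha> ^^ (n - 1)) (\<alpha> \<mu>) = (\<alpha> ^^ (n - 1 + 1)) \<mu>" by (simp only: pow_pow[symmetric] pow_1) simp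
  then have "(\<alpha> ^^ (n - 1)) (\<alpha> \<mu>) = \<mu>" using assms n2 by simp
  then show ?case using Suc by (simp add: E_rt_sg rt_Aw rt_Cw del: Aw.simps Cw.simps)
qed simp

text \<open>In positive even degrees these chains are built in such a way that the boundary vanishes when \<open>\<alpha>\<^sup>n(x) = x\<close>.\<close>

definition te :: "nat \<Rightarrow> 'a \<Rightarrow> (nat list \<Rightarrow>\<^sub>0 'a)" where
  "te N x = sg (0 # Aw N) x - sg (0 # Cw N) (\<alpha> x)"

lemma te_additive: "additive (te N)"
  by (simp add: additive_def te_def single_add al_add)

lemma sum_alternate: "(\<Sum>i<2 * N. if even i then a else b) = (\<Sum>i<N. a + b :: 'g::ab_group_add)" for N :: nat
  by (induction N) (simp_all add: ac_simps)

lemma BY_Aw: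
  assumes "(\<alpha> ^^ n) \<mu> = \<mu>"
  shows "BY (Suc (2 * N)) (sg (Aw (Suc N)) \<mu>) = te (Suc N) (\<Sum>u\<le>N. \<mu>)"
proof -
  have "Bun (Suc (2 * N)) (sg (Aw (Suc N)) \<mu>) =
      (\<Sum>i<2 * Suc N. if even i then sg (0 # Aw (Suc N)) \<mu> else - sg (0 # Cw (Suc N)) (\<alpha> \<mu>))"
    unfolding Bun_def
  proof (rule sum.cong)
    fix i assume i: "i \<in> {..<2 * Suc N}"
    then have e: "even (Suc (Suc (2 * N)) - i) = even i" by auto
    show "sgp (i * Suc (2 * N)) (pre 0 ((ext rt ^^ (Suc (Suc (2 * N)) - i)) (sg (Aw (Suc N)) \<mu>))) =
        (if even i then sg (0 # Aw (Suc N)) \<mu> else - sg (0 # Cw (Suc N)) (\<alpha> \<mu>))"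
      unfolding rt_pow_Aw[OF assms] e by (simp add: sgp_def pre_sg del: Aw.simps Cw.simps)
  qed simp
  also have "\<dots> = (\<Sum>i<Suc N. te (Suc N) \<mu>)"
    unfolding sum_alternate by (simp add: te_def)
  also have "\<dots> = te (Suc N) (\<Sum>u\<le>N. \<mu>)"
    by (simp only: additive_sum[OF te_additive] lessThan_Suc_atMost)
  finally show ?thesis
    using Aw_pos[of "Suc N"] Cw_pos[of "Suc N"]
    by (simp add: BY_def te_def additive_diff[OF Rz_additive] Rz_sg del: Aw.simps Cw.simps)
qed

text \<open>The comparison map. In positive degrees it only sees the eigenvalues \<open>w \<noteq> 1\<close> with \<open>w\<^sup>n = 1\<close>; the small complexes for the
  other eigenvalues are exact in positive degrees. The factor \<open>P'\<close> compensates the factor \<open>\<alpha> - 1\<close> in the boundary of the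
  small complex, which makes \<open>th\<close> commute with \<open>b\<close> and \<open>B\<close> exactly, except for a commutator in degree \<open>0\<close>.\<close>

definition th :: "nat \<Rightarrow> 'a \<Rightarrow> (nat list \<Rightarrow>\<^sub>0 'a)" where
  "th r x = (if r = 0 then sg [0] x else if even r then te (r div 2) (P' x) else sg (Aw (Suc (r div 2))) (P x))"

lemma th_additive: "additive (th r)"
  by (auto simp: additive_def th_def single_add additiveD[OF te_additive] additiveD[OF P'_additive] additiveD[OF P_additive])

lemma keys_te: "ks (te N x) \<subseteq> {t \<in> Wt (2 * N). sum_list t = n * N}"
  unfolding te_def using Aw0_Wt[of N] Cw0_Wt[of N]
  by (intro keys_diff_sub) (auto simp: sum_Aw sum_Cw)

lemma keys_th: "ks (th r x) \<subseteq> {t \<in> Wt r. sum_list t = n * ((r + 1) div 2)}"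
proof -
  consider "r = 0" | N where "r = Suc (2 * N)" | N where "r = 2 * N" "r \<noteq> 0"
    by (metis evenE oddE Suc_eq_plus1)
  then show ?thesis
  proof cases
    case 2
    then show ?thesis using Aw_Wt[of N] sum_Aw[of "Suc N"] by (auto simp: th_def simp del: Aw.simps)
  next
    case 3
    then show ?thesis using keys_te[of N "P' x"] by (simp add: th_def)
  qed (use n2 in \<open>auto simp: th_def Wt_def\<close>)
qed

lemma th_denY: "x \<in> TC (n * ((r + 1) div 2)) \<Longrightarrow> th r x \<in> denY"
proof -
  assume x: "x \<in> TC (n * ((r + 1) div 2))"
  consider "r = 0" | N where "r = Suc (2 * N)" | N where "r = 2 * N" "r \<noteq> 0"
    by (metis evenE oddE Suc_eq_plus1)
  then show ?thesis
  proof cases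
    case 2
    then show ?thesis using x sum_Aw[of "Suc N"] by (simp add: th_def denY_sg P_TC del: Aw.simps)
  next
    case 3
    then show ?thesis using x sum_Aw[of N] sum_Cw[of N]
      by (simp add: th_def te_def denY_sg P'_TC TC_al denY_diff)
  qed (use x in \<open>simp add: th_def denY_sg\<close>)
qed

lemma bY_th_odd: "bY (th (Suc (2 * N)) x) - th (2 * N) ((\<alpha> x - x) * l) \<in> denY"
proof (cases "N = 0")
  case True
  have "bY (th (Suc (2 * N)) x) - th (2 * N) ((\<alpha> x - x) * l) =
      sg [0] (\<alpha> (P x) * l) - sg [0] (P x * l) - sg [0] ((\<alpha> x - x) * l)"
    using bY_Aw[of 0 "P x"] True by (simp add: th_def)
  also have "\<dots> = - sg [0] ((\<alpha> (x - P x) - (x - P x)) * l)"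
    by (simp only: single_diff[symmetric] single_uminus[symmetric] al_diff) (simp add: algebra_simps)
  also have "\<dots> \<in> denY" using diff_P_TC[of x] by (simp add: denY_neg denY_sg)
  finally show ?thesis .
next
  case False
  then show ?thesis using bY_Aw[of N "P x"]
    by (simp add: th_def te_def P'_l P'_diff al_neg al_mult al_l single_uminus denY_0 del: Aw.simps)
qed

lemma bY_th_even: "bY (th (2 * Suc N) x) = 0"
proof -
  \<comment> \<open>the two words of \<open>te\<close> rotate into each other; a full turn applies \<open>\<alpha>\<^sup>n\<close>, which is the identity on the image of \<open>P'\<close>\<close>
  have "(\<alpha> ^^ (n - 1)) (\<alpha> y) = (\<alpha> ^^ (n - 1 + 1)) y" for y by (simp only: pow_pow[symmetric] pow_1) simp
  then have "(\<alpha> ^^ (n - 1)) (\<alpha> (P' x)) = P' x" using pow_P' n2 by simp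
  then show ?thesis
    by (simp add: th_def te_def additive_diff[OF bY_additive] bY_0Aw bY_0Cw del: Aw.simps Cw.simps)
qed

lemma th_E: "th (Suc (2 * N)) (E x) = 0"
  by (simp add: th_def P_E)

lemma BY_th_even: "BY (2 * N) (th (2 * N) x) = 0"
proof (rule BY_zero)
  fix t assume "t \<in> ks (th (2 * N) x)"
  then show "0 \<in> set t"
    using keys_diff[of "sg (0 # Aw N) (P' x)" "sg (0 # Cw N) (\<alpha> (P' x))"]
    by (auto simp: th_def te_def split: if_splits)
qed

lemma BY_th_odd: "BY (Suc (2 * N)) (th (Suc (2 * N)) x) = th (2 * Suc N) (\<Sum>u\<le>N. (\<alpha> ^^ (n * u)) (x - \<alpha> x))"
proof -
  have pP: "(\<alpha> ^^ (n * u)) (P x) = P x" for u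
    by (induction u) (simp_all add: pow_P pow_pow[symmetric])
  have pp: "P' ((\<alpha> ^^ i) y) = (\<alpha> ^^ i) (P' y)" for i y
    by (induction i) (simp_all add: P'_al)
  have "P' (x - \<alpha> x) = P x" using P'_diff[of x] additive_neg[OF P'_additive, of "\<alpha> x - x"] by simp
  then have "P' (\<Sum>u\<le>N. (\<alpha> ^^ (n * u)) (x - \<alpha> x)) = (\<Sum>u\<le>N. P x)"
    by (simp only: additive_sum[OF P'_additive] pp pP)
  then show ?thesis using BY_Aw[OF pow_P, of N x] by (simp add: th_def del: Aw.simps)
qed

end

section \<open>The comparison map is a quasi-isomorphism\<close>

context separated_algebra
begin

text \<open>The parts of weight at least \<open>n N\<close> vanish modulo the denominators. As the boundary does not increase the weight, chains
  are treated from the highest weight downwards.\<close>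

definition low :: "nat \<Rightarrow> (nat list \<Rightarrow>\<^sub>0 'a) \<Rightarrow> bool" where
  "low N z \<longleftrightarrow> (\<forall>t. n * N \<le> sum_list t \<longrightarrow> lk z t \<in> TC (sum_list t))"

lemma low_0: "low 0 z \<longleftrightarrow> z \<in> denY" by (simp add: low_def denY_def)

lemma low_den: "z \<in> denY \<Longrightarrow> low N z" by (simp add: low_def denY_def)

lemma low_add: "low N u \<Longrightarrow> low N v \<Longrightarrow> low N (u + v)"
  and low_diff: "low N u \<Longrightarrow> low N v \<Longrightarrow> low N (u - v)"
  by (auto simp: low_def lookup_add lookup_minus TC_add TC_diff)

lemma low_mono: "low N z \<Longrightarrow> N \<le> M \<Longrightarrow> low M z"
  unfolding low_def by (meson mult_le_mono2 order.trans)

lemma low_keys: "ks z \<subseteq> {t. sum_list t < n * N} \<Longrightarrow> low N z"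
  unfolding low_def
proof (intro allI impI)
  fix t assume "ks z \<subseteq> {t. sum_list t < n * N}" "n * N \<le> sum_list t"
  then have "t \<notin> ks z" by auto
  then show "lk z t \<in> TC (sum_list t)" by (simp add: in_keys_iff TC_0)
qed

lemma low_step: "low (Suc N) z \<Longrightarrow> prt (n * N) z \<in> dd (TC (n * N)) \<Longrightarrow> low N z"
  unfolding low_def
proof (intro allI impI)
  fix t assume l: "\<forall>t. n * Suc N \<le> sum_list t \<longrightarrow> lk z t \<in> TC (sum_list t)"
    and p: "prt (n * N) z \<in> dd (TC (n * N))" and t: "n * N \<le> sum_list t"
  show "lk z t \<in> TC (sum_list t)"
  proof (cases "n dvd sum_list t")
    case True
    then obtain k where k: "sum_list t = n * k" by blast
    then have "N \<le> k" using t n2 by simp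
    show ?thesis
    proof (cases "k = N")
      case True
      then show ?thesis using lk_dd[OF p, of t] k by (simp add: lk_prt)
    next
      case False
      then have "n * Suc N \<le> sum_list t" using \<open>N \<le> k\<close> k by (simp del: mult_Suc_right)
      then show ?thesis using l by blast
    qed
  qed (simp add: TC_UNIV)
qed

lemma low_prt: "low N z \<Longrightarrow> prt (n * N) z \<in> dd (TC (n * N))"
  unfolding dd_def
proof (intro CollectI allI)
  fix t assume "low N z"
  then have "n * N \<le> sum_list t \<Longrightarrow> lk z t \<in> TC (sum_list t)" by (simp add: low_def)
  then show "lk (prt (n * N) z) t \<in> TC (n * N)"
    by (cases "sum_list t = n * N") (simp_all add: lk_prt TC_0)
qed

lemma dd_denY: "v \<in> dd (TC I) \<Longrightarrow> ks v \<subseteq> {t. sum_list t = I} \<Longrightarrow> v \<in> denY"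
  unfolding denY_def
proof (intro CollectI allI)
  fix t assume "v \<in> dd (TC I)" "ks v \<subseteq> {t. sum_list t = I}"
  then show "lk v t \<in> TC (sum_list t)"
    by (cases "t \<in> ks v") (auto simp: dd_def in_keys_iff TC_0)
qed

text \<open>For a chain with vanishing parts of weight above \<open>n N\<close>, the weight \<open>n N\<close> part of the boundary is the boundary \<open>b0\<close>.\<close>

lemma prt_bY_low:
  assumes z: "ks z \<subseteq> Wt (Suc r)" and l: "low (Suc N) z"
  shows "prt (n * N) (bY z) - ext b0 (prt (n * N) z) \<in> dd (TC (n * N))"
proof -
  have e: "n * Suc N = n * N + n" by simp
  have "prt (n * N + n) z \<in> dd (TC (n * N + n))" using low_prt[OF l] unfolding e .
  moreover have "ks (prt (n * N + n) z) \<subseteq> {t. sum_list t = n * N + n}" by (auto simp: ks_prt)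
  ultimately have "prt (n * N + n) z \<in> denY" by (rule dd_denY)
  then have "low N (bY (prt (n * N + n) z))" by (intro low_den denY_bY)
  from low_prt[OF this] show ?thesis unfolding prt_bY[OF z, of "n * N"] by simp
qed

lemma bY_homogeneous:
  assumes v: "ks v \<subseteq> {t \<in> Wt (Suc r). sum_list t = n * N}"
  shows "prt (n * N) (bY v) = ext b0 v" and "low (Suc N) (bY v)"
proof -
  have kv: "ks v \<subseteq> Wt (Suc r)" and p: "prt (n * N) v = v" and p0: "J > n * N \<Longrightarrow> prt J v = 0" for J
    using v by (auto intro!: prt_id prt_null)
  have z: "prt J (bY 0) = 0" for J by (simp add: additive_0[OF bY_additive] additive_0[OF prt_additive])
  have "prt (n * N + n) v = 0" using n2 by (intro p0) simp
  then show "prt (n * N) (bY v) = ext b0 v" using prt_bY[OF kv, of "n * N"] z p by simp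
  have "prt J (bY v) = 0" if "J > n * N" for J
  proof -
    have "prt J v = 0" "prt (J + n) v = 0" using that p0 by simp_all
    then show ?thesis using prt_bY[OF kv, of J] z by (simp add: additive_0[OF E_b0])
  qed
  then have "lk (bY v) t = 0" if "sum_list t > n * N" for t
    using that lk_prt[of "sum_list t" "bY v" t] by simp
  then show "low (Suc N) (bY v)" using n2 by (simp add: low_def TC_0)
qed

lemma weight_step:
  assumes z: "ks z \<subseteq> Wt r" and l: "low (Suc N) z" and c: "r > 0 \<Longrightarrow> low N (bY z)"
    and q: "r = 2 * N \<Longrightarrow> qf (prt (n * N) z) \<in> TC (n * N)"
    and p: "r + 1 = 2 * N \<Longrightarrow> pf (prt (n * N) z) \<in> TC (n * N)"
  shows "\<exists>z'. ks z' \<subseteq> Wt (Suc r) \<and> low N (z - bY z')"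
proof -
  have "ext b0 (prt (n * N) z) \<in> dd (TC (n * N))" if r: "r > 0"
  proof -
    obtain r' where r': "r = Suc r'" using r by (cases r) auto
    from dd_diff[OF TC_subspace low_prt[OF c[OF r]] prt_bY_low[OF z[unfolded r'] l]] show ?thesis by simp
  qed
  moreover have "ks (prt (n * N) z) \<subseteq> {t \<in> Wt r. sum_list t = n * N}" using z by (auto simp: ks_prt)
  ultimately obtain v' where v': "ks v' \<subseteq> {t \<in> Wt (Suc r). sum_list t = n * N}"
    and vv: "prt (n * N) z - ext b0 v' \<in> dd (TC (n * N))"
    using HH_acyclic[of "prt (n * N) z" r N] q p by blast
  have "low N (z - bY v')"
  proof (rule low_step)
    show "low (Suc N) (z - bY v')" by (intro low_diff l bY_homogeneous(2)[OF v'])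
    show "prt (n * N) (z - bY v') \<in> dd (TC (n * N))"
      using vv by (simp add: additive_diff[OF prt_additive] bY_homogeneous(1)[OF v'])
  qed
  then show ?thesis using v' by blast
qed

lemma low_bY_diff:
  assumes "ks z' \<subseteq> Wt (Suc r)" "r > 0 \<Longrightarrow> low N (bY z)" "r > 0"
  shows "low N (bY (z - bY z'))"
proof -
  obtain r' where "r = Suc r'" using assms(3) by (cases r) auto
  then have "bY (bY z') \<in> denY" using assms(1) normal_bb by simp
  then show ?thesis using assms(2,3) by (simp add: additive_diff[OF bY_additive] low_diff low_den)
qed

lemma keys_diff_bY: "ks z \<subseteq> Wt r \<Longrightarrow> ks z' \<subseteq> Wt (Suc r) \<Longrightarrow> ks (z - bY z') \<subseteq> Wt r"
  by (intro keys_diff_sub keys_bY)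

text \<open>In the weights \<open>n N\<close> without homology in the given degree, a chain can be pushed down by subtracting boundaries.\<close>

lemma weight_descent:
  assumes "N1 \<le> N0" "ks z \<subseteq> Wt r" "low N0 z" "r > 0 \<Longrightarrow> low N1 (bY z)"
    "\<And>N. N1 \<le> N \<Longrightarrow> N < N0 \<Longrightarrow> r \<noteq> 2 * N \<and> r + 1 \<noteq> 2 * N"
  shows "\<exists>z'. ks z' \<subseteq> Wt (Suc r) \<and> low N1 (z - bY z')"
  using assms
proof (induction N0 arbitrary: z rule: dec_induct)
  case base
  then show ?case by (intro exI[of _ 0]) (simp add: additive_0[OF bY_additive])
next
  case (step N)
  have "\<exists>z'. ks z' \<subseteq> Wt (Suc r) \<and> low N (z - bY z')"
  proof (rule weight_step)
    show "r > 0 \<Longrightarrow> low N (bY z)" using step.prems(3) step.hyps low_mono by blast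
  qed (use step.prems step.hyps in auto)
  then obtain z1 where z1: "ks z1 \<subseteq> Wt (Suc r)" "low N (z - bY z1)" by blast
  have "\<exists>z'. ks z' \<subseteq> Wt (Suc r) \<and> low N1 ((z - bY z1) - bY z')"
  proof (rule step.IH)
    show "ks (z - bY z1) \<subseteq> Wt r" by (rule keys_diff_bY[OF step.prems(1) z1(1)])
    show "r > 0 \<Longrightarrow> low N1 (bY (z - bY z1))" by (rule low_bY_diff[OF z1(1) step.prems(3)])
  qed (use z1 step.prems in auto)
  then obtain z2 where z2: "ks z2 \<subseteq> Wt (Suc r)" "low N1 ((z - bY z1) - bY z2)" by blast
  have "ks (z1 + z2) \<subseteq> Wt (Suc r)" by (intro keys_add_sub z1 z2)
  moreover have "z - bY (z1 + z2) = (z - bY z1) - bY z2" by (simp add: additiveD[OF bY_additive])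
  ultimately show ?case using z2(2) by metis
qed

lemma low_top: "ks z \<subseteq> Wt r \<Longrightarrow> low (Suc r) z"
proof (rule low_keys)
  assume z: "ks z \<subseteq> Wt r"
  have s: "sum_list t \<le> (n - 1) * length t" if "set t \<subseteq> {..<n}" for t
    using that by (induction t) auto
  show "ks z \<subseteq> {t. sum_list t < n * Suc r}"
  proof
    fix t assume "t \<in> ks z"
    then have "t \<in> un r" using z by (auto simp: Wt_un)
    then have "sum_list t \<le> (n - 1) * Suc r" using s[of t] by (auto simp: un_def)
    also have "\<dots> < n * Suc r" using n2 by (simp del: mult_Suc_right)
    finally show "t \<in> {t. sum_list t < n * Suc r}" by simp
  qed
qed

lemma descent_from_top:
  assumes "ks z \<subseteq> Wt r" "r > 0 \<Longrightarrow> low N1 (bY z)" "\<And>N. N1 \<le> N \<Longrightarrow> r \<noteq> 2 * N \<and> r + 1 \<noteq> 2 * N"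
  shows "\<exists>z'. ks z' \<subseteq> Wt (Suc r) \<and> low N1 (z - bY z')"
proof (cases "N1 \<le> Suc r")
  case True
  then show ?thesis by (rule weight_descent[OF _ assms(1) low_top[OF assms(1)] assms(2)]) (use assms(3) in auto)
next
  case False
  then have "low N1 z" by (intro low_mono[OF low_top[OF assms(1)]]) simp
  then show ?thesis by (intro exI[of _ 0]) (simp add: additive_0[OF bY_additive])
qed

lemma low_th: "(r + 1) div 2 < N \<Longrightarrow> low N (th r x)"
proof (rule low_keys)
  assume "(r + 1) div 2 < N"
  then have "n * ((r + 1) div 2) < n * N" using n2 by simp
  then show "ks (th r x) \<subseteq> {t. sum_list t < n * N}" using keys_th[of r x] by auto
qed

lemma prt_th: "prt (n * ((r + 1) div 2)) (th r x) = th r x"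
  using keys_th[of r x] by (auto intro: prt_id)

lemma keys_th_Wt: "ks (th r x) \<subseteq> Wt r" using keys_th[of r x] by blast

lemma low_trans: "u - v \<in> denY \<Longrightarrow> low N v \<Longrightarrow> low N u"
  using low_add[OF low_den[of "u - v" N], of v] by simp

lemma qf_dd: "v \<in> dd (TC i) \<Longrightarrow> qf v \<in> TC i"
proof (rule additive_mem[OF qf_additive TC_0 TC_add])
  fix t assume "v \<in> dd (TC i)"
  then have "lk v t \<in> TC i" by (rule lk_dd)
  then show "qf (sg t (lk v t)) \<in> TC i" by (simp add: qf_sg TC_0)
qed

lemma pf_dd: "v \<in> dd (TC i) \<Longrightarrow> pf v \<in> TC i"
proof (rule additive_mem[OF pf_additive TC_0 TC_add])
  fix t assume "v \<in> dd (TC i)"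
  then have "lk v t \<in> TC i" by (rule lk_dd)
  then show "pf (sg t (lk v t)) \<in> TC i" by (simp add: pf_sg TC_0 TC_pow gs_TC)
qed

lemma qf_te: "qf (te N x) = x - \<alpha> x"
  by (simp add: te_def additive_diff[OF qf_additive] qf_sg chi_Aw chi_Cw)

lemma P'_P: "P' x - \<alpha> (P' x) = P x"
  using P'_diff[of x] by (simp add: additive_diff[OF P'_additive] P'_al algebra_simps)

lemma qf_th_even: "qf (th (2 * Suc N) x) = P x"
  by (simp add: th_def qf_te P'_P)

lemma pf_th_odd: "pf (th (Suc (2 * N)) x) = P x"
  using n2 by (simp add: th_def pf_sg chi_Aw gs_1[unfolded One_nat_def])

text \<open>The chain is pushed down to weight \<open>n (N + 1)\<close>, where \<open>qf\<close> obstructs. The invariant \<open>\<mu> = qf v\<close> satisfies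
  \<open>E \<mu> = P s\<close> modulo commutators by \<open>pf_b0\<close>. Applying \<open>P\<close> and \<open>G\<close> shows that \<open>P s\<close> and \<open>\<mu> - P \<mu>\<close> are sums of commutators, so that
  \<open>th (P \<mu> + G s)\<close> removes the obstruction, and \<open>E G s = s - P s\<close>.\<close>

lemma cone_even:
  assumes z: "ks z \<subseteq> Wt (2 * Suc N)" and zs: "bY z - th (Suc (2 * N)) s \<in> denY"
  shows "\<exists>s' z'. ks z' \<subseteq> Wt (Suc (2 * Suc N)) \<and> z - th (2 * Suc N) s' - bY z' \<in> denY \<and>
    s - E s' \<in> TC (n * Suc N)"
proof -
  let ?R = "2 * Suc N" and ?M = "Suc N"
  have lth: "low (Suc ?M) (th (Suc (2 * N)) x)" "low (Suc ?M) (th ?R x)" for x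
    by (rule low_th; simp)+
  have pth: "prt (n * ?M) (th (Suc (2 * N)) x) = th (Suc (2 * N)) x" "prt (n * ?M) (th ?R x) = th ?R x" for x
    using prt_th[of "Suc (2 * N)" x] prt_th[of ?R x] by simp_all
  have "\<exists>z'. ks z' \<subseteq> Wt (Suc ?R) \<and> low (Suc ?M) (z - bY z')"
    by (rule descent_from_top[OF z low_trans[OF zs lth(1)]]) presburger+
  then obtain a where a: "ks a \<subseteq> Wt (Suc ?R)" "low (Suc ?M) (z - bY a)" by blast
  define z1 where "z1 = z - bY a"
  have kz1: "ks z1 \<subseteq> Wt ?R" unfolding z1_def by (rule keys_diff_bY[OF z a(1)])
  have "bY (bY a) \<in> denY" using normal_bb[of a "Suc (2 * N)"] a(1) by simp
  from denY_diff[OF zs this] have z1s: "bY z1 - th (Suc (2 * N)) s \<in> denY"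
    by (simp add: z1_def additive_diff[OF bY_additive] algebra_simps)
  define v where "v = prt (n * ?M) z1"
  have kv: "ks v \<subseteq> {t \<in> Wt ?R. sum_list t = n * ?M}" using kz1 by (auto simp: v_def ks_prt)
  define \<mu> where "\<mu> = qf v"
  have m1: "prt (n * ?M) (bY z1) - ext b0 v \<in> dd (TC (n * ?M))"
    unfolding v_def by (rule prt_bY_low[where r = "Suc (2 * N)"]) (use kz1 a(2) in \<open>simp_all add: z1_def\<close>)
  have m2: "prt (n * ?M) (bY z1) - th (Suc (2 * N)) s \<in> dd (TC (n * ?M))"
    using low_prt[OF low_den[OF z1s], of ?M] unfolding additive_diff[OF prt_additive] pth .
  from dd_diff[OF TC_subspace m2 m1] have "pf (ext b0 v - th (Suc (2 * N)) s) \<in> TC (n * ?M)" by (intro pf_dd) simp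
  moreover have "pf (ext b0 v) = E \<mu>" unfolding \<mu>_def by (rule pf_Eb0[OF kv]) simp
  ultimately have e: "E \<mu> - P s \<in> TC (n * ?M)" by (simp add: additive_diff[OF pf_additive] pf_th_odd)
  have Ps: "P s \<in> TC (n * ?M)"
    using TC_neg[OF P_TC[OF e]] by (simp add: additive_diff[OF P_additive] P_E P_P)
  then have "E \<mu> \<in> TC (n * ?M)" using TC_add[OF e] by fastforce
  from G_TC[OF this] have m: "\<mu> - P \<mu> \<in> TC (n * ?M)" by (simp add: G_E)
  define s' where "s' = P \<mu> + G s"
  have s1: "P s' = P \<mu>" by (simp add: s'_def additiveD[OF P_additive] P_P P_G)
  have s2: "s - E s' = P s" by (simp add: s'_def E_add E_P E_G)
  define z2 where "z2 = z1 - th ?R s'"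
  have kz2: "ks z2 \<subseteq> Wt ?R" unfolding z2_def by (intro keys_diff_sub kz1 keys_th_Wt)
  have "th (Suc (2 * N)) s = th (Suc (2 * N)) (P s)" by (simp add: th_def P_P)
  moreover have "th (Suc (2 * N)) (P s) \<in> denY" using Ps by (intro th_denY) simp
  ultimately have "bY z1 \<in> denY" using denY_cong[OF z1s] by simp
  then have bz2: "bY z2 \<in> denY" unfolding z2_def by (simp add: additive_diff[OF bY_additive] bY_th_even del: mult_Suc_right)
  have "\<exists>z'. ks z' \<subseteq> Wt (Suc ?R) \<and> low ?M (z2 - bY z')"
  proof (rule weight_step[OF kz2])
    show "low (Suc ?M) z2" using a(2) lth by (simp add: z2_def z1_def low_diff del: mult_Suc_right)
    show "low ?M (bY z2)" by (rule low_den[OF bz2])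
    have "prt (n * ?M) z2 = v - th ?R s'" by (simp only: z2_def additive_diff[OF prt_additive] pth v_def)
    then show "qf (prt (n * ?M) z2) \<in> TC (n * ?M)"
      using m by (simp add: additive_diff[OF qf_additive] qf_th_even s1 \<mu>_def[symmetric] del: mult_Suc_right)
  qed simp
  then obtain b where b: "ks b \<subseteq> Wt (Suc ?R)" "low ?M (z2 - bY b)" by blast
  have "\<exists>z'. ks z' \<subseteq> Wt (Suc ?R) \<and> low 0 ((z2 - bY b) - bY z')"
  proof (rule weight_descent[OF _ keys_diff_bY[OF kz2 b(1)] b(2)])
    show "low 0 (bY (z2 - bY b))" by (rule low_bY_diff[OF b(1) low_den[OF bz2]]) simp
  qed auto
  then obtain c where c: "ks c \<subseteq> Wt (Suc ?R)" "(z2 - bY b) - bY c \<in> denY" by (auto simp: low_0)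
  have "z - th ?R s' - bY (a + b + c) = (z2 - bY b) - bY c"
    by (simp add: z2_def z1_def additiveD[OF bY_additive] algebra_simps del: mult_Suc_right)
  moreover have "ks (a + b + c) \<subseteq> Wt (Suc ?R)" by (intro keys_add_sub a b c)
  ultimately show ?thesis using c(2) Ps s2 by metis
qed

lemma hdc_Eb0:
  assumes u: "ks u \<subseteq> Wt (Suc r)"
  shows "hdc 0 (ext b0 u) = - ext bp (hdc 0 u)"
proof (rule poly_mapping_eqI)
  fix s
  show "lk (hdc 0 (ext b0 u)) s = lk (- ext bp (hdc 0 u)) s"
    unfolding lk_hdc
  proof (rule additive_eq[where F = "\<lambda>u. lk (ext b0 u) (0 # s)" and G = "\<lambda>u. lk (- ext bp (hdc 0 u)) s"])
    fix t assume "t \<in> ks u"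
    then have t: "t \<in> Wt (Suc r)" using u by blast
    then obtain i w where t': "t = i # w" by (cases t) (auto simp: Wt_def)
    have "hdc 0 (sg t (lk u t)) = (if i = 0 then sg w (lk u t) else 0)" by (simp add: t' hdc_sg)
    then show "lk (ext b0 (sg t (lk u t))) (0 # s) = lk (- ext bp (hdc 0 (sg t (lk u t)))) s"
      using lk_b0_head[OF t, of 0 "lk u t" s] by (simp add: E_b0_sg t' E_bp_sg additive_0[OF E_bp])
  qed (simp_all add: additive_def lookup_add additiveD[OF E_b0] additiveD[OF E_bp] additiveD[OF hdc_additive])
qed

text \<open>Boundaries from degree \<open>2N + 1\<close> do not reach the class detected by \<open>qf\<close>.\<close>

lemma qf_Eb0:
  assumes u: "ks u \<subseteq> {t \<in> Wt (Suc (2 * N)). sum_list t = n * N}"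
  shows "qf (ext b0 u) = 0"
proof -
  have "qf (ext b0 u) = chs (hdc 0 (ext b0 u))"
    by (rule qf_hdc) (rule keys_Eb0[OF u])
  also have "\<dots> = - chs (ext bp (hdc 0 u))"
    using hdc_Eb0[of u "2 * N"] u by (simp add: additive_neg[OF chs_additive] subset_iff)
  also have "chs (ext bp (hdc 0 u)) = chf (2 * N) (ext bp (hdc 0 u))" by (simp add: chf_even)
  also have "\<dots> = 0"
  proof (rule chf_Ebp_exceptional)
    show "ks (hdc 0 u) \<subseteq> Ww (Suc (2 * N)) (n * (2 * N div 2) + 2 * N mod 2)"
    proof
      fix s assume "s \<in> ks (hdc 0 u)"
      then have "0 # s \<in> ks u" by (simp add: in_keys_iff lk_hdc)
      from subsetD[OF u this] show "s \<in> Ww (Suc (2 * N)) (n * (2 * N div 2) + 2 * N mod 2)" by (auto simp: Wt_def Ww_def)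
    qed
  qed
  finally show ?thesis by simp
qed

text \<open>The obstruction \<open>\<mu> = pf z1\<close> now lives in weight \<open>n (N + 1)\<close>. Its part \<open>P \<mu>\<close> is the invariant of \<open>th (P \<mu>)\<close>, and \<open>\<mu> - P \<mu> = E G \<mu>\<close>
  is the invariant of the boundary of \<open>0 # Cw\<close> with coefficient \<open>G \<mu>\<close>. In the next weight \<open>n N\<close> the remaining
  \<open>s'' = s - (\<alpha> s' - s') l\<close> has to be a sum of commutators: \<open>P s''\<close> is one since \<open>qf\<close> vanishes on boundaries, and \<open>s'' - P s'' = G E s''\<close> is one
  since \<open>s\<close> is a cycle.\<close>

lemma cone_odd:
  assumes z: "ks z \<subseteq> Wt (Suc (2 * N))" and zs: "bY z - th (2 * N) s \<in> denY"
    and Es: "N > 0 \<Longrightarrow> E s \<in> TC (n * N)"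
  shows "\<exists>s' z'. ks z' \<subseteq> Wt (2 * Suc N) \<and> z - th (Suc (2 * N)) s' - bY z' \<in> denY \<and>
    s - (\<alpha> s' - s') * l \<in> TC (n * N)"
proof -
  let ?R = "Suc (2 * N)" and ?M = "Suc N"
  have lth: "low ?M (th (2 * N) x)" "low (Suc ?M) (th ?R x)" for x
    by (rule low_th; simp)+
  have pth: "prt (n * N) (th (2 * N) x) = th (2 * N) x" "prt (n * ?M) (th ?R x) = th ?R x" for x
    using prt_th[of "2 * N" x] prt_th[of ?R x] by simp_all
  have l2: "low (Suc ?M) (bY z)" by (rule low_mono[OF low_trans[OF zs lth(1)]]) simp
  have "\<exists>z'. ks z' \<subseteq> Wt (Suc ?R) \<and> low (Suc ?M) (z - bY z')"
    by (rule descent_from_top[OF z l2]) presburger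
  then obtain a where a: "ks a \<subseteq> Wt (Suc ?R)" "low (Suc ?M) (z - bY a)" by blast
  define z1 where "z1 = z - bY a"
  have kz1: "ks z1 \<subseteq> Wt ?R" unfolding z1_def by (rule keys_diff_bY[OF z a(1)])
  define \<mu> where "\<mu> = pf (prt (n * ?M) z1)"
  define s' where "s' = P \<mu>"
  define c where "c = sg (0 # Cw ?M) (G \<mu>)"
  have kc: "ks c \<subseteq> {t \<in> Wt (Suc ?R). sum_list t = n * ?M}"
    using Cw0_Wt[of ?M] sum_Cw[of ?M] by (auto simp: c_def simp del: Cw.simps)
  have kc': "ks c \<subseteq> Wt (Suc ?R)" using kc by blast
  define z2 where "z2 = z1 - th ?R s' - bY c"
  have kz2: "ks z2 \<subseteq> Wt ?R"
    unfolding z2_def by (intro keys_diff_bY[OF _ kc'] keys_diff_sub kz1 keys_th_Wt)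
  define s'' where "s'' = s - (\<alpha> s' - s') * l"
  have bb: "bY (bY x) \<in> denY" if "ks x \<subseteq> Wt (Suc ?R)" for x using normal_bb[of x "2 * N"] that by simp
  have "bY z2 - th (2 * N) s'' = (bY z - th (2 * N) s) - (bY (th ?R s') - th (2 * N) ((\<alpha> s' - s') * l))
      - bY (bY a) - bY (bY c)"
    by (simp add: z2_def z1_def s''_def additive_diff[OF bY_additive] additive_diff[OF th_additive] del: mult_Suc_right mult_Suc)
  also have "\<dots> \<in> denY"
    by (intro denY_diff zs bY_th_odd bb a kc')
  finally have z2s: "bY z2 - th (2 * N) s'' \<in> denY" .
  have "\<exists>z'. ks z' \<subseteq> Wt (Suc ?R) \<and> low ?M (z2 - bY z')"
  proof (rule weight_step[OF kz2])
    show "low (Suc ?M) z2"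
      unfolding z2_def by (intro low_diff lth bY_homogeneous(2)[OF kc]) (use a in \<open>simp add: z1_def\<close>)
    show "low ?M (bY z2)" by (rule low_trans[OF z2s lth(1)])
    have "pf (ext b0 c) = E (qf c)" by (rule pf_Eb0[where N = ?M]) (use kc in simp_all)
    also have "qf c = G \<mu>" by (simp add: c_def qf_sg chi_Cw del: Cw.simps)
    finally have "pf (ext b0 c) = \<mu> - P \<mu>" by (simp add: E_G)
    moreover have "prt (n * ?M) z2 = prt (n * ?M) z1 - th ?R s' - ext b0 c"
      by (simp only: z2_def additive_diff[OF prt_additive] pth bY_homogeneous(1)[OF kc])
    ultimately have "pf (prt (n * ?M) z2) = 0"
      by (simp add: additive_diff[OF pf_additive] pf_th_odd s'_def P_P \<mu>_def[symmetric] del: mult_Suc_right)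
    then show "pf (prt (n * ?M) z2) \<in> TC (n * ?M)" by (simp add: TC_0)
  qed simp
  then obtain b where b: "ks b \<subseteq> Wt (Suc ?R)" "low ?M (z2 - bY b)" by blast
  define z3 where "z3 = z2 - bY b"
  have kz3: "ks z3 \<subseteq> Wt ?R" unfolding z3_def by (rule keys_diff_bY[OF kz2 b(1)])
  from denY_diff[OF z2s bb[OF b(1)]] have z3s: "bY z3 - th (2 * N) s'' \<in> denY"
    by (simp add: z3_def additive_diff[OF bY_additive] algebra_simps)
  define u where "u = prt (n * N) z3"
  have ku: "ks u \<subseteq> {t \<in> Wt ?R. sum_list t = n * N}" using kz3 by (auto simp: u_def ks_prt)
  have m1: "prt (n * N) (bY z3) - ext b0 u \<in> dd (TC (n * N))"
    unfolding u_def by (rule prt_bY_low[OF kz3]) (use b in \<open>simp add: z3_def\<close>)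
  have m2: "prt (n * N) (bY z3) - th (2 * N) s'' \<in> dd (TC (n * N))"
    using low_prt[OF low_den[OF z3s], of N] unfolding additive_diff[OF prt_additive] pth .
  from dd_diff[OF TC_subspace m1 m2] have m: "th (2 * N) s'' - ext b0 u \<in> dd (TC (n * N))" by simp
  have s'': "s'' \<in> TC (n * N)"
  proof (cases N)
    case 0
    have "t \<notin> ks u" for t
      using subsetD[OF ku, of t] 0 by (cases t; cases "tl t") (auto simp: Wt_def)
    then have "u = 0" by (intro poly_mapping_eqI) (simp add: in_keys_iff)
    then show ?thesis using lk_dd[OF m, of "[0]"] 0 by (simp add: th_def additive_0[OF E_b0])
  next
    case (Suc K)
    from qf_dd[OF m] have p: "P s'' \<in> TC (n * N)"
      using qf_Eb0[OF ku] by (simp add: Suc additive_diff[OF qf_additive] qf_th_even del: mult_Suc_right)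
    have "E ((\<alpha> s' - s') * l) = 0"
    proof -
      have "E (\<alpha> s' - s') = E (P (\<alpha> \<mu> - \<mu>))"
        by (simp add: s'_def additive_diff[OF P_additive]) (simp add: P_def fc_al)
      then show ?thesis by (simp add: E_l E_P)
    qed
    then have "E s'' \<in> TC (n * N)" using Es Suc by (simp add: s''_def E_diff)
    from TC_add[OF G_TC[OF this] p] show ?thesis by (simp add: G_E)
  qed
  then have "th (2 * N) s'' \<in> denY" by (intro th_denY) simp
  with denY_cong[OF z3s] have bz3: "bY z3 \<in> denY" by blast
  have "\<exists>z'. ks z' \<subseteq> Wt (Suc ?R) \<and> low 0 (z3 - bY z')"
  proof (rule weight_descent[of 0 ?M])
    show "low ?M z3" using b by (simp add: z3_def)
    show "low 0 (bY z3)" by (rule low_den[OF bz3])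
    show "?R \<noteq> 2 * K \<and> ?R + 1 \<noteq> 2 * K" if "K < ?M" for K using that by presburger
  qed (simp_all add: kz3)
  then obtain d where d: "ks d \<subseteq> Wt (Suc ?R)" "z3 - bY d \<in> denY" by (auto simp: low_0)
  have "z - th ?R s' - bY (a + c + b + d) = z3 - bY d"
    by (simp add: z3_def z2_def z1_def additiveD[OF bY_additive] algebra_simps del: mult_Suc_right)
  moreover have "ks (a + c + b + d) \<subseteq> Wt (Suc ?R)" by (intro keys_add_sub a b kc' d)
  ultimately show ?thesis using d(2) s'' unfolding s''_def by (intro exI[of _ s'] exI[of _ "a + c + b + d"]) simp
qed

lemma cone_zero:
  assumes "ks z \<subseteq> Wt 0"
  shows "z - th 0 (lk z [0]) \<in> denY"
  unfolding denY_def
proof (intro CollectI allI)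
  fix t
  show "lk (z - th 0 (lk z [0])) t \<in> TC (sum_list t)"
  proof (cases "t \<in> ks z \<and> t \<noteq> [0]")
    case True
    then have "t \<in> Wt 0" "t \<noteq> [0]" using assms by auto
    moreover from this obtain i where i: "t = [i]" "i < n" by (auto simp: Wt_def length_Suc_conv)
    ultimately have "i \<noteq> 0" by simp
    with i have "\<not> n dvd sum_list t" by (auto dest: dvd_imp_le)
    then show ?thesis by (simp add: TC_UNIV)
  next
    case False
    then have "lk (z - th 0 (lk z [0])) t = 0"
      by (auto simp: th_def lookup_minus lookup_single when_def in_keys_iff)
    then show ?thesis by (simp add: TC_0)
  qed
qed

text \<open>The normal form complex is compared with the small complex on the whole of \<open>K\<close> before the eigenspaces are separated,
  since its words involve all powers of \<open>\<alpha>\<close> at once.\<close>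

theorem normal_HC_full: "cyclic_homology normal_complex r \<cong>\<^sub>q cyclic_homology full_complex r"
proof -
  have nc: "qnum (mc_space normal_complex r) = {v. ks v \<subseteq> Wt r}" "qden (mc_space normal_complex r) = denY"
    "mc_b normal_complex r v = (if r = 0 then 0 else bY v)" "mc_B normal_complex = BY" for r v
    by (simp_all add: normal_complex_def)
  have parity: "(r = 2 * N \<Longrightarrow> Q) \<Longrightarrow> (r = Suc (2 * N) \<Longrightarrow> Q) \<Longrightarrow> N = r div 2 \<Longrightarrow> Q" for r N :: nat and Q
    by (cases "even r") (auto elim!: evenE oddE)
  interpret mixed_quasi_iso full_complex scale normal_complex ysc th
  proof (intro mixed_quasi_iso.intro mixed_quasi_iso_axioms.intro full_presented normal_presented)
    fix r :: nat and x :: 'a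
    have ths: "th r (scale c x) = ysc c (th r x)" for c x
      by (simp add: th_def te_def ysc_sg additive_diff[OF ysc_additive] P'_scale P_scale al_scale)
    show "Vector_Spaces.linear scale ysc (th r)"
      using vsp ysc_vs by (simp add: Vector_Spaces.linear_iff additiveD[OF th_additive] ths)
    show "th r x \<in> qnum (mc_space normal_complex r)" by (simp add: nc keys_th_Wt)
    show "th r x \<in> qden (mc_space normal_complex r)" if "x \<in> qden (mc_space full_complex r)"
      using that by (simp add: nc full_den th_denY mult.commute)
    show "mc_b normal_complex (Suc r) (th (Suc r) x) - th r (mc_b full_complex (Suc r) x) \<in> qden (mc_space normal_complex r)"
    proof (rule parity[of r "r div 2"])
      assume r: "r = 2 * (r div 2)"
      show ?thesis by (subst (1 2 3 4) r) (simp add: nc full_complex_def bY_th_odd)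
    next
      assume r: "r = Suc (2 * (r div 2))"
      have "mc_b normal_complex (Suc r) (th (Suc r) x) = 0" 
        using bY_th_even[of "r div 2" x] r by (simp add: nc)
      moreover have "th r (mc_b full_complex (Suc r) x) = 0"
      proof -
        have "odd r" using r by presburger
        then show ?thesis using th_E[of "r div 2" x] r by (simp add: full_complex_def)
      qed
      ultimately show ?thesis by (simp add: nc denY_0)
    qed simp
    show "mc_B normal_complex r (th r x) - th (Suc r) (mc_B full_complex r x) \<in> qden (mc_space normal_complex (Suc r))"
    proof (rule parity[of r "r div 2"])
      assume r: "r = 2 * (r div 2)"
      have "BY r (th r x) = 0" using BY_th_even[of "r div 2" x] r by simp
      moreover have "even r" using r by presburger
      then have "mc_B full_complex r x = 0" by (simp add: full_complex_def)
      ultimately show ?thesis by (simp add: nc additive_0[OF th_additive] denY_0)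
    next
      assume r: "r = Suc (2 * (r div 2))"
      have "BY r (th r x) = th (Suc r) (\<Sum>u\<le>r div 2. (\<alpha> ^^ (n * u)) (x - \<alpha> x))"
        using BY_th_odd[of "r div 2" x] r by simp
      moreover have "mc_B full_complex r x = (\<Sum>u\<le>r div 2. (\<alpha> ^^ (n * u)) (x - \<alpha> x))"
        using r by (auto simp: full_complex_def)
      ultimately show ?thesis by (simp add: nc denY_0)
    qed simp
  next
    fix z assume "z \<in> qnum (mc_space normal_complex 0)"
    then have "z - th 0 (lk z [0]) \<in> denY" by (intro cone_zero) (simp add: nc)
    then show "\<exists>s'\<in>qnum (mc_space full_complex 0). \<exists>z'\<in>qnum (mc_space normal_complex 1).
        z - th 0 s' - mc_b normal_complex 1 z' \<in> qden (mc_space normal_complex 0)"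
      by (intro bexI[of _ "lk z [0]"] bexI[of _ 0]) (simp_all add: nc full_num additive_0[OF bY_additive])
  next
    fix r z s
    assume z: "z \<in> qnum (mc_space normal_complex (Suc r))"
      and zs: "mc_b normal_complex (Suc r) z - th r s \<in> qden (mc_space normal_complex r)"
      and s: "r > 0 \<Longrightarrow> mc_b full_complex r s \<in> qden (mc_space full_complex (r - 1))"
    show "\<exists>s'\<in>qnum (mc_space full_complex (Suc r)). \<exists>z'\<in>qnum (mc_space normal_complex (Suc (Suc r))).
         z - th (Suc r) s' - mc_b normal_complex (Suc (Suc r)) z' \<in> qden (mc_space normal_complex (Suc r)) \<and>
         s - mc_b full_complex (Suc r) s' \<in> qden (mc_space full_complex r)"
    proof (rule parity[of r "r div 2"])
      assume r: "r = 2 * (r div 2)"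
      define N where "N = r div 2"
      have rN: "r = 2 * N" using r by (simp add: N_def)
      have "N > 0 \<Longrightarrow> E s \<in> TC (n * N)" using s by (simp add: rN full_complex_def mult.commute)
      then obtain s' z' where "ks z' \<subseteq> Wt (2 * Suc N)" "z - th (Suc (2 * N)) s' - bY z' \<in> denY"
          "s - (\<alpha> s' - s') * l \<in> TC (n * N)"
        using cone_odd[of z N s] z zs by (auto simp: nc rN)
      then show ?thesis
        by (intro bexI[of _ s'] bexI[of _ z']) (simp_all add: nc rN full_complex_def mult.commute)
    next
      assume r: "r = Suc (2 * (r div 2))"
      define N where "N = r div 2"
      have rN: "r = Suc (2 * N)" using r by (simp add: N_def)
      obtain s' z' where "ks z' \<subseteq> Wt (Suc (2 * Suc N))" "z - th (2 * Suc N) s' - bY z' \<in> denY"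
          "s - E s' \<in> TC (n * Suc N)"
        using cone_even[of z N s] z zs by (auto simp: nc rN)
      then show ?thesis
        by (intro bexI[of _ s'] bexI[of _ z']) (simp_all add: nc rN full_complex_def mult.commute)
    qed simp
  qed
  show ?thesis by (rule cyclic_homology_iso(2))
qed

theorem relative_HC_split:
  fixes \<omega> :: "nat \<Rightarrow> 'k"
  assumes "inj_on \<omega> I" "\<omega> ` I = eigenvalues scale \<alpha>" "finite I"
  shows "cyclic_homology relative_complex r \<cong>\<^sub>q q_sum I (\<lambda>h. cyclic_homology (small (\<omega> h)) r)"
  by (rule q_iso_trans[OF q_iso_trans[OF relative_HC_normal normal_HC_full] full_HC_split[OF assms]])

end

section \<open>Cyclic homology of the monogenic extension\<close>

context k_algebra
begin

text \<open>For central \<open>z\<close> one has \<open>y \<alpha>\<^sup>j(z) - z y = y (\<alpha>\<^sup>j(z) - z)\<close>, and the second factor is invertible when \<open>n\<close> does not divide \<open>j\<close>, because \<open>\<alpha>\<^sup>j(z)\<close> only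
  depends on \<open>j\<close> modulo \<open>n\<close>.\<close>

lemma TC_UNIV_if_separated:
  assumes endo: "algebra_endo scale \<alpha>" and z: "z \<in> center" "(\<alpha> ^^ n) z = z" and n: "n \<ge> 2"
    and inv: "\<And>i. 1 \<le> i \<Longrightarrow> i < n \<Longrightarrow> invertible_elem (z - (\<alpha> ^^ i) z)" and j: "\<not> n dvd j"
  shows "twisted_comm scale \<alpha> j = UNIV"
proof -
  have zn: "(\<alpha> ^^ (n * q)) z = z" for q
    by (induction q) (simp_all add: z funpow_add)
  define i where "i = j mod n"
  have i: "1 \<le> i" "i < n" using j n by (auto simp: i_def mod_eq_0_iff_dvd Suc_le_eq intro: gr0I)
  have "(\<alpha> ^^ j) z = (\<alpha> ^^ (i + n * (j div n))) z" by (simp add: i_def)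
  then have jz: "(\<alpha> ^^ j) z = (\<alpha> ^^ i) z" by (simp only: funpow_add o_apply zn)
  obtain v where v: "v * (z - (\<alpha> ^^ i) z) = 1" using inv[OF i] by (auto simp: invertible_elem_def)
  have "x \<in> twisted_comm scale \<alpha> j" for x
  proof -
    have c: "z * (- x * v) = (- x * v) * z" using z(1) by (simp add: center_def)
    have "(- x * v) * (\<alpha> ^^ j) z - z * (- x * v) \<in> twisted_comm scale \<alpha> j"
      unfolding twisted_comm_def by (rule span_base) blast
    moreover have "(- x * v) * (\<alpha> ^^ j) z - z * (- x * v) = x * (v * (z - (\<alpha> ^^ i) z))"
      unfolding c jz by (simp add: algebra_simps)
    ultimately show ?thesis using v by simp
  qed
  then show ?thesis by auto
qed

end

theorem theorem3p6:
  fixes scale :: "'k::field_char_0 \<Rightarrow> 'a::ring_1 \<Rightarrow> 'a"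
    and \<alpha> :: "'a \<Rightarrow> 'a"
    and lam :: "nat \<Rightarrow> 'a"
    and z :: 'a
    and \<omega> :: "nat \<Rightarrow> 'k"
    and n s :: nat
  assumes "k_algebra scale"
    and "algebra_endo scale \<alpha>"
    and "n \<ge> 2"
    and "lam 0 = 1"
    and "\<And>i. 1 \<le> i \<Longrightarrow> i \<le> n \<Longrightarrow> \<alpha> (lam i) = lam i"
    and "\<And>i x. 1 \<le> i \<Longrightarrow> i \<le> n \<Longrightarrow> lam i * x = (\<alpha> ^^ i) x * lam i"
    and "z \<in> center"
    and "(\<alpha> ^^ n) z = z"
    and "\<And>i. 1 \<le> i \<Longrightarrow> i < n \<Longrightarrow> invertible_elem (z - (\<alpha> ^^ i) z)"
    and "diagonalizable scale \<alpha>"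
    and "s \<ge> 1"
    and "inj_on \<omega> {1..s}"
    and "\<omega> ` {1..s} = eigenvalues scale \<alpha>"
    and "\<omega> 1 = 1"
  shows
    "(\<forall>r. cyclic_homology
             (relative_mixed_complex scale (monogenic_ext \<alpha> n lam) (monogenic_incl \<alpha> n lam)) r
          \<cong>\<^sub>q q_sum {1..s} (\<lambda>h. cyclic_homology (small_mixed_complex scale \<alpha> n lam (\<omega> h)) r)) \<and>
     (\<forall>h\<in>{1..s}. \<forall>m.
        cyclic_homology (small_mixed_complex scale \<alpha> n lam (\<omega> h)) (2 * m) \<cong>\<^sub>q
          (if h = 1 then
             \<lparr>qscale = scale,
              qnum = eigenspace scale \<alpha> 1,
              qden = twisted_comm_eig scale \<alpha> 1 0\<rparr>
           else if \<omega> h ^ n \<noteq> 1 then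
             \<lparr>qscale = scale,
              qnum = eigenspace scale \<alpha> (\<omega> h),
              qden = {u + v * lam n | u v.
                        u \<in> twisted_comm_eig scale \<alpha> (\<omega> h) 0 \<and> v \<in> eigenspace scale \<alpha> (\<omega> h)}\<rparr>
           else
             \<lparr>qscale = scale,
              qnum = eigenspace scale \<alpha> (\<omega> h),
              qden = {u + v * lam n ^ (m + 1) | u v.
                        u \<in> twisted_comm_eig scale \<alpha> (\<omega> h) 0 \<and> v \<in> eigenspace scale \<alpha> (\<omega> h)}\<rparr>)) \<and>
     (\<forall>h\<in>{1..s}. \<forall>m.
        cyclic_homology (small_mixed_complex scale \<alpha> n lam (\<omega> h)) (2 * m + 1) \<cong>\<^sub>q
          (if h = 1 \<or> \<omega> h ^ n \<noteq> 1 then q_zero scale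
           else
             \<lparr>qscale = scale,
              qnum = {v \<in> eigenspace scale \<alpha> (\<omega> h).
                        v * lam n ^ (m + 1) \<in> twisted_comm_eig scale \<alpha> (\<omega> h) 0},
              qden = twisted_comm_eig scale \<alpha> (\<omega> h) ((m + 1) * n)\<rparr>))"
proof -
  interpret k_algebra scale by (rule assms(1))
  have n2: "n \<ge> 2" by (rule assms(3))
  interpret separated_algebra scale \<alpha> "lam n" n
  proof (intro separated_algebra.intro diag_algebra.intro twisted_algebra.intro separated_algebra_axioms.intro
      diag_algebra_axioms.intro twisted_algebra_axioms.intro)
    show "\<alpha> (lam n) = lam n" using assms(5)[of n] n2 by simp
    show "lam n * x = (\<alpha> ^^ n) x * lam n" for x using assms(6)[of n x] n2 by simp
    show "finite (eigenvalues scale \<alpha>)" unfolding assms(13)[symmetric] by simp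
    show "twisted_comm scale \<alpha> j = UNIV" if "\<not> n dvd j" for j
      by (rule TC_UNIV_if_separated[OF assms(2,7,8,3,9) that])
  qed (fact assms)+
  \<comment> \<open>the inner coefficients are killed by an invertible element: \<open>z \<lambda>\<^sub>i = \<lambda>\<^sub>i z = \<alpha>\<^sup>i(z) \<lambda>\<^sub>i\<close>\<close>
  have lam0: "lam i = 0" if i: "1 \<le> i" "i < n" for i
  proof -
    have "z * lam i = lam i * z" using assms(7) by (simp add: center_def)
    also have "\<dots> = (\<alpha> ^^ i) z * lam i" using assms(6)[of i z] i by simp
    finally have e: "(z - (\<alpha> ^^ i) z) * lam i = 0" by (simp add: left_diff_distrib)
    obtain v where v: "v * (z - (\<alpha> ^^ i) z) = 1" using assms(9)[OF i] by (auto simp: invertible_elem_def)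
    have "lam i = (v * (z - (\<alpha> ^^ i) z)) * lam i" by (simp add: v)
    also have "\<dots> = 0" by (simp only: mult.assoc e mult_zero_right)
    finally show ?thesis .
  qed
  have "monogenic_poly n lam = (\<Sum>i\<in>{0, n}. monom (lam i) (n - i))"
    unfolding monogenic_poly_def
  proof (rule sum.mono_neutral_right)
    show "\<forall>i\<in>{..n} - {0, n}. monom (lam i) (n - i) = 0" using lam0 by (auto simp: Suc_le_eq)
  qed auto
  then have poly: "monogenic_poly n lam = fpol" using n2 assms(4) by (simp add: fpol_def)
  have ideal: "monogenic_ideal \<alpha> n lam = J" by (simp add: monogenic_ideal_def poly genideal_fpol)
  have ext: "monogenic_ext \<alpha> n lam = A" by (simp add: monogenic_ext_def ideal A_def)
  have incl: "monogenic_incl \<alpha> n lam = io" by (simp add: fun_eq_iff monogenic_incl_def ideal cl_def)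
  have small: "small_mixed_complex scale \<alpha> n lam w = small w" for w
    by (simp add: small_mixed_complex_def)
  have w1: "\<omega> h \<noteq> 1" if "h \<in> {1..s}" "h \<noteq> 1" for h
  proof
    assume "\<omega> h = 1"
    then have "\<omega> h = \<omega> 1" using assms(14) by simp
    then show False using inj_onD[OF assms(12)] that assms(11) by simp
  qed
  show ?thesis
    unfolding ext incl small
  proof (intro conjI ballI allI)
    fix r
    show "cyclic_homology (relative_mixed_complex scale A io) r
        \<cong>\<^sub>q q_sum {1..s} (\<lambda>h. cyclic_homology (small (\<omega> h)) r)"
      by (rule relative_HC_split[OF assms(12,13)]) simp
  next
    fix h m assume h: "h \<in> {1..s}"
    consider (one) "h = 1" | (reg) "h \<noteq> 1" "\<omega> h ^ n \<noteq> 1" | (sing) "h \<noteq> 1" "\<omega> h ^ n = 1" by blast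
    note cases = this
    have geom: "(\<Sum>i<n. \<omega> h ^ i) \<noteq> 0" if "h = 1 \<or> \<omega> h ^ n \<noteq> 1"
      using that geom_n[of "\<omega> h"] assms(14) by auto
    let ?D0 = "twisted_comm_eig scale \<alpha> (\<omega> h) 0"
    \<comment> \<open>\<open>\<omega> h - 1\<close> is a nonzero scalar and can be absorbed into \<open>v\<close>\<close>
    have scaled: "{u + scale (\<omega> h - 1) v * lam n | u v. u \<in> ?D0 \<and> v \<in> eig (\<omega> h)} =
        {u + v * lam n | u v. u \<in> ?D0 \<and> v \<in> eig (\<omega> h)}" if "h \<noteq> 1"
    proof (intro equalityI subsetI)
      fix x assume "x \<in> {u + scale (\<omega> h - 1) v * lam n | u v. u \<in> ?D0 \<and> v \<in> eig (\<omega> h)}"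
      then show "x \<in> {u + v * lam n | u v. u \<in> ?D0 \<and> v \<in> eig (\<omega> h)}"
        using eig_scale by blast
    next
      fix x assume "x \<in> {u + v * lam n | u v. u \<in> ?D0 \<and> v \<in> eig (\<omega> h)}"
      then obtain u v where uv: "x = u + v * lam n" "u \<in> ?D0" "v \<in> eig (\<omega> h)" by blast
      have "x = u + scale (\<omega> h - 1) (scale (1 / (\<omega> h - 1)) v) * lam n" using w1[OF h that] uv(1) by simp
      moreover have "scale (1 / (\<omega> h - 1)) v \<in> eig (\<omega> h)" using uv(3) by (rule eig_scale)
      ultimately show "x \<in> {u + scale (\<omega> h - 1) v * lam n | u v. u \<in> ?D0 \<and> v \<in> eig (\<omega> h)}"
        using uv(2) by blast
    qed
    show "cyclic_homology (small (\<omega> h)) (2 * m) \<cong>\<^sub>q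
          (if h = 1 then
             \<lparr>qscale = scale, qnum = eigenspace scale \<alpha> 1, qden = twisted_comm_eig scale \<alpha> 1 0\<rparr>
           else if \<omega> h ^ n \<noteq> 1 then
             \<lparr>qscale = scale, qnum = eigenspace scale \<alpha> (\<omega> h),
              qden = {u + v * lam n | u v. u \<in> ?D0 \<and> v \<in> eigenspace scale \<alpha> (\<omega> h)}\<rparr>
           else
             \<lparr>qscale = scale, qnum = eigenspace scale \<alpha> (\<omega> h),
              qden = {u + v * lam n ^ (m + 1) | u v. u \<in> ?D0 \<and> v \<in> eigenspace scale \<alpha> (\<omega> h)}\<rparr>)"
    proof (cases rule: cases)
      case one
      have "0 \<in> eig 1" by (rule eig_0)
      then have "{u + scale (\<omega> h - 1) v * lam n | u v. u \<in> ?D0 \<and> v \<in> eig (\<omega> h)} = ?D0"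
        using one assms(14) by auto
      then show ?thesis using small_HC_regular(1)[OF geom, of m] one assms(14) by simp
    next
      case reg
      then show ?thesis using small_HC_regular(1)[OF geom, of m] scaled by simp
    next
      case sing
      then show ?thesis using small_HC_singular_even[OF w1[OF h], of m] by simp
    qed
    show "cyclic_homology (small (\<omega> h)) (2 * m + 1) \<cong>\<^sub>q
          (if h = 1 \<or> \<omega> h ^ n \<noteq> 1 then q_zero scale
           else
             \<lparr>qscale = scale,
              qnum = {v \<in> eigenspace scale \<alpha> (\<omega> h). v * lam n ^ (m + 1) \<in> ?D0},
              qden = twisted_comm_eig scale \<alpha> (\<omega> h) ((m + 1) * n)\<rparr>)"
    proof (cases rule: cases)
      case sing
      then show ?thesis using small_HC_singular_odd[OF w1[OF h], of m] by simp
    qed (use small_HC_regular(2)[OF geom, of m] in auto)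
  qed
qed

end
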